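(* Let $B=(B^1,\dots,B^d)$ be a $d$-dimensional fractional Brownian motion with Hurst parameter $\frac13<H\le\frac12$. Let $(F_t)_{t\in[0,1]}\in\mathcal J(\mathbb R)$ and let $1\le\alpha,\beta\le d$ be distinct. With $\tau^m_i=i2^{-m}$ and $D_m=\{\tau^m_i\}_{i=0}^{2^m}$, set for $t\in D_m$ $$I^m_{t}(F)=\sum_{i=1}^{\lfloor 2^mt\rfloor}F_{\tau^m_{i-1}}B^{\alpha,\beta}_{\tau^m_{i-1},\tau^m_i},\qquad \tilde I^m_{t}(F)=\sum_{i=1}^{\lfloor 2^mt\rfloor}F_{\tau^m_{i-1}}B^{\alpha}_{\tau^m_{i-1},\tau^m_i}B^{\beta}_{\tau^m_{i-1},\tau^m_i}.$$ Then for all $0<\theta<\frac12$ and all positive integers $p$, $$\sup_m\left\{\big\|\,\|(2^m)^{2H-\frac12}I^m(F)\|_\theta\,\big\|_{L^p}+\big\|\,\|(2^m)^{2H-\frac12}\tilde I^m(F)\|_\theta\,\big\|_{L^p}\right\}<\infty .$$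
   Context: $m$ ranges over natural numbers. For a discrete process $G=(G_t)_{t\in D_m}$ and $0<\lambda<1$, $\|G\|_\lambda=\sup_{s,t\in D_m,\,s\ne t}|G_t-G_s|/|t-s|^\lambda$. The fractional Brownian motion $B$ starts at $0$, has independent components, each centered Gaussian with covariance $R(s,t)=\frac12\{s^{2H}+t^{2H}-|t-s|^{2H}\}$. Write $B^\alpha_{s,t}=B^\alpha_t-B^\alpha_s$. For $\alpha\ne\beta$, $B^{\alpha,\beta}_{s,t}=\lim_{|\mathcal P|\to0}\sum_{i=1}^nB^\alpha_{s,u_{i-1}}B^\beta_{u_{i-1},u_i}$ in $L^2$, where $\mathcal P=\{u_i\}_{i=0}^n$ runs over partitions $s=u_0<\dots<u_n=t$ with mesh $|\mathcal P|\to 0$. $\mathcal H^d$ is the Cameron–Martin space of $B$ (isometric to the first Wiener chaos via $X\mapsto(E[XB^1_t],\dots,E[XB^d_t])_t$), and $\mathcal H^d\cong\mathcal H^1\otimes\mathbb R^d$. $\psi_u\in\mathcal H^1$ is the element corresponding to the value $B_u$ of one-dimensional fractional Brownian motion, i.e. $\psi_u(t)=R(u,t)$, and $\psi^\alpha_u=\psi_u\otimes e_\alpha\in\mathcal H^d$ with $\{e_\alpha\}$ the standard basis of $\mathbb R^d$. $(\mathcal H^d)^{\odot r}$ is the symmetric $r$-fold tensor product, a subspace of $(\mathcal H^d)^{\otimes r}$ with the restricted inner product, and $\odot$ is the symmetrization of $\otimes$. $D$ is the Malliavin derivative; $\mathbb D^{k,p}(\mathbb R^N)$ is the set of $k$-times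 Malliavin differentiable $\mathbb R^N$-valued random variables which together with their derivatives up to order $k$ are in $L^p$; $\mathbb D^\infty(\mathbb R^N)=\bigcap_{k,p}\mathbb D^{k,p}(\mathbb R^N)$; $L^{\infty-}=\bigcap_{p\ge1}L^p$. For a function $\phi(u_1,\dots,u_r)$, $\phi([s_1,t_1]\times\cdots\times[s_r,t_r])$ is its rectangular increment (e.g. $\phi([s_1,t_1]\times[s_2,t_2])=\phi(t_1,t_2)-\phi(s_1,t_2)-\phi(t_1,s_2)+\phi(s_1,s_2)$). $\mathcal J(\mathbb R^N)$ is the set of all families of random variables $(F_t)_{t\in[0,1]}$ such that: (i) $F_t\in\mathbb D^\infty(\mathbb R^N)$ for all $t$; (ii) there is a random variable $C\in L^{\infty-}$ with $|F_t|\le C$ for all $t\in[0,1]$; (iii) for all $r\ge1$ and $\alpha_1,\dots,\alpha_r\in\{1,\dots,d\}$, the function $\phi_t^{\alpha_1,\dots,\alpha_r}(u_1,\dots,u_r)=(D^rF_t,\psi^{\alpha_1}_{u_1}\odot\cdots\odot\psi^{\alpha_r}_{u_r})_{(\mathcal H^d)^{\odot r}}$ has a continuous modification in $(u_1,\dots,u_r)\in[0,1]^r$ satisfying $|\phi^{\alpha_1,\dots,\alpha_r}_t([s_1,t_1]\times\cdots\times[s_r,t_r])|\le C'\prod_{i=1}^r(t_i-s_i)^{2H}$, where $C'\in L^{\infty-}$ is a random variable which may depend on $r,\alpha_1,\dots,\alpha_r$. *)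

theory Defs
  imports "HOL-Probability.Probability"
begin

text \<open>
  Throughout, \<open>M\<close> is the underlying probability space, and the \<open>d\<close>-dimensional process
  \<open>B\<close> is written \<open>B \<alpha> t \<omega>\<close>, the coordinate \<open>\<alpha>\<close> ranging over a finite type \<open>'d\<close>.
\<close>

section \<open>\<open>L\<^sup>p\<close> norms and closed spans\<close>

definition Lp_norm :: "'a measure \<Rightarrow> real \<Rightarrow> ('a \<Rightarrow> real) \<Rightarrow> ennreal" where
  "Lp_norm M p f =
     (let I = (\<integral>\<^sup>+ \<omega>. ennreal (\<bar>f \<omega>\<bar> powr p) \<partial>M)
      in if I = \<top> then \<top> else ennreal (enn2real I powr (1 / p)))"

definition Lp_space :: "'a measure \<Rightarrow> real \<Rightarrow> ('a \<Rightarrow> real) set" where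
  "Lp_space M p = {f \<in> borel_measurable M. Lp_norm M p f < \<top>}"

definition L_infty_minus :: "'a measure \<Rightarrow> ('a \<Rightarrow> real) set" where
  "L_infty_minus M = (\<Inter>p\<in>{1..}. Lp_space M p)"

definition lin_combs :: "('a \<Rightarrow> real) set \<Rightarrow> ('a \<Rightarrow> real) set" where
  "lin_combs S = {\<lambda>w. \<Sum>i<n. c i * g i w | (n :: nat) (c :: nat \<Rightarrow> real) g. \<forall>i<n. g i \<in> S}"

definition L2_closed_span :: "'a measure \<Rightarrow> ('a \<Rightarrow> real) set \<Rightarrow> ('a \<Rightarrow> real) set" where
  "L2_closed_span N S =
     {X \<in> Lp_space N 2. \<forall>\<epsilon>>0. \<exists>Y\<in>lin_combs S. Lp_norm N 2 (\<lambda>w. X w - Y w) < \<epsilon>}"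


section \<open>Fractional Brownian motion\<close>

definition fbm_cov :: "real \<Rightarrow> real \<Rightarrow> real \<Rightarrow> real" where
  "fbm_cov H s t = (s powr (2 * H) + t powr (2 * H) - \<bar>t - s\<bar> powr (2 * H)) / 2"

text \<open>The normal law of variance \<open>0\<close> is included.\<close>

definition centered_gaussian :: "'w measure \<Rightarrow> ('w \<Rightarrow> real) \<Rightarrow> bool" where
  "centered_gaussian M X \<longleftrightarrow> X \<in> borel_measurable M \<and>
     ((AE \<omega> in M. X \<omega> = 0) \<or> (\<exists>\<sigma>>0. distributed M lborel X (normal_density 0 \<sigma>)))"

definition is_fbm ::
  "'w measure \<Rightarrow> real \<Rightarrow> ('d::finite \<Rightarrow> real \<Rightarrow> 'w \<Rightarrow> real) \<Rightarrow> bool" where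
  "is_fbm M H B \<longleftrightarrow>
     (\<forall>\<alpha>. \<forall>\<omega>\<in>space M. B \<alpha> 0 \<omega> = 0) \<and>
     prob_space.indep_vars M (\<lambda>_. PiM {0..1} (\<lambda>_. borel)) (\<lambda>\<alpha> \<omega>. \<lambda>t\<in>{0..1}. B \<alpha> t \<omega>) UNIV \<and>
     (\<forall>\<alpha>. \<forall>X\<in>lin_combs {B \<alpha> t | t. t \<in> {0..1}}. centered_gaussian M X) \<and>
     (\<forall>\<alpha>. \<forall>s\<in>{0..1}. \<forall>t\<in>{0..1}. (\<integral>\<omega>. B \<alpha> s \<omega> * B \<alpha> t \<omega> \<partial>M) = fbm_cov H s t)"

definition incr :: "(real \<Rightarrow> 'w \<Rightarrow> real) \<Rightarrow> real \<Rightarrow> real \<Rightarrow> 'w \<Rightarrow> real" where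
  "incr X s t \<omega> = X t \<omega> - X s \<omega>"

definition is_partition :: "real \<Rightarrow> real \<Rightarrow> nat \<Rightarrow> (nat \<Rightarrow> real) \<Rightarrow> bool" where
  "is_partition s t n u \<longleftrightarrow> u 0 = s \<and> u n = t \<and> (\<forall>i\<in>{1..n}. u (i - 1) < u i)"

text \<open>
  \<open>A\<close> is a version of the \<open>L\<^sup>2\<close>-limit, as the mesh tends to \<open>0\<close>, of the Riemann sums defining
  \<open>B\<^sup>\<alpha>\<^sup>\<beta>\<close> on \<open>[s, t]\<close>.  Such a limit is determined only up to null sets.
\<close>

definition is_iterated_integral ::
  "'w measure \<Rightarrow> ('d \<Rightarrow> real \<Rightarrow> 'w \<Rightarrow> real) \<Rightarrow> 'd \<Rightarrow> 'd \<Rightarrow> real \<Rightarrow> real \<Rightarrow> ('w \<Rightarrow> real) \<Rightarrow> bool" where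
  "is_iterated_integral M B \<alpha> \<beta> s t A \<longleftrightarrow> A \<in> Lp_space M 2 \<and>
     (\<forall>\<epsilon>>0. \<exists>\<delta>>0. \<forall>n u. is_partition s t n u \<and> (\<forall>i\<in>{1..n}. u i - u (i - 1) < \<delta>) \<longrightarrow>
        Lp_norm M 2 (\<lambda>\<omega>. (\<Sum>i=1..n. incr (B \<alpha>) s (u (i - 1)) \<omega> * incr (B \<beta>) (u (i - 1)) (u i) \<omega>) - A \<omega>)
          < \<epsilon>)"


section \<open>The Cameron--Martin space and its tensor powers\<close>

definition first_chaos :: "'w measure \<Rightarrow> ('d \<Rightarrow> real \<Rightarrow> 'w \<Rightarrow> real) \<Rightarrow> ('w \<Rightarrow> real) set" where
  "first_chaos M B = L2_closed_span M {B \<alpha> t | \<alpha> t. t \<in> {0..1}}"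

text \<open>
  The Cameron--Martin path of \<open>X\<close> in the first chaos.  An \<open>\<real>\<^sup>d\<close>-valued path is encoded as a
  function of the pair (time, coordinate).
\<close>

definition cm_path ::
  "'w measure \<Rightarrow> ('d \<Rightarrow> real \<Rightarrow> 'w \<Rightarrow> real) \<Rightarrow> ('w \<Rightarrow> real) \<Rightarrow> real \<times> 'd \<Rightarrow> real" where
  "cm_path M B X = (\<lambda>(t, \<beta>). \<integral>\<omega>. X \<omega> * B \<beta> t \<omega> \<partial>M)"

text \<open>\<open>\<psi>\<^sub>u \<otimes> e\<^sub>\<alpha>\<close>\<close>

definition cm_psi :: "real \<Rightarrow> real \<Rightarrow> 'd \<Rightarrow> real \<times> 'd \<Rightarrow> real" where
  "cm_psi H u \<alpha> = (\<lambda>(t, \<beta>). if \<alpha> = \<beta> then fbm_cov H u t else 0)"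

text \<open>
  The \<open>r\<close>-fold tensor power of the Cameron--Martin space is realised as a space of real functions
  of \<open>r\<close> points of \<open>[0,1] \<times> {1,\<dots>,d}\<close>, where
  \<open>(h\<^sub>0 \<otimes> \<dots> \<otimes> h\<^sub>r\<^sub>-\<^sub>1)(x\<^sub>0,\<dots>,x\<^sub>r\<^sub>-\<^sub>1) = \<Prod>i<r. h\<^sub>i(x\<^sub>i)\<close>.
  Its Hilbert structure is transported from the tensor power of the first chaos, which is
  the closed subspace of \<open>L\<^sup>2(M\<^sup>r)\<close> spanned by the products \<open>X\<^sub>0(w\<^sub>0) \<cdots> X\<^sub>r\<^sub>-\<^sub>1(w\<^sub>r\<^sub>-\<^sub>1)\<close>:
  the \<open>r\<close>-th tensor power of the isometry \<open>cm_path\<close> sends such a product to the tensor product of the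
  paths of the \<open>X\<^sub>i\<close>, and extends to the closure as \<open>cm_tensor_map\<close>.
  Functions are set to \<open>0\<close> outside the index set, so that pointwise differences stay in the space.
\<close>

definition cm_index :: "nat \<Rightarrow> (nat \<Rightarrow> real \<times> 'd) set" where
  "cm_index r = {..<r} \<rightarrow>\<^sub>E ({0..1} \<times> UNIV)"

definition cm_tensor :: "nat \<Rightarrow> (nat \<Rightarrow> real \<times> 'd \<Rightarrow> real) \<Rightarrow> (nat \<Rightarrow> real \<times> 'd) \<Rightarrow> real" where
  "cm_tensor r h x = (if x \<in> cm_index r then \<Prod>i<r. h i (x i) else 0)"

definition cm_sym_tensor :: "nat \<Rightarrow> (nat \<Rightarrow> real \<times> 'd \<Rightarrow> real) \<Rightarrow> (nat \<Rightarrow> real \<times> 'd) \<Rightarrow> real" where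
  "cm_sym_tensor r h x = (\<Sum>\<sigma> | \<sigma> permutes {..<r}. cm_tensor r (\<lambda>i. h (\<sigma> i)) x) / fact r"

definition chaos_tensor ::
  "'w measure \<Rightarrow> ('d \<Rightarrow> real \<Rightarrow> 'w \<Rightarrow> real) \<Rightarrow> nat \<Rightarrow> ((nat \<Rightarrow> 'w) \<Rightarrow> real) set" where
  "chaos_tensor M B r = L2_closed_span (PiM {..<r} (\<lambda>_. M))
     {\<lambda>w. \<Prod>i<r. X i (w i) | X. \<forall>i<r. X i \<in> first_chaos M B}"

definition cm_tensor_map ::
  "'w measure \<Rightarrow> ('d \<Rightarrow> real \<Rightarrow> 'w \<Rightarrow> real) \<Rightarrow> nat \<Rightarrow> ((nat \<Rightarrow> 'w) \<Rightarrow> real) \<Rightarrow> (nat \<Rightarrow> real \<times> 'd) \<Rightarrow> real" where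
  "cm_tensor_map M B r Z x =
     (if x \<in> cm_index r
      then \<integral>w. Z w * (\<Prod>i<r. B (snd (x i)) (fst (x i)) (w i)) \<partial>(PiM {..<r} (\<lambda>_. M)) else 0)"

definition cm_tensor_space ::
  "'w measure \<Rightarrow> ('d \<Rightarrow> real \<Rightarrow> 'w \<Rightarrow> real) \<Rightarrow> nat \<Rightarrow> ((nat \<Rightarrow> real \<times> 'd) \<Rightarrow> real) set" where
  "cm_tensor_space M B r = cm_tensor_map M B r ` chaos_tensor M B r"

definition cm_inner ::
  "'w measure \<Rightarrow> ('d \<Rightarrow> real \<Rightarrow> 'w \<Rightarrow> real) \<Rightarrow> nat \<Rightarrow>
     ((nat \<Rightarrow> real \<times> 'd) \<Rightarrow> real) \<Rightarrow> ((nat \<Rightarrow> real \<times> 'd) \<Rightarrow> real) \<Rightarrow> real" where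
  "cm_inner M B r f g =
     (let inv_map = inv_into (chaos_tensor M B r) (cm_tensor_map M B r)
      in \<integral>w. inv_map f w * inv_map g w \<partial>(PiM {..<r} (\<lambda>_. M)))"

definition cm_norm ::
  "'w measure \<Rightarrow> ('d \<Rightarrow> real \<Rightarrow> 'w \<Rightarrow> real) \<Rightarrow> nat \<Rightarrow> ((nat \<Rightarrow> real \<times> 'd) \<Rightarrow> real) \<Rightarrow> real" where
  "cm_norm M B r f = sqrt (cm_inner M B r f f)"

definition cm_sym_space ::
  "'w measure \<Rightarrow> ('d \<Rightarrow> real \<Rightarrow> 'w \<Rightarrow> real) \<Rightarrow> nat \<Rightarrow> ((nat \<Rightarrow> real \<times> 'd) \<Rightarrow> real) set" where
  "cm_sym_space M B r =
     {f \<in> cm_tensor_space M B r. \<forall>\<sigma> x. \<sigma> permutes {..<r} \<longrightarrow> f (x \<circ> \<sigma>) = f x}"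


section \<open>Malliavin calculus\<close>

definition partial_deriv :: "nat \<Rightarrow> ((nat \<Rightarrow> real) \<Rightarrow> real) \<Rightarrow> (nat \<Rightarrow> real) \<Rightarrow> real" where
  "partial_deriv i f x = deriv (\<lambda>z. f (x(i := z))) (x i)"

definition iter_partial :: "nat list \<Rightarrow> ((nat \<Rightarrow> real) \<Rightarrow> real) \<Rightarrow> (nat \<Rightarrow> real) \<Rightarrow> real" where
  "iter_partial js f = foldr partial_deriv js f"

text \<open>
  Smooth functions on \<open>\<real>\<^sup>n\<close> all of whose partial derivatives have polynomial growth; \<open>\<real>\<^sup>n\<close> is
  modelled by letting the functions depend on the first \<open>n\<close> coordinates only.
\<close>

definition smooth_poly_growth :: "nat \<Rightarrow> ((nat \<Rightarrow> real) \<Rightarrow> real) \<Rightarrow> bool" where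
  "smooth_poly_growth n f \<longleftrightarrow>
     (\<forall>x y. (\<forall>i<n. x i = y i) \<longrightarrow> f x = f y) \<and>
     (\<forall>js\<in>lists {..<n}.
        continuous_on UNIV (iter_partial js f) \<and>
        (\<forall>i<n. \<forall>x. (\<lambda>z. iter_partial js f (x(i := z))) field_differentiable at (x i)) \<and>
        (\<exists>C K. \<forall>x. \<bar>iter_partial js f x\<bar> \<le> C * (1 + (\<Sum>i<n. \<bar>x i\<bar>)) ^ K))"

text \<open>
  The \<open>r\<close>-th derivative of the smooth functional \<open>f(X\<^sub>0, \<dots>, X\<^sub>n\<^sub>-\<^sub>1)\<close> with the \<open>X\<^sub>i\<close> in the first
  chaos.
\<close>

definition cylinder_deriv ::
  "'w measure \<Rightarrow> ('d \<Rightarrow> real \<Rightarrow> 'w \<Rightarrow> real) \<Rightarrow> nat \<Rightarrow> nat \<Rightarrow> ((nat \<Rightarrow> real) \<Rightarrow> real) \<Rightarrow>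
     (nat \<Rightarrow> 'w \<Rightarrow> real) \<Rightarrow> 'w \<Rightarrow> (nat \<Rightarrow> real \<times> 'd) \<Rightarrow> real" where
  "cylinder_deriv M B r n f X \<omega> x =
     (\<Sum>i\<in>{..<r} \<rightarrow>\<^sub>E {..<n}.
        iter_partial (map i [0..<r]) f (\<lambda>k. X k \<omega>) * cm_tensor r (\<lambda>j. cm_path M B (X (i j))) x)"

text \<open>
  \<open>F\<close> belongs to the Sobolev space of order \<open>k\<close> and exponent \<open>p\<close> -- the completion of the smooth
  functionals -- with derivatives \<open>G 1, \<dots>, G k\<close>.
\<close>

definition has_malliavin_derivs ::
  "'w measure \<Rightarrow> ('d \<Rightarrow> real \<Rightarrow> 'w \<Rightarrow> real) \<Rightarrow> nat \<Rightarrow> real \<Rightarrow> ('w \<Rightarrow> real) \<Rightarrow>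
     (nat \<Rightarrow> 'w \<Rightarrow> (nat \<Rightarrow> real \<times> 'd) \<Rightarrow> real) \<Rightarrow> bool" where
  "has_malliavin_derivs M B k p F G \<longleftrightarrow>
     F \<in> borel_measurable M \<and>
     (\<forall>j\<in>{1..k}. (\<forall>\<omega>\<in>space M. G j \<omega> \<in> cm_sym_space M B j) \<and>
                 (\<forall>x. (\<lambda>\<omega>. G j \<omega> x) \<in> borel_measurable M)) \<and>
     (\<exists>n f X.
        (\<forall>l. smooth_poly_growth (n l) (f l) \<and> (\<forall>i<n l. X l i \<in> first_chaos M B)) \<and>
        (\<lambda>l::nat. Lp_norm M p (\<lambda>\<omega>. F \<omega> - f l (\<lambda>i. X l i \<omega>))) \<longlonglongrightarrow> 0 \<and>
        (\<forall>j\<in>{1..k}.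
           (\<lambda>l. Lp_norm M p (\<lambda>\<omega>. cm_norm M B j
                  (\<lambda>x. G j \<omega> x - cylinder_deriv M B j (n l) (f l) (X l) \<omega> x))) \<longlonglongrightarrow> 0))"

definition malliavin_space ::
  "'w measure \<Rightarrow> ('d \<Rightarrow> real \<Rightarrow> 'w \<Rightarrow> real) \<Rightarrow> nat \<Rightarrow> real \<Rightarrow> ('w \<Rightarrow> real) set" where
  "malliavin_space M B k p = {F. \<exists>G. has_malliavin_derivs M B k p F G}"

definition malliavin_smooth ::
  "'w measure \<Rightarrow> ('d \<Rightarrow> real \<Rightarrow> 'w \<Rightarrow> real) \<Rightarrow> ('w \<Rightarrow> real) set" where
  "malliavin_smooth M B = (\<Inter>k\<in>{1..}. \<Inter>p\<in>{1..}. malliavin_space M B k p)"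

text \<open>
  A version of \<open>D\<^sup>rF\<close>.  By closability it is almost surely unique and does not depend on the
  exponent, so for elements of \<open>malliavin_smooth\<close> the exponent \<open>2\<close> is no restriction.
\<close>

definition malliavin_D ::
  "'w measure \<Rightarrow> ('d \<Rightarrow> real \<Rightarrow> 'w \<Rightarrow> real) \<Rightarrow> nat \<Rightarrow> ('w \<Rightarrow> real) \<Rightarrow>
     'w \<Rightarrow> (nat \<Rightarrow> real \<times> 'd) \<Rightarrow> real" where
  "malliavin_D M B r F = (SOME G. has_malliavin_derivs M B r 2 F G) r"


section \<open>The class of processes\<close>

definition rect_incr :: "nat \<Rightarrow> ((nat \<Rightarrow> real) \<Rightarrow> real) \<Rightarrow> (nat \<Rightarrow> real) \<Rightarrow> (nat \<Rightarrow> real) \<Rightarrow> real" where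
  "rect_incr r \<phi> s t =
     (\<Sum>A\<in>Pow {..<r}. (- 1) ^ (r - card A) * \<phi> (\<lambda>i. if i \<in> A then t i else s i))"

text \<open>
  The class \<open>\<J>(\<real>)\<close>.  The bound \<open>C'\<close> may depend on the order and the coordinates, but not on \<open>t\<close>;
  random variables are identified when almost surely equal.
\<close>

definition class_J ::
  "'w measure \<Rightarrow> real \<Rightarrow> ('d \<Rightarrow> real \<Rightarrow> 'w \<Rightarrow> real) \<Rightarrow> (real \<Rightarrow> 'w \<Rightarrow> real) set" where
  "class_J M H B = {F.
     (\<forall>t\<in>{0..1}. F t \<in> malliavin_smooth M B) \<and>
     (\<exists>C\<in>L_infty_minus M. \<forall>t\<in>{0..1}. AE \<omega> in M. \<bar>F t \<omega>\<bar> \<le> C \<omega>) \<and>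
     (\<forall>r\<ge>1. \<forall>\<alpha>. \<exists>C'\<in>L_infty_minus M. \<forall>t\<in>{0..1}. \<exists>\<phi>.
        (\<forall>u\<in>{..<r} \<rightarrow>\<^sub>E {0..1}. \<phi> u \<in> borel_measurable M \<and>
           (AE \<omega> in M. \<phi> u \<omega> =
              cm_inner M B r (malliavin_D M B r (F t) \<omega>) (cm_sym_tensor r (\<lambda>i. cm_psi H (u i) (\<alpha> i))))) \<and>
        (AE \<omega> in M. continuous_on ({..<r} \<rightarrow>\<^sub>E {0..1}) (\<lambda>u. \<phi> u \<omega>) \<and>
           (\<forall>a\<in>{..<r} \<rightarrow>\<^sub>E {0..1}. \<forall>b\<in>{..<r} \<rightarrow>\<^sub>E {0..1}. (\<forall>i<r. a i \<le> b i) \<longrightarrow>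
              \<bar>rect_incr r (\<lambda>u. \<phi> u \<omega>) a b\<bar> \<le> C' \<omega> * (\<Prod>i<r. (b i - a i) powr (2 * H)))))}"


section \<open>Discrete processes on the dyadic grid\<close>

definition dyadic :: "nat \<Rightarrow> nat \<Rightarrow> real" where
  "dyadic m i = real i / 2 ^ m"

definition dyadics :: "nat \<Rightarrow> real set" where
  "dyadics m = dyadic m ` {0..2 ^ m}"

definition holder_norm :: "nat \<Rightarrow> real \<Rightarrow> (real \<Rightarrow> real) \<Rightarrow> real" where
  "holder_norm m \<kappa> g =
     Sup {\<bar>g t - g s\<bar> / \<bar>t - s\<bar> powr \<kappa> | s t. s \<in> dyadics m \<and> t \<in> dyadics m \<and> s \<noteq> t}"

definition weighted_area_sum ::
  "(real \<Rightarrow> 'w \<Rightarrow> real) \<Rightarrow> (real \<Rightarrow> real \<Rightarrow> 'w \<Rightarrow> real) \<Rightarrow> nat \<Rightarrow> real \<Rightarrow> 'w \<Rightarrow> real" where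
  "weighted_area_sum F A m t \<omega> =
     (\<Sum>i=1..nat \<lfloor>2 ^ m * t\<rfloor>. F (dyadic m (i - 1)) \<omega> * A (dyadic m (i - 1)) (dyadic m i) \<omega>)"

definition weighted_product_sum ::
  "('d \<Rightarrow> real \<Rightarrow> 'w \<Rightarrow> real) \<Rightarrow> 'd \<Rightarrow> 'd \<Rightarrow> (real \<Rightarrow> 'w \<Rightarrow> real) \<Rightarrow> nat \<Rightarrow> real \<Rightarrow> 'w \<Rightarrow> real" where
  "weighted_product_sum B \<alpha> \<beta> F m t \<omega> =
     (\<Sum>i=1..nat \<lfloor>2 ^ m * t\<rfloor>. F (dyadic m (i - 1)) \<omega> *
        incr (B \<alpha>) (dyadic m (i - 1)) (dyadic m i) \<omega> * incr (B \<beta>) (dyadic m (i - 1)) (dyadic m i) \<omega>)"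

end

theory Submission
  imports Defs
begin

text \<open>
  Everything reduces to the moment bound \<open>E |\<Sum>\<^sub>i\<^sub>\<in>\<^sub>S F(t\<^sub>i) X\<^sub>i Y\<^sub>i|\<^sup>q \<le> C (|S|\<^sup>1\<^sup>/\<^sup>2 \<sigma>)\<^sup>q\<close>, where the \<open>X\<^sub>i\<close>, \<open>Y\<^sub>i\<close> are
  increments of \<open>B\<^sup>\<alpha>\<close>, \<open>B\<^sup>\<beta>\<close> over distinct dyadic intervals of length \<open>2\<^sup>-\<^sup>n\<close> and \<open>\<sigma> = 2\<^sup>-\<^sup>2\<^sup>H\<^sup>n\<close>.  Write \<open>Z\<close> for the sum and
  \<open>Z(e\<^sub>1,\<dots>,e\<^sub>r)\<close> for the same sum with \<open>F\<close> replaced by its \<open>r\<close>-th Malliavin derivative along increments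
  \<open>e\<^sub>1,\<dots>,e\<^sub>r\<close>, which the class \<open>\<J>\<close> bounds by \<open>O(\<sigma>\<^sup>r)\<close>.  Gaussian integration by parts in \<open>X\<^sub>i\<close> and in \<open>Y\<^sub>i\<close>, the
  bound \<open>\<Sum>\<^sub>j |E X\<^sub>i X\<^sub>j| \<le> 2 \<sigma>\<close> (valid since \<open>H \<le> 1/2\<close>) and Hoelder's inequality control the moments of \<open>Z(e\<^sub>1,\<dots>,e\<^sub>r)\<close> by those
  of the sums of order \<open>r + 1\<close> and \<open>r + 2\<close> with a small factor, so the trivial bound, known for all \<open>r\<close>, improves
  itself; as \<open>H > 1/3\<close>, four rounds reach the square root.

  The product sum is of this form.  The difference of two consecutive dyadic Riemann sums of the iterated
  integrals is so too, on a finer grid; these bounds form a convergent geometric series and pass to the limit by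
  Fatou's lemma.  A chaining argument over the dyadic points turns the moments of the increments into those
  of the Hoelder norm.
\<close>

section \<open>Random variables with moments of all orders\<close>

text \<open>Neither adaptedness nor independence of the increments can be relied on:
  \<open>F t\<close> may depend on the whole path, and increments over disjoint intervals are
  correlated for H < 1/2. All cancellation comes from Gaussian integration by parts, which in turn
  produces higher derivatives of \<open>F\<close>. Since order r calls for orders r + 1 and r + 2,
  an induction on r cannot close; each bound is therefore kept for all r at once
  (\<open>area_bound\<close>) and only the size \<open>L\<close> in it is iterated. The covariance
  terms demand |S| \<sigma>^2 <= L^2, so the square root is where the iteration ends.

  A second obstacle is the form of the data. Derivatives are arbitrary versions in a function space
  whose inner product is transported by a choice of preimage, while the class bounds rectangular
  increments. Point evaluation is bounded by the norm, so the calculus can be carried out on the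
  real variables \<open>W F es\<close>, and uniqueness ties the versions of different orders
  together.\<close>

context prob_space
begin

definition all_moments :: "('a \<Rightarrow> real) set" where
  "all_moments = {f \<in> borel_measurable M. \<forall>q::nat. integrable M (\<lambda>\<omega>. \<bar>f \<omega>\<bar> ^ q)}"

text \<open>The integral of a non-integrable function defaults to 0, and so does this norm; a bound
  on \<open>nrm\<close> is informative only next to membership in \<open>all_moments\<close> or an
  integrability statement. Being real-valued, it can enter the polynomial inequalities of the moment
  estimate directly.\<close>

definition nrm :: "nat \<Rightarrow> ('a \<Rightarrow> real) \<Rightarrow> real" where
  "nrm q f = root q (\<integral>\<omega>. \<bar>f \<omega>\<bar> ^ q \<partial>M)"

lemma all_momentsD:
  assumes "f \<in> all_moments"
  shows "f \<in> borel_measurable M" "integrable M (\<lambda>\<omega>. \<bar>f \<omega>\<bar> ^ q)"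
  using assms by (auto simp: all_moments_def)

lemma all_moments_dominated:
  assumes "f \<in> borel_measurable M" "\<And>q. integrable M (\<lambda>\<omega>. g q \<omega> :: real)"
    "\<And>q \<omega>. \<bar>f \<omega>\<bar> ^ q \<le> g q \<omega>"
  shows "f \<in> all_moments"
  unfolding all_moments_def
proof (safe intro!: assms(1))
  fix q
  have [measurable]: "f \<in> borel_measurable M" by fact
  show "integrable M (\<lambda>\<omega>. \<bar>f \<omega>\<bar> ^ q)"
    by (rule Bochner_Integration.integrable_bound[OF assms(2)[of q]])
       (use assms(3) in \<open>auto intro: order_trans[OF _ abs_ge_self]\<close>)
qed

lemma all_moments_mult:
  assumes "f \<in> all_moments" "g \<in> all_moments"
  shows "(\<lambda>\<omega>. f \<omega> * g \<omega>) \<in> all_moments"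
proof (rule all_moments_dominated)
  note [measurable] = all_momentsD(1)[OF assms(1)] all_momentsD(1)[OF assms(2)]
  show "(\<lambda>\<omega>. f \<omega> * g \<omega>) \<in> borel_measurable M" by measurable
  show "integrable M (\<lambda>\<omega>. \<bar>f \<omega>\<bar> ^ (2*q) + \<bar>g \<omega>\<bar> ^ (2*q))" for q
    using assms by (intro Bochner_Integration.integrable_add all_momentsD)
  fix q \<omega>
  have "2 * (\<bar>f \<omega>\<bar>^q * \<bar>g \<omega>\<bar>^q) \<le> (\<bar>f \<omega>\<bar>^q)\<^sup>2 + (\<bar>g \<omega>\<bar>^q)\<^sup>2"
    using sum_squares_bound[of "\<bar>f \<omega>\<bar>^q" "\<bar>g \<omega>\<bar>^q"] by (simp add: mult.assoc)
  moreover have "0 \<le> \<bar>f \<omega>\<bar>^q * \<bar>g \<omega>\<bar>^q" by simp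
  ultimately have "\<bar>f \<omega>\<bar>^q * \<bar>g \<omega>\<bar>^q \<le> (\<bar>f \<omega>\<bar>^q)\<^sup>2 + (\<bar>g \<omega>\<bar>^q)\<^sup>2" by linarith
  then show "\<bar>f \<omega> * g \<omega>\<bar> ^ q \<le> \<bar>f \<omega>\<bar> ^ (2*q) + \<bar>g \<omega>\<bar> ^ (2*q)"
    by (simp add: abs_mult power_mult_distrib power_mult[symmetric] mult.commute)
qed

lemma power_add_le:
  fixes a b :: real
  assumes "0 \<le> a" "0 \<le> b"
  shows "(a + b) ^ q \<le> 2 ^ q * (a ^ q + b ^ q)"
proof -
  have "(a + b) ^ q \<le> (2 * max a b) ^ q"
    by (rule power_mono) (use assms in auto)
  also have "\<dots> = 2 ^ q * (max a b) ^ q" by (simp add: power_mult_distrib)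
  also have "\<dots> \<le> 2 ^ q * (a ^ q + b ^ q)"
    by (rule mult_left_mono) (use assms in \<open>auto simp: max_def\<close>)
  finally show ?thesis .
qed

lemma all_moments_add:
  assumes "f \<in> all_moments" "g \<in> all_moments"
  shows "(\<lambda>\<omega>. f \<omega> + g \<omega>) \<in> all_moments"
proof (rule all_moments_dominated)
  note [measurable] = all_momentsD(1)[OF assms(1)] all_momentsD(1)[OF assms(2)]
  show "(\<lambda>\<omega>. f \<omega> + g \<omega>) \<in> borel_measurable M" by measurable
  show "integrable M (\<lambda>\<omega>. 2 ^ q * (\<bar>f \<omega>\<bar> ^ q + \<bar>g \<omega>\<bar> ^ q))" for q
    using assms by (intro Bochner_Integration.integrable_add integrable_mult_right all_momentsD)
  fix q \<omega>
  have "\<bar>f \<omega> + g \<omega>\<bar> ^ q \<le> (\<bar>f \<omega>\<bar> + \<bar>g \<omega>\<bar>) ^ q"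
    by (rule power_mono) auto
  also have "\<dots> \<le> 2 ^ q * (\<bar>f \<omega>\<bar> ^ q + \<bar>g \<omega>\<bar> ^ q)"
    by (rule power_add_le) auto
  finally show "\<bar>f \<omega> + g \<omega>\<bar> ^ q \<le> 2 ^ q * (\<bar>f \<omega>\<bar> ^ q + \<bar>g \<omega>\<bar> ^ q)" .
qed

lemma all_moments_const [simp]: "(\<lambda>_. c) \<in> all_moments"
  by (auto simp: all_moments_def)

lemma all_moments_cmult:
  "f \<in> all_moments \<Longrightarrow> (\<lambda>\<omega>. c * f \<omega>) \<in> all_moments"
  using all_moments_mult[of "\<lambda>_. c" f] by simp

lemma all_moments_minus: "f \<in> all_moments \<Longrightarrow> (\<lambda>\<omega>. - f \<omega>) \<in> all_moments"
  using all_moments_cmult[of f "-1"] by simp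

lemma all_moments_diff:
  "f \<in> all_moments \<Longrightarrow> g \<in> all_moments \<Longrightarrow> (\<lambda>\<omega>. f \<omega> - g \<omega>) \<in> all_moments"
  using all_moments_add[OF _ all_moments_minus, of f g] by simp

lemma all_moments_sum:
  "(\<And>i. i \<in> I \<Longrightarrow> f i \<in> all_moments) \<Longrightarrow> (\<lambda>\<omega>. \<Sum>i\<in>I. f i \<omega>) \<in> all_moments"
  by (induction I rule: infinite_finite_induct) (auto intro: all_moments_add)

lemma all_moments_prod:
  "(\<And>i. i \<in> I \<Longrightarrow> f i \<in> all_moments) \<Longrightarrow> (\<lambda>\<omega>. \<Prod>i\<in>I. f i \<omega>) \<in> all_moments"
  by (induction I rule: infinite_finite_induct) (auto intro: all_moments_mult)

lemma all_moments_power: "f \<in> all_moments \<Longrightarrow> (\<lambda>\<omega>. f \<omega> ^ n) \<in> all_moments"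
  by (induction n) (auto intro: all_moments_mult)

lemma all_moments_abs: "f \<in> all_moments \<Longrightarrow> (\<lambda>\<omega>. \<bar>f \<omega>\<bar>) \<in> all_moments"
  by (auto simp: all_moments_def)

lemma all_moments_AE_bound:
  assumes "f \<in> borel_measurable M" "g \<in> all_moments" "AE \<omega> in M. \<bar>f \<omega>\<bar> \<le> \<bar>g \<omega>\<bar>"
  shows "f \<in> all_moments"
  unfolding all_moments_def
proof safe
  fix q
  have [measurable]: "f \<in> borel_measurable M" by fact
  have "AE \<omega> in M. norm (\<bar>f \<omega>\<bar> ^ q) \<le> norm (\<bar>g \<omega>\<bar> ^ q)"
    using assms(3) by eventually_elim (auto intro: power_mono)
  then show "integrable M (\<lambda>\<omega>. \<bar>f \<omega>\<bar> ^ q)"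
    by (intro Bochner_Integration.integrable_bound[OF all_momentsD(2)[OF assms(2), of q]]) auto
qed fact

lemma all_moments_integrable: "f \<in> all_moments \<Longrightarrow> integrable M f"
  using all_momentsD(2)[of f 1] by (auto intro: integrable_norm_cancel all_momentsD(1))

lemma nrm_nonneg [simp]: "0 \<le> nrm q f"
  by (cases "q = 0") (simp_all add: nrm_def)

lemma nrm_power: "q > 0 \<Longrightarrow> nrm q f ^ q = (\<integral>\<omega>. \<bar>f \<omega>\<bar> ^ q \<partial>M)"
  by (simp add: nrm_def)

lemma nrm_const [simp]: "q > 0 \<Longrightarrow> nrm q (\<lambda>_. c) = \<bar>c\<bar>"
  by (simp add: nrm_def real_root_power_cancel prob_space)

lemma nrm_cmult: "q > 0 \<Longrightarrow> nrm q (\<lambda>\<omega>. c * f \<omega>) = \<bar>c\<bar> * nrm q f"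
  unfolding nrm_def abs_mult power_mult_distrib by (simp add: real_root_mult real_root_power_cancel)

lemma nrm_mono_AE:
  assumes "q > 0" "f \<in> borel_measurable M" "g \<in> all_moments" "AE \<omega> in M. \<bar>f \<omega>\<bar> \<le> \<bar>g \<omega>\<bar>"
  shows "nrm q f \<le> nrm q g"
  unfolding nrm_def
proof (intro real_root_le_mono[OF assms(1)] integral_mono_AE all_momentsD)
  show "f \<in> all_moments" by (rule all_moments_AE_bound[OF assms(2-4)])
  show "AE \<omega> in M. \<bar>f \<omega>\<bar> ^ q \<le> \<bar>g \<omega>\<bar> ^ q"
    using assms(4) by eventually_elim (auto intro: power_mono)
qed fact

lemma nrm_le_power:
  assumes "q > 0" "(\<integral>\<omega>. \<bar>f \<omega>\<bar> ^ q \<partial>M) \<le> A ^ q" "0 \<le> A"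
  shows "nrm q f \<le> A"
  using real_root_le_mono[OF assms(1,2)] assms by (simp add: nrm_def real_root_power_cancel)

lemma nrm_zero_AE:
  assumes "q > 0" "f \<in> all_moments" "nrm q f = 0"
  shows "AE \<omega> in M. f \<omega> = 0"
proof -
  have "(\<integral>\<omega>. \<bar>f \<omega>\<bar> ^ q \<partial>M) = 0"
    using nrm_power[OF assms(1), of f] assms(1,3) by (metis power_0_left not_gr0)
  then have "AE \<omega> in M. \<bar>f \<omega>\<bar> ^ q = 0"
    using integral_nonneg_eq_0_iff_AE[OF all_momentsD(2)[OF assms(2), of q]] by simp
  then show ?thesis using assms(1) by simp
qed

text \<open>From the arithmetic-geometric mean inequality for the normalised functions.\<close>

lemma Hoelder_prod:
  assumes "q > 0" "\<And>i. i < q \<Longrightarrow> f i \<in> all_moments"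
  shows "(\<integral>\<omega>. \<bar>\<Prod>i<q. f i \<omega>\<bar> \<partial>M) \<le> (\<Prod>i<q. nrm q (f i))"
proof (cases "\<exists>i<q. nrm q (f i) = 0")
  case True
  then obtain i where i: "i < q" "nrm q (f i) = 0" by auto
  have "AE \<omega> in M. f i \<omega> = 0" using nrm_zero_AE[OF assms(1) assms(2)[OF i(1)] i(2)] .
  then have "AE \<omega> in M. \<bar>\<Prod>i<q. f i \<omega>\<bar> = 0"
    by eventually_elim (use i in auto)
  then have "(\<integral>\<omega>. \<bar>\<Prod>i<q. f i \<omega>\<bar> \<partial>M) = 0"
    by (simp add: integral_eq_zero_AE)
  then show ?thesis by (simp add: prod_nonneg)
next
  case False
  define n where "n i = nrm q (f i)" for i
  have n: "n i > 0" if "i < q" for i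
    using False that nrm_nonneg[of q "f i"] by (auto simp: n_def less_le)
  have amgm: "\<bar>\<Prod>i<q. f i \<omega>\<bar> \<le> (\<Prod>i<q. n i) * (\<Sum>i<q. \<bar>f i \<omega>\<bar> ^ q / n i ^ q / q)" for \<omega>
  proof -
    have "(\<Prod>i<q. (\<bar>f i \<omega>\<bar> / n i) ^ q) powr (1 / real q) \<le> (\<Sum>i<q. (\<bar>f i \<omega>\<bar> / n i) ^ q / q)"
      using arith_geom_mean[of "{..<q}" "\<lambda>i. (\<bar>f i \<omega>\<bar> / n i) ^ q"] assms(1) n
      by (fastforce simp: less_imp_le)
    also have "(\<Prod>i<q. (\<bar>f i \<omega>\<bar> / n i) ^ q) = (\<Prod>i<q. (\<bar>f i \<omega>\<bar> / n i)) ^ q"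
      by (simp add: prod_power_distrib)
    also have "\<dots> powr (1 / real q) = (\<Prod>i<q. (\<bar>f i \<omega>\<bar> / n i))"
    proof -
      have "0 \<le> (\<Prod>i<q. (\<bar>f i \<omega>\<bar> / n i))"
        using n by (intro prod_nonneg) (auto simp: less_imp_le)
      then show ?thesis using assms(1)
        by (subst root_powr_inverse[symmetric]) (simp_all add: real_root_power_cancel)
    qed
    also have "\<dots> = \<bar>\<Prod>i<q. f i \<omega>\<bar> / (\<Prod>i<q. n i)"
      by (simp add: prod_dividef abs_prod)
    finally show ?thesis
      using prod_pos[of "{..<q}" n] n by (simp add: divide_le_eq power_divide mult.commute)
  qed
  have "(\<integral>\<omega>. \<bar>\<Prod>i<q. f i \<omega>\<bar> \<partial>M) \<le> (\<integral>\<omega>. (\<Prod>i<q. n i) * (\<Sum>i<q. \<bar>f i \<omega>\<bar> ^ q / n i ^ q / q) \<partial>M)"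
  proof (rule integral_mono)
    show "integrable M (\<lambda>\<omega>. \<bar>\<Prod>i<q. f i \<omega>\<bar>)"
      using assms by (intro all_moments_integrable all_moments_abs all_moments_prod) auto
    show "integrable M (\<lambda>\<omega>. (\<Prod>i<q. n i) * (\<Sum>i<q. \<bar>f i \<omega>\<bar> ^ q / n i ^ q / q))"
      using assms by (intro integrable_mult_right Bochner_Integration.integrable_sum
        integrable_divide all_momentsD) auto
  qed (rule amgm)
  also have "\<dots> = (\<Prod>i<q. n i) * (\<Sum>i<q. (\<integral>\<omega>. \<bar>f i \<omega>\<bar> ^ q \<partial>M) / n i ^ q / q)"
    using assms by (simp add: all_momentsD)
  also have "\<dots> = (\<Prod>i<q. n i) * (\<Sum>i<q. 1 / q)"
    using n by (intro arg_cong2[where f="(*)"] sum.cong refl)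
      (fastforce simp: n_def nrm_power[OF assms(1), symmetric])
  also have "\<dots> = (\<Prod>i<q. n i)" using assms(1) by simp
  finally show ?thesis by (simp add: n_def)
qed

text \<open>Minkowski's inequality from convexity of \<open>x ^ q\<close> on the half line: (|f| +
  |g|) / (a + b), with a and b the two norms, is the convex combination of |f| / a and |g| / b with
  weights a / (a + b) and b / (a + b). Vanishing norms are split off because of the
  division.\<close>

lemma nrm_add:
  assumes "q > 0" "f \<in> all_moments" "g \<in> all_moments"
  shows "nrm q (\<lambda>\<omega>. f \<omega> + g \<omega>) \<le> nrm q f + nrm q g"
proof -
  consider "nrm q f = 0" | "nrm q g = 0" | "nrm q f > 0" "nrm q g > 0"
    using nrm_nonneg[of q f] nrm_nonneg[of q g] by linarith
  then show ?thesis
  proof cases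
    case 1
    have "nrm q (\<lambda>\<omega>. f \<omega> + g \<omega>) \<le> nrm q g"
      using nrm_zero_AE[OF assms(1,2) 1] assms all_momentsD(1)[OF all_moments_add[OF assms(2,3)]]
      by (intro nrm_mono_AE) auto
    then show ?thesis by (simp add: 1)
  next
    case 2
    have "nrm q (\<lambda>\<omega>. f \<omega> + g \<omega>) \<le> nrm q f"
      using nrm_zero_AE[OF assms(1,3) 2] assms all_momentsD(1)[OF all_moments_add[OF assms(2,3)]]
      by (intro nrm_mono_AE) auto
    then show ?thesis by (simp add: 2)
  next
    case 3
    define a b where "a = nrm q f" and "b = nrm q g"
    have ab: "a > 0" "b > 0" using 3 by (auto simp: a_def b_def)
    have conv: "convex_on {0::real..} (\<lambda>x. x ^ q)"
      using convex_power_odd[of q] convex_on_subset[OF convex_power_even[of q], of "{0..}"]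
      by (cases "even q") auto
    have *: "\<bar>f \<omega> + g \<omega>\<bar> ^ q \<le> (a + b) ^ q * (a / (a + b) * (\<bar>f \<omega>\<bar> ^ q / a ^ q) + b / (a + b) * (\<bar>g \<omega>\<bar> ^ q / b ^ q))"
      for \<omega>
    proof -
      have "\<bar>f \<omega> + g \<omega>\<bar> ^ q \<le> (\<bar>f \<omega>\<bar> + \<bar>g \<omega>\<bar>) ^ q" by (rule power_mono) auto
      also have "\<bar>f \<omega>\<bar> + \<bar>g \<omega>\<bar> = (a + b) * (a / (a + b) * (\<bar>f \<omega>\<bar> / a) + b / (a + b) * (\<bar>g \<omega>\<bar> / b))"
        using ab by (simp add: distrib_left)
      also have "\<dots> ^ q = (a + b) ^ q * (a / (a + b) * (\<bar>f \<omega>\<bar> / a) + b / (a + b) * (\<bar>g \<omega>\<bar> / b)) ^ q"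
        by (simp add: power_mult_distrib)
      also have "(a / (a + b) * (\<bar>f \<omega>\<bar> / a) + b / (a + b) * (\<bar>g \<omega>\<bar> / b)) ^ q
          \<le> a / (a + b) * (\<bar>f \<omega>\<bar> / a) ^ q + b / (a + b) * (\<bar>g \<omega>\<bar> / b) ^ q"
      proof -
        have "a / (a + b) + b / (a + b) = 1" using ab by (simp add: add_divide_distrib[symmetric])
        then show ?thesis
          using conv ab
          unfolding convex_on_def real_scaleR_def
          by (metis (no_types, lifting) atLeast_iff abs_ge_zero divide_nonneg_pos add_pos_pos less_imp_le)
      qed
      finally show ?thesis using ab by (simp add: power_divide mult_left_mono)
    qed
    have "(\<integral>\<omega>. \<bar>f \<omega> + g \<omega>\<bar> ^ q \<partial>M) \<le>
      (\<integral>\<omega>. (a + b) ^ q * (a / (a + b) * (\<bar>f \<omega>\<bar> ^ q / a ^ q) + b / (a + b) * (\<bar>g \<omega>\<bar> ^ q / b ^ q)) \<partial>M)"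
      using assms by (intro integral_mono * all_momentsD(2)[of "\<lambda>\<omega>. f \<omega> + g \<omega>"] all_moments_add)
        (auto intro!: integrable_mult_right Bochner_Integration.integrable_add integrable_divide all_momentsD)
    also have "\<dots> = (a + b) ^ q * (a / (a + b) * ((\<integral>\<omega>. \<bar>f \<omega>\<bar> ^ q \<partial>M) / a ^ q) + b / (a + b) * ((\<integral>\<omega>. \<bar>g \<omega>\<bar> ^ q \<partial>M) / b ^ q))"
      using assms by (simp add: all_momentsD)
    also have "\<dots> = (a + b) ^ q * (a / (a + b) + b / (a + b))"
      using ab by (simp add: nrm_power[OF assms(1), symmetric] a_def b_def)
    also have "\<dots> = (a + b) ^ q" using ab by (simp add: add_divide_distrib[symmetric])
    finally show ?thesis
      using assms(1) ab by (intro nrm_le_power) (auto simp: a_def b_def)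
  qed
qed

lemma nrm_sum:
  assumes "q > 0" "\<And>i. i \<in> I \<Longrightarrow> f i \<in> all_moments"
  shows "nrm q (\<lambda>\<omega>. \<Sum>i\<in>I. f i \<omega>) \<le> (\<Sum>i\<in>I. nrm q (f i))"
  using assms(2)
proof (induction I rule: infinite_finite_induct)
  case (insert x I)
  have "nrm q (\<lambda>\<omega>. \<Sum>i\<in>insert x I. f i \<omega>) \<le> nrm q (f x) + nrm q (\<lambda>\<omega>. \<Sum>i\<in>I. f i \<omega>)"
    using insert nrm_add[OF assms(1), of "f x" "\<lambda>\<omega>. \<Sum>i\<in>I. f i \<omega>"] by (auto intro: all_moments_sum)
  with insert show ?case by auto
qed (use assms in auto)

text \<open>The generalised Hoelder inequality for 2q factors, q of them equal to f and q equal to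
  g.\<close>

lemma nrm_mult:
  assumes "q > 0" "f \<in> all_moments" "g \<in> all_moments"
  shows "nrm q (\<lambda>\<omega>. f \<omega> * g \<omega>) \<le> nrm (2 * q) f * nrm (2 * q) g"
proof (rule nrm_le_power[OF assms(1)])
  define h where "h i = (if i < q then f else g)" for i :: nat
  have *: "(\<Prod>i<2*q. H (h i)) = H f ^ q * H g ^ q" for H :: "('a \<Rightarrow> real) \<Rightarrow> real"
  proof -
    have "{..<2*q} = {..<q} \<union> {q..<2*q}" by auto
    then have "(\<Prod>i<2*q. H (h i)) = (\<Prod>i<q. H (h i)) * (\<Prod>i\<in>{q..<2*q}. H (h i))"
      by (simp add: prod.union_disjoint ivl_disj_int)
    also have "\<dots> = (\<Prod>i<q. H f) * (\<Prod>i\<in>{q..<2*q}. H g)"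
      by (intro arg_cong2[where f="(*)"] prod.cong) (auto simp: h_def)
    finally show ?thesis by (simp add: mult_2)
  qed
  have "(\<integral>\<omega>. \<bar>f \<omega> * g \<omega>\<bar> ^ q \<partial>M) = (\<integral>\<omega>. \<bar>\<Prod>i<2*q. h i \<omega>\<bar> \<partial>M)"
    by (intro Bochner_Integration.integral_cong refl)
       (simp add: *[of "\<lambda>f. f x" for x] abs_mult power_abs power_mult_distrib)
  also have "\<dots> \<le> (\<Prod>i<2*q. nrm (2*q) (h i))"
    using assms by (intro Hoelder_prod) (auto simp: h_def)
  also have "\<dots> = (nrm (2 * q) f * nrm (2 * q) g) ^ q"
    by (simp add: * power_mult_distrib)
  finally show "(\<integral>\<omega>. \<bar>f \<omega> * g \<omega>\<bar> ^ q \<partial>M) \<le> \<dots>" .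
qed simp

text \<open>The q copies of f are padded with q' - q copies of the constant 1, whose norm is 1 on a
  probability space; then \<open>Hoelder_prod\<close> applies with q' factors.\<close>

lemma nrm_mono_exponent:
  assumes "0 < q" "q \<le> q'" "f \<in> all_moments"
  shows "nrm q f \<le> nrm q' f"
proof (rule nrm_le_power[OF assms(1)])
  define h where "h i = (if i < q then f else (\<lambda>_. 1))" for i :: nat
  have *: "(\<Prod>i<q'. H (h i)) = H f ^ q * H (\<lambda>_. 1) ^ (q' - q)" for H :: "('a \<Rightarrow> real) \<Rightarrow> real"
  proof -
    have "{..<q'} = {..<q} \<union> {q..<q'}" using assms by auto
    then have "(\<Prod>i<q'. H (h i)) = (\<Prod>i<q. H (h i)) * (\<Prod>i\<in>{q..<q'}. H (h i))"
      by (simp add: prod.union_disjoint ivl_disj_int)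
    also have "\<dots> = (\<Prod>i<q. H f) * (\<Prod>i\<in>{q..<q'}. H (\<lambda>_. 1))"
      by (intro arg_cong2[where f="(*)"] prod.cong) (auto simp: h_def)
    finally show ?thesis by simp
  qed
  have "(\<integral>\<omega>. \<bar>f \<omega>\<bar> ^ q \<partial>M) = (\<integral>\<omega>. \<bar>\<Prod>i<q'. h i \<omega>\<bar> \<partial>M)"
    by (intro Bochner_Integration.integral_cong refl)
       (simp add: *[of "\<lambda>f. f x" for x] power_abs)
  also have "\<dots> \<le> (\<Prod>i<q'. nrm q' (h i))"
    using assms by (intro Hoelder_prod) (auto simp: h_def)
  also have "\<dots> = nrm q' f ^ q"
    using assms by (simp add: *)
  finally show "(\<integral>\<omega>. \<bar>f \<omega>\<bar> ^ q \<partial>M) \<le> \<dots>" .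
qed simp

lemma abs_expectation_le_nrm:
  assumes "0 < q" "f \<in> all_moments"
  shows "\<bar>expectation f\<bar> \<le> nrm q f"
proof -
  have "\<bar>expectation f\<bar> \<le> expectation (\<lambda>\<omega>. \<bar>f \<omega>\<bar>)" by (rule integral_abs_bound)
  also have "\<dots> = nrm 1 f" by (simp add: nrm_def)
  also have "\<dots> \<le> nrm q f" using assms by (intro nrm_mono_exponent) auto
  finally show ?thesis .
qed

text \<open>A real power with exponent p >= 1 is dominated by 1 plus the power with the rounded-up
  exponent, so natural exponents describe the whole space.\<close>

lemma L_infty_minus_eq: "L_infty_minus M = all_moments"
proof
  show "L_infty_minus M \<subseteq> all_moments"
  proof
    fix f assume f: "f \<in> L_infty_minus M"
    have [measurable]: "f \<in> borel_measurable M"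
      using f by (auto simp: L_infty_minus_def Lp_space_def)
    show "f \<in> all_moments" unfolding all_moments_def
    proof safe
      fix q :: nat
      show "integrable M (\<lambda>\<omega>. \<bar>f \<omega>\<bar> ^ q)"
      proof (cases "q = 0")
        case False
        then have "real q \<in> {1..}" by auto
        then have "Lp_norm M (real q) f < \<top>"
          using f unfolding L_infty_minus_def Lp_space_def by blast
        then have "(\<integral>\<^sup>+ \<omega>. ennreal (\<bar>f \<omega>\<bar> powr q) \<partial>M) < \<top>"
          by (auto simp: Lp_norm_def Let_def less_top split: if_splits)
        moreover have "\<bar>f \<omega>\<bar> powr q = \<bar>f \<omega>\<bar> ^ q" for \<omega>
          using False by (cases "f \<omega> = 0") (auto simp: powr_realpow)
        ultimately show ?thesis by (intro integrableI_bounded) auto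
      qed simp
    qed fact
  qed
  show "all_moments \<subseteq> L_infty_minus M"
  proof
    fix f assume f: "f \<in> all_moments"
    note [measurable] = all_momentsD(1)[OF f]
    show "f \<in> L_infty_minus M" unfolding L_infty_minus_def Lp_space_def
    proof (safe intro!: INT_I)
      fix p :: real assume p: "1 \<le> p"
      have "(\<integral>\<^sup>+ \<omega>. ennreal (\<bar>f \<omega>\<bar> powr p) \<partial>M) \<le> (\<integral>\<^sup>+ \<omega>. ennreal (1 + \<bar>f \<omega>\<bar> ^ nat \<lceil>p\<rceil>) \<partial>M)"
      proof (intro nn_integral_mono ennreal_leI)
        fix \<omega>
        show "\<bar>f \<omega>\<bar> powr p \<le> 1 + \<bar>f \<omega>\<bar> ^ nat \<lceil>p\<rceil>"
        proof (cases "\<bar>f \<omega>\<bar> \<le> 1")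
          case True
          then have "\<bar>f \<omega>\<bar> powr p \<le> 1" using p by (intro powr_le1) auto
          then show ?thesis by (smt (verit) zero_le_power abs_ge_zero)
        next
          case False
          then have "\<bar>f \<omega>\<bar> powr p \<le> \<bar>f \<omega>\<bar> powr (nat \<lceil>p\<rceil>)"
            using p by (intro powr_mono) auto
          also have "\<dots> = \<bar>f \<omega>\<bar> ^ nat \<lceil>p\<rceil>" using False by (intro powr_realpow) auto
          finally show ?thesis by simp
        qed
      qed
      also have "\<dots> = ennreal (\<integral>\<omega>. 1 + \<bar>f \<omega>\<bar> ^ nat \<lceil>p\<rceil> \<partial>M)"
        using f by (intro nn_integral_eq_integral Bochner_Integration.integrable_add all_momentsD) auto
      also have "\<dots> < \<top>" by simp
      finally show "Lp_norm M p f < \<top>" by (auto simp: Lp_norm_def Let_def)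
    qed measurable
  qed
qed

end

section \<open>Gaussian spaces and integration by parts\<close>

context prob_space
begin

text \<open>The hypothesis at s = 0 says that W has mean 0, so D = 1 + W / L is a probability
  density once L bounds |W|. Under this density U has the same characteristic function as under M,
  hence the same law by Levy's theorem, and subtracting the two laws on A isolates the W
  part.\<close>

lemma fourier_zero_real:
  fixes W :: "'a \<Rightarrow> real"
  assumes [measurable]: "U \<in> borel_measurable M" "W \<in> borel_measurable M"
    and bd: "\<And>\<omega>. \<bar>W \<omega>\<bar> \<le> K"
    and F: "\<And>s. (CLINT \<omega>|M. of_real (W \<omega>) * iexp (s * U \<omega>)) = 0"
    and A[measurable]: "A \<in> sets borel"
  shows "(\<integral>\<omega>. W \<omega> * indicator A (U \<omega>) \<partial>M) = 0"
proof -
  define L where "L = max K 1"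
  have L: "L > 0" "\<bar>W \<omega>\<bar> \<le> L" for \<omega> using bd[of \<omega>] by (auto simp: L_def)
  define D where "D \<omega> = 1 + W \<omega> / L" for \<omega>
  have D0: "0 \<le> D \<omega>" for \<omega>
    using L(2)[of \<omega>] L(1) by (simp add: D_def field_simps abs_le_iff)
  have [measurable]: "D \<in> borel_measurable M" unfolding D_def by measurable
  have intW: "integrable M W"
    by (rule integrable_const_bound[of _ K]) (use bd in auto)
  have EW: "(\<integral>\<omega>. W \<omega> \<partial>M) = 0"
    using F[of 0] by simp
  have intD: "integrable M D" unfolding D_def using intW by auto
  have ED: "(\<integral>\<omega>. D \<omega> \<partial>M) = 1"
    unfolding D_def using intW EW by (simp add: prob_space)
  define N where "N = density M D"
  have N: "prob_space N"
  proof
    show "emeasure N (space N) = 1"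
      unfolding N_def by (simp add: emeasure_density nn_integral_eq_integral intD D0 ED cong: nn_integral_cong)
  qed
  interpret N: prob_space N by (rule N)
  have UN[measurable]: "U \<in> borel_measurable N" unfolding N_def by simp
  have ch: "char (distr N borel U) = char (distr M borel U)"
  proof
    fix s
    have "char (distr N borel U) s = (CLINT \<omega>|N. iexp (s * U \<omega>))"
      unfolding char_def by (subst integral_distr) auto
    also have "\<dots> = (CLINT \<omega>|M. D \<omega> *\<^sub>R iexp (s * U \<omega>))"
      unfolding N_def by (subst integral_density) (auto simp: D0)
    also have "\<dots> = (CLINT \<omega>|M. iexp (s * U \<omega>) + (of_real (W \<omega>) * iexp (s * U \<omega>)) / of_real L)"
      by (intro Bochner_Integration.integral_cong refl) (simp add: D_def scaleR_conv_of_real algebra_simps)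
    also have "\<dots> = (CLINT \<omega>|M. iexp (s * U \<omega>)) + (CLINT \<omega>|M. of_real (W \<omega>) * iexp (s * U \<omega>)) / of_real L"
    proof (subst Bochner_Integration.integral_add)
      show "complex_integrable M (\<lambda>\<omega>. of_real (W \<omega>) * iexp (s * U \<omega>) / of_real L)"
      proof (rule integrable_const_bound)
        show "AE \<omega> in M. norm (of_real (W \<omega>) * iexp (s * U \<omega>) / complex_of_real L) \<le> K / L"
          using bd L(1) by (intro AE_I2) (simp add: norm_mult norm_divide divide_right_mono)
      qed measurable
      show "complex_integrable M (\<lambda>\<omega>. iexp (s * U \<omega>))"
        using integrable_iexp[of "\<lambda>\<omega>. s * U \<omega>"] by simp
    qed simp
    also have "\<dots> = char (distr M borel U) s"
      unfolding char_def using F[of s] by (subst integral_distr) auto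
    finally show "char (distr N borel U) s = char (distr M borel U) s" .
  qed
  have eq: "distr N borel U = distr M borel U"
    by (intro Levy_uniqueness ch) (auto intro: N.real_distribution_distr real_distribution_distr)
  have "(\<integral>\<omega>. D \<omega> * indicator A (U \<omega>) \<partial>M) = (\<integral>\<omega>. indicator A (U \<omega>) \<partial>N)"
    unfolding N_def by (subst integral_density) (auto simp: D0)
  also have "\<dots> = (\<integral>x. indicator A x \<partial>distr N borel U)"
    by (subst integral_distr) auto
  also have "\<dots> = (\<integral>\<omega>. indicator A (U \<omega>) \<partial>M)"
    unfolding eq by (subst integral_distr) auto
  finally have *: "(\<integral>\<omega>. D \<omega> * indicator A (U \<omega>) \<partial>M) = (\<integral>\<omega>. indicator A (U \<omega>) \<partial>M)" .
  have i1: "integrable M (\<lambda>\<omega>. indicator A (U \<omega>) :: real)"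
    by (rule integrable_const_bound[of _ 1]) auto
  have i2: "integrable M (\<lambda>\<omega>. W \<omega> * indicator A (U \<omega>))"
    by (rule integrable_const_bound[of _ K]) (use bd order_trans[OF abs_ge_zero bd] in \<open>auto simp: abs_mult indicator_def\<close>)
  have "(\<integral>\<omega>. D \<omega> * indicator A (U \<omega>) \<partial>M) =
     (\<integral>\<omega>. indicator A (U \<omega>) + (W \<omega> * indicator A (U \<omega>)) / L \<partial>M)"
    by (intro Bochner_Integration.integral_cong refl) (simp add: D_def algebra_simps)
  also have "\<dots> = (\<integral>\<omega>. indicator A (U \<omega>) \<partial>M) + (\<integral>\<omega>. W \<omega> * indicator A (U \<omega>) \<partial>M) / L"
    using i1 i2 by simp
  finally show ?thesis using * L(1) by simp
qed

text \<open>Conjugation turns the hypothesis at -s into the same hypothesis for the conjugate of W.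
  The real and the imaginary part of W are combinations of W and its conjugate, so each falls under
  the real case.\<close>

lemma fourier_zero_complex:
  fixes W :: "'a \<Rightarrow> complex"
  assumes [measurable]: "U \<in> borel_measurable M" "W \<in> borel_measurable M"
    and bd: "\<And>\<omega>. cmod (W \<omega>) \<le> K"
    and F: "\<And>s. (CLINT \<omega>|M. W \<omega> * iexp (s * U \<omega>)) = 0"
    and A[measurable]: "A \<in> sets borel"
  shows "(CLINT \<omega>|M. W \<omega> * indicator A (U \<omega>)) = 0"
proof -
  have int: "complex_integrable M (\<lambda>\<omega>. W \<omega> * iexp (s * U \<omega>))" for s
    by (rule integrable_const_bound[of _ K]) (use bd in \<open>auto simp: norm_mult\<close>)
  have [measurable]: "(\<lambda>\<omega>. cnj (W \<omega>)) \<in> borel_measurable M"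
    by (rule borel_measurable_continuous_on[OF _ assms(2)]) (intro continuous_intros)
  have intc: "complex_integrable M (\<lambda>\<omega>. cnj (W \<omega>) * iexp (s * U \<omega>))" for s
    by (rule integrable_const_bound[of _ K]) (use bd in \<open>auto simp: norm_mult\<close>)
  have Fc: "(CLINT \<omega>|M. cnj (W \<omega>) * iexp (s * U \<omega>)) = 0" for s
  proof -
    have "(CLINT \<omega>|M. cnj (W \<omega>) * iexp (s * U \<omega>)) = (CLINT \<omega>|M. cnj (W \<omega> * iexp ((-s) * U \<omega>)))"
      by (intro Bochner_Integration.integral_cong refl) (simp add: exp_cnj)
    also have "\<dots> = 0" using F[of "-s"] by (subst Bochner_Integration.integral_cnj) simp
    finally show ?thesis .
  qed
  have re: "(\<integral>\<omega>. Re (W \<omega>) * indicator A (U \<omega>) \<partial>M) = 0"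
  proof (rule fourier_zero_real[of U _ K])
    show "(CLINT \<omega>|M. of_real (Re (W \<omega>)) * iexp (s * U \<omega>)) = 0" for s
    proof -
      have "(CLINT \<omega>|M. of_real (Re (W \<omega>)) * iexp (s * U \<omega>)) =
         (CLINT \<omega>|M. (W \<omega> * iexp (s * U \<omega>) + cnj (W \<omega>) * iexp (s * U \<omega>)) / 2)"
        by (intro Bochner_Integration.integral_cong refl) (simp add: distrib_right[symmetric] complex_add_cnj)
      also have "\<dots> = 0" using int[of s] intc[of s] F[of s] Fc[of s] by simp
      finally show ?thesis .
    qed
    show "\<bar>Re (W \<omega>)\<bar> \<le> K" for \<omega> using bd[of \<omega>] abs_Re_le_cmod[of "W \<omega>"] by linarith
  qed (auto intro: A)
  have im: "(\<integral>\<omega>. Im (W \<omega>) * indicator A (U \<omega>) \<partial>M) = 0"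
  proof (rule fourier_zero_real[of U _ K])
    show "(CLINT \<omega>|M. of_real (Im (W \<omega>)) * iexp (s * U \<omega>)) = 0" for s
    proof -
      have "(CLINT \<omega>|M. of_real (Im (W \<omega>)) * iexp (s * U \<omega>)) =
         (CLINT \<omega>|M. (W \<omega> * iexp (s * U \<omega>) - cnj (W \<omega>) * iexp (s * U \<omega>)) / (2 * \<i>))"
      proof (intro Bochner_Integration.integral_cong refl)
        fix \<omega>
        have "complex_of_real (Im (W \<omega>)) = (W \<omega> - cnj (W \<omega>)) / (2 * \<i>)"
          by (simp add: complex_eq_iff)
        then show "of_real (Im (W \<omega>)) * iexp (s * U \<omega>) =
            (W \<omega> * iexp (s * U \<omega>) - cnj (W \<omega>) * iexp (s * U \<omega>)) / (2 * \<i>)"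
          by (simp only:) (simp add: left_diff_distrib diff_divide_distrib)
      qed
      also have "\<dots> = 0" using int[of s] intc[of s] F[of s] Fc[of s] by simp
      finally show ?thesis .
    qed
    show "\<bar>Im (W \<omega>)\<bar> \<le> K" for \<omega> using bd[of \<omega>] abs_Im_le_cmod[of "W \<omega>"] by linarith
  qed (auto intro: A)
  have i: "complex_integrable M (\<lambda>\<omega>. W \<omega> * indicator A (U \<omega>))"
    by (rule integrable_const_bound[of _ K])
       (use bd order_trans[OF norm_ge_zero bd] in \<open>auto simp: norm_mult indicator_def\<close>)
  show ?thesis
  proof (rule complex_eqI)
    have "Re (CLINT \<omega>|M. W \<omega> * indicator A (U \<omega>)) = (\<integral>\<omega>. Re (W \<omega> * indicator A (U \<omega>)) \<partial>M)"
      by (rule integral_Re[OF i, symmetric])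
    also have "\<dots> = (\<integral>\<omega>. Re (W \<omega>) * indicator A (U \<omega>) \<partial>M)"
      by (intro Bochner_Integration.integral_cong refl) (auto simp: indicator_def)
    finally show "Re (CLINT \<omega>|M. W \<omega> * indicator A (U \<omega>)) = Re 0" using re by simp
    have "Im (CLINT \<omega>|M. W \<omega> * indicator A (U \<omega>)) = (\<integral>\<omega>. Im (W \<omega> * indicator A (U \<omega>)) \<partial>M)"
      by (rule integral_Im[OF i, symmetric])
    also have "\<dots> = (\<integral>\<omega>. Im (W \<omega>) * indicator A (U \<omega>) \<partial>M)"
      by (intro Bochner_Integration.integral_cong refl) (auto simp: indicator_def)
    finally show "Im (CLINT \<omega>|M. W \<omega> * indicator A (U \<omega>)) = Im 0" using im by simp
  qed
qed

text \<open>One coordinate at a time: for fixed frequencies of the others, the one-dimensional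
  statement is applied with weight W times their exponential. The indicator of the treated
  coordinate is then absorbed into the weight of the induction hypothesis.\<close>

lemma fourier_zero_vector:
  fixes Y :: "'i \<Rightarrow> 'a \<Rightarrow> real"
  assumes "finite V" and "\<And>v. v \<in> V \<Longrightarrow> Y v \<in> borel_measurable M"
    and "W \<in> borel_measurable M" "\<And>\<omega>. cmod (W \<omega>) \<le> K"
    and "\<And>s. (CLINT \<omega>|M. W \<omega> * iexp (\<Sum>v\<in>V. s v * Y v \<omega>)) = 0"
    and "\<And>v. v \<in> V \<Longrightarrow> A v \<in> sets borel"
  shows "(CLINT \<omega>|M. W \<omega> * (\<Prod>v\<in>V. indicator (A v) (Y v \<omega>))) = 0"
  using assms
proof (induction V arbitrary: W)
  case empty
  then show ?case by simp
next
  case (insert v V)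
  have [measurable]: "Y v \<in> borel_measurable M" "W \<in> borel_measurable M" "A v \<in> sets borel"
    "\<And>u. u \<in> V \<Longrightarrow> Y u \<in> borel_measurable M"
    using insert.prems by auto
  define W' where "W' \<omega> = W \<omega> * indicator (A v) (Y v \<omega>)" for \<omega>
  have "(CLINT \<omega>|M. W' \<omega> * (\<Prod>v\<in>V. indicator (A v) (Y v \<omega>))) = 0"
  proof (rule insert.IH)
    show "W' \<in> borel_measurable M" unfolding W'_def by measurable
    show "cmod (W' \<omega>) \<le> K" for \<omega>
      using insert.prems(3)[of \<omega>] order_trans[OF norm_ge_zero insert.prems(3)]
      by (auto simp: W'_def norm_mult indicator_def)
    show "(CLINT \<omega>|M. W' \<omega> * iexp (\<Sum>v\<in>V. s v * Y v \<omega>)) = 0" for s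
    proof -
      have "(CLINT \<omega>|M. (W \<omega> * iexp (\<Sum>u\<in>V. s u * Y u \<omega>)) * indicator (A v) (Y v \<omega>)) = 0"
      proof (rule fourier_zero_complex[of _ _ K])
        show "(\<lambda>\<omega>. W \<omega> * iexp (\<Sum>u\<in>V. s u * Y u \<omega>)) \<in> borel_measurable M"
          by measurable
        show "cmod (W \<omega> * iexp (\<Sum>u\<in>V. s u * Y u \<omega>)) \<le> K" for \<omega>
          using insert.prems(3)[of \<omega>] by (simp add: norm_mult)
        fix t
        have "(CLINT \<omega>|M. W \<omega> * iexp (\<Sum>u\<in>V. s u * Y u \<omega>) * iexp (t * Y v \<omega>)) =
          (CLINT \<omega>|M. W \<omega> * iexp (\<Sum>u\<in>insert v V. (s(v := t)) u * Y u \<omega>))"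
        proof (intro Bochner_Integration.integral_cong refl)
          fix \<omega>
          have "(\<Sum>u\<in>V. (s(v := t)) u * Y u \<omega>) = (\<Sum>u\<in>V. s u * Y u \<omega>)"
            using insert.hyps(2) by (intro sum.cong) auto
          then show "W \<omega> * iexp (\<Sum>u\<in>V. s u * Y u \<omega>) * iexp (t * Y v \<omega>) =
             W \<omega> * iexp (\<Sum>u\<in>insert v V. (s(v := t)) u * Y u \<omega>)"
            using insert.hyps by (simp add: exp_add[symmetric] algebra_simps)
        qed
        also have "\<dots> = 0" by (rule insert.prems(4))
        finally show "(CLINT \<omega>|M. W \<omega> * iexp (\<Sum>u\<in>V. s u * Y u \<omega>) * iexp (t * Y v \<omega>)) = 0" .
      qed measurable
      then show ?thesis by (simp add: W'_def mult_ac)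
    qed
  qed (use insert.prems in auto)
  then show ?case using insert.hyps by (simp add: W'_def mult_ac)
qed

text \<open>Fourier uniqueness is used twice. With weight \<open>iexp (t * X)\<close> minus its
  mean, the vector version removes the frequencies of the Y's in favour of a box; with weight I - c,
  the centred indicator of that box, the real version replaces the frequency of X by a Borel set.
  Measure uniqueness then extends the factorisation from boxes to all product sets.\<close>

lemma indep_if_char_factorises:
  fixes Y :: "'i \<Rightarrow> 'a \<Rightarrow> real"
  assumes "finite V" and Y: "\<And>v. v \<in> V \<Longrightarrow> Y v \<in> borel_measurable M"
    and X[measurable]: "X \<in> borel_measurable M"
    and ch: "\<And>t s. (CLINT \<omega>|M. iexp (t * X \<omega> + (\<Sum>v\<in>V. s v * Y v \<omega>))) =
       (CLINT \<omega>|M. iexp (t * X \<omega>)) * (CLINT \<omega>|M. iexp (\<Sum>v\<in>V. s v * Y v \<omega>))"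
  shows "distr M borel X \<Otimes>\<^sub>M distr M (PiM V (\<lambda>_. borel)) (\<lambda>\<omega>. \<lambda>v\<in>V. Y v \<omega>) =
    distr M (borel \<Otimes>\<^sub>M PiM V (\<lambda>_. borel)) (\<lambda>\<omega>. (X \<omega>, \<lambda>v\<in>V. Y v \<omega>))"
proof -
  note Y[measurable]
  define Z where "Z \<omega> = (\<lambda>v\<in>V. Y v \<omega>)" for \<omega>
  have Z[measurable]: "Z \<in> measurable M (PiM V (\<lambda>_. borel))"
    unfolding Z_def using Y by (intro measurable_restrict) auto
  have box: "prob {\<omega>\<in>space M. X \<omega> \<in> A \<and> (\<forall>v\<in>V. Y v \<omega> \<in> E v)} =
     prob {\<omega>\<in>space M. X \<omega> \<in> A} * prob {\<omega>\<in>space M. \<forall>v\<in>V. Y v \<omega> \<in> E v}"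
    if [measurable]: "A \<in> sets borel" and E: "\<And>v. v \<in> V \<Longrightarrow> E v \<in> sets borel" for A E
  proof -
    note E[measurable]
    define c where "c = prob {\<omega>\<in>space M. \<forall>v\<in>V. Y v \<omega> \<in> E v}"
    define I where "I \<omega> = (\<Prod>v\<in>V. indicator (E v) (Y v \<omega>) :: real)" for \<omega>
    have I: "I \<omega> = indicator {\<omega>\<in>space M. \<forall>v\<in>V. Y v \<omega> \<in> E v} \<omega>" if "\<omega> \<in> space M" for \<omega>
      using that \<open>finite V\<close> by (auto simp: I_def indicator_def)
    have I01: "0 \<le> I \<omega>" "I \<omega> \<le> 1" for \<omega>
      unfolding I_def by (auto intro!: prod_nonneg prod_le_1)
    have Im[measurable]: "I \<in> borel_measurable M" unfolding I_def by measurable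
    have meas[measurable]: "{\<omega>\<in>space M. \<forall>v\<in>V. Y v \<omega> \<in> E v} \<in> sets M"
      using \<open>finite V\<close> by measurable
    have EI: "(\<integral>\<omega>. I \<omega> \<partial>M) = c"
      unfolding c_def by (subst Bochner_Integration.integral_cong[OF refl I]) auto
    have c01: "\<bar>c\<bar> \<le> 1" by (simp add: c_def)
    have "(\<integral>\<omega>. (I \<omega> - c) * indicator A (X \<omega>) \<partial>M) = 0"
    proof (rule fourier_zero_real[of _ _ 2])
      show "\<bar>I \<omega> - c\<bar> \<le> 2" for \<omega> using I01[of \<omega>] c01 by linarith
      fix t
      have it: "complex_integrable M (\<lambda>\<omega>. iexp (t * X \<omega>))"
        using integrable_iexp[of "\<lambda>\<omega>. t * X \<omega>"] by simp
      have "(CLINT \<omega>|M. (iexp (t * X \<omega>) - (CLINT \<omega>|M. iexp (t * X \<omega>))) * (\<Prod>v\<in>V. indicator (E v) (Y v \<omega>))) = 0"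
      proof (rule fourier_zero_vector[OF \<open>finite V\<close>, of _ _ 2])
        have "cmod (CLINT \<omega>|M. iexp (t * X \<omega>)) \<le> (\<integral>\<omega>. cmod (iexp (t * X \<omega>)) \<partial>M)"
          by (rule integral_norm_bound)
        then have "cmod (CLINT \<omega>|M. iexp (t * X \<omega>)) \<le> 1" by (simp add: prob_space)
        then show "cmod (iexp (t * X \<omega>) - (CLINT \<omega>|M. iexp (t * X \<omega>))) \<le> 2" for \<omega>
          by (intro order_trans[OF norm_triangle_ineq4]) auto
        fix s
        have iss: "complex_integrable M (\<lambda>\<omega>. iexp (\<Sum>v\<in>V. s v * Y v \<omega>))"
          by (rule integrable_iexp[of "\<lambda>\<omega>. \<Sum>v\<in>V. s v * Y v \<omega>"]) auto
        have its: "complex_integrable M (\<lambda>\<omega>. iexp (t * X \<omega> + (\<Sum>v\<in>V. s v * Y v \<omega>)))"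
          by (rule integrable_iexp[of "\<lambda>\<omega>. t * X \<omega> + (\<Sum>v\<in>V. s v * Y v \<omega>)"]) auto
        have "(CLINT \<omega>|M. (iexp (t * X \<omega>) - (CLINT \<omega>|M. iexp (t * X \<omega>))) * iexp (\<Sum>v\<in>V. s v * Y v \<omega>)) =
          (CLINT \<omega>|M. iexp (t * X \<omega> + (\<Sum>v\<in>V. s v * Y v \<omega>)) - (CLINT \<omega>|M. iexp (t * X \<omega>)) * iexp (\<Sum>v\<in>V. s v * Y v \<omega>))"
          by (intro Bochner_Integration.integral_cong refl)
             (simp add: left_diff_distrib exp_add[symmetric] distrib_left)
        also have "\<dots> = 0"
          using its iss ch[of t s] by (subst Bochner_Integration.integral_diff) auto
        finally show "(CLINT \<omega>|M. (iexp (t * X \<omega>) - (CLINT \<omega>|M. iexp (t * X \<omega>))) * iexp (\<Sum>v\<in>V. s v * Y v \<omega>)) = 0" .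
      qed (use Y E in auto)
      moreover have pI: "(\<Prod>v\<in>V. indicator (E v) (Y v \<omega>)) = complex_of_real (I \<omega>)" for \<omega>
        unfolding I_def of_real_prod by (intro prod.cong refl) (auto simp: indicator_def)
      ultimately have "(CLINT \<omega>|M. iexp (t * X \<omega>) * I \<omega> - (CLINT \<omega>|M. iexp (t * X \<omega>)) * I \<omega>) = 0"
        by (simp add: left_diff_distrib)
      moreover have iI: "complex_integrable M (\<lambda>\<omega>. iexp (t * X \<omega>) * I \<omega>)"
        by (rule integrable_const_bound[of _ 1]) (use I01 in \<open>auto simp: norm_mult\<close>)
      moreover have iI': "complex_integrable M (\<lambda>\<omega>. complex_of_real (I \<omega>))"
        by (rule integrable_const_bound[of _ 1]) (use I01 in auto)
      ultimately have "(CLINT \<omega>|M. iexp (t * X \<omega>) * I \<omega>) = (CLINT \<omega>|M. iexp (t * X \<omega>)) * of_real c"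
        using EI by simp
      then show "(CLINT \<omega>|M. of_real (I \<omega> - c) * iexp (t * X \<omega>)) = 0"
        using iI it by (simp add: algebra_simps)
    qed auto
    moreover have "integrable M (\<lambda>\<omega>. I \<omega> * indicator A (X \<omega>))" "integrable M (\<lambda>\<omega>. c * indicator A (X \<omega>))"
      using I01 c01 by (auto intro!: integrable_const_bound[of _ 1] simp: abs_mult mult_le_one indicator_def)
    ultimately have "(\<integral>\<omega>. I \<omega> * indicator A (X \<omega>) \<partial>M) = c * (\<integral>\<omega>. indicator A (X \<omega>) \<partial>M)"
      by (simp add: left_diff_distrib)
    moreover have "(\<integral>\<omega>. I \<omega> * indicator A (X \<omega>) \<partial>M) =
        (\<integral>\<omega>. indicator {\<omega>\<in>space M. X \<omega> \<in> A \<and> (\<forall>v\<in>V. Y v \<omega> \<in> E v)} \<omega> \<partial>M)"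
      by (intro Bochner_Integration.integral_cong refl) (auto simp: I indicator_def)
    moreover have "(\<integral>\<omega>. indicator A (X \<omega>) \<partial>M) = (\<integral>\<omega>. indicat_real {\<omega>\<in>space M. X \<omega> \<in> A} \<omega> \<partial>M)"
      by (intro Bochner_Integration.integral_cong refl) (auto simp: indicator_def)
    moreover have "{\<omega>\<in>space M. X \<omega> \<in> A \<and> (\<forall>v\<in>V. Y v \<omega> \<in> E v)} \<in> sets M"
      using \<open>finite V\<close> by measurable
    ultimately show ?thesis by (simp add: c_def mult.commute)
  qed
  have gen: "emeasure M (X -` A \<inter> space M) * emeasure M (Z -` C \<inter> space M) =
      emeasure M (X -` A \<inter> Z -` C \<inter> space M)"
    if [measurable]: "A \<in> sets borel" and C[measurable]: "C \<in> sets (PiM V (\<lambda>_. borel))" for A C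
  proof -
    define a where "a = emeasure M (X -` A \<inter> space M)"
    \<comment> \<open>With A frozen, both sides are finite measures in C: the law of Z restricted to
      the event that X lies in A, and the law of Z scaled by the probability of that event. They
      agree on boxes, which generate the product sigma-algebra.\<close>
    define P where "P = distr (restrict_space M (X -` A \<inter> space M)) (PiM V (\<lambda>_. borel)) Z"
    define Q where "Q = scale_measure a (distr M (PiM V (\<lambda>_. borel)) Z)"
    have XA: "X -` A \<inter> space M \<in> sets M" by measurable
    have [measurable]: "Z \<in> measurable (restrict_space M (X -` A \<inter> space M)) (PiM V (\<lambda>_. borel))"
      by (rule measurable_restrict_space1) measurable
    have Pm: "emeasure P C = emeasure M (X -` A \<inter> Z -` C \<inter> space M)"
      if [measurable]: "C \<in> sets (PiM V (\<lambda>_. borel))" for C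
    proof -
      have "emeasure P C = emeasure (restrict_space M (X -` A \<inter> space M)) (Z -` C \<inter> (X -` A \<inter> space M))"
        unfolding P_def by (subst emeasure_distr) (auto simp: space_restrict_space Int_absorb2)
      also have "\<dots> = emeasure M (Z -` C \<inter> (X -` A \<inter> space M))"
        using XA by (subst emeasure_restrict_space) auto
      finally show ?thesis by (simp add: Int_ac)
    qed
    have Qm: "emeasure Q C = a * emeasure M (Z -` C \<inter> space M)"
      if [measurable]: "C \<in> sets (PiM V (\<lambda>_. borel))" for C
      unfolding Q_def by (simp add: emeasure_distr)
    have "P = Q"
    proof (rule measure_eqI_PiM_finite[OF \<open>finite V\<close>, of P "\<lambda>_. borel" Q "\<lambda>_. \<Pi>\<^sub>E i\<in>V. UNIV"])
      fix E :: "'i \<Rightarrow> real set" assume E: "\<And>i. i \<in> V \<Longrightarrow> E i \<in> sets borel"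
      have E': "Pi\<^sub>E V E \<in> sets (PiM V (\<lambda>_. borel))"
        using E \<open>finite V\<close> by (intro sets_PiM_I_finite) auto
      have 1: "X -` A \<inter> Z -` (Pi\<^sub>E V E) \<inter> space M = {\<omega>\<in>space M. X \<omega> \<in> A \<and> (\<forall>v\<in>V. Y v \<omega> \<in> E v)}"
        by (auto simp: Z_def PiE_iff)
      have 2: "Z -` (Pi\<^sub>E V E) \<inter> space M = {\<omega>\<in>space M. \<forall>v\<in>V. Y v \<omega> \<in> E v}"
        by (auto simp: Z_def PiE_iff)
      have 3: "X -` A \<inter> space M = {\<omega>\<in>space M. X \<omega> \<in> A}" by auto
      show "emeasure P (Pi\<^sub>E V E) = emeasure Q (Pi\<^sub>E V E)"
        unfolding Pm[OF E'] Qm[OF E'] a_def 1 2 3 emeasure_eq_measure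
        using box[OF \<open>A \<in> sets borel\<close> E] by (simp add: ennreal_mult)
    next
      show "range (\<lambda>_::nat. \<Pi>\<^sub>E i\<in>V. UNIV) \<subseteq> prod_algebra V (\<lambda>_. borel :: real measure)"
        using \<open>finite V\<close> by (auto intro!: prod_algebraI_finite)
      show "emeasure P (\<Pi>\<^sub>E i\<in>V. UNIV) \<noteq> \<infinity>"
        using Pm[of "\<Pi>\<^sub>E i\<in>V. UNIV"] \<open>finite V\<close> by (simp add: sets_PiM_I_finite)
    qed (auto simp: P_def Q_def space_PiM)
    then show ?thesis using Pm[OF C] Qm[OF C] by (simp add: a_def)
  qed
  have "distr M borel X \<Otimes>\<^sub>M distr M (PiM V (\<lambda>_. borel)) Z =
    distr M (borel \<Otimes>\<^sub>M PiM V (\<lambda>_. borel)) (\<lambda>\<omega>. (X \<omega>, Z \<omega>))"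
  proof (intro pair_measure_eqI)
    show "sigma_finite_measure (distr M borel X)" "sigma_finite_measure (distr M (PiM V (\<lambda>_. borel)) Z)"
      by (auto intro!: prob_space_imp_sigma_finite prob_space_distr)
    fix A C assume A: "A \<in> sets (distr M borel X)" "C \<in> sets (distr M (PiM V (\<lambda>_. borel)) Z)"
    then have [measurable]: "A \<in> sets borel" "C \<in> sets (PiM V (\<lambda>_. borel))" by auto
    have "(\<lambda>x. (X x, Z x)) -` (A \<times> C) \<inter> space M = X -` A \<inter> Z -` C \<inter> space M" by auto
    then show "emeasure (distr M borel X) A * emeasure (distr M (PiM V (\<lambda>_. borel)) Z) C =
       emeasure (distr M (borel \<Otimes>\<^sub>M PiM V (\<lambda>_. borel)) (\<lambda>x. (X x, Z x))) (A \<times> C)"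
      using gen[of A C] by (simp add: emeasure_distr)
  next
    show "sets (distr M borel X \<Otimes>\<^sub>M distr M (PiM V (\<lambda>_. borel)) Z) =
      sets (distr M (borel \<Otimes>\<^sub>M PiM V (\<lambda>_. borel)) (\<lambda>\<omega>. (X \<omega>, Z \<omega>)))"
      unfolding sets_distr by (rule sets_pair_measure_cong) simp_all
  qed
  then show ?thesis unfolding Z_def .
qed

end

text \<open>Joint centred Gaussianity in disguise: the space is closed under linear combinations, so
  the characteristic function at frequency 1 of every element determines all joint characteristic
  functions. Degenerate elements, almost surely 0, are allowed.\<close>

locale gaussian_space = prob_space M for M :: "'a measure" +
  fixes \<G> :: "('a \<Rightarrow> real) set"
  assumes G_measurable: "X \<in> \<G> \<Longrightarrow> X \<in> borel_measurable M"
    and G_square_integrable: "X \<in> \<G> \<Longrightarrow> integrable M (\<lambda>\<omega>. (X \<omega>)\<^sup>2)"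
    and G_lin: "X \<in> \<G> \<Longrightarrow> Y \<in> \<G> \<Longrightarrow> (\<lambda>\<omega>. a * X \<omega> + b * Y \<omega>) \<in> \<G>"
    and G_char: "X \<in> \<G> \<Longrightarrow> (CLINT \<omega>|M. iexp (X \<omega>)) = of_real (exp (- (\<integral>\<omega>. (X \<omega>)\<^sup>2 \<partial>M) / 2))"

text \<open>Stein's identity. With \<phi> the normal density, \<phi> g' - x \<phi> g is the
  derivative of \<phi> g, and \<phi> g vanishes at both infinities since g grows only polynomially.
  Growth of g and g' also gives the integrability needed to split the integral.\<close>

lemma std_normal_ibp:
  fixes g g' :: "real \<Rightarrow> real"
  assumes g: "\<And>x. (g has_real_derivative g' x) (at x)" and g': "continuous_on UNIV g'"
    and bd: "\<And>x. \<bar>g x\<bar> \<le> C * (1 + \<bar>x\<bar>) ^ K" and bd': "\<And>x. \<bar>g' x\<bar> \<le> C * (1 + \<bar>x\<bar>) ^ K"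
  shows "(\<integral>x. x * g x \<partial>std_normal_distribution) = (\<integral>x. g' x \<partial>std_normal_distribution)"
proof -
  have C: "0 \<le> C" using bd[of 0] by (simp add: order_trans[OF abs_ge_zero])
  have cg: "continuous_on UNIV g"
    using g by (auto intro!: DERIV_continuous_on)
  have [measurable]: "g \<in> borel_measurable borel" "g' \<in> borel_measurable borel"
    using cg g' by (auto intro: borel_measurable_continuous_onI)
  let ?\<phi> = std_normal_density
  have pint: "integrable lborel (\<lambda>x. ?\<phi> x * (1 + \<bar>x\<bar>) ^ n)" for n
  proof (rule Bochner_Integration.integrable_bound)
    show "integrable lborel (\<lambda>x. 2 ^ n * (?\<phi> x * \<bar>x\<bar> ^ 0 + ?\<phi> x * \<bar>x\<bar> ^ n))"
      by (intro integrable_mult_right Bochner_Integration.integrable_add integrable_std_normal_moment_abs)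
    show "AE x in lborel. norm (?\<phi> x * (1 + \<bar>x\<bar>) ^ n) \<le> norm (2 ^ n * (?\<phi> x * \<bar>x\<bar> ^ 0 + ?\<phi> x * \<bar>x\<bar> ^ n))"
    proof (rule AE_I2)
      fix x :: real
      have "(1 + \<bar>x\<bar>) ^ n \<le> (2 * max 1 \<bar>x\<bar>) ^ n" by (rule power_mono) auto
      also have "\<dots> = 2 ^ n * (max 1 \<bar>x\<bar>) ^ n" by (simp add: power_mult_distrib)
      also have "\<dots> \<le> 2 ^ n * (1 + \<bar>x\<bar> ^ n)"
        by (rule mult_left_mono) (auto simp: max_def)
      finally have "?\<phi> x * (1 + \<bar>x\<bar>) ^ n \<le> ?\<phi> x * (2 ^ n * (1 + \<bar>x\<bar> ^ n))"
        by (rule mult_left_mono) simp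
      then show "norm (?\<phi> x * (1 + \<bar>x\<bar>) ^ n) \<le> norm (2 ^ n * (?\<phi> x * \<bar>x\<bar> ^ 0 + ?\<phi> x * \<bar>x\<bar> ^ n))"
        by (simp add: abs_mult algebra_simps)
    qed
  qed measurable
  have i1: "integrable lborel (\<lambda>x. ?\<phi> x * (x * g x))"
  proof (rule Bochner_Integration.integrable_bound)
    show "integrable lborel (\<lambda>x. C * (?\<phi> x * (1 + \<bar>x\<bar>) ^ Suc K))"
      by (intro integrable_mult_right pint)
    show "AE x in lborel. norm (?\<phi> x * (x * g x)) \<le> norm (C * (?\<phi> x * (1 + \<bar>x\<bar>) ^ Suc K))"
    proof (rule AE_I2)
      fix x :: real
      have "\<bar>x\<bar> * \<bar>g x\<bar> \<le> (1 + \<bar>x\<bar>) * (C * (1 + \<bar>x\<bar>) ^ K)"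
        using bd[of x] by (intro mult_mono) auto
      then have "?\<phi> x * (\<bar>x\<bar> * \<bar>g x\<bar>) \<le> ?\<phi> x * ((1 + \<bar>x\<bar>) * (C * (1 + \<bar>x\<bar>) ^ K))"
        by (rule mult_left_mono) simp
      then show "norm (?\<phi> x * (x * g x)) \<le> norm (C * (?\<phi> x * (1 + \<bar>x\<bar>) ^ Suc K))"
        using C by (simp add: abs_mult mult_ac)
    qed
  qed measurable
  have i2: "integrable lborel (\<lambda>x. ?\<phi> x * g' x)"
  proof (rule Bochner_Integration.integrable_bound)
    show "integrable lborel (\<lambda>x. C * (?\<phi> x * (1 + \<bar>x\<bar>) ^ K))"
      by (intro integrable_mult_right pint)
    show "AE x in lborel. norm (?\<phi> x * g' x) \<le> norm (C * (?\<phi> x * (1 + \<bar>x\<bar>) ^ K))"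
    proof (rule AE_I2)
      fix x :: real
      have "?\<phi> x * \<bar>g' x\<bar> \<le> ?\<phi> x * (C * (1 + \<bar>x\<bar>) ^ K)"
        using bd'[of x] by (rule mult_left_mono) simp
      then show "norm (?\<phi> x * g' x) \<le> norm (C * (?\<phi> x * (1 + \<bar>x\<bar>) ^ K))"
        using C by (simp add: abs_mult mult_ac)
    qed
  qed measurable
  have d\<phi>: "(?\<phi> has_real_derivative - x * ?\<phi> x) (at x)" for x
    unfolding std_normal_density_def by (auto intro!: derivative_eq_intros simp: field_simps)
  have c\<phi>: "continuous_on UNIV ?\<phi>" using d\<phi> by (auto intro!: DERIV_continuous_on)
  have lim: "((\<lambda>x. ?\<phi> x * g x) \<longlongrightarrow> 0) F"
    if F: "((\<lambda>x. exp (- x\<^sup>2 / 2) * exp (1 + \<bar>x\<bar>)) \<longlongrightarrow> 0) F" for F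
  proof (rule Lim_null_comparison)
    show "((\<lambda>x. (1 / sqrt (2 * pi) * C * fact K) * (exp (- x\<^sup>2 / 2) * exp (1 + \<bar>x\<bar>))) \<longlongrightarrow> 0) F"
      by (rule tendsto_mult_right_zero[OF F])
    show "\<forall>\<^sub>F x in F. norm (?\<phi> x * g x) \<le> (1 / sqrt (2 * pi) * C * fact K) * (exp (- x\<^sup>2 / 2) * exp (1 + \<bar>x\<bar>))"
    proof (rule always_eventually, rule allI)
      fix x :: real
      \<comment> \<open>A single term of the exponential series, which turns polynomial growth into
        (1 + |x|)^K <= K! exp (1 + |x|).\<close>
      have "(\<Sum>n\<in>{K}. inverse (fact n) *\<^sub>R (1 + \<bar>x\<bar>) ^ n) \<le> exp (1 + \<bar>x\<bar>)"
        unfolding exp_def by (rule sum_le_suminf[OF summable_exp_generic]) auto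
      then have "(1 + \<bar>x\<bar>) ^ K / fact K \<le> exp (1 + \<bar>x\<bar>)"
        by (simp add: divide_inverse mult.commute)
      then have "(1 + \<bar>x\<bar>) ^ K \<le> fact K * exp (1 + \<bar>x\<bar>)"
        by (simp add: field_simps)
      then have "C * (1 + \<bar>x\<bar>) ^ K \<le> C * (fact K * exp (1 + \<bar>x\<bar>))"
        using C by (rule mult_left_mono)
      then have "\<bar>g x\<bar> \<le> C * (fact K * exp (1 + \<bar>x\<bar>))" using bd[of x] by linarith
      then have "?\<phi> x * \<bar>g x\<bar> \<le> ?\<phi> x * (C * (fact K * exp (1 + \<bar>x\<bar>)))"
        by (rule mult_left_mono) simp
      then show "norm (?\<phi> x * g x) \<le> (1 / sqrt (2 * pi) * C * fact K) * (exp (- x\<^sup>2 / 2) * exp (1 + \<bar>x\<bar>))"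
        by (simp add: abs_mult std_normal_density_def mult_ac)
    qed
  qed
  have null: "((\<lambda>x. exp (- x\<^sup>2 / 2) * exp (1 + \<bar>x\<bar>)) \<longlongrightarrow> (0::real)) F"
    if F: "filterlim (\<lambda>x::real. \<bar>x\<bar>) at_top F" for F
  proof (rule Lim_null_comparison)
    have "((\<lambda>x. exp (- \<bar>x\<bar>)) \<longlongrightarrow> (0::real)) F"
      by (rule filterlim_compose[OF exp_at_bot]) (use F in \<open>simp add: filterlim_uminus_at_top\<close>)
    then show "((\<lambda>x. exp 3 * exp (- \<bar>x\<bar>)) \<longlongrightarrow> (0::real)) F"
      by (rule tendsto_mult_right_zero)
    show "\<forall>\<^sub>F x in F. norm (exp (- x\<^sup>2 / 2) * exp (1 + \<bar>x\<bar>)) \<le> exp 3 * exp (- \<bar>x\<bar>)"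
    proof (rule always_eventually, rule allI)
      fix x :: real
      \<comment> \<open>Completing the square at |x| = 2 gives -x^2/2 + 1 + |x| <= 3 - |x|; this is
        the origin of the constant \<open>exp 3\<close>.\<close>
      have "0 \<le> (\<bar>x\<bar> - 2)\<^sup>2 / 2" by simp
      also have "\<dots> = x\<^sup>2 / 2 - 2 * \<bar>x\<bar> + 2" by (simp add: power2_diff field_simps)
      finally show "norm (exp (- x\<^sup>2 / 2) * exp (1 + \<bar>x\<bar>)) \<le> exp 3 * exp (- \<bar>x\<bar>)"
        by (simp add: exp_add[symmetric])
    qed
  qed
  have top: "((\<lambda>x. exp (- x\<^sup>2 / 2) * exp (1 + \<bar>x\<bar>)) \<longlongrightarrow> (0::real)) at_top"
    by (rule null, rule filterlim_at_top_mono[OF filterlim_ident]) (auto intro!: always_eventually)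
  have bot: "((\<lambda>x. exp (- x\<^sup>2 / 2) * exp (1 + \<bar>x\<bar>)) \<longlongrightarrow> (0::real)) at_bot"
    by (rule null, rule filterlim_at_top_mono[OF filterlim_uminus_at_top_at_bot]) (auto intro!: always_eventually)
  have "(LBINT x=-\<infinity>..\<infinity>. ?\<phi> x * g' x - ?\<phi> x * (x * g x)) = 0 - 0"
  proof (rule interval_integral_FTC_integrable[where F="\<lambda>x. ?\<phi> x * g x"])
    fix x :: real
    show "((\<lambda>x. ?\<phi> x * g x) has_vector_derivative ?\<phi> x * g' x - ?\<phi> x * (x * g x)) (at x)"
      unfolding has_real_derivative_iff_has_vector_derivative[symmetric]
      using DERIV_mult[OF d\<phi>[of x] g[of x]] by (simp add: algebra_simps)
    show "isCont (\<lambda>x. ?\<phi> x * g' x - ?\<phi> x * (x * g x)) x"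
      using c\<phi> cg g' by (intro continuous_intros) (auto simp: continuous_on_eq_continuous_at)
  next
    show "set_integrable lborel (einterval (-\<infinity>) \<infinity>) (\<lambda>x. ?\<phi> x * g' x - ?\<phi> x * (x * g x))"
      unfolding set_integrable_def einterval_def using i1 i2 by simp
    show "(((\<lambda>x. ?\<phi> x * g x) \<circ> real_of_ereal) \<longlongrightarrow> 0) (at_right (-\<infinity>))"
      unfolding ereal_tendsto_simps1 by (rule lim[OF bot])
    show "(((\<lambda>x. ?\<phi> x * g x) \<circ> real_of_ereal) \<longlongrightarrow> 0) (at_left \<infinity>)"
      unfolding ereal_tendsto_simps1 by (rule lim[OF top])
  qed simp
  then have "(\<integral>x. ?\<phi> x * g' x - ?\<phi> x * (x * g x) \<partial>lborel) = 0"
    by (simp add: interval_lebesgue_integral_def set_lebesgue_integral_def einterval_def)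
  then have "(\<integral>x. ?\<phi> x * g' x \<partial>lborel) = (\<integral>x. ?\<phi> x * (x * g x) \<partial>lborel)"
    using i1 i2 by simp
  then show ?thesis
    by (subst (1 2) integral_density) (auto simp: normal_density_nonneg)
qed

section \<open>Moments of Gaussian variables and cylinder functions\<close>

context gaussian_space
begin

lemma G_cmult: "X \<in> \<G> \<Longrightarrow> (\<lambda>\<omega>. a * X \<omega>) \<in> \<G>"
  using G_lin[of X X a 0] by simp

lemma G_sum:
  assumes "finite V" "\<And>v. v \<in> V \<Longrightarrow> Y v \<in> \<G>" "X \<in> \<G>"
  shows "(\<lambda>\<omega>. t * X \<omega> + (\<Sum>v\<in>V. s v * Y v \<omega>)) \<in> \<G>"
  using assms
proof (induction V)
  case empty
  then show ?case by (simp add: G_cmult)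
next
  case (insert v V)
  then have "(\<lambda>\<omega>. 1 * (t * X \<omega> + (\<Sum>v\<in>V. s v * Y v \<omega>)) + s v * Y v \<omega>) \<in> \<G>"
    by (intro G_lin) auto
  with insert.hyps show ?case by (simp add: algebra_simps)
qed

lemma G_std:
  assumes X: "X \<in> \<G>" and v: "(\<integral>\<omega>. (X \<omega>)\<^sup>2 \<partial>M) = 1"
  shows "distr M borel X = std_normal_distribution"
proof (rule Levy_uniqueness)
  note [measurable] = G_measurable[OF X]
  show "real_distribution (distr M borel X)" by (rule real_distribution_distr) measurable
  show "real_distribution std_normal_distribution" by (rule real_dist_normal_dist)
  show "char (distr M borel X) = char std_normal_distribution"
  proof
    fix t
    have "char (distr M borel X) t = (CLINT \<omega>|M. iexp (t * X \<omega>))"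
      unfolding char_def by (subst integral_distr) auto
    also have "\<dots> = of_real (exp (- (\<integral>\<omega>. (t * X \<omega>)\<^sup>2 \<partial>M) / 2))"
      by (rule G_char[OF G_cmult[OF X]])
    also have "\<dots> = char std_normal_distribution t"
      using v by (simp add: power_mult_distrib char_std_normal_distribution)
    finally show "char (distr M borel X) t = char std_normal_distribution t" .
  qed
qed

lemma G_zero_variance:
  assumes "X \<in> \<G>" "(\<integral>\<omega>. (X \<omega>)\<^sup>2 \<partial>M) = 0"
  shows "AE \<omega> in M. X \<omega> = 0"
  using integral_nonneg_eq_0_iff_AE[OF G_square_integrable[OF assms(1)]] assms(2) by simp

text \<open>The \<open>L^q\<close> norm of a standard normal variable rather than its moment, so
  that norms of Gaussian variables are this constant times the standard deviation.\<close>

definition gauss_moment :: "nat \<Rightarrow> real" where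
  "gauss_moment q = root q (\<integral>x. \<bar>x\<bar> ^ q \<partial>std_normal_distribution)"

lemma gauss_moment_nonneg: "0 \<le> gauss_moment q"
  by (cases "q = 0") (simp_all add: gauss_moment_def)

lemma G_moments:
  assumes X: "X \<in> \<G>"
  shows "X \<in> all_moments" "q > 0 \<Longrightarrow> nrm q X = gauss_moment q * sqrt (\<integral>\<omega>. (X \<omega>)\<^sup>2 \<partial>M)"
proof -
  define v where "v = (\<integral>\<omega>. (X \<omega>)\<^sup>2 \<partial>M)"
  note [measurable] = G_measurable[OF X]
  have v0: "0 \<le> v" by (simp add: v_def)
  have "X \<in> all_moments \<and> (q > 0 \<longrightarrow> nrm q X = gauss_moment q * sqrt v)"
  proof (cases "v = 0")
    case True
    then have ae: "AE \<omega> in M. X \<omega> = 0" using G_zero_variance[OF X] by (simp add: v_def)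
    have "X \<in> all_moments"
      by (rule all_moments_AE_bound[of _ "\<lambda>_. 0"]) (use ae in auto)
    moreover have "nrm q X \<le> nrm q (\<lambda>_. 0)" if "q > 0"
      by (rule nrm_mono_AE[OF that]) (use ae in auto)
    ultimately show ?thesis using True nrm_nonneg[of q X] by (auto intro: antisym)
  next
    case False
    define Z where "Z \<omega> = X \<omega> / sqrt v" for \<omega>
    have Z: "Z \<in> \<G>" unfolding Z_def using G_cmult[OF X, of "1 / sqrt v"] by simp
    have XZ: "X = (\<lambda>\<omega>. sqrt v * Z \<omega>)" using False v0 by (simp add: Z_def fun_eq_iff)
    have Z1: "(\<integral>\<omega>. (Z \<omega>)\<^sup>2 \<partial>M) = 1"
      unfolding Z_def power_divide using False v0 by (simp add: v_def[symmetric])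
    note [measurable] = G_measurable[OF Z]
    have "integrable M (\<lambda>\<omega>. \<bar>Z \<omega>\<bar> ^ n) \<and> (\<integral>\<omega>. \<bar>Z \<omega>\<bar> ^ n \<partial>M) = (\<integral>x. \<bar>x\<bar> ^ n \<partial>std_normal_distribution)" for n
    proof -
      have "integrable std_normal_distribution (\<lambda>x. \<bar>x\<bar> ^ n)"
        using integrable_std_normal_moment_abs[of n]
        by (subst integrable_density) (auto simp: normal_density_nonneg)
      then have "integrable (distr M borel Z) (\<lambda>x. \<bar>x\<bar> ^ n)" by (simp add: G_std[OF Z Z1])
      then have "integrable M (\<lambda>\<omega>. \<bar>Z \<omega>\<bar> ^ n)" by (subst (asm) integrable_distr_eq) auto
      moreover have "(\<integral>\<omega>. \<bar>Z \<omega>\<bar> ^ n \<partial>M) = (\<integral>x. \<bar>x\<bar> ^ n \<partial>distr M borel Z)"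
        by (subst integral_distr) auto
      ultimately show ?thesis by (simp add: G_std[OF Z Z1])
    qed
    then have "Z \<in> all_moments" "nrm q Z = gauss_moment q"
      by (auto simp: all_moments_def nrm_def gauss_moment_def)
    then show ?thesis unfolding XZ
      using v0 by (auto intro: all_moments_cmult simp: nrm_cmult)
  qed
  then show "X \<in> all_moments" "q > 0 \<Longrightarrow> nrm q X = gauss_moment q * sqrt (\<integral>\<omega>. (X \<omega>)\<^sup>2 \<partial>M)"
    by (auto simp: v_def)
qed

definition cov :: "('a \<Rightarrow> real) \<Rightarrow> ('a \<Rightarrow> real) \<Rightarrow> real" where
  "cov X Y = (\<integral>\<omega>. X \<omega> * Y \<omega> \<partial>M)"

lemma G_prod_integrable: "X \<in> \<G> \<Longrightarrow> Y \<in> \<G> \<Longrightarrow> integrable M (\<lambda>\<omega>. X \<omega> * Y \<omega>)"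
  by (intro all_moments_integrable all_moments_mult G_moments)

lemma cov_commute: "cov X Y = cov Y X"
  by (simp add: cov_def mult.commute)

lemma cov_lin: "X \<in> \<G> \<Longrightarrow> Y \<in> \<G> \<Longrightarrow> Z \<in> \<G> \<Longrightarrow>
    cov X (\<lambda>\<omega>. a * Y \<omega> + b * Z \<omega>) = a * cov X Y + b * cov X Z"
  using G_prod_integrable[of X Y] G_prod_integrable[of X Z]
  unfolding cov_def distrib_left mult.left_commute[of "X _"] by simp

text \<open>Cylinder functions are indexed by the Gaussian variables themselves, so that products of
  cylinder functions of different vectors need no renaming of coordinates.\<close>

definition ev :: "'a \<Rightarrow> ('a \<Rightarrow> real) \<Rightarrow> real" where "ev \<omega> X = X \<omega>"

definition cyl :: "('a \<Rightarrow> real) set \<Rightarrow> ((('a \<Rightarrow> real) \<Rightarrow> real) \<Rightarrow> real) \<Rightarrow> bool" where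
  "cyl V f \<longleftrightarrow> finite V \<and> V \<subseteq> \<G> \<and> f \<in> borel_measurable (PiM V (\<lambda>_. borel)) \<and>
     (\<forall>z. f (restrict z V) = f z) \<and> (\<exists>C K. \<forall>z. \<bar>f z\<bar> \<le> C * (1 + (\<Sum>v\<in>V. \<bar>z v\<bar>)) ^ K)"

text \<open>Translation by s times the Cameron-Martin direction of X, read off on the Gaussian
  coordinates: the coordinate v moves by s times its covariance with X.\<close>

definition shift :: "('a \<Rightarrow> real) \<Rightarrow> real \<Rightarrow> (('a \<Rightarrow> real) \<Rightarrow> real) \<Rightarrow> ('a \<Rightarrow> real) \<Rightarrow> real" where
  "shift X s z = (\<lambda>v. z v + s * cov X v)"

text \<open>The derivative is required along whole lines and to be continuous there, because
  integration by parts restricts f to a line and applies the one-dimensional identity with the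
  fundamental theorem of calculus.\<close>

definition cyld :: "('a \<Rightarrow> real) \<Rightarrow> ((('a \<Rightarrow> real) \<Rightarrow> real) \<Rightarrow> real) \<Rightarrow> ((('a \<Rightarrow> real) \<Rightarrow> real) \<Rightarrow> real) \<Rightarrow> bool" where
  "cyld X f f' \<longleftrightarrow> (\<exists>V. cyl V f \<and> cyl V f') \<and>
     (\<forall>z s. ((\<lambda>s. f (shift X s z)) has_real_derivative f' (shift X s z)) (at s)) \<and>
     (\<forall>z. continuous_on UNIV (\<lambda>s. f' (shift X s z)))"

lemma cylE:
  assumes "cyl V f"
  obtains C K where "C \<ge> 0" "\<And>z. \<bar>f z\<bar> \<le> C * (1 + (\<Sum>v\<in>V. \<bar>z v\<bar>)) ^ K"
proof -
  from assms obtain C K where CK: "\<And>z. \<bar>f z\<bar> \<le> C * (1 + (\<Sum>v\<in>V. \<bar>z v\<bar>)) ^ K"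
    unfolding cyl_def by blast
  have "0 \<le> C" using CK[of "\<lambda>_. 0"] by (simp add: order_trans[OF abs_ge_zero])
  with CK that show ?thesis by blast
qed

lemma cyl_growth_mono:
  fixes C C' :: real
  assumes "0 \<le> C" "C \<le> C'" "K \<le> K'" "V \<subseteq> V'" "finite V'"
  shows "C * (1 + (\<Sum>v\<in>V. \<bar>z v\<bar>)) ^ K \<le> C' * (1 + (\<Sum>v\<in>V'. \<bar>z v\<bar>)) ^ K'"
proof (rule mult_mono)
  have s: "(\<Sum>v\<in>V. \<bar>z v\<bar>) \<le> (\<Sum>v\<in>V'. \<bar>z v\<bar>)"
    using assms by (intro sum_mono2) auto
  have "(1 + (\<Sum>v\<in>V. \<bar>z v\<bar>)) ^ K \<le> (1 + (\<Sum>v\<in>V'. \<bar>z v\<bar>)) ^ K"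
    using s by (intro power_mono) (auto intro: add_nonneg_nonneg sum_nonneg)
  also have "\<dots> \<le> (1 + (\<Sum>v\<in>V'. \<bar>z v\<bar>)) ^ K'"
    using assms by (intro power_increasing) (auto intro: sum_nonneg)
  finally show "(1 + (\<Sum>v\<in>V. \<bar>z v\<bar>)) ^ K \<le> (1 + (\<Sum>v\<in>V'. \<bar>z v\<bar>)) ^ K'" .
qed (use assms in \<open>auto intro!: zero_le_power add_nonneg_nonneg sum_nonneg\<close>)

lemma cyl_mono:
  assumes "cyl V f" "V \<subseteq> V'" "finite V'" "V' \<subseteq> \<G>"
  shows "cyl V' f"
proof -
  have f: "f (restrict z V) = f z" for z using assms by (auto simp: cyl_def)
  have "f (restrict z V') = f z" for z
    using f[of "restrict z V'"] f[of z] assms(2)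
    by (metis (no_types, lifting) Int_absorb1 restrict_restrict)
  moreover have "f \<in> borel_measurable (PiM V' (\<lambda>_. borel))"
  proof -
    have "(\<lambda>z. f (restrict z V)) \<in> borel_measurable (PiM V' (\<lambda>_. borel))"
      using assms by (intro measurable_compose[OF measurable_restrict_subset]) (auto simp: cyl_def)
    then show ?thesis by (simp add: f)
  qed
  moreover from assms(1) obtain C K where "C \<ge> 0" "\<And>z. \<bar>f z\<bar> \<le> C * (1 + (\<Sum>v\<in>V. \<bar>z v\<bar>)) ^ K"
    by (rule cylE) blast
  then have "\<bar>f z\<bar> \<le> C * (1 + (\<Sum>v\<in>V'. \<bar>z v\<bar>)) ^ K" for z
    using cyl_growth_mono[of C C K K V V' z] assms by (meson order_refl order_trans)
  ultimately show ?thesis using assms unfolding cyl_def by blast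
qed

lemma cyl_measurable_comp:
  assumes "cyl V f" "\<And>v. v \<in> V \<Longrightarrow> (\<lambda>x. h x v) \<in> borel_measurable N"
  shows "(\<lambda>x. f (h x)) \<in> borel_measurable N"
proof -
  have f: "f (restrict z V) = f z" for z using assms by (auto simp: cyl_def)
  have "(\<lambda>x. f (\<lambda>v\<in>V. h x v)) \<in> borel_measurable N"
  proof (rule measurable_compose[where f="\<lambda>x. \<lambda>v\<in>V. h x v" and g=f and N="PiM V (\<lambda>_. borel)"])
    show "(\<lambda>x. \<lambda>v\<in>V. h x v) \<in> measurable N (PiM V (\<lambda>_. borel))"
      by (rule measurable_restrict) (rule assms(2))
    show "f \<in> borel_measurable (PiM V (\<lambda>_. borel))" using assms(1) by (auto simp: cyl_def)
  qed
  then show ?thesis using f by simp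
qed

lemma cyl_all_moments:
  assumes "cyl V f"
  shows "(\<lambda>\<omega>. f (ev \<omega>)) \<in> all_moments"
proof -
  from assms obtain C K where CK: "C \<ge> 0" "\<And>z. \<bar>f z\<bar> \<le> C * (1 + (\<Sum>v\<in>V. \<bar>z v\<bar>)) ^ K"
    by (rule cylE) blast
  have V: "V \<subseteq> \<G>" using assms by (simp add: cyl_def)
  show ?thesis
  proof (rule all_moments_AE_bound)
    show "(\<lambda>\<omega>. f (ev \<omega>)) \<in> borel_measurable M"
      by (rule cyl_measurable_comp[OF assms]) (use V in \<open>auto simp: ev_def intro: G_measurable\<close>)
    show "(\<lambda>\<omega>. C * (1 + (\<Sum>v\<in>V. \<bar>v \<omega>\<bar>)) ^ K) \<in> all_moments"
      using V by (intro all_moments_const all_moments_cmult all_moments_power all_moments_add all_moments_sum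
        all_moments_abs G_moments) auto
    show "AE \<omega> in M. \<bar>f (ev \<omega>)\<bar> \<le> \<bar>C * (1 + (\<Sum>v\<in>V. \<bar>v \<omega>\<bar>)) ^ K\<bar>"
    proof (intro AE_I2 order_trans[OF _ abs_ge_self])
      fix \<omega>
      show "\<bar>f (ev \<omega>)\<bar> \<le> C * (1 + (\<Sum>v\<in>V. \<bar>v \<omega>\<bar>)) ^ K"
        using CK(2)[of "ev \<omega>"] by (simp add: ev_def)
    qed
  qed
qed

end

section \<open>Integration by parts for cylinder functions\<close>

context gaussian_space
begin

text \<open>Subtracting from each v its projection on Z leaves variables orthogonal to Z. Then the
  variance of t Z + S is the sum of the two variances, so the characteristic function factorises,
  and orthogonality becomes independence.\<close>

lemma G_std_decomposition:
  assumes Z: "Z \<in> \<G>" "(\<integral>\<omega>. (Z \<omega>)\<^sup>2 \<partial>M) = 1" and V: "finite V" "V \<subseteq> \<G>"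
  defines "Y \<equiv> \<lambda>v \<omega>. v \<omega> - cov Z v * Z \<omega>"
  shows "distr M borel Z \<Otimes>\<^sub>M distr M (PiM V (\<lambda>_. borel)) (\<lambda>\<omega>. \<lambda>v\<in>V. Y v \<omega>) =
    distr M (borel \<Otimes>\<^sub>M PiM V (\<lambda>_. borel)) (\<lambda>\<omega>. (Z \<omega>, \<lambda>v\<in>V. Y v \<omega>))"
proof (rule indep_if_char_factorises[OF V(1)])
  have Y: "Y v \<in> \<G>" if "v \<in> V" for v
    unfolding Y_def using G_lin[of v Z 1 "- cov Z v"] Z V that by auto
  show "Y v \<in> borel_measurable M" if "v \<in> V" for v using Y[OF that] by (rule G_measurable)
  show "Z \<in> borel_measurable M" by (rule G_measurable[OF Z(1)])
  fix t s
  define S where "S \<omega> = (\<Sum>v\<in>V. s v * Y v \<omega>)" for \<omega>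
  have S: "S \<in> \<G>" using G_sum[OF V(1) Y Z(1), where t=0 and s=s] by (simp add: S_def[abs_def])
  have orth: "(\<integral>\<omega>. Z \<omega> * Y v \<omega> \<partial>M) = 0" if "v \<in> V" for v
  proof -
    have "(\<integral>\<omega>. Z \<omega> * Y v \<omega> \<partial>M) = (\<integral>\<omega>. Z \<omega> * v \<omega> - cov Z v * (Z \<omega>)\<^sup>2 \<partial>M)"
      by (intro Bochner_Integration.integral_cong refl) (simp add: Y_def algebra_simps power2_eq_square)
    also have "\<dots> = (\<integral>\<omega>. Z \<omega> * v \<omega> \<partial>M) - cov Z v * (\<integral>\<omega>. (Z \<omega>)\<^sup>2 \<partial>M)"
      using G_prod_integrable[of Z v] Z V that G_square_integrable[OF Z(1)] by auto
    finally show ?thesis by (simp add: Z(2) cov_def)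
  qed
  have "(\<integral>\<omega>. Z \<omega> * S \<omega> \<partial>M) = (\<integral>\<omega>. (\<Sum>v\<in>V. s v * (Z \<omega> * Y v \<omega>)) \<partial>M)"
    by (intro Bochner_Integration.integral_cong refl) (simp add: S_def sum_distrib_left mult_ac)
  also have "\<dots> = (\<Sum>v\<in>V. s v * (\<integral>\<omega>. Z \<omega> * Y v \<omega> \<partial>M))"
    using G_prod_integrable[OF Z(1) Y] by (subst Bochner_Integration.integral_sum) auto
  also have "\<dots> = 0" by (simp add: orth)
  finally have ZS: "(\<integral>\<omega>. Z \<omega> * S \<omega> \<partial>M) = 0" .
  have "(\<integral>\<omega>. (t * Z \<omega> + S \<omega>)\<^sup>2 \<partial>M) = (\<integral>\<omega>. t\<^sup>2 * (Z \<omega>)\<^sup>2 + (S \<omega>)\<^sup>2 + 2 * t * (Z \<omega> * S \<omega>) \<partial>M)"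
    by (intro Bochner_Integration.integral_cong refl) (simp add: power2_sum power_mult_distrib algebra_simps)
  also have "\<dots> = t\<^sup>2 * (\<integral>\<omega>. (Z \<omega>)\<^sup>2 \<partial>M) + (\<integral>\<omega>. (S \<omega>)\<^sup>2 \<partial>M) + 2 * t * (\<integral>\<omega>. Z \<omega> * S \<omega> \<partial>M)"
    using G_square_integrable[OF Z(1)] G_square_integrable[OF S] G_prod_integrable[OF Z(1) S] by simp
  finally have q: "(\<integral>\<omega>. (t * Z \<omega> + S \<omega>)\<^sup>2 \<partial>M) = t\<^sup>2 + (\<integral>\<omega>. (S \<omega>)\<^sup>2 \<partial>M)"
    by (simp add: Z(2) ZS)
  have "(\<lambda>\<omega>. t * Z \<omega> + S \<omega>) \<in> \<G>" using G_lin[OF Z(1) S, of t 1] by simp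
  then have "(CLINT \<omega>|M. iexp (t * Z \<omega> + S \<omega>)) = of_real (exp (- (t\<^sup>2 + (\<integral>\<omega>. (S \<omega>)\<^sup>2 \<partial>M)) / 2))"
    by (simp only: G_char q)
  also have "\<dots> = of_real (exp (- t\<^sup>2 / 2)) * of_real (exp (- (\<integral>\<omega>. (S \<omega>)\<^sup>2 \<partial>M) / 2))"
    by (simp only: of_real_mult[symmetric] exp_add[symmetric] add_divide_distrib[symmetric] minus_add_distrib)
  also have "of_real (exp (- (\<integral>\<omega>. (S \<omega>)\<^sup>2 \<partial>M) / 2)) = (CLINT \<omega>|M. iexp (S \<omega>))"
    by (rule G_char[OF S, symmetric])
  also have "of_real (exp (- t\<^sup>2 / 2)) = (CLINT \<omega>|M. iexp (t * Z \<omega>))"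
    using G_char[OF G_cmult[OF Z(1), of t]] Z(2) by (simp add: power_mult_distrib)
  finally show "(CLINT \<omega>|M. iexp (t * Z \<omega> + (\<Sum>v\<in>V. s v * Y v \<omega>))) =
       (CLINT \<omega>|M. iexp (t * Z \<omega>)) * (CLINT \<omega>|M. iexp (\<Sum>v\<in>V. s v * Y v \<omega>))"
    unfolding S_def .
qed

text \<open>Supplies the growth hypothesis of \<open>std_normal_ibp\<close> on each line on which
  the residual coordinates are fixed.\<close>

lemma cyl_section_growth:
  assumes "cyl V f"
  shows "\<exists>C K. \<forall>x. \<bar>f (\<lambda>v. y v + x * d v)\<bar> \<le> C * (1 + \<bar>x\<bar>) ^ K"
proof -
  from assms obtain C K where CK: "C \<ge> 0" "\<And>z. \<bar>f z\<bar> \<le> C * (1 + (\<Sum>v\<in>V. \<bar>z v\<bar>)) ^ K"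
    by (rule cylE) blast
  define A where "A = 1 + (\<Sum>v\<in>V. \<bar>y v\<bar>) + (\<Sum>v\<in>V. \<bar>d v\<bar>)"
  have "\<bar>f (\<lambda>v. y v + x * d v)\<bar> \<le> C * A ^ K * (1 + \<bar>x\<bar>) ^ K" for x
  proof -
    have "(\<Sum>v\<in>V. \<bar>y v + x * d v\<bar>) \<le> (\<Sum>v\<in>V. \<bar>y v\<bar> + \<bar>x\<bar> * \<bar>d v\<bar>)"
      by (intro sum_mono) (metis abs_mult abs_triangle_ineq)
    also have "\<dots> = (\<Sum>v\<in>V. \<bar>y v\<bar>) + \<bar>x\<bar> * (\<Sum>v\<in>V. \<bar>d v\<bar>)"
      by (simp add: sum.distrib sum_distrib_left)
    finally have "1 + (\<Sum>v\<in>V. \<bar>y v + x * d v\<bar>) \<le> 1 + (\<Sum>v\<in>V. \<bar>y v\<bar>) + \<bar>x\<bar> * (\<Sum>v\<in>V. \<bar>d v\<bar>)" by simp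
    also have "\<dots> \<le> A * (1 + \<bar>x\<bar>)"
      using mult_nonneg_nonneg[OF abs_ge_zero[of x] sum_nonneg[of V "\<lambda>v. \<bar>y v\<bar>"]]
      sum_nonneg[of V "\<lambda>v. \<bar>d v\<bar>"] by (simp add: A_def algebra_simps)
    finally have "(1 + (\<Sum>v\<in>V. \<bar>y v + x * d v\<bar>)) ^ K \<le> (A * (1 + \<bar>x\<bar>)) ^ K"
      by (intro power_mono) (auto intro!: add_nonneg_nonneg sum_nonneg)
    then have "C * (1 + (\<Sum>v\<in>V. \<bar>y v + x * d v\<bar>)) ^ K \<le> C * (A * (1 + \<bar>x\<bar>)) ^ K"
      using CK(1) by (rule mult_left_mono)
    with CK(2)[of "\<lambda>v. y v + x * d v"] show ?thesis by (simp add: power_mult_distrib mult.assoc)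
  qed
  then show ?thesis by blast
qed

text \<open>Each coordinate is its residual plus its covariance with Z times Z, so varying Z with
  the residuals fixed is exactly \<open>shift Z\<close>. Since Z and the residuals are independent,
  Fubini reduces the claim to Stein's identity in the variable Z.\<close>

lemma cyld_ibp_std:
  assumes Z: "Z \<in> \<G>" "(\<integral>\<omega>. (Z \<omega>)\<^sup>2 \<partial>M) = 1" and f: "cyld Z f f'"
  shows "(\<integral>\<omega>. Z \<omega> * f (ev \<omega>) \<partial>M) = (\<integral>\<omega>. f' (ev \<omega>) \<partial>M)"
proof -
  from f obtain V where V: "cyl V f" "cyl V f'" unfolding cyld_def by blast
  then have V': "finite V" "V \<subseteq> \<G>" by (auto simp: cyl_def)
  have fV: "f (restrict z V) = f z" "f' (restrict z V) = f' z" for z using V by (auto simp: cyl_def)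
  define Y where "Y v \<omega> = v \<omega> - cov Z v * Z \<omega>" for v \<omega>
  let ?N = "distr M borel Z" and ?P = "distr M (PiM V (\<lambda>_. borel)) (\<lambda>\<omega>. \<lambda>v\<in>V. Y v \<omega>)"
  let ?J = "distr M (borel \<Otimes>\<^sub>M PiM V (\<lambda>_. borel)) (\<lambda>\<omega>. (Z \<omega>, \<lambda>v\<in>V. Y v \<omega>))"
  have J: "?N \<Otimes>\<^sub>M ?P = ?J"
    unfolding Y_def by (rule G_std_decomposition[OF Z V'])
  note [measurable] = G_measurable[OF Z(1)]
  have Ym: "v \<in> V \<Longrightarrow> Y v \<in> borel_measurable M" for v
    unfolding Y_def using V'(2) G_measurable[of v] by auto
  have [measurable]: "(\<lambda>\<omega>. \<lambda>v\<in>V. Y v \<omega>) \<in> measurable M (PiM V (\<lambda>_. borel))"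
    by (rule measurable_restrict) (rule Ym)
  interpret N: prob_space ?N by (rule prob_space_distr) measurable
  interpret Q: prob_space ?P by (rule prob_space_distr) measurable
  interpret NQ: pair_sigma_finite ?N ?P ..
  have ev: "f (\<lambda>v. (\<lambda>v\<in>V. Y v \<omega>) v + Z \<omega> * cov Z v) = f (ev \<omega>)"
    "f' (\<lambda>v. (\<lambda>v\<in>V. Y v \<omega>) v + Z \<omega> * cov Z v) = f' (ev \<omega>)" for \<omega>
  proof -
    have "restrict (\<lambda>v. (\<lambda>v\<in>V. Y v \<omega>) v + Z \<omega> * cov Z v) V = restrict (ev \<omega>) V"
      by (rule restrict_ext) (simp add: Y_def ev_def)
    then show "f (\<lambda>v. (\<lambda>v\<in>V. Y v \<omega>) v + Z \<omega> * cov Z v) = f (ev \<omega>)"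
      "f' (\<lambda>v. (\<lambda>v\<in>V. Y v \<omega>) v + Z \<omega> * cov Z v) = f' (ev \<omega>)"
      using fV by metis+
  qed
  have meas: "(\<lambda>p. g (\<lambda>v. snd p v + fst p * cov Z v)) \<in> borel_measurable (borel \<Otimes>\<^sub>M PiM V (\<lambda>_. borel))"
    if "cyl V g" for g
    by (rule cyl_measurable_comp[OF that]) measurable
  note [measurable] = meas[OF V(1)] meas[OF V(2)]
  have mZ: "Z \<in> all_moments" by (rule G_moments(1)[OF Z(1)])
  have i1: "integrable ?J (\<lambda>p. fst p * f (\<lambda>v. snd p v + fst p * cov Z v))"
  proof -
    have "integrable M (\<lambda>\<omega>. Z \<omega> * f (ev \<omega>))"
      by (intro all_moments_integrable all_moments_mult mZ cyl_all_moments[OF V(1)])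
    then show ?thesis by (subst integrable_distr_eq) (auto simp: ev(1)[unfolded restrict_apply])
  qed
  have i2: "integrable ?J (\<lambda>p. f' (\<lambda>v. snd p v + fst p * cov Z v))"
  proof -
    have "integrable M (\<lambda>\<omega>. f' (ev \<omega>))"
      by (intro all_moments_integrable cyl_all_moments[OF V(2)])
    then show ?thesis by (subst integrable_distr_eq) (auto simp: ev(2)[unfolded restrict_apply])
  qed
  have inner: "(\<integral>x. x * f (\<lambda>v. y v + x * cov Z v) \<partial>?N) = (\<integral>x. f' (\<lambda>v. y v + x * cov Z v) \<partial>?N)" for y
  proof -
    obtain C K where CK: "\<And>x. \<bar>f (\<lambda>v. y v + x * cov Z v)\<bar> \<le> C * (1 + \<bar>x\<bar>) ^ K"
      using cyl_section_growth[OF V(1)] by blast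
    obtain C' K' where CK': "\<And>x. \<bar>f' (\<lambda>v. y v + x * cov Z v)\<bar> \<le> C' * (1 + \<bar>x\<bar>) ^ K'"
      using cyl_section_growth[OF V(2)] by blast
    have up: "c * (1 + \<bar>x\<bar>) ^ k \<le> max 0 (max C C') * (1 + \<bar>x\<bar>) ^ max K K'"
      if "c \<le> max C C'" "k \<le> max K K'" for c k and x :: real
    proof -
      have "c * (1 + \<bar>x\<bar>) ^ k \<le> max 0 (max C C') * (1 + \<bar>x\<bar>) ^ k"
        using that by (intro mult_right_mono) auto
      also have "\<dots> \<le> max 0 (max C C') * (1 + \<bar>x\<bar>) ^ max K K'"
        using that by (intro mult_left_mono power_increasing) auto
      finally show ?thesis .
    qed
    show ?thesis unfolding G_std[OF Z]
    proof (rule std_normal_ibp[where C="max 0 (max C C')" and K="max K K'"])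
      show "\<bar>f (\<lambda>v. y v + x * cov Z v)\<bar> \<le> max 0 (max C C') * (1 + \<bar>x\<bar>) ^ max K K'" for x
        using CK[of x] up[of C K x] by linarith
      show "\<bar>f' (\<lambda>v. y v + x * cov Z v)\<bar> \<le> max 0 (max C C') * (1 + \<bar>x\<bar>) ^ max K K'" for x
        using CK'[of x] up[of C' K' x] by linarith
      show "((\<lambda>x. f (\<lambda>v. y v + x * cov Z v)) has_real_derivative f' (\<lambda>v. y v + x * cov Z v)) (at x)" for x
        using f unfolding cyld_def shift_def by blast
      show "continuous_on UNIV (\<lambda>x. f' (\<lambda>v. y v + x * cov Z v))"
        using f unfolding cyld_def shift_def by blast
    qed
  qed
  have "(\<integral>\<omega>. Z \<omega> * f (ev \<omega>) \<partial>M) = (\<integral>p. fst p * f (\<lambda>v. snd p v + fst p * cov Z v) \<partial>?J)"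
    by (subst integral_distr) (auto simp: ev(1)[unfolded restrict_apply])
  also have "\<dots> = (\<integral>y. \<integral>x. x * f (\<lambda>v. y v + x * cov Z v) \<partial>?N \<partial>?P)"
    using NQ.integral_snd[of "\<lambda>x y. x * f (\<lambda>v. y v + x * cov Z v)"] i1
    unfolding J[symmetric] by (simp add: case_prod_beta')
  also have "\<dots> = (\<integral>y. \<integral>x. f' (\<lambda>v. y v + x * cov Z v) \<partial>?N \<partial>?P)"
    by (simp only: inner)
  also have "\<dots> = (\<integral>p. f' (\<lambda>v. snd p v + fst p * cov Z v) \<partial>?J)"
    using NQ.integral_snd[of "\<lambda>x y. f' (\<lambda>v. y v + x * cov Z v)"] i2
    unfolding J[symmetric] by (simp add: case_prod_beta')
  also have "\<dots> = (\<integral>\<omega>. f' (ev \<omega>) \<partial>M)"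
    by (subst integral_distr) (auto simp: ev(2)[unfolded restrict_apply])
  finally show ?thesis .
qed

lemma cyl_const: "cyl {} (\<lambda>_. c)"
  unfolding cyl_def by (intro conjI exI[where x="\<bar>c\<bar>"] exI[where x="0::nat"]) auto

lemma cyl_coord: "Z \<in> \<G> \<Longrightarrow> cyl {Z} (\<lambda>z. z Z)"
  unfolding cyl_def by (auto intro!: exI[of _ 1])

lemma cyl_cmult:
  assumes "cyl V f" shows "cyl V (\<lambda>z. c * f z)"
proof -
  from assms obtain C K where CK: "C \<ge> 0" "\<And>z. \<bar>f z\<bar> \<le> C * (1 + (\<Sum>v\<in>V. \<bar>z v\<bar>)) ^ K"
    by (rule cylE) blast
  have "\<bar>c * f z\<bar> \<le> (\<bar>c\<bar> * C) * (1 + (\<Sum>v\<in>V. \<bar>z v\<bar>)) ^ K" for z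
    using mult_left_mono[OF CK(2)[of z] abs_ge_zero[of c]] by (simp add: abs_mult mult_ac)
  then show ?thesis using assms unfolding cyl_def by (auto intro: borel_measurable_times)
qed

lemma cyl_mult:
  assumes "cyl V f" "cyl V g" shows "cyl V (\<lambda>z. f z * g z)"
proof -
  from assms(1) obtain C K where CK: "C \<ge> 0" "\<And>z. \<bar>f z\<bar> \<le> C * (1 + (\<Sum>v\<in>V. \<bar>z v\<bar>)) ^ K"
    by (rule cylE) blast
  from assms(2) obtain C' K' where CK': "C' \<ge> 0" "\<And>z. \<bar>g z\<bar> \<le> C' * (1 + (\<Sum>v\<in>V. \<bar>z v\<bar>)) ^ K'"
    by (rule cylE) blast
  have "\<bar>f z * g z\<bar> \<le> (C * C') * (1 + (\<Sum>v\<in>V. \<bar>z v\<bar>)) ^ (K + K')" for z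
    using mult_mono[OF CK(2)[of z] CK'(2)[of z]] CK(1)
    by (simp add: abs_mult power_add mult_ac sum_nonneg)
  then show ?thesis using assms unfolding cyl_def by (auto intro: borel_measurable_times)
qed

lemma cyl_add:
  assumes "cyl V f" "cyl V g" shows "cyl V (\<lambda>z. f z + g z)"
proof -
  from assms(1) obtain C K where CK: "C \<ge> 0" "\<And>z. \<bar>f z\<bar> \<le> C * (1 + (\<Sum>v\<in>V. \<bar>z v\<bar>)) ^ K"
    by (rule cylE) blast
  from assms(2) obtain C' K' where CK': "C' \<ge> 0" "\<And>z. \<bar>g z\<bar> \<le> C' * (1 + (\<Sum>v\<in>V. \<bar>z v\<bar>)) ^ K'"
    by (rule cylE) blast
  have fin: "finite V" using assms by (simp add: cyl_def)
  have "\<bar>f z + g z\<bar> \<le> (C + C') * (1 + (\<Sum>v\<in>V. \<bar>z v\<bar>)) ^ (K + K')" for z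
  proof -
    have "\<bar>f z + g z\<bar> \<le> \<bar>f z\<bar> + \<bar>g z\<bar>" by (rule abs_triangle_ineq)
    also have "\<dots> \<le> C * (1 + (\<Sum>v\<in>V. \<bar>z v\<bar>)) ^ (K + K') + C' * (1 + (\<Sum>v\<in>V. \<bar>z v\<bar>)) ^ (K + K')"
      using CK(2)[of z] CK'(2)[of z] cyl_growth_mono[OF CK(1) order_refl, of K "K + K'" V V z]
        cyl_growth_mono[OF CK'(1) order_refl, of K' "K + K'" V V z] fin by simp
    finally show ?thesis by (simp add: distrib_right)
  qed
  then show ?thesis using assms unfolding cyl_def by (auto intro: borel_measurable_add)
qed

lemma cyl_sum:
  assumes "finite V" "V \<subseteq> \<G>" "\<And>i. i \<in> I \<Longrightarrow> cyl V (f i)" shows "cyl V (\<lambda>z. \<Sum>i\<in>I. f i z)"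
  using assms(3)
proof (induction I rule: infinite_finite_induct)
  case (insert x I)
  then show ?case using cyl_add[of V "f x" "\<lambda>z. \<Sum>i\<in>I. f i z"] by simp
qed (use assms in \<open>auto intro: cyl_mono[OF cyl_const]\<close>)

lemma cyld_cyl: "cyld X f f' \<Longrightarrow> \<exists>V. cyl V f \<and> cyl V f'"
  by (simp add: cyld_def)

lemma cyld_cyl2:
  assumes "cyld X f f'" "cyld Y g g'"
  obtains V where "cyl V f" "cyl V f'" "cyl V g" "cyl V g'"
proof -
  obtain V1 V2 where V: "cyl V1 f" "cyl V1 f'" "cyl V2 g" "cyl V2 g'"
    using assms cyld_cyl by meson
  then have "V1 \<union> V2 \<subseteq> \<G>" "finite (V1 \<union> V2)" by (auto simp: cyl_def)
  then show ?thesis using V that[of "V1 \<union> V2"] by (meson cyl_mono sup_ge1 sup_ge2)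
qed

lemma cyldI:
  assumes "cyl V f" "cyl V f'"
    "\<And>z s. ((\<lambda>s. f (shift X s z)) has_real_derivative f' (shift X s z)) (at s)"
    "\<And>z. continuous_on UNIV (\<lambda>s. f' (shift X s z))"
  shows "cyld X f f'"
  using assms unfolding cyld_def by blast

lemma cyldD:
  assumes "cyld X f f'"
  shows "((\<lambda>s. f (shift X s z)) has_real_derivative f' (shift X s z)) (at s)"
    "continuous_on UNIV (\<lambda>s. f' (shift X s z))" "continuous_on UNIV (\<lambda>s. f (shift X s z))"
proof -
  show *: "((\<lambda>s. f (shift X s z)) has_real_derivative f' (shift X s z)) (at s)" for s
    using assms unfolding cyld_def by blast
  show "continuous_on UNIV (\<lambda>s. f' (shift X s z))"
    using assms unfolding cyld_def by blast
  show "continuous_on UNIV (\<lambda>s. f (shift X s z))"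
    by (rule DERIV_continuous_on) (rule *)
qed

lemma cyld_const: "cyld X (\<lambda>_. c) (\<lambda>_. 0)"
  by (rule cyldI[OF cyl_const cyl_const]) auto

lemma cyld_coord: "Z \<in> \<G> \<Longrightarrow> cyld X (\<lambda>z. z Z) (\<lambda>_. cov X Z)"
  by (rule cyldI[OF cyl_coord cyl_mono[OF cyl_const]])
     (auto simp: shift_def intro!: derivative_eq_intros)

lemma cyld_add:
  assumes "cyld X f f'" "cyld X g g'" shows "cyld X (\<lambda>z. f z + g z) (\<lambda>z. f' z + g' z)"
proof -
  obtain V where "cyl V f" "cyl V f'" "cyl V g" "cyl V g'" by (rule cyld_cyl2[OF assms])
  then show ?thesis
    by (intro cyldI[of V] cyl_add DERIV_add continuous_on_add cyldD[OF assms(1)] cyldD[OF assms(2)])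
qed

lemma cyld_mult:
  assumes "cyld X f f'" "cyld X g g'" shows "cyld X (\<lambda>z. f z * g z) (\<lambda>z. f' z * g z + g' z * f z)"
proof -
  obtain V where "cyl V f" "cyl V f'" "cyl V g" "cyl V g'" by (rule cyld_cyl2[OF assms])
  then show ?thesis
    by (intro cyldI[of V] cyl_add cyl_mult DERIV_mult continuous_on_add continuous_on_mult
       cyldD[OF assms(1)] cyldD[OF assms(2)])
qed

text \<open>Provides the test functions of \<open>malliavin_unique\<close>. The arctangent and its
  derivative are bounded, so the growth condition and the chain rule cause no loss.\<close>

lemma cyld_arctan:
  assumes "cyld X f f'" shows "cyld X (\<lambda>z. arctan (f z)) (\<lambda>z. inverse (1 + (f z)\<^sup>2) * f' z)"
proof -
  obtain V where V: "cyl V f" "cyl V f'" using cyld_cyl[OF assms] by blast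
  have p: "1 + x\<^sup>2 \<noteq> 0" for x :: real by (metis add_pos_nonneg less_irrefl zero_le_power2 zero_less_one)
  have "cyl V (\<lambda>z. arctan (f z))"
  proof -
    have "\<bar>arctan x\<bar> \<le> 2" for x using arctan_bounded[of x] pi_less_4 by (simp add: abs_le_iff)
    then show ?thesis using V(1) unfolding cyl_def
      by (auto intro!: exI[where x="2::real"] exI[where x="0::nat"] borel_measurable_arctan)
  qed
  moreover have "cyl V (\<lambda>z. inverse (1 + (f z)\<^sup>2))"
  proof -
    have "\<bar>inverse (1 + x\<^sup>2)\<bar> \<le> 1" for x :: real by (auto simp: abs_inverse intro!: inverse_le_1_iff[THEN iffD2])
    then show ?thesis using V(1) unfolding cyl_def
      by (auto intro!: exI[where x="1::real"] exI[where x="0::nat"])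
  qed
  moreover have "continuous_on UNIV (\<lambda>s. inverse (1 + (f (shift X s z))\<^sup>2) * f' (shift X s z))" for z
    using p by (intro continuous_on_mult continuous_on_inverse continuous_on_add continuous_on_const
      continuous_on_power cyldD[OF assms]) auto
  moreover have "((\<lambda>s. arctan (f (shift X s z))) has_real_derivative inverse (1 + (f (shift X s z))\<^sup>2) * f' (shift X s z)) (at s)" for z s
    by (rule DERIV_chain2[OF DERIV_arctan cyldD(1)[OF assms]])
  ultimately show ?thesis using V(2) by (intro cyldI[of V] cyl_mult)
qed

lemma cyld_scale_direction:
  assumes "cyld X f f'" "c \<noteq> 0"
  shows "cyld (\<lambda>\<omega>. c * X \<omega>) f (\<lambda>z. c * f' z)"
proof -
  obtain V where V: "cyl V f" "cyl V f'" using cyld_cyl[OF assms(1)] by blast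
  have sh: "shift (\<lambda>\<omega>. c * X \<omega>) s z = shift X (c * s) z" for s z
    by (simp add: shift_def cov_def mult_ac)
  show ?thesis
  proof (rule cyldI[OF V(1) cyl_cmult[OF V(2)]])
    show "((\<lambda>s. f (shift (\<lambda>\<omega>. c * X \<omega>) s z)) has_real_derivative c * f' (shift (\<lambda>\<omega>. c * X \<omega>) s z)) (at s)" for z s
    proof -
      have "((\<lambda>s. f (shift X (c * s) z)) has_real_derivative f' (shift X (c * s) z) * c) (at s)"
        by (rule DERIV_chain2[OF cyldD(1)[OF assms(1)]]) (auto intro!: derivative_eq_intros)
      then show ?thesis unfolding sh by (simp add: mult.commute)
    qed
    show "continuous_on UNIV (\<lambda>s. c * f' (shift (\<lambda>\<omega>. c * X \<omega>) s z))" for z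
      unfolding sh
      by (intro continuous_intros continuous_on_compose2[OF cyldD(2)[OF assms(1)]]) auto
  qed
qed

text \<open>Normalisation to unit variance. A variable of variance 0 has covariance 0 with
  everything, so \<open>shift\<close> does not move and f' must be 0; both sides vanish.\<close>

lemma cyld_ibp:
  assumes X: "X \<in> \<G>" and f: "cyld X f f'"
  shows "(\<integral>\<omega>. X \<omega> * f (ev \<omega>) \<partial>M) = (\<integral>\<omega>. f' (ev \<omega>) \<partial>M)"
proof (cases "(\<integral>\<omega>. (X \<omega>)\<^sup>2 \<partial>M) = 0")
  case True
  note [measurable] = G_measurable[OF X]
  obtain V where V: "cyl V f" "cyl V f'" using cyld_cyl[OF f] by blast
  have ae: "AE \<omega> in M. X \<omega> = 0" by (rule G_zero_variance[OF X True])
  have c0: "cov X v = 0" for v unfolding cov_def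
    using ae by (intro integral_eq_zero_AE) auto
  have "f' z = 0" for z
  proof -
    have "((\<lambda>s. f z) has_real_derivative f' z) (at 0)"
      using cyldD(1)[OF f, of z 0] by (simp add: shift_def c0)
    then show ?thesis using DERIV_unique DERIV_const by blast
  qed
  moreover have "(\<integral>\<omega>. X \<omega> * f (ev \<omega>) \<partial>M) = 0"
    using ae by (intro integral_eq_zero_AE) auto
  ultimately show ?thesis by simp
next
  case False
  define s where "s = sqrt (\<integral>\<omega>. (X \<omega>)\<^sup>2 \<partial>M)"
  have s: "s > 0" "s\<^sup>2 = (\<integral>\<omega>. (X \<omega>)\<^sup>2 \<partial>M)" using False by (auto simp: s_def less_le)
  define Z where "Z = (\<lambda>\<omega>. (1 / s) * X \<omega>)"
  have Z: "Z \<in> \<G>" unfolding Z_def by (rule G_cmult[OF X])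
  have Z1: "(\<integral>\<omega>. (Z \<omega>)\<^sup>2 \<partial>M) = 1"
  proof -
    have "(\<integral>\<omega>. (Z \<omega>)\<^sup>2 \<partial>M) = (1 / s)\<^sup>2 * (\<integral>\<omega>. (X \<omega>)\<^sup>2 \<partial>M)"
      unfolding Z_def power_mult_distrib by simp
    then show ?thesis using s(1) by (simp add: s(2)[symmetric] power_divide)
  qed
  have "cyld Z f (\<lambda>z. (1 / s) * f' z)"
    unfolding Z_def using s by (intro cyld_scale_direction[OF f]) auto
  from cyld_ibp_std[OF Z Z1 this]
  have "(1 / s) * (\<integral>\<omega>. X \<omega> * f (ev \<omega>) \<partial>M) = (1 / s) * (\<integral>\<omega>. f' (ev \<omega>) \<partial>M)"
    unfolding Z_def mult.assoc by simp
  then show ?thesis using s by simp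
qed

end

section \<open>Directional derivatives closed under limits in all moments\<close>

context gaussian_space
begin

text \<open>\<open>\<Phi>'\<close> is the derivative of \<open>\<Phi>\<close> in the direction \<open>X\<close>, by closure from the cylinder functions.\<close>

definition mder :: "('a \<Rightarrow> real) \<Rightarrow> ('a \<Rightarrow> real) \<Rightarrow> ('a \<Rightarrow> real) \<Rightarrow> bool" where
  "mder X \<Phi> \<Phi>' \<longleftrightarrow> \<Phi> \<in> all_moments \<and> \<Phi>' \<in> all_moments \<and>
     (\<forall>q>0. \<forall>\<epsilon>>0. \<exists>f f'. cyld X f f' \<and> nrm q (\<lambda>\<omega>. \<Phi> \<omega> - f (ev \<omega>)) < \<epsilon> \<and>
        nrm q (\<lambda>\<omega>. \<Phi>' \<omega> - f' (ev \<omega>)) < \<epsilon>)"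

lemma mderD:
  assumes "mder X \<Phi> \<Phi>'"
  shows "\<Phi> \<in> all_moments" "\<Phi>' \<in> all_moments"
  using assms by (auto simp: mder_def)

lemma mderE:
  assumes "mder X \<Phi> \<Phi>'" "0 < q" "0 < \<epsilon>"
  obtains f f' where "cyld X f f'" "nrm q (\<lambda>\<omega>. \<Phi> \<omega> - f (ev \<omega>)) < \<epsilon>"
    "nrm q (\<lambda>\<omega>. \<Phi>' \<omega> - f' (ev \<omega>)) < \<epsilon>"
    "(\<lambda>\<omega>. f (ev \<omega>)) \<in> all_moments" "(\<lambda>\<omega>. f' (ev \<omega>)) \<in> all_moments"
proof -
  obtain f f' where f: "cyld X f f'" "nrm q (\<lambda>\<omega>. \<Phi> \<omega> - f (ev \<omega>)) < \<epsilon>"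
    "nrm q (\<lambda>\<omega>. \<Phi>' \<omega> - f' (ev \<omega>)) < \<epsilon>" using assms unfolding mder_def by blast
  moreover obtain V where "cyl V f" "cyl V f'" using cyld_cyl[OF f(1)] by blast
  ultimately show ?thesis using that cyl_all_moments by blast
qed

lemma mder_cyld:
  assumes "cyld X f f'"
  shows "mder X (\<lambda>\<omega>. f (ev \<omega>)) (\<lambda>\<omega>. f' (ev \<omega>))"
proof -
  obtain V where "cyl V f" "cyl V f'" using cyld_cyl[OF assms] by blast
  then have "(\<lambda>\<omega>. f (ev \<omega>)) \<in> all_moments" "(\<lambda>\<omega>. f' (ev \<omega>)) \<in> all_moments"
    by (auto intro: cyl_all_moments)
  then show ?thesis unfolding mder_def using assms
    by (intro conjI allI impI exI[where x=f] exI[where x=f']) auto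
qed

lemma mder_const: "mder X (\<lambda>_. c) (\<lambda>_. 0)"
  using mder_cyld[OF cyld_const] .

lemma mder_coord: "Z \<in> \<G> \<Longrightarrow> mder X Z (\<lambda>_. cov X Z)"
  using mder_cyld[OF cyld_coord, of Z X] by (simp add: ev_def)

lemma mder_add:
  assumes "mder X \<Phi> \<Phi>'" "mder X \<Psi> \<Psi>'"
  shows "mder X (\<lambda>\<omega>. \<Phi> \<omega> + \<Psi> \<omega>) (\<lambda>\<omega>. \<Phi>' \<omega> + \<Psi>' \<omega>)"
  unfolding mder_def
proof (intro conjI allI impI)
  note mom = mderD[OF assms(1)] mderD[OF assms(2)]
  show "(\<lambda>\<omega>. \<Phi> \<omega> + \<Psi> \<omega>) \<in> all_moments" "(\<lambda>\<omega>. \<Phi>' \<omega> + \<Psi>' \<omega>) \<in> all_moments"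
    using mom by (auto intro: all_moments_add)
  fix q :: nat and \<epsilon> :: real assume q: "0 < q" "0 < \<epsilon>"
  then have e: "0 < \<epsilon> / 2" by simp
  obtain f f' where f: "cyld X f f'" "nrm q (\<lambda>\<omega>. \<Phi> \<omega> - f (ev \<omega>)) < \<epsilon> / 2"
    "nrm q (\<lambda>\<omega>. \<Phi>' \<omega> - f' (ev \<omega>)) < \<epsilon> / 2"
    "(\<lambda>\<omega>. f (ev \<omega>)) \<in> all_moments" "(\<lambda>\<omega>. f' (ev \<omega>)) \<in> all_moments"
    by (rule mderE[OF assms(1) q(1) e])
  obtain g g' where g: "cyld X g g'" "nrm q (\<lambda>\<omega>. \<Psi> \<omega> - g (ev \<omega>)) < \<epsilon> / 2"
    "nrm q (\<lambda>\<omega>. \<Psi>' \<omega> - g' (ev \<omega>)) < \<epsilon> / 2"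
    "(\<lambda>\<omega>. g (ev \<omega>)) \<in> all_moments" "(\<lambda>\<omega>. g' (ev \<omega>)) \<in> all_moments"
    by (rule mderE[OF assms(2) q(1) e])
  have "nrm q (\<lambda>\<omega>. (\<Phi> \<omega> + \<Psi> \<omega>) - (f (ev \<omega>) + g (ev \<omega>))) < \<epsilon>"
    using nrm_add[OF q(1) all_moments_diff[OF mom(1) f(4)] all_moments_diff[OF mom(3) g(4)]] f(2) g(2)
    by (simp add: algebra_simps)
  moreover have "nrm q (\<lambda>\<omega>. (\<Phi>' \<omega> + \<Psi>' \<omega>) - (f' (ev \<omega>) + g' (ev \<omega>))) < \<epsilon>"
    using nrm_add[OF q(1) all_moments_diff[OF mom(2) f(5)] all_moments_diff[OF mom(4) g(5)]] f(3) g(3)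
    by (simp add: algebra_simps)
  ultimately show "\<exists>f f'. cyld X f f' \<and> nrm q (\<lambda>\<omega>. (\<Phi> \<omega> + \<Psi> \<omega>) - f (ev \<omega>)) < \<epsilon> \<and>
      nrm q (\<lambda>\<omega>. (\<Phi>' \<omega> + \<Psi>' \<omega>) - f' (ev \<omega>)) < \<epsilon>"
    using cyld_add[OF f(1) g(1)] by blast
qed

lemma nrm_prod_diff:
  assumes "0 < q" "\<Phi> \<in> all_moments" "\<Psi> \<in> all_moments" "f \<in> all_moments" "g \<in> all_moments"
    and "nrm (2*q) (\<lambda>\<omega>. \<Phi> \<omega> - f \<omega>) \<le> \<delta>" "nrm (2*q) (\<lambda>\<omega>. \<Psi> \<omega> - g \<omega>) \<le> \<delta>" "\<delta> \<le> 1"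
  shows "nrm q (\<lambda>\<omega>. \<Phi> \<omega> * \<Psi> \<omega> - f \<omega> * g \<omega>) \<le> \<delta> * (nrm (2*q) \<Phi> + nrm (2*q) \<Psi> + 1)"
proof -
  have \<delta>: "0 \<le> \<delta>" using order_trans[OF nrm_nonneg assms(6)] .
  have "nrm (2*q) g \<le> nrm (2*q) \<Psi> + nrm (2*q) (\<lambda>\<omega>. - (\<Psi> \<omega> - g \<omega>))"
    using nrm_add[of "2*q" \<Psi> "\<lambda>\<omega>. - (\<Psi> \<omega> - g \<omega>)"] assms
    by (auto intro!: all_moments_diff)
  also have "nrm (2*q) (\<lambda>\<omega>. - (\<Psi> \<omega> - g \<omega>)) = nrm (2*q) (\<lambda>\<omega>. \<Psi> \<omega> - g \<omega>)"
    by (simp add: nrm_def abs_minus_commute)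
  finally have g: "nrm (2*q) g \<le> nrm (2*q) \<Psi> + 1" using assms by simp
  have "nrm q (\<lambda>\<omega>. \<Phi> \<omega> * \<Psi> \<omega> - f \<omega> * g \<omega>) =
     nrm q (\<lambda>\<omega>. \<Phi> \<omega> * (\<Psi> \<omega> - g \<omega>) + (\<Phi> \<omega> - f \<omega>) * g \<omega>)"
    by (simp add: algebra_simps)
  also have "\<dots> \<le> nrm q (\<lambda>\<omega>. \<Phi> \<omega> * (\<Psi> \<omega> - g \<omega>)) + nrm q (\<lambda>\<omega>. (\<Phi> \<omega> - f \<omega>) * g \<omega>)"
    using assms by (intro nrm_add all_moments_mult all_moments_diff)
  also have "\<dots> \<le> nrm (2*q) \<Phi> * nrm (2*q) (\<lambda>\<omega>. \<Psi> \<omega> - g \<omega>) + nrm (2*q) (\<lambda>\<omega>. \<Phi> \<omega> - f \<omega>) * nrm (2*q) g"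
    using assms by (intro add_mono nrm_mult all_moments_diff)
  also have "\<dots> \<le> nrm (2*q) \<Phi> * \<delta> + \<delta> * (nrm (2*q) \<Psi> + 1)"
    using assms g \<delta> by (intro add_mono mult_mono) auto
  finally show ?thesis by (simp add: algebra_simps)
qed

text \<open>Approximating a product in \<open>L^q\<close> uses approximations of the factors in
  \<open>L^(2q)\<close>; this is why \<open>mder\<close> asks for every exponent. The approximants
  may change with the exponent.\<close>

lemma mder_mult:
  assumes "mder X \<Phi> \<Phi>'" "mder X \<Psi> \<Psi>'"
  shows "mder X (\<lambda>\<omega>. \<Phi> \<omega> * \<Psi> \<omega>) (\<lambda>\<omega>. \<Phi>' \<omega> * \<Psi> \<omega> + \<Psi>' \<omega> * \<Phi> \<omega>)"
  unfolding mder_def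
proof (intro conjI allI impI)
  note mom = mderD[OF assms(1)] mderD[OF assms(2)]
  show "(\<lambda>\<omega>. \<Phi> \<omega> * \<Psi> \<omega>) \<in> all_moments" "(\<lambda>\<omega>. \<Phi>' \<omega> * \<Psi> \<omega> + \<Psi>' \<omega> * \<Phi> \<omega>) \<in> all_moments"
    using mom by (auto intro: all_moments_add all_moments_mult)
  fix q :: nat and \<epsilon> :: real assume q: "0 < q" "0 < \<epsilon>"
  define A where "A = nrm (2*q) \<Phi> + nrm (2*q) \<Psi> + nrm (2*q) \<Phi>' + nrm (2*q) \<Psi>' + 1"
  have A: "1 \<le> A" by (simp add: A_def)
  \<comment> \<open>The bound by 1 is required by \<open>nrm_prod_diff\<close>. The factor 4 makes
    each product error at most \<epsilon> / 4, so that the two errors in the derivative stay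
    strictly below \<epsilon> together.\<close>
  define \<delta> where "\<delta> = min 1 (\<epsilon> / (4 * A))"
  have \<delta>: "0 < \<delta>" "\<delta> \<le> 1" "\<delta> * A \<le> \<epsilon> / 4"
    using q A mult_right_mono[of \<delta> "\<epsilon> / (4 * A)" A] by (auto simp: \<delta>_def)
  have q2: "0 < 2 * q" using q by simp
  obtain f f' where f: "cyld X f f'" "nrm (2*q) (\<lambda>\<omega>. \<Phi> \<omega> - f (ev \<omega>)) < \<delta>"
    "nrm (2*q) (\<lambda>\<omega>. \<Phi>' \<omega> - f' (ev \<omega>)) < \<delta>"
    "(\<lambda>\<omega>. f (ev \<omega>)) \<in> all_moments" "(\<lambda>\<omega>. f' (ev \<omega>)) \<in> all_moments"
    by (rule mderE[OF assms(1) q2 \<delta>(1)])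
  obtain g g' where g: "cyld X g g'" "nrm (2*q) (\<lambda>\<omega>. \<Psi> \<omega> - g (ev \<omega>)) < \<delta>"
    "nrm (2*q) (\<lambda>\<omega>. \<Psi>' \<omega> - g' (ev \<omega>)) < \<delta>"
    "(\<lambda>\<omega>. g (ev \<omega>)) \<in> all_moments" "(\<lambda>\<omega>. g' (ev \<omega>)) \<in> all_moments"
    by (rule mderE[OF assms(2) q2 \<delta>(1)])
  have le: "\<delta> * (a + b + 1) \<le> \<epsilon> / 4" if "a + b + 1 \<le> A" for a b
    using mult_left_mono[OF that, of \<delta>] \<delta> by linarith
  have e1: "nrm q (\<lambda>\<omega>. \<Phi> \<omega> * \<Psi> \<omega> - f (ev \<omega>) * g (ev \<omega>)) \<le> \<epsilon> / 4"
    using nrm_prod_diff[OF q(1) mom(1,3) f(4) g(4), of \<delta>] f g \<delta> le[of "nrm (2*q) \<Phi>" "nrm (2*q) \<Psi>"]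
    by (simp add: A_def)
  have e2: "nrm q (\<lambda>\<omega>. \<Phi>' \<omega> * \<Psi> \<omega> - f' (ev \<omega>) * g (ev \<omega>)) \<le> \<epsilon> / 4"
    using nrm_prod_diff[OF q(1) mom(2,3) f(5) g(4), of \<delta>] f g \<delta> le[of "nrm (2*q) \<Phi>'" "nrm (2*q) \<Psi>"]
    by (simp add: A_def)
  have e3: "nrm q (\<lambda>\<omega>. \<Psi>' \<omega> * \<Phi> \<omega> - g' (ev \<omega>) * f (ev \<omega>)) \<le> \<epsilon> / 4"
    using nrm_prod_diff[OF q(1) mom(4,1) g(5) f(4), of \<delta>] f g \<delta> le[of "nrm (2*q) \<Psi>'" "nrm (2*q) \<Phi>"]
    by (simp add: A_def)
  have "nrm q (\<lambda>\<omega>. (\<Phi>' \<omega> * \<Psi> \<omega> + \<Psi>' \<omega> * \<Phi> \<omega>) - (f' (ev \<omega>) * g (ev \<omega>) + g' (ev \<omega>) * f (ev \<omega>))) =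
     nrm q (\<lambda>\<omega>. (\<Phi>' \<omega> * \<Psi> \<omega> - f' (ev \<omega>) * g (ev \<omega>)) + (\<Psi>' \<omega> * \<Phi> \<omega> - g' (ev \<omega>) * f (ev \<omega>)))"
    by (simp add: algebra_simps)
  also have "\<dots> \<le> nrm q (\<lambda>\<omega>. \<Phi>' \<omega> * \<Psi> \<omega> - f' (ev \<omega>) * g (ev \<omega>)) + nrm q (\<lambda>\<omega>. \<Psi>' \<omega> * \<Phi> \<omega> - g' (ev \<omega>) * f (ev \<omega>))"
    using q mom f g by (intro nrm_add all_moments_diff all_moments_mult) auto
  also have "\<dots> < \<epsilon>" using e2 e3 q by linarith
  finally show "\<exists>h h'. cyld X h h' \<and> nrm q (\<lambda>\<omega>. \<Phi> \<omega> * \<Psi> \<omega> - h (ev \<omega>)) < \<epsilon> \<and>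
      nrm q (\<lambda>\<omega>. \<Phi>' \<omega> * \<Psi> \<omega> + \<Psi>' \<omega> * \<Phi> \<omega> - h' (ev \<omega>)) < \<epsilon>"
    using cyld_mult[OF f(1) g(1)] e1 q by (intro exI conjI) (assumption, simp_all)
qed

lemma mder_cmult: "mder X \<Phi> \<Phi>' \<Longrightarrow> mder X (\<lambda>\<omega>. c * \<Phi> \<omega>) (\<lambda>\<omega>. c * \<Phi>' \<omega>)"
  using mder_mult[OF mder_const[of X c], of \<Phi> \<Phi>'] by (simp add: mult.commute)

lemma mder_sum:
  "(\<And>i. i \<in> I \<Longrightarrow> mder X (f i) (f' i)) \<Longrightarrow> mder X (\<lambda>\<omega>. \<Sum>i\<in>I. f i \<omega>) (\<lambda>\<omega>. \<Sum>i\<in>I. f' i \<omega>)"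
  by (induction I rule: infinite_finite_induct) (auto intro: mder_const mder_add)

lemma mder_power:
  "mder X \<Phi> \<Phi>' \<Longrightarrow> mder X (\<lambda>\<omega>. \<Phi> \<omega> ^ n) (\<lambda>\<omega>. of_nat n * \<Phi> \<omega> ^ (n - 1) * \<Phi>' \<omega>)"
proof (induction n)
  case 0
  then show ?case using mder_const[of X 1] by simp
next
  case (Suc n)
  have "mder X (\<lambda>\<omega>. \<Phi> \<omega> * \<Phi> \<omega> ^ n) (\<lambda>\<omega>. \<Phi>' \<omega> * \<Phi> \<omega> ^ n + (of_nat n * \<Phi> \<omega> ^ (n - 1) * \<Phi>' \<omega>) * \<Phi> \<omega>)"
    by (rule mder_mult[OF Suc.prems Suc.IH[OF Suc.prems]])
  moreover have "\<Phi>' \<omega> * \<Phi> \<omega> ^ n + (of_nat n * \<Phi> \<omega> ^ (n - 1) * \<Phi>' \<omega>) * \<Phi> \<omega> =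
      of_nat (Suc n) * \<Phi> \<omega> ^ (Suc n - 1) * \<Phi>' \<omega>" for \<omega>
    by (cases n) (auto simp: algebra_simps)
  ultimately show ?case by simp
qed

text \<open>Both integrals are continuous in the approximation: with \<delta>-approximants in
  \<open>L^2\<close>, the left side moves by at most \<delta> times the norm of X and the right side
  by at most \<delta>.\<close>

lemma mder_ibp:
  assumes X: "X \<in> \<G>" and d: "mder X \<Phi> \<Phi>'"
  shows "(\<integral>\<omega>. X \<omega> * \<Phi> \<omega> \<partial>M) = (\<integral>\<omega>. \<Phi>' \<omega> \<partial>M)"
proof -
  note mom = mderD[OF d] and mX = G_moments(1)[OF X]
  have "\<bar>(\<integral>\<omega>. X \<omega> * \<Phi> \<omega> \<partial>M) - (\<integral>\<omega>. \<Phi>' \<omega> \<partial>M)\<bar> \<le> \<epsilon>" if "0 < \<epsilon>" for \<epsilon>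
  proof -
    define \<delta> where "\<delta> = \<epsilon> / (nrm 2 X + 1)"
    have pos: "0 < nrm 2 X + 1" using nrm_nonneg[of 2 X] by linarith
    have \<delta>: "0 < \<delta>" "\<delta> * (nrm 2 X + 1) = \<epsilon>" using that pos by (auto simp: \<delta>_def)
    obtain f f' where f: "cyld X f f'" "nrm 2 (\<lambda>\<omega>. \<Phi> \<omega> - f (ev \<omega>)) < \<delta>"
      "nrm 2 (\<lambda>\<omega>. \<Phi>' \<omega> - f' (ev \<omega>)) < \<delta>"
      "(\<lambda>\<omega>. f (ev \<omega>)) \<in> all_moments" "(\<lambda>\<omega>. f' (ev \<omega>)) \<in> all_moments"
      by (rule mderE[OF d _ \<delta>(1), of 2]) simp
    have 1: "\<bar>\<integral>\<omega>. X \<omega> * (\<Phi> \<omega> - f (ev \<omega>)) \<partial>M\<bar> \<le> nrm 2 X * \<delta>"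
    proof -
      have "\<bar>\<integral>\<omega>. X \<omega> * (\<Phi> \<omega> - f (ev \<omega>)) \<partial>M\<bar> \<le> nrm 1 (\<lambda>\<omega>. X \<omega> * (\<Phi> \<omega> - f (ev \<omega>)))"
        using mom mX f by (intro abs_expectation_le_nrm all_moments_mult all_moments_diff) auto
      also have "\<dots> \<le> nrm 2 X * nrm 2 (\<lambda>\<omega>. \<Phi> \<omega> - f (ev \<omega>))"
        using nrm_mult[OF _ mX all_moments_diff[OF mom(1) f(4)], of 1] by simp
      also have "\<dots> \<le> nrm 2 X * \<delta>" using f by (intro mult_left_mono) auto
      finally show ?thesis .
    qed
    have 2: "\<bar>\<integral>\<omega>. \<Phi>' \<omega> - f' (ev \<omega>) \<partial>M\<bar> \<le> \<delta>"
      using abs_expectation_le_nrm[OF _ all_moments_diff[OF mom(2) f(5)], of 2] f(3) by simp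
    have int: "integrable M (\<lambda>\<omega>. X \<omega> * \<Phi> \<omega>)" "integrable M (\<lambda>\<omega>. X \<omega> * f (ev \<omega>))" "integrable M \<Phi>'" "integrable M (\<lambda>\<omega>. f' (ev \<omega>))"
      using mom mX f by (auto intro!: all_moments_integrable all_moments_mult)
    have "(\<integral>\<omega>. X \<omega> * (\<Phi> \<omega> - f (ev \<omega>)) \<partial>M) = (\<integral>\<omega>. X \<omega> * \<Phi> \<omega> \<partial>M) - (\<integral>\<omega>. X \<omega> * f (ev \<omega>) \<partial>M)"
      using int by (simp add: right_diff_distrib)
    moreover have "(\<integral>\<omega>. \<Phi>' \<omega> - f' (ev \<omega>) \<partial>M) = (\<integral>\<omega>. \<Phi>' \<omega> \<partial>M) - (\<integral>\<omega>. f' (ev \<omega>) \<partial>M)"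
      using int by simp
    ultimately show ?thesis using 1 2 cyld_ibp[OF X f(1)] \<delta> by (simp add: algebra_simps)
  qed
  then have "\<bar>(\<integral>\<omega>. X \<omega> * \<Phi> \<omega> \<partial>M) - (\<integral>\<omega>. \<Phi>' \<omega> \<partial>M)\<bar> \<le> 0"
    by (rule field_le_epsilon) simp
  then show ?thesis by simp
qed

lemma nrm_cong_AE:
  assumes "AE \<omega> in M. f \<omega> = g \<omega>" "f \<in> borel_measurable M" "g \<in> borel_measurable M"
  shows "nrm q f = nrm q g"
proof -
  note [measurable] = assms(2,3)
  have "(\<integral>\<omega>. \<bar>f \<omega>\<bar> ^ q \<partial>M) = (\<integral>\<omega>. \<bar>g \<omega>\<bar> ^ q \<partial>M)"
    using assms(1) by (intro integral_cong_AE) auto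
  then show ?thesis by (simp add: nrm_def)
qed

end

section \<open>Square integrable functions and closed spans\<close>

text \<open>A real-valued working form of \<open>Lp_space N 2\<close>, with which it is identified
  in \<open>Lp_space_2\<close>. The measure is arbitrary because the same facts serve M and its
  finite powers.\<close>

definition L2 :: "'a measure \<Rightarrow> ('a \<Rightarrow> real) set" where
  "L2 N = {f \<in> borel_measurable N. integrable N (\<lambda>x. (f x)\<^sup>2)}"

definition n2 :: "'a measure \<Rightarrow> ('a \<Rightarrow> real) \<Rightarrow> real" where
  "n2 N f = sqrt (\<integral>x. (f x)\<^sup>2 \<partial>N)"

lemma L2D: "f \<in> L2 N \<Longrightarrow> f \<in> borel_measurable N" "f \<in> L2 N \<Longrightarrow> integrable N (\<lambda>x. (f x)\<^sup>2)"
  by (auto simp: L2_def)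

lemma n2_nonneg [simp]: "0 \<le> n2 N f"
  by (simp add: n2_def)

lemma n2_sq: "(n2 N f)\<^sup>2 = (\<integral>x. (f x)\<^sup>2 \<partial>N)"
  by (simp add: n2_def)

lemma L2_prod_integrable:
  assumes "f \<in> L2 N" "g \<in> L2 N"
  shows "integrable N (\<lambda>x. f x * g x)"
proof (rule Bochner_Integration.integrable_bound)
  note [measurable] = L2D(1)[OF assms(1)] L2D(1)[OF assms(2)]
  show "integrable N (\<lambda>x. (f x)\<^sup>2 + (g x)\<^sup>2)"
    using assms by (auto intro: L2D)
  show "(\<lambda>x. f x * g x) \<in> borel_measurable N" by measurable
  show "AE x in N. norm (f x * g x) \<le> norm ((f x)\<^sup>2 + (g x)\<^sup>2)"
  proof (rule AE_I2)
    fix x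
    have "2 * (\<bar>f x\<bar> * \<bar>g x\<bar>) \<le> (f x)\<^sup>2 + (g x)\<^sup>2"
      using sum_squares_bound[of "\<bar>f x\<bar>" "\<bar>g x\<bar>"] by (simp add: mult.assoc)
    moreover have "0 \<le> \<bar>f x\<bar> * \<bar>g x\<bar>" by simp
    ultimately have "\<bar>f x\<bar> * \<bar>g x\<bar> \<le> (f x)\<^sup>2 + (g x)\<^sup>2" by linarith
    then show "norm (f x * g x) \<le> norm ((f x)\<^sup>2 + (g x)\<^sup>2)" by (simp add: abs_mult)
  qed
qed

lemma L2_Cauchy_Schwarz:
  assumes "f \<in> L2 N" "g \<in> L2 N"
  shows "\<bar>\<integral>x. f x * g x \<partial>N\<bar> \<le> n2 N f * n2 N g"
proof -
  note [measurable] = L2D(1)[OF assms(1)] L2D(1)[OF assms(2)]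
  define A B I where "A = (\<integral>x. (f x)\<^sup>2 \<partial>N)" and "B = (\<integral>x. (g x)\<^sup>2 \<partial>N)" and "I = (\<integral>x. f x * g x \<partial>N)"
  have q: "0 \<le> A - 2 * t * I + t\<^sup>2 * B" for t
  proof -
    have "0 \<le> (\<integral>x. (f x - t * g x)\<^sup>2 \<partial>N)" by simp
    also have "\<dots> = (\<integral>x. (f x)\<^sup>2 - 2 * t * (f x * g x) + t\<^sup>2 * (g x)\<^sup>2 \<partial>N)"
      by (intro Bochner_Integration.integral_cong refl) (simp add: power2_diff power_mult_distrib algebra_simps)
    also have "\<dots> = A - 2 * t * I + t\<^sup>2 * B"
      using L2D(2)[OF assms(1)] L2D(2)[OF assms(2)] L2_prod_integrable[OF assms]
      by (simp add: A_def B_def I_def)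
    finally show ?thesis .
  qed
  have "I\<^sup>2 \<le> A * B"
  proof (cases "B = 0")
    case True
    then have "AE x in N. g x = 0"
      using integral_nonneg_eq_0_iff_AE[OF L2D(2)[OF assms(2)]] by (simp add: B_def)
    then have "I = 0" unfolding I_def by (intro integral_eq_zero_AE) auto
    then show ?thesis using True by simp
  next
    case False
    moreover have "0 \<le> B" by (simp add: B_def)
    ultimately have B: "B > 0" by simp
    have "0 \<le> (A - 2 * (I / B) * I + (I / B)\<^sup>2 * B) * B"
      using q[of "I / B"] B by (intro mult_nonneg_nonneg) auto
    also have "\<dots> = A * B - I\<^sup>2" using B by (simp add: field_simps power2_eq_square)
    finally show ?thesis by simp
  qed
  then have "\<bar>I\<bar> \<le> sqrt (A * B)" by (metis real_sqrt_abs real_sqrt_le_mono)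
  then show ?thesis by (simp add: I_def A_def B_def n2_def real_sqrt_mult)
qed

lemma L2_lin:
  assumes "f \<in> L2 N" "g \<in> L2 N"
  shows "(\<lambda>x. a * f x + b * g x) \<in> L2 N"
  unfolding L2_def
proof safe
  note [measurable] = L2D(1)[OF assms(1)] L2D(1)[OF assms(2)]
  show "(\<lambda>x. a * f x + b * g x) \<in> borel_measurable N" by measurable
  have "integrable N (\<lambda>x. a\<^sup>2 * (f x)\<^sup>2 + 2 * a * b * (f x * g x) + b\<^sup>2 * (g x)\<^sup>2)"
    using L2D(2)[OF assms(1)] L2D(2)[OF assms(2)] L2_prod_integrable[OF assms] by simp
  then show "integrable N (\<lambda>x. (a * f x + b * g x)\<^sup>2)"
    by (simp add: power2_sum power_mult_distrib algebra_simps)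
qed

lemma L2_diff: "f \<in> L2 N \<Longrightarrow> g \<in> L2 N \<Longrightarrow> (\<lambda>x. f x - g x) \<in> L2 N"
  using L2_lin[of f N g 1 "-1"] by simp

lemma L2_zero: "(\<lambda>_. 0) \<in> L2 N"
  by (simp add: L2_def)

lemma L2_sum: "(\<And>i. i \<in> I \<Longrightarrow> f i \<in> L2 N) \<Longrightarrow> (\<lambda>x. \<Sum>i\<in>I. c i * f i x) \<in> L2 N"
proof (induction I rule: infinite_finite_induct)
  case (insert i I)
  then show ?case using L2_lin[of "f i" N "\<lambda>x. \<Sum>i\<in>I. c i * f i x" "c i" 1] by simp
qed (auto simp: L2_zero)

lemma n2_cmult: "n2 N (\<lambda>x. c * f x) = \<bar>c\<bar> * n2 N f"
  by (simp add: n2_def power_mult_distrib real_sqrt_mult)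

lemma n2_add:
  assumes "f \<in> L2 N" "g \<in> L2 N"
  shows "n2 N (\<lambda>x. f x + g x) \<le> n2 N f + n2 N g"
proof (rule power2_le_imp_le)
  have "(n2 N (\<lambda>x. f x + g x))\<^sup>2 = (\<integral>x. (f x)\<^sup>2 + 2 * (f x * g x) + (g x)\<^sup>2 \<partial>N)"
    unfolding n2_sq by (intro Bochner_Integration.integral_cong refl) (simp add: power2_sum algebra_simps)
  also have "\<dots> = (n2 N f)\<^sup>2 + 2 * (\<integral>x. f x * g x \<partial>N) + (n2 N g)\<^sup>2"
    using assms L2_prod_integrable[OF assms] by (simp add: n2_sq L2D)
  also have "\<dots> \<le> (n2 N f)\<^sup>2 + 2 * (n2 N f * n2 N g) + (n2 N g)\<^sup>2"
    using L2_Cauchy_Schwarz[OF assms] by simp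
  finally show "(n2 N (\<lambda>x. f x + g x))\<^sup>2 \<le> (n2 N f + n2 N g)\<^sup>2" by (simp add: power2_sum)
qed simp

lemma Lp_norm_nat:
  assumes "q > 0" "f \<in> borel_measurable N"
  shows "Lp_norm N (real q) f < \<top> \<longleftrightarrow> integrable N (\<lambda>x. \<bar>f x\<bar> ^ q)"
    "integrable N (\<lambda>x. \<bar>f x\<bar> ^ q) \<Longrightarrow> Lp_norm N (real q) f = ennreal (root q (\<integral>x. \<bar>f x\<bar> ^ q \<partial>N))"
proof -
  note [measurable] = assms(2)
  have p: "\<bar>f x\<bar> powr q = \<bar>f x\<bar> ^ q" for x
    using assms(1) by (cases "f x = 0") (auto simp: powr_realpow)
  have I: "(\<integral>\<^sup>+ x. ennreal (\<bar>f x\<bar> powr q) \<partial>N) = (\<integral>\<^sup>+ x. ennreal (\<bar>f x\<bar> ^ q) \<partial>N)"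
    by (simp add: p)
  have iff: "(\<integral>\<^sup>+ x. ennreal (\<bar>f x\<bar> ^ q) \<partial>N) \<noteq> \<top> \<longleftrightarrow> integrable N (\<lambda>x. \<bar>f x\<bar> ^ q)"
    by (subst integrable_iff_bounded) (auto simp: less_top)
  show "Lp_norm N (real q) f < \<top> \<longleftrightarrow> integrable N (\<lambda>x. \<bar>f x\<bar> ^ q)"
    using iff by (auto simp: Lp_norm_def Let_def I)
  assume int: "integrable N (\<lambda>x. \<bar>f x\<bar> ^ q)"
  then have "(\<integral>\<^sup>+ x. ennreal (\<bar>f x\<bar> ^ q) \<partial>N) = ennreal (\<integral>x. \<bar>f x\<bar> ^ q \<partial>N)"
    by (intro nn_integral_eq_integral) auto
  then show "Lp_norm N (real q) f = ennreal (root q (\<integral>x. \<bar>f x\<bar> ^ q \<partial>N))"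
    using assms(1) by (simp add: Lp_norm_def Let_def I root_powr_inverse)
qed

lemma Lp_space_2: "Lp_space N 2 = L2 N"
proof -
  have "f \<in> Lp_space N 2 \<longleftrightarrow> f \<in> L2 N" for f
    using Lp_norm_nat(1)[of 2 f N] by (auto simp: Lp_space_def L2_def)
  then show ?thesis by blast
qed

lemma Lp_norm_2:
  assumes "f \<in> L2 N" shows "Lp_norm N 2 f = ennreal (n2 N f)"
  using Lp_norm_nat(2)[of 2 f N] assms by (simp add: L2_def n2_def sqrt_def)

lemma lin_combsE:
  assumes "X \<in> lin_combs S"
  obtains c g and n :: nat where "X = (\<lambda>w. \<Sum>i<n. c i * g i w)" "\<And>i. i < n \<Longrightarrow> g i \<in> S"
  using assms[unfolded lin_combs_def mem_Collect_eq]
proof (elim exE conjE)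
  fix n :: nat and c g assume "X = (\<lambda>w. \<Sum>i<n. c i * g i w)" "\<forall>i<n. g i \<in> S"
  then show thesis by (intro that) auto
qed

lemma lin_combs_lin:
  assumes "X \<in> lin_combs S" "Y \<in> lin_combs S"
  shows "(\<lambda>w. a * X w + b * Y w) \<in> lin_combs S"
proof -
  obtain c g and n :: nat where X: "X = (\<lambda>w. \<Sum>i<n. c i * g i w)" "\<And>i. i < n \<Longrightarrow> g i \<in> S"
    by (rule lin_combsE[OF assms(1)]) (rule that, assumption+)
  obtain d h and m :: nat where Y: "Y = (\<lambda>w. \<Sum>i<m. d i * h i w)" "\<And>i. i < m \<Longrightarrow> h i \<in> S"
    by (rule lin_combsE[OF assms(2)]) (rule that, assumption+)
  define e where "e i = (if i < n then a * c i else b * d (i - n))" for i :: nat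
  define k where "k i = (if i < n then g i else h (i - n))" for i :: nat
  have split: "(\<Sum>i<n + l. f i) = (\<Sum>i<n. f i) + (\<Sum>i<l. f (n + i))" for f :: "nat \<Rightarrow> real" and l
    by (induction l) auto
  have "a * X w + b * Y w = (\<Sum>i<n + m. e i * k i w)" for w
  proof -
    have "(\<Sum>i<n + m. e i * k i w) = (\<Sum>i<n. e i * k i w) + (\<Sum>i<m. e (n + i) * k (n + i) w)"
      by (rule split)
    also have "\<dots> = a * X w + b * Y w"
      by (simp add: e_def k_def X Y sum_distrib_left mult.assoc)
    finally show ?thesis by simp
  qed
  moreover have "\<forall>i<n + m. k i \<in> S" using X(2) Y(2) by (auto simp: k_def)
  ultimately show ?thesis unfolding lin_combs_def by blast
qed

lemma lin_combs_base: "X \<in> S \<Longrightarrow> X \<in> lin_combs S"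
  unfolding lin_combs_def by (rule CollectI, rule exI[of _ 1], rule exI[of _ "\<lambda>_. 1"], rule exI[of _ "\<lambda>_. X"]) simp

lemma lin_combs_L2:
  assumes "S \<subseteq> L2 N" "X \<in> lin_combs S" shows "X \<in> L2 N"
  using assms unfolding lin_combs_def by (auto intro!: L2_sum)

text \<open>The original definition takes its radii in \<open>ennreal\<close>; below each positive
  one lies a positive real, so real radii and the real norm \<open>n2\<close> describe the same
  closure.\<close>

lemma closed_span_iff:
  assumes "S \<subseteq> L2 N"
  shows "X \<in> L2_closed_span N S \<longleftrightarrow>
    X \<in> L2 N \<and> (\<forall>\<epsilon>>0. \<exists>Y\<in>lin_combs S. n2 N (\<lambda>w. X w - Y w) < \<epsilon>)"
proof -
  have *: "Lp_norm N 2 (\<lambda>w. X w - Y w) = ennreal (n2 N (\<lambda>w. X w - Y w))"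
    if "X \<in> L2 N" "Y \<in> lin_combs S" for X Y
    using that lin_combs_L2[OF assms] by (intro Lp_norm_2 L2_diff) auto
  show ?thesis unfolding L2_closed_span_def Lp_space_2
  proof safe
    fix \<epsilon> :: real
    assume X: "X \<in> L2 N" and "0 < \<epsilon>" and "\<forall>\<epsilon>>0. \<exists>Y\<in>lin_combs S. Lp_norm N 2 (\<lambda>w. X w - Y w) < \<epsilon>"
    then obtain Y where Y: "Y \<in> lin_combs S" "Lp_norm N 2 (\<lambda>w. X w - Y w) < ennreal \<epsilon>"
      by (metis ennreal_less_zero_iff)
    then show "\<exists>Y\<in>lin_combs S. n2 N (\<lambda>w. X w - Y w) < \<epsilon>"
      using *[OF X Y(1)] by (auto simp: ennreal_less_iff)
  next
    fix \<epsilon> :: ennreal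
    assume X: "X \<in> L2 N" and "0 < \<epsilon>" and H: "\<forall>\<epsilon>>0. \<exists>Y\<in>lin_combs S. n2 N (\<lambda>w. X w - Y w) < \<epsilon>"
    then obtain e where e: "0 < e" "ennreal e < \<epsilon>"
      by (metis ennreal_less_zero_iff ennreal_enn2real_if dense ennreal_enn2real less_trans top.not_eq_extremum)
    then obtain Y where Y: "Y \<in> lin_combs S" "n2 N (\<lambda>w. X w - Y w) < e" using H by blast
    then have "Lp_norm N 2 (\<lambda>w. X w - Y w) < \<epsilon>"
      using *[OF X Y(1)] e by (metis ennreal_lessI less_trans)
    then show "\<exists>Y\<in>lin_combs S. Lp_norm N 2 (\<lambda>w. X w - Y w) < \<epsilon>" using Y by blast
  qed
qed

lemma closed_span_L2:
  assumes "S \<subseteq> L2 N" "X \<in> L2_closed_span N S" shows "X \<in> L2 N"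
  using assms closed_span_iff by blast

lemma lin_combs_subset_closed_span:
  assumes "S \<subseteq> L2 N" "X \<in> lin_combs S" shows "X \<in> L2_closed_span N S"
  using assms lin_combs_L2[OF assms] by (auto simp: closed_span_iff n2_def intro!: bexI[of _ X])

lemma closed_span_lin:
  assumes S: "S \<subseteq> L2 N" and X: "X \<in> L2_closed_span N S" and Y: "Y \<in> L2_closed_span N S"
  shows "(\<lambda>w. a * X w + b * Y w) \<in> L2_closed_span N S"
  unfolding closed_span_iff[OF S]
proof (intro conjI allI impI)
  note XY = closed_span_L2[OF S X] closed_span_L2[OF S Y]
  show "(\<lambda>w. a * X w + b * Y w) \<in> L2 N" using XY by (rule L2_lin)
  fix \<epsilon> :: real assume \<epsilon>: "0 < \<epsilon>"
  define \<delta> where "\<delta> = \<epsilon> / (\<bar>a\<bar> + \<bar>b\<bar> + 1)"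
  have \<delta>: "0 < \<delta>" "\<delta> * (\<bar>a\<bar> + \<bar>b\<bar> + 1) = \<epsilon>" using \<epsilon> by (auto simp: \<delta>_def)
  obtain X' where X': "X' \<in> lin_combs S" "n2 N (\<lambda>w. X w - X' w) < \<delta>"
    using X \<delta> closed_span_iff[OF S] by blast
  obtain Y' where Y': "Y' \<in> lin_combs S" "n2 N (\<lambda>w. Y w - Y' w) < \<delta>"
    using Y \<delta> closed_span_iff[OF S] by blast
  have L: "(\<lambda>w. X w - X' w) \<in> L2 N" "(\<lambda>w. Y w - Y' w) \<in> L2 N"
    using XY X' Y' lin_combs_L2[OF S] by (auto intro: L2_diff)
  have "n2 N (\<lambda>w. (a * X w + b * Y w) - (a * X' w + b * Y' w)) =
     n2 N (\<lambda>w. a * (X w - X' w) + b * (Y w - Y' w))" by (simp add: algebra_simps)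
  also have "\<dots> \<le> n2 N (\<lambda>w. a * (X w - X' w)) + n2 N (\<lambda>w. b * (Y w - Y' w))"
    using n2_add[OF L2_lin[OF L, of a 0] L2_lin[OF L, of 0 b]] by simp
  also have "\<dots> \<le> \<bar>a\<bar> * \<delta> + \<bar>b\<bar> * \<delta>"
    unfolding n2_cmult using X' Y' by (intro add_mono mult_left_mono) auto
  also have "\<dots> < \<epsilon>" using \<delta> by (simp add: algebra_simps)
  finally show "\<exists>Z\<in>lin_combs S. n2 N (\<lambda>w. (a * X w + b * Y w) - Z w) < \<epsilon>"
    by (rule bexI[OF _ lin_combs_lin[OF X'(1) Y'(1)]])
qed

text \<open>Orthogonality passes to linear combinations by linearity and to their limits by
  Cauchy-Schwarz.\<close>

lemma closed_span_orthogonal: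
  assumes S: "S \<subseteq> L2 N" and D: "D \<in> L2 N" and o: "\<And>s. s \<in> S \<Longrightarrow> (\<integral>w. D w * s w \<partial>N) = 0"
    and X: "X \<in> L2_closed_span N S"
  shows "(\<integral>w. D w * X w \<partial>N) = 0"
proof -
  have lc: "(\<integral>w. D w * Y w \<partial>N) = 0" if Yin: "Y \<in> lin_combs S" for Y
  proof -
    obtain c g and n :: nat where Y: "Y = (\<lambda>w. \<Sum>i<n. c i * g i w)" "\<And>i. i < n \<Longrightarrow> g i \<in> S"
      by (rule lin_combsE[OF Yin]) (rule that, assumption+)
    have "(\<integral>w. D w * Y w \<partial>N) = (\<integral>w. (\<Sum>i<n. c i * (D w * g i w)) \<partial>N)"
      by (intro Bochner_Integration.integral_cong refl) (simp add: Y(1) sum_distrib_left mult_ac)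
    also have "\<dots> = (\<Sum>i<n. c i * (\<integral>w. D w * g i w \<partial>N))"
      using Y(2) S D by (subst Bochner_Integration.integral_sum) (auto intro: L2_prod_integrable)
    also have "\<dots> = 0" using o Y(2) by simp
    finally show ?thesis .
  qed
  note XL = closed_span_L2[OF S X]
  have "\<bar>\<integral>w. D w * X w \<partial>N\<bar> \<le> \<epsilon>" if \<epsilon>: "0 < \<epsilon>" for \<epsilon>
  proof -
    have pos: "0 < n2 N D + 1" using n2_nonneg[of N D] by linarith
    obtain Y where Y: "Y \<in> lin_combs S" "n2 N (\<lambda>w. X w - Y w) < \<epsilon> / (n2 N D + 1)"
      using X \<epsilon> pos closed_span_iff[OF S] by (metis divide_pos_pos)
    note YL = lin_combs_L2[OF S Y(1)]
    have "(\<integral>w. D w * X w \<partial>N) = (\<integral>w. D w * X w \<partial>N) - (\<integral>w. D w * Y w \<partial>N)" using lc[OF Y(1)] by simp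
    also have "\<dots> = (\<integral>w. D w * (X w - Y w) \<partial>N)"
      using L2_prod_integrable[OF D XL] L2_prod_integrable[OF D YL] by (simp add: right_diff_distrib)
    finally have "\<bar>\<integral>w. D w * X w \<partial>N\<bar> \<le> n2 N D * n2 N (\<lambda>w. X w - Y w)"
      using L2_Cauchy_Schwarz[OF D L2_diff[OF XL YL]] by simp
    also have "\<dots> \<le> n2 N D * (\<epsilon> / (n2 N D + 1))"
      using Y by (intro mult_left_mono) auto
    also have "\<dots> \<le> \<epsilon>" using pos \<epsilon> by (simp add: field_simps)
    finally show ?thesis .
  qed
  then have "\<bar>\<integral>w. D w * X w \<partial>N\<bar> \<le> 0" by (rule field_le_epsilon) simp
  then show ?thesis by simp
qed

section \<open>The first chaos of fractional Brownian motion\<close>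

locale fbm = prob_space M for M :: "'w measure" +
  fixes H :: real and B :: "'d::finite \<Rightarrow> real \<Rightarrow> 'w \<Rightarrow> real"
  assumes fbm: "is_fbm M H B" and H_pos: "0 < H" and H_half: "H \<le> 1 / 2"
begin

abbreviation "BS \<equiv> {B \<alpha> t | \<alpha> t. t \<in> {0..1}}"
abbreviation "\<C> \<equiv> first_chaos M B"

lemma L2_n2_small:
  assumes "X \<in> L2 M" shows "\<bar>\<integral>\<omega>. X \<omega> \<partial>M\<bar> \<le> n2 M X" "integrable M X" "(\<integral>\<omega>. \<bar>X \<omega>\<bar> \<partial>M) \<le> n2 M X"
proof -
  have 1: "(\<lambda>_. 1::real) \<in> L2 M" by (simp add: L2_def)
  show "\<bar>\<integral>\<omega>. X \<omega> \<partial>M\<bar> \<le> n2 M X" using L2_Cauchy_Schwarz[OF assms 1] by (simp add: n2_def prob_space)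
  show "integrable M X" using L2_prod_integrable[OF assms 1] by simp
  have a: "(\<lambda>\<omega>. \<bar>X \<omega>\<bar>) \<in> L2 M" using assms by (auto simp: L2_def)
  show "(\<integral>\<omega>. \<bar>X \<omega>\<bar> \<partial>M) \<le> n2 M X" using L2_Cauchy_Schwarz[OF a 1] by (simp add: n2_def prob_space)
qed

lemma centered_gaussian_char:
  assumes "centered_gaussian M X"
  shows "X \<in> L2 M" "(\<integral>\<omega>. X \<omega> \<partial>M) = 0"
    "(CLINT \<omega>|M. iexp (X \<omega>)) = of_real (exp (- (\<integral>\<omega>. (X \<omega>)\<^sup>2 \<partial>M) / 2))"
proof -
  have [measurable]: "X \<in> borel_measurable M" using assms by (simp add: centered_gaussian_def)
  consider "AE \<omega> in M. X \<omega> = 0" | \<sigma> where "\<sigma> > 0" "distributed M lborel X (normal_density 0 \<sigma>)"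
    using assms by (auto simp: centered_gaussian_def)
  then have "X \<in> L2 M \<and> (\<integral>\<omega>. X \<omega> \<partial>M) = 0 \<and>
    (CLINT \<omega>|M. iexp (X \<omega>)) = of_real (exp (- (\<integral>\<omega>. (X \<omega>)\<^sup>2 \<partial>M) / 2))"
  proof cases
    case 1
    have "integrable M (\<lambda>\<omega>. (X \<omega>)\<^sup>2) \<longleftrightarrow> integrable M (\<lambda>_. 0::real)"
      using 1 by (intro integrable_cong_AE) auto
    moreover have "(\<integral>\<omega>. (X \<omega>)\<^sup>2 \<partial>M) = 0" "(\<integral>\<omega>. X \<omega> \<partial>M) = 0"
      using 1 by (auto intro!: integral_eq_zero_AE)
    moreover have "(CLINT \<omega>|M. iexp (X \<omega>)) = (CLINT \<omega>|M. 1)"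
      using 1 by (intro integral_cong_AE) auto
    ultimately show ?thesis by (simp add: L2_def prob_space)
  next
    case (2 \<sigma>)
    define Z where "Z \<omega> = X \<omega> / \<sigma>" for \<omega>
    have XZ: "X \<omega> = \<sigma> * Z \<omega>" for \<omega> using 2 by (simp add: Z_def)
    have [measurable]: "Z \<in> borel_measurable M" unfolding Z_def by measurable
    have "distributed M lborel Z std_normal_density"
      using 2 normal_standard_normal_convert[of \<sigma> X 0] by (simp add: Z_def[abs_def])
    then have Z: "distr M borel Z = std_normal_distribution"
      by (auto dest: distributed_distr_eq_density simp: distr_cong[of M M lborel borel])
    have "integrable std_normal_distribution (\<lambda>x. x\<^sup>2)"
      by (rule integrable_std_normal_distribution_moment)
    then have "integrable M (\<lambda>\<omega>. (Z \<omega>)\<^sup>2)"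
      unfolding Z[symmetric] by (subst (asm) integrable_distr_eq) auto
    then have i: "integrable M (\<lambda>\<omega>. (X \<omega>)\<^sup>2)" by (simp add: XZ power_mult_distrib)
    have "(\<integral>\<omega>. (Z \<omega>)\<^sup>2 \<partial>M) = (\<integral>x. x\<^sup>2 \<partial>std_normal_distribution)"
      unfolding Z[symmetric] by (subst integral_distr) auto
    also have "\<dots> = 1" using std_normal_distribution_even_moments[of 1] by simp
    finally have v: "(\<integral>\<omega>. (X \<omega>)\<^sup>2 \<partial>M) = \<sigma>\<^sup>2" by (simp add: XZ power_mult_distrib)
    have "(CLINT \<omega>|M. iexp (X \<omega>)) = char (distr M borel Z) \<sigma>"
      unfolding char_def by (subst integral_distr) (auto simp: XZ)
    also have "\<dots> = of_real (exp (- (\<sigma>\<^sup>2) / 2))" by (simp only: Z char_std_normal_distribution)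
    finally show ?thesis
      using i v normal_distributed_expectation[OF 2] by (simp add: L2_def)
  qed
  then show "X \<in> L2 M" "(\<integral>\<omega>. X \<omega> \<partial>M) = 0"
    "(CLINT \<omega>|M. iexp (X \<omega>)) = of_real (exp (- (\<integral>\<omega>. (X \<omega>)\<^sup>2 \<partial>M) / 2))" by auto
qed

lemma B_gaussian:
  assumes "X \<in> lin_combs {B \<alpha> t | t. t \<in> {0..1}}" shows "centered_gaussian M X"
  using assms fbm by (auto simp: is_fbm_def)

lemma B_L2: "t \<in> {0..1} \<Longrightarrow> B \<alpha> t \<in> L2 M"
  by (rule centered_gaussian_char(1)[OF B_gaussian[OF lin_combs_base]]) auto

lemma BS_L2: "BS \<subseteq> L2 M"
  using B_L2 by blast

text \<open>\<open>is_fbm\<close> provides Gaussian linear combinations only within one coordinate.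
  A general combination is grouped by coordinate; the groups are functions of independent paths, so
  their characteristic functions multiply and, the cross terms being 0, their variances add.\<close>

lemma lin_combs_BS_char:
  assumes X: "X \<in> lin_combs BS"
  shows "(CLINT \<omega>|M. iexp (X \<omega>)) = of_real (exp (- (\<integral>\<omega>. (X \<omega>)\<^sup>2 \<partial>M) / 2))"
proof -
  obtain c g and n :: nat where g: "X = (\<lambda>w. \<Sum>i<n. c i * g i w)" "\<And>i. i < n \<Longrightarrow> g i \<in> BS"
    by (rule lin_combsE[OF X]) (rule that, assumption+)
  have "\<forall>i. \<exists>\<alpha> t. i < n \<longrightarrow> g i = B \<alpha> t \<and> t \<in> {0..1}" using g(2) by blast
  then obtain a u where au: "\<And>i. i < n \<Longrightarrow> g i = B (a i) (u i) \<and> u i \<in> {0..1}" by metis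
  \<comment> \<open>Coefficients of other coordinates are set to 0 instead of being dropped, so all
    groups use the same index set and the same times.\<close>
  define Y where "Y \<alpha> \<omega> = (\<Sum>i<n. (if a i = \<alpha> then c i else 0) * B \<alpha> (u i) \<omega>)" for \<alpha> \<omega>
  have XY: "X \<omega> = (\<Sum>\<alpha>\<in>UNIV. Y \<alpha> \<omega>)" for \<omega>
  proof -
    have "(\<Sum>\<alpha>\<in>UNIV. Y \<alpha> \<omega>) = (\<Sum>i<n. \<Sum>\<alpha>\<in>UNIV. (if a i = \<alpha> then c i else 0) * B \<alpha> (u i) \<omega>)"
      unfolding Y_def by (rule sum.swap)
    also have "\<dots> = (\<Sum>i<n. \<Sum>\<alpha>\<in>UNIV. if a i = \<alpha> then c i * B \<alpha> (u i) \<omega> else 0)"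
      by (intro sum.cong refl) auto
    also have "\<dots> = X \<omega>" unfolding g(1) using au by (intro sum.cong refl) auto
    finally show ?thesis by simp
  qed
  have Yl: "Y \<alpha> \<in> lin_combs {B \<alpha> t | t. t \<in> {0..1}}" for \<alpha>
    unfolding lin_combs_def using au
    by (auto intro!: exI[of _ n] exI[of _ "\<lambda>i. if a i = \<alpha> then c i else 0"] exI[of _ "\<lambda>i. B \<alpha> (u i)"] simp: Y_def[abs_def])
  note Yc = centered_gaussian_char[OF B_gaussian[OF Yl]]
  have indep: "indep_vars (\<lambda>_. borel) Y UNIV"
  proof -
    have "indep_vars (\<lambda>_. borel) (\<lambda>\<alpha> \<omega>. (\<lambda>p. \<Sum>i<n. (if a i = \<alpha> then c i else 0) * p (u i)) (\<lambda>t\<in>{0..1}. B \<alpha> t \<omega>)) UNIV"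
    proof (rule indep_vars_compose2[where M'="\<lambda>_. PiM {0..1} (\<lambda>_. borel)" and X="\<lambda>\<alpha> \<omega>. \<lambda>t\<in>{0..1}. B \<alpha> t \<omega>"
        and Y="\<lambda>\<alpha> p. \<Sum>i<n. (if a i = \<alpha> then c i else 0) * p (u i)"])
      show "indep_vars (\<lambda>_. PiM {0..1} (\<lambda>_. borel)) (\<lambda>\<alpha> \<omega>. \<lambda>t\<in>{0..1}. B \<alpha> t \<omega>) UNIV"
        using fbm by (simp add: is_fbm_def)
      show "(\<lambda>p. \<Sum>i<n. (if a i = \<alpha> then c i else 0) * p (u i)) \<in> borel_measurable (PiM {0..1} (\<lambda>_. borel :: real measure))" for \<alpha>
        using au by (intro borel_measurable_sum borel_measurable_times measurable_const measurable_component_singleton) auto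
    qed
    also have "(\<lambda>\<alpha> \<omega>. (\<lambda>p. \<Sum>i<n. (if a i = \<alpha> then c i else 0) * p (u i)) (\<lambda>t\<in>{0..1}. B \<alpha> t \<omega>)) = Y"
      using au by (auto simp: Y_def fun_eq_iff intro!: sum.cong)
    finally show ?thesis .
  qed
  have orth: "(\<integral>\<omega>. Y \<alpha> \<omega> * Y \<beta> \<omega> \<partial>M) = 0" if "\<alpha> \<noteq> \<beta>" for \<alpha> \<beta>
  proof -
    have "indep_vars (\<lambda>_. borel) Y {\<alpha>, \<beta>}" by (rule indep_vars_subset[OF indep]) auto
    then have "(\<integral>\<omega>. (\<Prod>\<gamma>\<in>{\<alpha>, \<beta>}. Y \<gamma> \<omega>) \<partial>M) = (\<Prod>\<gamma>\<in>{\<alpha>, \<beta>}. \<integral>\<omega>. Y \<gamma> \<omega> \<partial>M)"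
      using L2_n2_small(2)[OF Yc(1)] by (intro indep_vars_lebesgue_integral) auto
    then show ?thesis using that Yc(2) by simp
  qed
  have "(\<integral>\<omega>. (X \<omega>)\<^sup>2 \<partial>M) = (\<integral>\<omega>. (\<Sum>\<alpha>\<in>UNIV. \<Sum>\<beta>\<in>UNIV. Y \<alpha> \<omega> * Y \<beta> \<omega>) \<partial>M)"
    unfolding XY by (simp add: power2_eq_square sum_product)
  also have "\<dots> = (\<Sum>\<alpha>\<in>UNIV. \<Sum>\<beta>\<in>UNIV. \<integral>\<omega>. Y \<alpha> \<omega> * Y \<beta> \<omega> \<partial>M)"
    using L2_prod_integrable[OF Yc(1) Yc(1)] by (simp add: Bochner_Integration.integral_sum)
  also have "\<dots> = (\<Sum>\<alpha>\<in>UNIV. \<Sum>\<beta>\<in>UNIV. if \<alpha> = \<beta> then (\<integral>\<omega>. (Y \<alpha> \<omega>)\<^sup>2 \<partial>M) else 0)"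
    using orth by (intro sum.cong refl) (auto simp: power2_eq_square)
  also have "\<dots> = (\<Sum>\<alpha>\<in>UNIV. \<integral>\<omega>. (Y \<alpha> \<omega>)\<^sup>2 \<partial>M)" by simp
  finally have var: "(\<integral>\<omega>. (X \<omega>)\<^sup>2 \<partial>M) = (\<Sum>\<alpha>\<in>UNIV. \<integral>\<omega>. (Y \<alpha> \<omega>)\<^sup>2 \<partial>M)" .
  have Ym: "Y \<alpha> \<in> borel_measurable M" for \<alpha> by (rule L2D(1)[OF Yc(1)])
  have Xm: "(\<lambda>\<omega>. \<Sum>\<alpha>\<in>UNIV. Y \<alpha> \<omega>) \<in> borel_measurable M" using Ym by measurable
  have "(CLINT \<omega>|M. iexp (X \<omega>)) = char (distr M borel (\<lambda>\<omega>. \<Sum>\<alpha>\<in>UNIV. Y \<alpha> \<omega>)) 1"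
    unfolding char_def using Xm by (subst integral_distr) (auto simp: XY)
  also have "\<dots> = (\<Prod>\<alpha>\<in>UNIV. char (distr M borel (Y \<alpha>)) 1)" by (rule char_distr_sum[OF indep])
  also have "\<dots> = (\<Prod>\<alpha>\<in>UNIV. of_real (exp (- (\<integral>\<omega>. (Y \<alpha> \<omega>)\<^sup>2 \<partial>M) / 2)))"
  proof (rule prod.cong[OF refl])
    fix \<alpha>
    have "char (distr M borel (Y \<alpha>)) 1 = (CLINT \<omega>|M. iexp (Y \<alpha> \<omega>))"
      unfolding char_def using Ym[of \<alpha>] by (subst integral_distr) auto
    then show "char (distr M borel (Y \<alpha>)) 1 = of_real (exp (- (\<integral>\<omega>. (Y \<alpha> \<omega>)\<^sup>2 \<partial>M) / 2))"
      using Yc(3) by simp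
  qed
  also have "\<dots> = of_real (exp (\<Sum>\<alpha>\<in>UNIV. - (\<integral>\<omega>. (Y \<alpha> \<omega>)\<^sup>2 \<partial>M) / 2))"
    by (simp add: exp_sum)
  also have "(\<Sum>\<alpha>\<in>UNIV. - (\<integral>\<omega>. (Y \<alpha> \<omega>)\<^sup>2 \<partial>M) / 2) = - (\<integral>\<omega>. (X \<omega>)\<^sup>2 \<partial>M) / 2"
    by (simp add: var sum_negf sum_divide_distrib[symmetric])
  finally show ?thesis .
qed

lemma abs_exp_neg_diff:
  fixes a b :: real assumes "0 \<le> a" "0 \<le> b"
  shows "\<bar>exp (- a / 2) - exp (- b / 2)\<bar> \<le> \<bar>a - b\<bar>"
proof -
  have *: "exp (- x / 2) - exp (- y / 2) \<le> y - x" if "0 \<le> x" "x \<le> y" for x y :: real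
  proof -
    have "1 + (x - y) / 2 \<le> exp ((x - y) / 2)" by (rule exp_ge_add_one_self)
    then have "1 - exp ((x - y) / 2) \<le> (y - x) / 2" by (simp add: field_simps)
    moreover have "exp (- x / 2) - exp (- y / 2) = exp (- x / 2) * (1 - exp ((x - y) / 2))"
      by (simp add: right_diff_distrib exp_add[symmetric] field_simps)
    moreover have "exp (- x / 2) * (1 - exp ((x - y) / 2)) \<le> 1 * (1 - exp ((x - y) / 2))"
      using that by (intro mult_right_mono) auto
    ultimately have "exp (- x / 2) - exp (- y / 2) \<le> (y - x) / 2" by simp
    then show ?thesis using that by simp
  qed
  show ?thesis
  proof (cases "a \<le> b")
    case True
    then have "exp (- b / 2) \<le> exp (- a / 2)" by simp
    then show ?thesis using *[OF assms(1) True] True by linarith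
  next
    case False
    then have "exp (- a / 2) \<le> exp (- b / 2)" by simp
    then show ?thesis using *[of b a] False assms by linarith
  qed
qed

text \<open>Both sides are continuous in \<open>L^2\<close>: the exponential is 1-Lipschitz, and the
  variances of X and Y differ by the integral of (X - Y)(X + Y), which Cauchy-Schwarz controls. The
  identity therefore passes from linear combinations to the closed span.\<close>

lemma chaos_char:
  assumes X: "X \<in> \<C>"
  shows "(CLINT \<omega>|M. iexp (X \<omega>)) = of_real (exp (- (\<integral>\<omega>. (X \<omega>)\<^sup>2 \<partial>M) / 2))"
proof -
  have XL: "X \<in> L2 M" using closed_span_L2[OF BS_L2] X unfolding first_chaos_def by blast
  note [measurable] = L2D(1)[OF XL]
  let ?e = "\<lambda>X. complex_of_real (exp (- (\<integral>\<omega>. (X \<omega>)\<^sup>2 \<partial>M) / 2))"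
  have "cmod ((CLINT \<omega>|M. iexp (X \<omega>)) - ?e X) \<le> \<epsilon>" if \<epsilon>: "0 < \<epsilon>" for \<epsilon>
  proof -
    define \<delta> where "\<delta> = min 1 (\<epsilon> / (2 * n2 M X + 2))"
    have pos: "0 < 2 * n2 M X + 2" using n2_nonneg[of M X] by linarith
    have \<delta>: "0 < \<delta>" "\<delta> \<le> 1" "\<delta> * (2 * n2 M X + 2) \<le> \<epsilon>"
      using \<epsilon> pos mult_right_mono[of \<delta> "\<epsilon> / (2 * n2 M X + 2)" "2 * n2 M X + 2"] by (auto simp: \<delta>_def)
    obtain Y where Y: "Y \<in> lin_combs BS" "n2 M (\<lambda>w. X w - Y w) < \<delta>"
      using X \<delta>(1) closed_span_iff[OF BS_L2] unfolding first_chaos_def by blast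
    have YL: "Y \<in> L2 M" by (rule lin_combs_L2[OF BS_L2 Y(1)])
    note [measurable] = L2D(1)[OF YL]
    have DL: "(\<lambda>w. X w - Y w) \<in> L2 M" by (rule L2_diff[OF XL YL])
    have i: "complex_integrable M (\<lambda>\<omega>. iexp (X \<omega>))" "complex_integrable M (\<lambda>\<omega>. iexp (Y \<omega>))"
      using integrable_iexp[of X] integrable_iexp[of Y] by auto
    have lip: "cmod (iexp x - iexp y) \<le> \<bar>x - y\<bar>" for x y
    proof -
      have "iexp x - iexp y = iexp y * (iexp (x - y) - 1)"
        by (simp add: right_diff_distrib exp_add[symmetric])
      then have "cmod (iexp x - iexp y) = cmod (iexp (x - y) - 1)" by (simp add: norm_mult)
      also have "\<dots> \<le> \<bar>x - y\<bar>" using iexp_approx1[of "x - y" 0] by simp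
      finally show ?thesis .
    qed
    have "cmod ((CLINT \<omega>|M. iexp (X \<omega>)) - (CLINT \<omega>|M. iexp (Y \<omega>))) = cmod (CLINT \<omega>|M. iexp (X \<omega>) - iexp (Y \<omega>))"
      using i by simp
    also have "\<dots> \<le> (\<integral>\<omega>. cmod (iexp (X \<omega>) - iexp (Y \<omega>)) \<partial>M)" by (rule integral_norm_bound)
    also have "\<dots> \<le> (\<integral>\<omega>. \<bar>X \<omega> - Y \<omega>\<bar> \<partial>M)"
      using i L2_n2_small(2)[OF DL] lip by (intro integral_mono) auto
    also have "\<dots> \<le> \<delta>" using L2_n2_small(3)[OF DL] Y(2) by simp
    finally have 1: "cmod ((CLINT \<omega>|M. iexp (X \<omega>)) - (CLINT \<omega>|M. iexp (Y \<omega>))) \<le> \<delta>" .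
    have "(\<integral>\<omega>. (X \<omega>)\<^sup>2 \<partial>M) - (\<integral>\<omega>. (Y \<omega>)\<^sup>2 \<partial>M) = (\<integral>\<omega>. (X \<omega> - Y \<omega>) * (X \<omega> + Y \<omega>) \<partial>M)"
    proof -
      have "(\<integral>\<omega>. (X \<omega> - Y \<omega>) * (X \<omega> + Y \<omega>) \<partial>M) = (\<integral>\<omega>. (X \<omega>)\<^sup>2 - (Y \<omega>)\<^sup>2 \<partial>M)"
        by (intro Bochner_Integration.integral_cong refl) (simp add: power2_eq_square algebra_simps)
      then show ?thesis using L2D(2)[OF XL] L2D(2)[OF YL] by simp
    qed
    moreover have SL: "(\<lambda>w. X w + Y w) \<in> L2 M" using L2_lin[OF XL YL, of 1 1] by simp
    ultimately have "\<bar>(\<integral>\<omega>. (X \<omega>)\<^sup>2 \<partial>M) - (\<integral>\<omega>. (Y \<omega>)\<^sup>2 \<partial>M)\<bar> \<le> n2 M (\<lambda>w. X w - Y w) * n2 M (\<lambda>w. X w + Y w)"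
      using L2_Cauchy_Schwarz[OF DL SL] by simp
    also have "n2 M (\<lambda>w. X w + Y w) \<le> 2 * n2 M X + 1"
    proof -
      have "n2 M (\<lambda>w. 2 * X w + -1 * (X w - Y w)) \<le> n2 M (\<lambda>w. 2 * X w) + n2 M (\<lambda>w. -1 * (X w - Y w))"
        using n2_add[OF L2_lin[OF XL XL, of 2 0] L2_lin[OF DL DL, of "-1" 0]] by simp
      also have "\<dots> \<le> 2 * n2 M X + 1" unfolding n2_cmult using Y(2) \<delta> by simp
      finally show ?thesis by (simp add: algebra_simps)
    qed
    finally have "\<bar>(\<integral>\<omega>. (X \<omega>)\<^sup>2 \<partial>M) - (\<integral>\<omega>. (Y \<omega>)\<^sup>2 \<partial>M)\<bar> \<le> n2 M (\<lambda>w. X w - Y w) * (2 * n2 M X + 1)"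
      by (simp add: mult_left_mono)
    also have "\<dots> \<le> \<delta> * (2 * n2 M X + 1)" using Y(2) by (intro mult_right_mono) auto
    finally have "\<bar>exp (- (\<integral>\<omega>. (X \<omega>)\<^sup>2 \<partial>M) / 2) - exp (- (\<integral>\<omega>. (Y \<omega>)\<^sup>2 \<partial>M) / 2)\<bar> \<le> \<delta> * (2 * n2 M X + 1)"
      using abs_exp_neg_diff[of "\<integral>\<omega>. (X \<omega>)\<^sup>2 \<partial>M" "\<integral>\<omega>. (Y \<omega>)\<^sup>2 \<partial>M"] by simp
    then have 2: "cmod (?e Y - ?e X) \<le> \<delta> * (2 * n2 M X + 1)"
      by (simp only: of_real_diff[symmetric] norm_of_real abs_minus_commute)
    have "(CLINT \<omega>|M. iexp (X \<omega>)) - ?e X = ((CLINT \<omega>|M. iexp (X \<omega>)) - (CLINT \<omega>|M. iexp (Y \<omega>))) + (?e Y - ?e X)"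
      using lin_combs_BS_char[OF Y(1)] by simp
    then have "cmod ((CLINT \<omega>|M. iexp (X \<omega>)) - ?e X) \<le> \<delta> + \<delta> * (2 * n2 M X + 1)"
      using norm_triangle_mono[OF 1 2] by simp
    then show ?thesis using \<delta>(3) by (simp add: algebra_simps)
  qed
  then have "cmod ((CLINT \<omega>|M. iexp (X \<omega>)) - ?e X) \<le> 0" by (rule field_le_epsilon) simp
  then show ?thesis by simp
qed

sublocale gaussian_space M \<C>
proof
  fix X Y a b
  assume X: "X \<in> \<C>"
  then have XL: "X \<in> L2 M" using closed_span_L2[OF BS_L2] unfolding first_chaos_def by blast
  show "X \<in> borel_measurable M" "integrable M (\<lambda>\<omega>. (X \<omega>)\<^sup>2)" using L2D[OF XL] by auto
  show "(CLINT \<omega>|M. iexp (X \<omega>)) = of_real (exp (- (\<integral>\<omega>. (X \<omega>)\<^sup>2 \<partial>M) / 2))"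
    by (rule chaos_char[OF X])
  show "(\<lambda>\<omega>. a * X \<omega> + b * Y \<omega>) \<in> \<C>" if "Y \<in> \<C>"
    using closed_span_lin[OF BS_L2] X that unfolding first_chaos_def by blast
qed

lemma B_chaos: "t \<in> {0..1} \<Longrightarrow> B \<alpha> t \<in> \<C>"
  unfolding first_chaos_def by (rule lin_combs_subset_closed_span[OF BS_L2 lin_combs_base]) auto

lemma chaos_L2: "X \<in> \<C> \<Longrightarrow> X \<in> L2 M"
  using closed_span_L2[OF BS_L2] unfolding first_chaos_def by blast

lemma cov_B:
  assumes "s \<in> {0..1}" "t \<in> {0..1}"
  shows "cov (B \<alpha> s) (B \<beta> t) = (if \<alpha> = \<beta> then fbm_cov H s t else 0)"
proof (cases "\<alpha> = \<beta>")
  case True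
  then show ?thesis using fbm assms by (simp add: is_fbm_def cov_def)
next
  case False
  define u where "u \<gamma> = (if \<gamma> = \<alpha> then s else t)" for \<gamma>
  have "indep_vars (\<lambda>_. borel) (\<lambda>\<gamma> \<omega>. (\<lambda>p. p (u \<gamma>)) (\<lambda>t\<in>{0..1}. B \<gamma> t \<omega>)) UNIV"
  proof (rule indep_vars_compose2[where M'="\<lambda>_. PiM {0..1} (\<lambda>_. borel)" and X="\<lambda>\<alpha> \<omega>. \<lambda>t\<in>{0..1}. B \<alpha> t \<omega>" and Y="\<lambda>\<gamma> p. p (u \<gamma>)"])
    show "indep_vars (\<lambda>_. PiM {0..1} (\<lambda>_. borel)) (\<lambda>\<alpha> \<omega>. \<lambda>t\<in>{0..1}. B \<alpha> t \<omega>) UNIV"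
      using fbm by (simp add: is_fbm_def)
    show "(\<lambda>p. p (u \<gamma>)) \<in> borel_measurable (PiM {0..1} (\<lambda>_. borel :: real measure))" for \<gamma>
      using assms by (intro measurable_component_singleton) (auto simp: u_def)
  qed
  also have "(\<lambda>\<gamma> \<omega>. (\<lambda>p. p (u \<gamma>)) (\<lambda>t\<in>{0..1}. B \<gamma> t \<omega>)) = (\<lambda>\<gamma>. B \<gamma> (u \<gamma>))"
    using assms by (auto simp: u_def fun_eq_iff)
  finally have ind: "indep_vars (\<lambda>_. borel) (\<lambda>\<gamma>. B \<gamma> (u \<gamma>)) UNIV" .
  have "indep_vars (\<lambda>_. borel) (\<lambda>\<gamma>. B \<gamma> (u \<gamma>)) {\<alpha>, \<beta>}" by (rule indep_vars_subset[OF ind]) auto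
  moreover have uI: "u \<gamma> \<in> {0..1}" for \<gamma> using assms by (auto simp: u_def)
  ultimately have "(\<integral>\<omega>. (\<Prod>\<gamma>\<in>{\<alpha>, \<beta>}. B \<gamma> (u \<gamma>) \<omega>) \<partial>M) = (\<Prod>\<gamma>\<in>{\<alpha>, \<beta>}. \<integral>\<omega>. B \<gamma> (u \<gamma>) \<omega> \<partial>M)"
    using L2_n2_small(2)[OF B_L2] by (intro indep_vars_lebesgue_integral) blast+
  moreover have "(\<integral>\<omega>. B \<gamma> (u \<gamma>) \<omega> \<partial>M) = 0" for \<gamma>
    by (rule centered_gaussian_char(2)[OF B_gaussian[OF lin_combs_base]]) (use uI in blast)
  ultimately have "(\<integral>\<omega>. B \<alpha> (u \<alpha>) \<omega> * B \<beta> (u \<beta>) \<omega> \<partial>M) = 0" using False by simp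
  then show ?thesis using False by (simp add: cov_def u_def)
qed

end

section \<open>Tensor powers of the first chaos\<close>

context fbm
begin

definition tens :: "nat \<Rightarrow> (nat \<Rightarrow> 'w \<Rightarrow> real) \<Rightarrow> (nat \<Rightarrow> 'w) \<Rightarrow> real" where
  "tens r X w = (\<Prod>i<r. X i (w i))"

abbreviation "PM r \<equiv> PiM {..<r} (\<lambda>_::nat. M)"
abbreviation "TS r \<equiv> {\<lambda>w. \<Prod>i<r. X i (w i) | X. \<forall>i<r. X i \<in> \<C>}"

lemma product_sf: "product_sigma_finite (\<lambda>_::nat. M)"
  unfolding product_sigma_finite_def using prob_space_imp_sigma_finite[OF prob_space_axioms] by blast

lemma tens_measurable:
  assumes "\<And>i. i < r \<Longrightarrow> X i \<in> borel_measurable M"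
  shows "tens r X \<in> borel_measurable (PM r)"
proof -
  have "(\<lambda>w. \<Prod>i\<in>{..<r}. X i (w i)) \<in> borel_measurable (PM r)"
    using assms by (intro borel_measurable_prod measurable_compose[OF measurable_component_singleton]) auto
  then show ?thesis by (simp add: tens_def[abs_def])
qed

lemma tens_integral:
  assumes "\<And>i. i < r \<Longrightarrow> X i \<in> L2 M" "\<And>i. i < r \<Longrightarrow> Y i \<in> L2 M"
  shows "integrable (PM r) (\<lambda>w. tens r X w * tens r Y w)"
    "(\<integral>w. tens r X w * tens r Y w \<partial>PM r) = (\<Prod>i<r. cov (X i) (Y i))"
proof -
  interpret product_sigma_finite "\<lambda>_::nat. M" by (rule product_sf)
  have e: "tens r X w * tens r Y w = (\<Prod>i<r. X i (w i) * Y i (w i))" for w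
    by (simp add: tens_def prod.distrib)
  have i: "integrable M (\<lambda>\<omega>. X i \<omega> * Y i \<omega>)" if "i < r" for i
    using assms that by (intro L2_prod_integrable) auto
  show "integrable (PM r) (\<lambda>w. tens r X w * tens r Y w)"
    unfolding e using i by (intro product_integrable_prod) auto
  show "(\<integral>w. tens r X w * tens r Y w \<partial>PM r) = (\<Prod>i<r. cov (X i) (Y i))"
    unfolding e cov_def using i by (intro product_integral_prod) auto
qed

lemma tens_L2:
  assumes "\<And>i. i < r \<Longrightarrow> X i \<in> L2 M"
  shows "tens r X \<in> L2 (PM r)" "n2 (PM r) (tens r X) = (\<Prod>i<r. n2 M (X i))"
proof -
  show "tens r X \<in> L2 (PM r)"
    using tens_integral(1)[OF assms assms] tens_measurable L2D(1)[OF assms]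
    by (simp add: L2_def power2_eq_square)
  have "(\<integral>w. (tens r X w)\<^sup>2 \<partial>PM r) = (\<Prod>i<r. \<integral>\<omega>. (X i \<omega>)\<^sup>2 \<partial>M)"
    using tens_integral(2)[OF assms assms] by (simp add: power2_eq_square cov_def)
  show "n2 (PM r) (tens r X) = (\<Prod>i<r. n2 M (X i))"
  proof -
    have "sqrt (\<Prod>i<k. f i) = (\<Prod>i<k. sqrt (f i))" for k :: nat and f
      by (induction k) (auto simp: real_sqrt_mult)
    then show ?thesis using \<open>(\<integral>w. (tens r X w)\<^sup>2 \<partial>PM r) = _\<close> by (simp add: n2_def)
  qed
qed

lemma TS_tens: "TS r = {tens r X | X. \<forall>i<r. X i \<in> \<C>}"
  by (simp add: tens_def[abs_def])

lemma TS_L2: "TS r \<subseteq> L2 (PM r)"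
  unfolding TS_tens using tens_L2(1) chaos_L2 by blast

lemma chaos_tensor_L2: "Z \<in> chaos_tensor M B r \<Longrightarrow> Z \<in> L2 (PM r)"
  unfolding chaos_tensor_def by (rule closed_span_L2[OF TS_L2])

lemma chaos_tensor_lin:
  "Z \<in> chaos_tensor M B r \<Longrightarrow> W \<in> chaos_tensor M B r \<Longrightarrow> (\<lambda>w. a * Z w + b * W w) \<in> chaos_tensor M B r"
  unfolding chaos_tensor_def by (rule closed_span_lin[OF TS_L2])

lemma chaos_tensor_tens:
  assumes "\<And>i. i < r \<Longrightarrow> X i \<in> \<C>" shows "tens r X \<in> chaos_tensor M B r"
  unfolding chaos_tensor_def
  by (rule lin_combs_subset_closed_span[OF TS_L2 lin_combs_base]) (use assms TS_tens in blast)

lemma chaos_tensor_sum: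
  assumes "finite I" "\<And>i. i \<in> I \<Longrightarrow> Z i \<in> chaos_tensor M B r" "\<C> \<noteq> {}"
  shows "(\<lambda>w. \<Sum>i\<in>I. c i * Z i w) \<in> chaos_tensor M B r"
  using assms(1,2)
proof (induction I)
  case empty
  obtain X where "X \<in> \<C>" using assms(3) by blast
  then have "tens r (\<lambda>_. X) \<in> chaos_tensor M B r" by (intro chaos_tensor_tens) auto
  from chaos_tensor_lin[OF this this, of 0 0] show ?case by simp
next
  case (insert i I)
  then have "(\<lambda>w. c i * Z i w + 1 * (\<Sum>i\<in>I. c i * Z i w)) \<in> chaos_tensor M B r"
    by (intro chaos_tensor_lin) auto
  with insert.hyps show ?case by simp
qed

lemma chaos_nonempty: "\<C> \<noteq> {}"
  using B_chaos[of 0] by auto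

lemma cm_index_B:
  assumes "x \<in> cm_index r" "i < r"
  shows "B (snd (x i)) (fst (x i)) \<in> \<C>" "fst (x i) \<in> {0..1}"
proof -
  have "x i \<in> {0..1} \<times> UNIV" using PiE_mem[OF assms(1)[unfolded cm_index_def]] assms(2) by auto
  then show "fst (x i) \<in> {0..1}" by (simp add: mem_Times_iff)
  then show "B (snd (x i)) (fst (x i)) \<in> \<C>" by (rule B_chaos)
qed

lemma cm_tensor_map_eq:
  assumes "x \<in> cm_index r"
  shows "cm_tensor_map M B r Z x = (\<integral>w. Z w * tens r (\<lambda>i. B (snd (x i)) (fst (x i))) w \<partial>PM r)"
  using assms by (simp add: cm_tensor_map_def tens_def)

lemma cm_tensor_map_tens:
  assumes "\<And>i. i < r \<Longrightarrow> X i \<in> \<C>"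
  shows "cm_tensor_map M B r (tens r X) = cm_tensor r (\<lambda>i. cm_path M B (X i))"
proof
  fix x :: "nat \<Rightarrow> real \<times> 'd"
  show "cm_tensor_map M B r (tens r X) x = cm_tensor r (\<lambda>i. cm_path M B (X i)) x"
  proof (cases "x \<in> cm_index r")
    case True
    have "cm_tensor_map M B r (tens r X) x = (\<Prod>i<r. cov (X i) (B (snd (x i)) (fst (x i))))"
      unfolding cm_tensor_map_eq[OF True]
      using assms cm_index_B(1)[OF True] chaos_L2 by (intro tens_integral(2)) auto
    then show ?thesis using True by (simp add: cm_tensor_def cm_path_def cov_def case_prod_beta)
  qed (simp add: cm_tensor_map_def cm_tensor_def)
qed

lemma cm_tensor_map_sum:
  assumes "finite I" "\<And>i. i \<in> I \<Longrightarrow> Z i \<in> L2 (PM r)"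
  shows "cm_tensor_map M B r (\<lambda>w. \<Sum>i\<in>I. c i * Z i w) x = (\<Sum>i\<in>I. c i * cm_tensor_map M B r (Z i) x)"
proof (cases "x \<in> cm_index r")
  case True
  let ?T = "tens r (\<lambda>i. B (snd (x i)) (fst (x i)))"
  have T: "?T \<in> L2 (PM r)" using cm_index_B(1)[OF True] chaos_L2 by (intro tens_L2) auto
  have "(\<integral>w. (\<Sum>i\<in>I. c i * Z i w) * ?T w \<partial>PM r) = (\<integral>w. (\<Sum>i\<in>I. c i * (Z i w * ?T w)) \<partial>PM r)"
    by (intro Bochner_Integration.integral_cong refl) (simp add: sum_distrib_right mult_ac)
  also have "\<dots> = (\<Sum>i\<in>I. c i * (\<integral>w. Z i w * ?T w \<partial>PM r))"
    using L2_prod_integrable[OF assms(2) T] by (subst Bochner_Integration.integral_sum) auto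
  finally show ?thesis by (simp add: cm_tensor_map_eq[OF True])
qed (simp add: cm_tensor_map_def)

lemma cm_tensor_map_diff:
  assumes "Z \<in> L2 (PM r)" "W \<in> L2 (PM r)"
  shows "cm_tensor_map M B r (\<lambda>w. 1 * Z w + (-1) * W w) = (\<lambda>x. cm_tensor_map M B r Z x - cm_tensor_map M B r W x)"
proof
  fix x
  show "cm_tensor_map M B r (\<lambda>w. 1 * Z w + (-1) * W w) x = cm_tensor_map M B r Z x - cm_tensor_map M B r W x"
    using cm_tensor_map_sum[of "{0, 1}" "\<lambda>i::nat. if i = 0 then Z else W" r "\<lambda>i. if i = 0 then 1 else -1" x] assms
    by simp
qed

lemma inv_map:
  assumes "f \<in> cm_tensor_space M B r"
  defines "Z \<equiv> inv_into (chaos_tensor M B r) (cm_tensor_map M B r) f"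
  shows "Z \<in> chaos_tensor M B r" "cm_tensor_map M B r Z = f"
  unfolding Z_def
proof -
  have f: "f \<in> cm_tensor_map M B r ` chaos_tensor M B r" using assms(1) by (simp add: cm_tensor_space_def)
  show "inv_into (chaos_tensor M B r) (cm_tensor_map M B r) f \<in> chaos_tensor M B r" by (rule inv_into_into[OF f])
  show "cm_tensor_map M B r (inv_into (chaos_tensor M B r) (cm_tensor_map M B r) f) = f" by (rule f_inv_into_f[OF f])
qed

lemma n2_B:
  assumes "t \<in> {0..1}" shows "n2 M (B \<alpha> t) \<le> 1"
proof -
  have "(\<integral>\<omega>. (B \<alpha> t \<omega>)\<^sup>2 \<partial>M) = fbm_cov H t t"
    using cov_B[OF assms assms, of \<alpha> \<alpha>] by (simp add: cov_def power2_eq_square)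
  also have "\<dots> = t powr (2 * H)" by (simp add: fbm_cov_def)
  also have "\<dots> \<le> 1" using assms H_pos by (intro powr_le1) auto
  finally show ?thesis by (simp add: n2_def)
qed

text \<open>Evaluating at x is pairing the preimage with the tensor of the values of
  \<open>B\<close> named by x. On the unit interval these values have variance at most 1, so the
  tensor has norm at most 1.\<close>

lemma cm_eval_le_norm:
  assumes f: "f \<in> cm_tensor_space M B r" and x: "x \<in> cm_index r"
  shows "\<bar>f x\<bar> \<le> cm_norm M B r f"
proof -
  define Z where "Z = inv_into (chaos_tensor M B r) (cm_tensor_map M B r) f"
  have Z: "Z \<in> chaos_tensor M B r" "cm_tensor_map M B r Z = f" unfolding Z_def using inv_map[OF f] by auto
  let ?T = "tens r (\<lambda>i. B (snd (x i)) (fst (x i)))"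
  have T: "?T \<in> L2 (PM r)" "n2 (PM r) ?T = (\<Prod>i<r. n2 M (B (snd (x i)) (fst (x i))))"
    using cm_index_B(1)[OF x] chaos_L2 by (auto intro!: tens_L2)
  have "n2 (PM r) ?T \<le> 1" unfolding T(2) using n2_B cm_index_B(2)[OF x] by (intro prod_le_1) auto
  have "\<bar>f x\<bar> = \<bar>\<integral>w. Z w * ?T w \<partial>PM r\<bar>" using cm_tensor_map_eq[OF x, of Z] Z(2) by simp
  also have "\<dots> \<le> n2 (PM r) Z * n2 (PM r) ?T" by (rule L2_Cauchy_Schwarz[OF chaos_tensor_L2[OF Z(1)] T(1)])
  also have "\<dots> \<le> n2 (PM r) Z * 1" using \<open>n2 (PM r) ?T \<le> 1\<close> by (intro mult_left_mono) auto
  also have "\<dots> = cm_norm M B r f" by (simp add: cm_norm_def cm_inner_def Let_def Z_def n2_def power2_eq_square)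
  finally show ?thesis .
qed

lemma cm_tensor_space_diff:
  assumes "f \<in> cm_tensor_space M B r" "g \<in> cm_tensor_space M B r"
  shows "(\<lambda>x. f x - g x) \<in> cm_tensor_space M B r"
proof -
  obtain Z W where Z: "Z \<in> chaos_tensor M B r" "f = cm_tensor_map M B r Z"
    and W: "W \<in> chaos_tensor M B r" "g = cm_tensor_map M B r W"
    using assms unfolding cm_tensor_space_def by blast
  have "(\<lambda>x. f x - g x) = cm_tensor_map M B r (\<lambda>w. 1 * Z w + (-1) * W w)"
    unfolding Z(2) W(2) by (rule cm_tensor_map_diff[OF chaos_tensor_L2[OF Z(1)] chaos_tensor_L2[OF W(1)], symmetric])
  then show ?thesis unfolding cm_tensor_space_def
    by (intro image_eqI[where x="\<lambda>w. 1 * Z w + (-1) * W w"] chaos_tensor_lin Z W)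
qed

text \<open>The preimage is written down: the same coefficients in front of tensors of the variables
  themselves instead of their paths.\<close>

lemma cylinder_deriv_space:
  assumes "\<And>i. i < n \<Longrightarrow> X i \<in> \<C>"
  shows "cylinder_deriv M B r n f X \<omega> \<in> cm_tensor_space M B r"
proof -
  let ?I = "{..<r} \<rightarrow>\<^sub>E {..<n}"
  let ?c = "\<lambda>i. iter_partial (map i [0..<r]) f (\<lambda>k. X k \<omega>)"
  have fin: "finite ?I" by (intro finite_PiE) auto
  have X: "X (i j) \<in> \<C>" if "i \<in> ?I" "j < r" for i j using that assms by (auto simp: PiE_iff)
  define Z where "Z w = (\<Sum>i\<in>?I. ?c i * tens r (\<lambda>j. X (i j)) w)" for w
  have "Z \<in> chaos_tensor M B r" unfolding Z_def
    using X by (intro chaos_tensor_sum fin chaos_tensor_tens chaos_nonempty) auto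
  moreover have "cm_tensor_map M B r Z = cylinder_deriv M B r n f X \<omega>"
  proof
    fix x
    have "cm_tensor_map M B r Z x = (\<Sum>i\<in>?I. ?c i * cm_tensor_map M B r (tens r (\<lambda>j. X (i j))) x)"
      unfolding Z_def using X by (intro cm_tensor_map_sum fin tens_L2 chaos_L2) auto
    also have "\<dots> = (\<Sum>i\<in>?I. ?c i * cm_tensor r (\<lambda>j. cm_path M B (X (i j))) x)"
      using X by (intro sum.cong refl arg_cong2[where f="(*)"]) (simp add: cm_tensor_map_tens)
    finally show "cm_tensor_map M B r Z x = cylinder_deriv M B r n f X \<omega> x"
      by (simp add: cylinder_deriv_def)
  qed
  ultimately show ?thesis unfolding cm_tensor_space_def by (metis image_eqI)
qed

text \<open>The slots are exchanged one at a time, from values of \<open>B\<close> to elements of the first chaos.\<close>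

lemma chaos_tensor_total_slots:
  assumes D: "D \<in> L2 (PM r)" and z: "\<And>x. x \<in> cm_index r \<Longrightarrow> cm_tensor_map M B r D x = 0"
    and "k \<le> r" "\<And>i. i < k \<Longrightarrow> X i \<in> \<C>" "\<And>i. k \<le> i \<Longrightarrow> i < r \<Longrightarrow> X i \<in> BS"
  shows "(\<integral>w. D w * tens r X w \<partial>PM r) = 0"
  using assms(3-5)
proof (induction k arbitrary: X)
  case 0
  then have "\<forall>i. \<exists>\<alpha> t. i < r \<longrightarrow> X i = B \<alpha> t \<and> t \<in> {0..1}" by blast
  then obtain a u where au: "\<And>i. i < r \<Longrightarrow> X i = B (a i) (u i) \<and> u i \<in> {0..1}" by metis
  define x where "x = (\<lambda>i\<in>{..<r}. (u i, a i))"
  have x: "x \<in> cm_index r" using au by (auto simp: x_def cm_index_def)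
  have "tens r (\<lambda>i. B (snd (x i)) (fst (x i))) = tens r X"
    using au by (auto simp: tens_def x_def fun_eq_iff intro!: prod.cong)
  then show ?case using z[OF x] cm_tensor_map_eq[OF x, of D] by simp
next
  case (Suc k)
  have k: "k < r" using Suc.prems by simp
  have BSC: "BS \<subseteq> \<C>" using B_chaos by auto
  have XC: "X i \<in> \<C>" if "i < r" for i
    using Suc.prems(2)[of i] Suc.prems(3)[of i] that BSC by (cases "i < Suc k") auto
  have TL: "tens r (X(k := Y)) \<in> L2 (PM r)" if "Y \<in> L2 M" for Y
    using XC chaos_L2 that by (intro tens_L2) auto
  have split: "tens r (X(k := Y)) w = Y (w k) * (\<Prod>i\<in>{..<r} - {k}. X i (w i))" for Y w
  proof -
    have "tens r (X(k := Y)) w = (X(k := Y)) k (w k) * (\<Prod>i\<in>{..<r} - {k}. (X(k := Y)) i (w i))"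
      unfolding tens_def using k by (intro prod.remove) auto
    also have "(\<Prod>i\<in>{..<r} - {k}. (X(k := Y)) i (w i)) = (\<Prod>i\<in>{..<r} - {k}. X i (w i))"
      by (intro prod.cong) auto
    finally show ?thesis by (simp only: fun_upd_same)
  qed
  have BSz: "(\<integral>w. D w * tens r (X(k := Y)) w \<partial>PM r) = 0" if "Y \<in> BS" for Y
    using Suc.prems that by (intro Suc.IH) auto
  have lin: "(\<integral>w. D w * tens r (X(k := Y)) w \<partial>PM r) = 0" if Y: "Y \<in> lin_combs BS" for Y
  proof -
    obtain c g and n :: nat where g: "Y = (\<lambda>w. \<Sum>i<n. c i * g i w)" "\<And>i. i < n \<Longrightarrow> g i \<in> BS"
      by (rule lin_combsE[OF Y]) (rule that, assumption+)
    have "(\<integral>w. D w * tens r (X(k := Y)) w \<partial>PM r) = (\<integral>w. (\<Sum>i<n. c i * (D w * tens r (X(k := g i)) w)) \<partial>PM r)"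
      by (intro Bochner_Integration.integral_cong refl) (simp add: split g(1) sum_distrib_left sum_distrib_right mult_ac)
    also have "\<dots> = (\<Sum>i<n. c i * (\<integral>w. D w * tens r (X(k := g i)) w \<partial>PM r))"
      using g(2) BS_L2 by (subst Bochner_Integration.integral_sum) (auto intro!: L2_prod_integrable D TL)
    also have "\<dots> = 0" using BSz g(2) by simp
    finally show ?thesis .
  qed
  define K where "K = n2 (PM r) D * (\<Prod>i\<in>{..<r} - {k}. n2 M (X i))"
  have K: "0 \<le> K" by (auto simp: K_def intro!: mult_nonneg_nonneg prod_nonneg)
  have "\<bar>\<integral>w. D w * tens r X w \<partial>PM r\<bar> \<le> \<epsilon>" if \<epsilon>: "0 < \<epsilon>" for \<epsilon>
  proof -
    have "X k \<in> L2_closed_span M BS" using XC[OF k] by (simp add: first_chaos_def)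
    moreover have "0 < \<epsilon> / (K + 1)" using \<epsilon> K by simp
    ultimately obtain Y where Y: "Y \<in> lin_combs BS" "n2 M (\<lambda>w. X k w - Y w) < \<epsilon> / (K + 1)"
      using closed_span_iff[OF BS_L2] by blast
    have YL: "Y \<in> L2 M" by (rule lin_combs_L2[OF BS_L2 Y(1)])
    have DL: "(\<lambda>w. X k w - Y w) \<in> L2 M" by (rule L2_diff[OF chaos_L2[OF XC[OF k]] YL])
    have Xk: "X(k := X k) = X" by simp
    have "(\<integral>w. D w * tens r X w \<partial>PM r) = (\<integral>w. D w * tens r X w \<partial>PM r) - (\<integral>w. D w * tens r (X(k := Y)) w \<partial>PM r)"
      using lin[OF Y(1)] by simp
    also have "\<dots> = (\<integral>w. D w * tens r X w - D w * tens r (X(k := Y)) w \<partial>PM r)"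
      using TL[OF chaos_L2[OF XC[OF k]]] TL[OF YL] L2_prod_integrable[OF D] unfolding Xk
      by (intro Bochner_Integration.integral_diff[symmetric]) auto
    also have "\<dots> = (\<integral>w. D w * tens r (X(k := (\<lambda>w. X k w - Y w))) w \<partial>PM r)"
      using split[of "X k"] unfolding Xk
      by (intro Bochner_Integration.integral_cong refl) (simp add: split algebra_simps)
    finally have "\<bar>\<integral>w. D w * tens r X w \<partial>PM r\<bar> \<le> n2 (PM r) D * n2 (PM r) (tens r (X(k := (\<lambda>w. X k w - Y w))))"
      using L2_Cauchy_Schwarz[OF D TL[OF DL]] by simp
    also have "n2 (PM r) (tens r (X(k := (\<lambda>w. X k w - Y w)))) = (\<Prod>i<r. n2 M ((X(k := (\<lambda>w. X k w - Y w))) i))"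
      using XC chaos_L2 DL by (intro tens_L2) auto
    also have "\<dots> = n2 M (\<lambda>w. X k w - Y w) * (\<Prod>i\<in>{..<r} - {k}. n2 M (X i))"
    proof -
      have "(\<Prod>i\<in>{..<r} - {k}. n2 M ((X(k := (\<lambda>w. X k w - Y w))) i)) = (\<Prod>i\<in>{..<r} - {k}. n2 M (X i))"
        by (intro prod.cong) auto
      then show ?thesis using k prod.remove[of "{..<r}" k "\<lambda>i. n2 M ((X(k := (\<lambda>w. X k w - Y w))) i)"] by simp
    qed
    also have "n2 (PM r) D * (n2 M (\<lambda>w. X k w - Y w) * (\<Prod>i\<in>{..<r} - {k}. n2 M (X i))) = K * n2 M (\<lambda>w. X k w - Y w)"
      by (simp add: K_def)
    also have "\<dots> \<le> K * (\<epsilon> / (K + 1))" using Y(2) K by (intro mult_left_mono) auto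
    also have "\<dots> \<le> \<epsilon>" using K \<epsilon> by (simp add: field_simps)
    finally show ?thesis .
  qed
  then have "\<bar>\<integral>w. D w * tens r X w \<partial>PM r\<bar> \<le> 0" by (rule field_le_epsilon) simp
  then show ?case by simp
qed

text \<open>With Z = D this is injectivity of \<open>cm_tensor_map\<close> up to null sets. It makes
  \<open>cm_inner\<close>, which goes through an arbitrary preimage, computable from any explicit
  preimage.\<close>

lemma chaos_tensor_total:
  assumes D: "D \<in> L2 (PM r)" and z: "\<And>x. x \<in> cm_index r \<Longrightarrow> cm_tensor_map M B r D x = 0"
    and Z: "Z \<in> chaos_tensor M B r"
  shows "(\<integral>w. D w * Z w \<partial>PM r) = 0"
proof (rule closed_span_orthogonal[OF TS_L2 D])
  show "Z \<in> L2_closed_span (PM r) (TS r)" using Z by (simp add: chaos_tensor_def)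
  fix s assume "s \<in> TS r"
  then obtain X where X: "s = tens r X" "\<And>i. i < r \<Longrightarrow> X i \<in> \<C>" unfolding TS_tens by blast
  show "(\<integral>w. D w * s w \<partial>PM r) = 0"
    unfolding X(1) by (rule chaos_tensor_total_slots[OF D z order_refl X(2)]) auto
qed

text \<open>The reproducing property.\<close>

lemma cm_inner_psi:
  assumes f: "f \<in> cm_sym_space M B r" and u: "u \<in> {..<r} \<rightarrow>\<^sub>E {0..1}"
  shows "cm_inner M B r f (cm_sym_tensor r (\<lambda>i. cm_psi H (u i) (\<alpha> i))) = f (\<lambda>i\<in>{..<r}. (u i, \<alpha> i))"
proof -
  define x where "x = (\<lambda>i\<in>{..<r}. (u i, \<alpha> i))"
  have x: "x \<in> cm_index r" using u by (auto simp: x_def cm_index_def PiE_iff)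
  define P where "P = {\<sigma>. \<sigma> permutes {..<r}}"
  have P: "finite P" "card P = fact r" unfolding P_def by (auto simp: finite_permutations card_permutations)
  have ft: "f \<in> cm_tensor_space M B r" and symf: "\<And>\<sigma>. \<sigma> \<in> P \<Longrightarrow> f (x \<circ> \<sigma>) = f x"
    using f by (auto simp: cm_sym_space_def P_def)
  define g where "g = cm_sym_tensor r (\<lambda>i. cm_psi H (u i) (\<alpha> i))"
  have perm: "\<sigma> i < r" if "\<sigma> \<in> P" "i < r" for \<sigma> i using that permutes_in_image[of \<sigma> "{..<r}" i] by (auto simp: P_def)
  have xs: "x \<circ> \<sigma> \<in> cm_index r" if "\<sigma> \<in> P" for \<sigma>
    using x perm[OF that] that permutes_not_in[of \<sigma> "{..<r}"] by (auto simp: cm_index_def PiE_iff P_def extensional_def)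
  define T where "T \<sigma> = tens r (\<lambda>i. B (snd ((x \<circ> \<sigma>) i)) (fst ((x \<circ> \<sigma>) i)))" for \<sigma>
  have T: "T \<sigma> \<in> chaos_tensor M B r" if "\<sigma> \<in> P" for \<sigma>
    unfolding T_def using cm_index_B(1)[OF xs[OF that]] by (intro chaos_tensor_tens) auto
  \<comment> \<open>An explicit preimage of the symmetric tensor: the average over all permutations
    of products of values of \<open>B\<close>.\<close>
  define W where "W w = (\<Sum>\<sigma>\<in>P. (1 / fact r) * T \<sigma> w)" for w
  have W: "W \<in> chaos_tensor M B r" unfolding W_def by (intro chaos_tensor_sum P T chaos_nonempty)
  have Wg: "cm_tensor_map M B r W = g"
  proof
    fix y :: "nat \<Rightarrow> real \<times> 'd"
    have "cm_tensor_map M B r W y = (\<Sum>\<sigma>\<in>P. (1 / fact r) * cm_tensor_map M B r (T \<sigma>) y)"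
      unfolding W_def by (intro cm_tensor_map_sum P chaos_tensor_L2 T)
    also have "\<dots> = (\<Sum>\<sigma>\<in>P. (1 / fact r) * cm_tensor r (\<lambda>i. cm_psi H (u (\<sigma> i)) (\<alpha> (\<sigma> i))) y)"
    proof (intro sum.cong refl arg_cong2[where f="(*)"])
      fix \<sigma> assume s: "\<sigma> \<in> P"
      have "cm_tensor_map M B r (T \<sigma>) = cm_tensor r (\<lambda>i. cm_path M B (B (snd ((x \<circ> \<sigma>) i)) (fst ((x \<circ> \<sigma>) i))))"
        unfolding T_def using cm_index_B(1)[OF xs[OF s]] by (intro cm_tensor_map_tens) auto
      then have "cm_tensor_map M B r (T \<sigma>) y = cm_tensor r (\<lambda>i. cm_path M B (B (snd ((x \<circ> \<sigma>) i)) (fst ((x \<circ> \<sigma>) i)))) y"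
        by (rule fun_cong)
      also have "\<dots> = cm_tensor r (\<lambda>i. cm_psi H (u (\<sigma> i)) (\<alpha> (\<sigma> i))) y"
      proof (cases "y \<in> cm_index r")
        case True
        have "cm_path M B (B (snd ((x \<circ> \<sigma>) i)) (fst ((x \<circ> \<sigma>) i))) (y i) = cm_psi H (u (\<sigma> i)) (\<alpha> (\<sigma> i)) (y i)"
          if "i < r" for i
        proof -
          have "u (\<sigma> i) \<in> {0..1}" using u perm[OF s that] by (auto simp: PiE_iff)
          then show ?thesis
            using cov_B[of "u (\<sigma> i)" "fst (y i)" "\<alpha> (\<sigma> i)" "snd (y i)"] cm_index_B(2)[OF True that] perm[OF s that]
            by (simp add: cm_path_def cm_psi_def cov_def case_prod_beta x_def)
        qed
        then show ?thesis using True by (simp add: cm_tensor_def)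
      qed (simp add: cm_tensor_def)
      finally show "cm_tensor_map M B r (T \<sigma>) y = cm_tensor r (\<lambda>i. cm_psi H (u (\<sigma> i)) (\<alpha> (\<sigma> i))) y" .
    qed
    also have "\<dots> = g y" by (simp add: g_def cm_sym_tensor_def P_def sum_divide_distrib)
    finally show "cm_tensor_map M B r W y = g y" .
  qed
  then have gt: "g \<in> cm_tensor_space M B r" unfolding cm_tensor_space_def using W by (metis image_eqI)
  define Zf where "Zf = inv_into (chaos_tensor M B r) (cm_tensor_map M B r) f"
  define Zg where "Zg = inv_into (chaos_tensor M B r) (cm_tensor_map M B r) g"
  have Zf: "Zf \<in> chaos_tensor M B r" "cm_tensor_map M B r Zf = f" unfolding Zf_def using inv_map[OF ft] by auto
  have Zg: "Zg \<in> chaos_tensor M B r" "cm_tensor_map M B r Zg = g" unfolding Zg_def using inv_map[OF gt] by auto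
  note L = chaos_tensor_L2[OF Zf(1)] chaos_tensor_L2[OF Zg(1)] chaos_tensor_L2[OF W]
  \<comment> \<open>The preimage \<open>Zg\<close> picked by \<open>inv_into\<close> need not be
    \<open>W\<close>, but their difference is mapped to 0 and is therefore orthogonal to
    \<open>Zf\<close>.\<close>
  have "0 = (\<integral>w. (1 * Zg w + (-1) * W w) * Zf w \<partial>PM r)"
  proof (rule sym, rule chaos_tensor_total[OF L2_lin[OF L(2,3)] _ Zf(1)])
    show "cm_tensor_map M B r (\<lambda>w. 1 * Zg w + (-1) * W w) y = 0" for y
      using cm_tensor_map_diff[OF L(2,3)] Zg(2) Wg by simp
  qed
  also have "(\<integral>w. (1 * Zg w + (-1) * W w) * Zf w \<partial>PM r) = (\<integral>w. Zf w * Zg w - Zf w * W w \<partial>PM r)"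
    by (intro Bochner_Integration.integral_cong refl) (simp add: algebra_simps)
  finally have "(\<integral>w. Zf w * Zg w \<partial>PM r) = (\<integral>w. Zf w * W w \<partial>PM r)"
    using L2_prod_integrable[OF L(1,2)] L2_prod_integrable[OF L(1,3)] by simp
  also have "\<dots> = (\<integral>w. (\<Sum>\<sigma>\<in>P. (1 / fact r) * (Zf w * T \<sigma> w)) \<partial>PM r)"
    by (intro Bochner_Integration.integral_cong refl) (simp add: W_def sum_distrib_left mult_ac)
  also have "\<dots> = (\<Sum>\<sigma>\<in>P. (1 / fact r) * (\<integral>w. Zf w * T \<sigma> w \<partial>PM r))"
    using L2_prod_integrable[OF L(1) chaos_tensor_L2[OF T]] by (subst Bochner_Integration.integral_sum) auto
  \<comment> \<open>Each permutation contributes the value of f at a permuted point, and f is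
    symmetric; the r! equal terms cancel the normalisation.\<close>
  also have "\<dots> = (\<Sum>\<sigma>\<in>P. (1 / fact r) * f x)"
  proof (intro sum.cong refl arg_cong2[where f="(*)"])
    fix \<sigma> assume s: "\<sigma> \<in> P"
    show "(\<integral>w. Zf w * T \<sigma> w \<partial>PM r) = f x"
      using cm_tensor_map_eq[OF xs[OF s], of Zf] Zf(2) symf[OF s] by (simp add: T_def)
  qed
  also have "\<dots> = f x" using P by simp
  finally show ?thesis by (simp add: cm_inner_def Let_def Zf_def Zg_def g_def x_def)
qed

end

section \<open>Malliavin derivatives along increments\<close>

text \<open>The hypotheses concern separate partial derivatives, and joint differentiability has to
  be earned from their continuity. The induction is on the number of moving coordinates.\<close>

lemma line_derivative:
  fixes f :: "(nat \<Rightarrow> real) \<Rightarrow> real"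
  assumes "\<And>i x. i < n \<Longrightarrow> (\<lambda>z. f (x(i := z))) field_differentiable at (x i)"
    and "\<And>i. i < n \<Longrightarrow> continuous_on UNIV (partial_deriv i f)"
  shows "((\<lambda>s. f (\<lambda>i. if i < n then x i + s * c i else y i)) has_real_derivative
    (\<Sum>i<n. c i * partial_deriv i f (\<lambda>i. if i < n then x i + s * c i else y i))) (at s)"
  using assms
proof (induction n arbitrary: y s)
  case 0
  then show ?case by simp
next
  case (Suc m)
  \<comment> \<open>The first m coordinates run with s and coordinate m with t, the line being the
    diagonal s = t. The two-variable criterion needs joint continuity of only one partial
    derivative, here the one in t.\<close>
  define \<Phi> where "\<Phi> s t = (\<lambda>i. if i < m then x i + s * c i else if i = m then x m + t * c m else y i)" for s t
  have diag: "(\<lambda>i. if i < Suc m then x i + s * c i else y i) = \<Phi> s s" for s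
    by (auto simp: \<Phi>_def fun_eq_iff less_Suc_eq)
  have ds: "((\<lambda>s. f (\<Phi> s t)) has_real_derivative (\<Sum>i<m. c i * partial_deriv i f (\<Phi> s t))) (at s)" for s t
  proof -
    have "(\<lambda>i. if i < m then x i + s * c i else (y(m := x m + t * c m)) i) = \<Phi> s t" for s
      by (auto simp: \<Phi>_def fun_eq_iff)
    then show ?thesis using Suc.IH[of "y(m := x m + t * c m)"] Suc.prems by simp
  qed
  have dt: "((\<lambda>t. f (\<Phi> s t)) has_real_derivative c m * partial_deriv m f (\<Phi> s t)) (at t)" for s t
  proof -
    have pm: "\<Phi> s t m = x m + t * c m" by (simp add: \<Phi>_def)
    have "((\<lambda>z. f ((\<Phi> s t)(m := z))) has_real_derivative partial_deriv m f (\<Phi> s t)) (at (x m + t * c m))"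
      using Suc.prems(1)[of m "\<Phi> s t"] unfolding partial_deriv_def pm DERIV_deriv_iff_field_differentiable
      by (simp only: lessI)
    then have "((\<lambda>t'. f ((\<Phi> s t)(m := x m + t' * c m))) has_real_derivative partial_deriv m f (\<Phi> s t) * c m) (at t)"
      by (rule DERIV_chain2) (auto intro!: derivative_eq_intros)
    moreover have "(\<Phi> s t)(m := x m + t' * c m) = \<Phi> s t'" for t' by (auto simp: \<Phi>_def fun_eq_iff)
    ultimately show ?thesis by (simp add: mult.commute)
  qed
  have cont: "continuous_on UNIV (\<lambda>p. partial_deriv m f (\<Phi> (fst p) (snd p)))"
  proof (rule continuous_on_compose2[OF Suc.prems(2)[of m]])
    show "continuous_on UNIV (\<lambda>p. \<Phi> (fst p) (snd p))"
    proof (rule continuous_on_coordinatewise_then_product)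
      fix i
      consider "i < m" | "i = m" | "i > m" by linarith
      then show "continuous_on UNIV (\<lambda>p. \<Phi> (fst p) (snd p) i)"
        by cases (auto simp: \<Phi>_def intro!: continuous_intros)
    qed
  qed auto
  have "((\<lambda>(s, t). f (\<Phi> s t)) has_derivative
      (\<lambda>(ts, tt). (\<Sum>i<m. c i * partial_deriv i f (\<Phi> s s)) * ts + blinfun_mult_right (c m * partial_deriv m f (\<Phi> s s)) tt))
      (at (s, s) within UNIV \<times> UNIV)"
  proof (rule has_derivative_partialsI[where fy="\<lambda>s t. blinfun_mult_right (c m * partial_deriv m f (\<Phi> s t))"])
    show "((\<lambda>s'. f (\<Phi> s' s)) has_derivative (*) (\<Sum>i<m. c i * partial_deriv i f (\<Phi> s s))) (at s)"
      using ds[of s s] by (simp add: has_field_derivative_def)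
    show "((\<lambda>t. f (\<Phi> s t)) has_derivative blinfun_mult_right (c m * partial_deriv m f (\<Phi> s t))) (at t)" for s t
      using dt[of s t] by (simp add: has_field_derivative_def)
    have "continuous_on UNIV (\<lambda>p. blinfun_mult_right (c m * partial_deriv m f (\<Phi> (fst p) (snd p))))"
      by (intro bounded_linear.continuous_on[OF bounded_linear_blinfun_mult_right] continuous_on_mult continuous_on_const cont)
    then show "continuous (at (s, s) within UNIV \<times> UNIV) (\<lambda>(s, t). blinfun_mult_right (c m * partial_deriv m f (\<Phi> s t)))"
      by (simp add: continuous_on_eq_continuous_at case_prod_beta')
  qed auto
  then have A: "((\<lambda>(s, t). f (\<Phi> s t)) has_derivative
      (\<lambda>(ts, tt). (\<Sum>i<m. c i * partial_deriv i f (\<Phi> s s)) * ts + c m * partial_deriv m f (\<Phi> s s) * tt)) (at (s, s))"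
    by simp
  have C: "((\<lambda>s::real. (s, s)) has_derivative (\<lambda>h. (h, h))) (at s)"
    by (auto intro!: derivative_eq_intros)
  have "((\<lambda>s. f (\<Phi> s s)) has_derivative
      (\<lambda>h. (\<Sum>i<m. c i * partial_deriv i f (\<Phi> s s)) * h + c m * partial_deriv m f (\<Phi> s s) * h)) (at s)"
    using has_derivative_compose[OF C A] by simp
  moreover have "(\<lambda>h. (\<Sum>i<m. c i * partial_deriv i f (\<Phi> s s)) * h + c m * partial_deriv m f (\<Phi> s s) * h) =
      (*) (\<Sum>i<Suc m. c i * partial_deriv i f (\<Phi> s s))"
    by (simp add: fun_eq_iff distrib_right)
  ultimately show ?case unfolding diag has_field_derivative_def by simp
qed

lemma iter_partial_Cons: "iter_partial (k # js) f = partial_deriv k (iter_partial js f)"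
  by (simp add: iter_partial_def)

lemma smooth_poly_growth_depends:
  assumes "smooth_poly_growth n f" "set js \<subseteq> {..<n}" "\<And>i. i < n \<Longrightarrow> x i = y i"
  shows "iter_partial js f x = iter_partial js f y"
  using assms(2,3)
proof (induction js arbitrary: x y)
  case Nil
  then show ?case using assms(1) by (simp add: iter_partial_def smooth_poly_growth_def)
next
  case (Cons k js)
  have "(\<lambda>z. iter_partial js f (x(k := z))) = (\<lambda>z. iter_partial js f (y(k := z)))"
    using Cons by (intro ext Cons.IH) auto
  moreover have "x k = y k" using Cons by auto
  ultimately show ?case by (simp add: iter_partial_Cons partial_deriv_def)
qed

lemma smooth_poly_growthD:
  assumes "smooth_poly_growth n f" "set js \<subseteq> {..<n}"
  shows "continuous_on UNIV (iter_partial js f)"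
    "i < n \<Longrightarrow> (\<lambda>z. iter_partial js f (x(i := z))) field_differentiable at (x i)"
    "\<exists>C K. \<forall>x. \<bar>iter_partial js f x\<bar> \<le> C * (1 + (\<Sum>i<n. \<bar>x i\<bar>)) ^ K"
  using assms unfolding smooth_poly_growth_def lists_eq_set by blast+

text \<open>The dominating g will be the norm of a random element of the tensor space, about whose
  measurability nothing is stated; monotonicity of \<open>nn_integral\<close> works for arbitrary
  functions.\<close>

lemma Lp_norm_dominated:
  assumes "q > 0" "u \<in> borel_measurable N" "\<And>x. x \<in> space N \<Longrightarrow> \<bar>u x\<bar> \<le> g x"
    and "Lp_norm N (real q) g < ennreal c"
  shows "integrable N (\<lambda>x. \<bar>u x\<bar> ^ q)" "root q (\<integral>x. \<bar>u x\<bar> ^ q \<partial>N) < c"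
proof -
  define I where "I g = (\<integral>\<^sup>+ x. ennreal (\<bar>g x\<bar> powr real q) \<partial>N)" for g
  have le: "I u \<le> I g" unfolding I_def
  proof (intro nn_integral_mono ennreal_leI powr_mono2)
    fix x assume "x \<in> space N"
    then show "\<bar>u x\<bar> \<le> \<bar>g x\<bar>" using assms(3)[of x] by linarith
  qed auto
  have g: "I g \<noteq> \<top>" "ennreal (enn2real (I g) powr (1 / real q)) < ennreal c"
    using assms(4) by (auto simp: Lp_norm_def Let_def I_def split: if_splits)
  have ug: "I u \<noteq> \<top>" using le g(1) by (auto simp: top_unique)
  then have "Lp_norm N (real q) u < \<top>" by (simp add: Lp_norm_def Let_def I_def)
  then show int: "integrable N (\<lambda>x. \<bar>u x\<bar> ^ q)" using Lp_norm_nat(1)[OF assms(1,2)] by simp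
  have "ennreal (root q (\<integral>x. \<bar>u x\<bar> ^ q \<partial>N)) = ennreal (enn2real (I u) powr (1 / real q))"
    using Lp_norm_nat(2)[OF assms(1,2) int] ug by (simp add: Lp_norm_def Let_def I_def)
  also have "\<dots> \<le> ennreal (enn2real (I g) powr (1 / real q))"
    using le g(1) by (intro ennreal_leI powr_mono2 enn2real_mono) (auto simp: less_top)
  finally have "ennreal (root q (\<integral>x. \<bar>u x\<bar> ^ q \<partial>N)) < ennreal c" using g(2) by (rule le_less_trans)
  then show "root q (\<integral>x. \<bar>u x\<bar> ^ q \<partial>N) < c"
    using assms(1) by (simp add: ennreal_less_iff)
qed

context prob_space
begin

text \<open>Only the q-th power of f is known to be integrable, so \<open>nrm_mono_exponent\<close>
  does not apply. Splitting at the level \<delta> = \<epsilon> / 2 gives f^2 <= \<delta>^2 +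
  \<delta>^2 (|f| / \<delta>)^q, whose integral is at most 2 \<delta>^2 < \<epsilon>^2.\<close>

lemma L2_of_Lq:
  assumes "2 \<le> q" "0 < \<epsilon>" "f \<in> borel_measurable M" "integrable M (\<lambda>\<omega>. \<bar>f \<omega>\<bar> ^ q)"
    "nrm q f < \<epsilon> / 2"
  shows "f \<in> L2 M" "n2 M f < \<epsilon>"
proof -
  define \<delta> where "\<delta> = \<epsilon> / 2"
  have \<delta>: "0 < \<delta>" using assms(2) by (simp add: \<delta>_def)
  note [measurable] = assms(3)
  have le: "(f \<omega>)\<^sup>2 \<le> \<delta>\<^sup>2 + \<delta>\<^sup>2 / \<delta> ^ q * \<bar>f \<omega>\<bar> ^ q" for \<omega>
  proof (cases "\<bar>f \<omega>\<bar> \<le> \<delta>")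
    case True
    then have "(f \<omega>)\<^sup>2 \<le> \<delta>\<^sup>2" using \<delta> by (simp add: abs_le_square_iff[symmetric])
    moreover have "0 \<le> \<delta>\<^sup>2 / \<delta> ^ q * \<bar>f \<omega>\<bar> ^ q" using \<delta> by simp
    ultimately show ?thesis by linarith
  next
    case False
    then have "(\<bar>f \<omega>\<bar> / \<delta>) ^ 2 \<le> (\<bar>f \<omega>\<bar> / \<delta>) ^ q" using \<delta> assms(1) by (intro power_increasing) auto
    then have "\<delta>\<^sup>2 * (\<bar>f \<omega>\<bar> / \<delta>) ^ 2 \<le> \<delta>\<^sup>2 * (\<bar>f \<omega>\<bar> / \<delta>) ^ q" by (rule mult_left_mono) simp
    then have "(f \<omega>)\<^sup>2 \<le> \<delta>\<^sup>2 / \<delta> ^ q * \<bar>f \<omega>\<bar> ^ q" using \<delta> by (simp add: power_divide)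
    then show ?thesis by (simp add: add_increasing)
  qed
  have int: "integrable M (\<lambda>\<omega>. \<delta>\<^sup>2 + \<delta>\<^sup>2 / \<delta> ^ q * \<bar>f \<omega>\<bar> ^ q)" using assms(4) by simp
  have i2: "integrable M (\<lambda>\<omega>. (f \<omega>)\<^sup>2)"
    by (rule Bochner_Integration.integrable_bound[OF int]) (use le in \<open>auto intro: order_trans[OF _ abs_ge_self]\<close>)
  then show "f \<in> L2 M" by (simp add: L2_def)
  have q0: "q > 0" using assms(1) by simp
  have "(\<integral>\<omega>. (f \<omega>)\<^sup>2 \<partial>M) \<le> (\<integral>\<omega>. \<delta>\<^sup>2 + \<delta>\<^sup>2 / \<delta> ^ q * \<bar>f \<omega>\<bar> ^ q \<partial>M)"
    by (rule integral_mono[OF i2 int le])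
  also have "\<dots> = \<delta>\<^sup>2 + \<delta>\<^sup>2 / \<delta> ^ q * nrm q f ^ q"
    using assms(4) by (simp add: prob_space nrm_power[OF q0])
  also have "\<dots> \<le> \<delta>\<^sup>2 + \<delta>\<^sup>2 / \<delta> ^ q * \<delta> ^ q"
    using assms(5) \<delta> by (intro add_left_mono mult_left_mono power_mono) (auto simp: \<delta>_def)
  also have "\<dots> = 2 * \<delta>\<^sup>2" using \<delta> by simp
  also have "\<dots> < \<epsilon>\<^sup>2" using assms(2) by (simp add: \<delta>_def power2_eq_square)
  finally have "(n2 M f)\<^sup>2 < \<epsilon>\<^sup>2" by (simp add: n2_sq)
  then show "n2 M f < \<epsilon>" using assms(2) by (simp add: power2_less_imp_less)
qed

end

context fbm
begin

text \<open>A direction \<open>(\<alpha>, s, t)\<close> stands for \<open>\<psi>\<^sup>\<alpha>\<^sub>t - \<psi>\<^sup>\<alpha>\<^sub>s\<close>, that is, for the increment of \<open>B\<^sup>\<alpha>\<close> from \<open>s\<close> to \<open>t\<close>.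
  By the reproducing property, pairing an element of the tensor power with a product of directions is
  a rectangular increment, \<open>rinc\<close>.\<close>

definition vdir :: "'d \<times> real \<times> real \<Rightarrow> bool" where
  "vdir e \<longleftrightarrow> fst (snd e) \<in> {0..1} \<and> snd (snd e) \<in> {0..1}"

definition binc :: "'d \<times> real \<times> real \<Rightarrow> 'w \<Rightarrow> real" where
  "binc e \<omega> = B (fst e) (snd (snd e)) \<omega> - B (fst e) (fst (snd e)) \<omega>"

definition pt :: "('d \<times> real \<times> real) list \<Rightarrow> nat set \<Rightarrow> nat \<Rightarrow> real \<times> 'd" where
  "pt es A = (\<lambda>i\<in>{..<length es}. (if i \<in> A then snd (snd (es ! i)) else fst (snd (es ! i)), fst (es ! i)))"

definition rinc :: "('d \<times> real \<times> real) list \<Rightarrow> ((nat \<Rightarrow> real \<times> 'd) \<Rightarrow> real) \<Rightarrow> real" where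
  "rinc es g = (\<Sum>A\<in>Pow {..<length es}. (- 1) ^ (length es - card A) * g (pt es A))"

lemma binc_chaos: "vdir e \<Longrightarrow> binc e \<in> \<C>"
  using G_lin[OF B_chaos B_chaos, of "snd (snd e)" "fst (snd e)" 1 "fst e" "-1" "fst e"]
  by (simp add: vdir_def binc_def[abs_def])

lemma cov_binc:
  assumes "X \<in> \<C>" "vdir e"
  shows "cov X (binc e) = cov X (B (fst e) (snd (snd e))) - cov X (B (fst e) (fst (snd e)))"
  using cov_lin[OF assms(1) B_chaos B_chaos, of "snd (snd e)" "fst (snd e)" 1 "fst e" "-1" "fst e"] assms(2)
  by (simp add: vdir_def binc_def[abs_def])

lemma pt_index: "(\<And>e. e \<in> set es \<Longrightarrow> vdir e) \<Longrightarrow> pt es A \<in> cm_index (length es)"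
  by (auto simp: pt_def cm_index_def vdir_def)

lemma rinc_bound:
  assumes "\<And>e. e \<in> set es \<Longrightarrow> vdir e" "\<And>x. x \<in> cm_index (length es) \<Longrightarrow> \<bar>g x\<bar> \<le> K"
  shows "\<bar>rinc es g\<bar> \<le> 2 ^ length es * K"
proof -
  have "\<bar>rinc es g\<bar> \<le> (\<Sum>A\<in>Pow {..<length es}. \<bar>(- 1) ^ (length es - card A) * g (pt es A)\<bar>)"
    unfolding rinc_def by (rule sum_abs)
  also have "\<dots> \<le> (\<Sum>A\<in>Pow {..<length es}. K)"
    using assms pt_index[OF assms(1)] by (intro sum_mono) (simp add: abs_mult power_abs)
  also have "\<dots> = 2 ^ length es * K" by (simp add: card_Pow)
  finally show ?thesis .
qed

lemma rinc_diff: "rinc es (\<lambda>x. g x - h x) = rinc es g - rinc es h"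
  by (simp add: rinc_def right_diff_distrib sum_subtractf)

lemma rinc_lin: "rinc es (\<lambda>x. \<Sum>i\<in>I. c i * g i x) = (\<Sum>i\<in>I. c i * rinc es (g i))"
  unfolding rinc_def sum_distrib_left by (subst sum.swap) (simp add: mult_ac)

text \<open>Expanding the product of differences by \<open>prod_add\<close> yields one term per
  subset A of slots, namely the corner of the box with right endpoints exactly on A.\<close>

lemma rinc_tensor:
  assumes "\<And>e. e \<in> set es \<Longrightarrow> vdir e"
  shows "rinc es (cm_tensor (length es) h) =
    (\<Prod>i<length es. h i (snd (snd (es ! i)), fst (es ! i)) - h i (fst (snd (es ! i)), fst (es ! i)))"
proof -
  let ?r = "length es"
  let ?b = "\<lambda>i. h i (snd (snd (es ! i)), fst (es ! i))" and ?a = "\<lambda>i. h i (fst (snd (es ! i)), fst (es ! i))"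
  have "(\<Prod>i<?r. ?b i - ?a i) = (\<Prod>i<?r. ?b i + (-1) * ?a i)" by simp
  also have "\<dots> = (\<Sum>A\<in>Pow {..<?r}. (\<Prod>i\<in>A. ?b i) * (\<Prod>i\<in>{..<?r} - A. (-1) * ?a i))"
    by (rule prod_add) simp
  also have "\<dots> = (\<Sum>A\<in>Pow {..<?r}. (- 1) ^ (?r - card A) * cm_tensor ?r h (pt es A))"
  proof (intro sum.cong refl)
    fix A assume A: "A \<in> Pow {..<?r}"
    then have fA: "finite A" by (auto intro: finite_subset)
    have "cm_tensor ?r h (pt es A) = (\<Prod>i<?r. h i (pt es A i))"
      using pt_index[OF assms] by (simp add: cm_tensor_def)
    also have "{..<?r} = A \<union> ({..<?r} - A)" using A by auto
    also have "(\<Prod>i\<in>A \<union> ({..<?r} - A). h i (pt es A i)) = (\<Prod>i\<in>A. h i (pt es A i)) * (\<Prod>i\<in>{..<?r} - A. h i (pt es A i))"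
      using fA by (intro prod.union_disjoint) auto
    also have "(\<Prod>i\<in>A. h i (pt es A i)) = (\<Prod>i\<in>A. ?b i)"
      using A by (intro prod.cong refl) (auto simp: pt_def)
    also have "(\<Prod>i\<in>{..<?r} - A. h i (pt es A i)) = (\<Prod>i\<in>{..<?r} - A. ?a i)"
      by (intro prod.cong refl) (auto simp: pt_def)
    finally have "cm_tensor ?r h (pt es A) = (\<Prod>i\<in>A. ?b i) * (\<Prod>i\<in>{..<?r} - A. ?a i)" .
    moreover have "(\<Prod>i\<in>{..<?r} - A. (-1) * ?a i) = (-1) ^ (?r - card A) * (\<Prod>i\<in>{..<?r} - A. ?a i)"
    proof -
      have "card ({..<?r} - A) = ?r - card A" using A fA by (simp add: card_Diff_subset)
      then show ?thesis by (simp only: prod.distrib prod_constant)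
    qed
    ultimately show "(\<Prod>i\<in>A. ?b i) * (\<Prod>i\<in>{..<?r} - A. (-1) * ?a i) = (- 1) ^ (?r - card A) * cm_tensor ?r h (pt es A)"
      by (simp only: mult_ac)
  qed
  finally show ?thesis by (simp add: rinc_def)
qed

text \<open>The iterated directional derivative of f(X) along the increments \<open>es\<close>, as a
  cylinder function of the Gaussian coordinates. Indices run over lists, so that prepending a
  direction prepends an index; see \<open>cder_cyld\<close>.\<close>

definition cder :: "nat \<Rightarrow> ((nat \<Rightarrow> real) \<Rightarrow> real) \<Rightarrow> (nat \<Rightarrow> 'w \<Rightarrow> real) \<Rightarrow> ('d \<times> real \<times> real) list \<Rightarrow>
    (('w \<Rightarrow> real) \<Rightarrow> real) \<Rightarrow> real" where
  "cder n f X es z = (\<Sum>js\<in>{js. set js \<subseteq> {..<n} \<and> length js = length es}.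
     (\<Prod>j<length es. cov (X (js ! j)) (binc (es ! j))) * iter_partial js f (\<lambda>i. z (X i)))"

lemma cder_Nil: "cder n f X [] z = f (\<lambda>i. z (X i))"
proof -
  have "{js. set js \<subseteq> {..<n} \<and> js = []} = {[]}" by auto
  then show ?thesis by (simp add: cder_def iter_partial_def)
qed

text \<open>Each factor of the rectangular increment is a difference of path values of X, that is,
  the covariance of X with an increment of \<open>B\<close>. The rest is the passage from index
  functions to index lists.\<close>

lemma rinc_cylinder:
  assumes X: "\<And>i. i < n \<Longrightarrow> X i \<in> \<C>" and es: "\<And>e. e \<in> set es \<Longrightarrow> vdir e"
  shows "rinc es (cylinder_deriv M B (length es) n f X \<omega>) = cder n f X es (ev \<omega>)"
proof -
  let ?r = "length es"
  let ?I = "{..<?r} \<rightarrow>\<^sub>E {..<n}" and ?J = "{js. set js \<subseteq> {..<n} \<and> length js = ?r}"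
  have bij: "bij_betw (\<lambda>i. map i [0..<?r]) ?I ?J"
  proof (rule bij_betw_byWitness[where f'="\<lambda>js. \<lambda>i\<in>{..<?r}. js ! i"])
    show "\<forall>i\<in>?I. (\<lambda>k\<in>{..<?r}. map i [0..<?r] ! k) = i" by (auto simp: fun_eq_iff PiE_iff extensional_def)
    show "\<forall>js\<in>?J. map (\<lambda>k\<in>{..<?r}. js ! k) [0..<?r] = js" by (auto intro!: nth_equalityI)
    show "(\<lambda>i. map i [0..<?r]) ` ?I \<subseteq> ?J"
    proof (rule image_subsetI)
      fix i assume i: "i \<in> ?I"
      have "i k \<in> {..<n}" if "k < ?r" for k using PiE_mem[OF i, of k] that by simp
      then show "map i [0..<?r] \<in> ?J" by (simp add: image_subset_iff)
    qed
    show "(\<lambda>js. \<lambda>i\<in>{..<?r}. js ! i) ` ?J \<subseteq> ?I"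
    proof (rule image_subsetI)
      fix js assume "js \<in> ?J"
      then have "js ! k \<in> {..<n}" if "k < ?r" for k using that nth_mem[of k js] by (auto simp: subset_iff)
      then show "(\<lambda>i\<in>{..<?r}. js ! i) \<in> ?I" by (simp add: restrict_PiE_iff)
    qed
  qed
  have "rinc es (cylinder_deriv M B ?r n f X \<omega>) =
     (\<Sum>i\<in>?I. iter_partial (map i [0..<?r]) f (\<lambda>k. X k \<omega>) * rinc es (cm_tensor ?r (\<lambda>j. cm_path M B (X (i j)))))"
    unfolding cylinder_deriv_def[abs_def] by (rule rinc_lin)
  also have "\<dots> = (\<Sum>i\<in>?I. (\<Prod>j<?r. cov (X (map i [0..<?r] ! j)) (binc (es ! j))) * iter_partial (map i [0..<?r]) f (\<lambda>k. ev \<omega> (X k)))"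
  proof (intro sum.cong refl)
    fix i assume i: "i \<in> ?I"
    have "rinc es (cm_tensor ?r (\<lambda>j. cm_path M B (X (i j)))) = (\<Prod>j<?r. cov (X (map i [0..<?r] ! j)) (binc (es ! j)))"
    proof (rule trans[OF rinc_tensor[OF es]], assumption, intro prod.cong refl)
      fix j assume j: "j \<in> {..<?r}"
      then have "i j < n" using i by (auto simp: PiE_iff)
      moreover have "vdir (es ! j)" using j es by auto
      ultimately show "cm_path M B (X (i j)) (snd (snd (es ! j)), fst (es ! j)) - cm_path M B (X (i j)) (fst (snd (es ! j)), fst (es ! j)) =
        cov (X (map i [0..<?r] ! j)) (binc (es ! j))"
        using j cov_binc[OF X] by (simp add: cm_path_def cov_def)
    qed
    then show "iter_partial (map i [0..<?r]) f (\<lambda>k. X k \<omega>) * rinc es (cm_tensor ?r (\<lambda>j. cm_path M B (X (i j)))) =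
      (\<Prod>j<?r. cov (X (map i [0..<?r] ! j)) (binc (es ! j))) * iter_partial (map i [0..<?r]) f (\<lambda>k. ev \<omega> (X k))"
      by (simp add: ev_def)
  qed
  also have "\<dots> = cder n f X es (ev \<omega>)"
    unfolding cder_def by (rule sum.reindex_bij_betw[OF bij])
  finally show ?thesis .
qed

lemma cyl_iter_partial:
  assumes f: "smooth_poly_growth n f" and X: "\<And>i. i < n \<Longrightarrow> X i \<in> \<C>" and js: "set js \<subseteq> {..<n}"
  shows "cyl (X ` {..<n}) (\<lambda>z. iter_partial js f (\<lambda>i. z (X i)))"
proof -
  let ?V = "X ` {..<n}" and ?g = "iter_partial js f"
  have dep: "?g x = ?g y" if "\<And>i. i < n \<Longrightarrow> x i = y i" for x y
    using smooth_poly_growth_depends[OF f js that] .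
  obtain C K where CK: "\<And>x. \<bar>?g x\<bar> \<le> C * (1 + (\<Sum>i<n. \<bar>x i\<bar>)) ^ K"
    using smooth_poly_growthD(3)[OF f js] by blast
  have C: "0 \<le> C" using CK[of "\<lambda>_. 0"] by (simp add: order_trans[OF abs_ge_zero])
  have "\<bar>?g (\<lambda>i. z (X i))\<bar> \<le> C * (real n + 1) ^ K * (1 + (\<Sum>v\<in>?V. \<bar>z v\<bar>)) ^ K" for z
  proof -
    \<comment> \<open>X need not be injective, so several arguments of f may read the same Gaussian
      coordinate. Bounding each argument by the full sum over V costs the factor n.\<close>
    have "(\<Sum>i<n. \<bar>z (X i)\<bar>) \<le> (\<Sum>i<n. \<Sum>v\<in>?V. \<bar>z v\<bar>)"
      by (intro sum_mono) (auto intro!: member_le_sum)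
    then have "1 + (\<Sum>i<n. \<bar>z (X i)\<bar>) \<le> (real n + 1) * (1 + (\<Sum>v\<in>?V. \<bar>z v\<bar>))"
    proof -
      assume a: "(\<Sum>i<n. \<bar>z (X i)\<bar>) \<le> (\<Sum>i<n. \<Sum>v\<in>?V. \<bar>z v\<bar>)"
      have "0 \<le> (\<Sum>v\<in>?V. \<bar>z v\<bar>)" by (rule sum_nonneg) simp
      then have "1 + real n * (\<Sum>v\<in>?V. \<bar>z v\<bar>) \<le> (real n + 1) * (1 + (\<Sum>v\<in>?V. \<bar>z v\<bar>))"
        by (simp add: algebra_simps)
      moreover have "(\<Sum>i<n. \<bar>z (X i)\<bar>) \<le> real n * (\<Sum>v\<in>?V. \<bar>z v\<bar>)" using a by simp
      ultimately show ?thesis by linarith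
    qed
    then have "(1 + (\<Sum>i<n. \<bar>z (X i)\<bar>)) ^ K \<le> ((real n + 1) * (1 + (\<Sum>v\<in>?V. \<bar>z v\<bar>))) ^ K"
      by (intro power_mono) (auto intro!: add_nonneg_nonneg sum_nonneg)
    then have "C * (1 + (\<Sum>i<n. \<bar>z (X i)\<bar>)) ^ K \<le> C * ((real n + 1) * (1 + (\<Sum>v\<in>?V. \<bar>z v\<bar>))) ^ K"
      using C by (rule mult_left_mono)
    with CK[of "\<lambda>i. z (X i)"] show ?thesis by (simp add: power_mult_distrib mult.assoc)
  qed
  moreover have "(\<lambda>z. ?g (\<lambda>i. z (X i))) \<in> borel_measurable (PiM ?V (\<lambda>_. borel))"
  proof -
    have gm: "?g \<in> borel_measurable borel"
      by (rule borel_measurable_continuous_onI[OF smooth_poly_growthD(1)[OF f js]])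
    \<comment> \<open>f takes infinite sequences, while only n coordinates are supplied; the others
      are filled with 0, which f does not see.\<close>
    have "(\<lambda>z i. if i < n then z (X i) else 0) \<in> measurable (PiM ?V (\<lambda>_. borel)) (borel :: (nat \<Rightarrow> real) measure)"
    proof (rule measurable_coordinatewise_then_product)
      fix i
      show "(\<lambda>z. if i < n then z (X i) else 0) \<in> borel_measurable (PiM ?V (\<lambda>_. borel))"
        by (cases "i < n") (auto intro!: measurable_component_singleton)
    qed
    from measurable_compose[OF this gm]
    have "(\<lambda>z. ?g (\<lambda>i. if i < n then z (X i) else 0)) \<in> borel_measurable (PiM ?V (\<lambda>_. borel))" .
    also have "(\<lambda>z. ?g (\<lambda>i. if i < n then z (X i) else 0)) = (\<lambda>z. ?g (\<lambda>i. z (X i)))"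
      by (rule ext, rule dep) simp
    finally show ?thesis .
  qed
  moreover have "?g (\<lambda>i. restrict z ?V (X i)) = ?g (\<lambda>i. z (X i))" for z
    by (rule dep) auto
  ultimately show ?thesis unfolding cyl_def using X by blast
qed

lemma cyl_cder:
  assumes f: "smooth_poly_growth n f" and X: "\<And>i. i < n \<Longrightarrow> X i \<in> \<C>"
  shows "cyl (X ` {..<n}) (cder n f X es)"
  unfolding cder_def[abs_def] using X
  by (intro cyl_sum cyl_cmult cyl_iter_partial[OF f X]) auto

text \<open>Along \<open>binc e\<close> the i-th argument of f moves with speed
  \<open>cov (binc e) (X i)\<close>, so \<open>line_derivative\<close> puts one more partial
  derivative in front, matching the new head of the list.\<close>

lemma cder_cyld:
  assumes f: "smooth_poly_growth n f" and X: "\<And>i. i < n \<Longrightarrow> X i \<in> \<C>"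
  shows "cyld (binc e) (cder n f X es) (cder n f X (e # es))"
proof -
  let ?r = "length es"
  let ?J = "{js. set js \<subseteq> {..<n} \<and> length js = ?r}"
  define c where "c js = (\<Prod>j<?r. cov (X (js ! j)) (binc (es ! j)))" for js
  define d where "d k = cov (binc e) (X k)" for k
  have Cons: "cder n f X (e # es) z = (\<Sum>js\<in>?J. c js * (\<Sum>k<n. d k * iter_partial (k # js) f (\<lambda>i. z (X i))))" for z
  proof -
    have "cder n f X (e # es) z = (\<Sum>p\<in>?J \<times> {..<n}. (\<Prod>j<Suc ?r. cov (X ((snd p # fst p) ! j)) (binc ((e # es) ! j))) *
        iter_partial (snd p # fst p) f (\<lambda>i. z (X i)))"
      unfolding cder_def length_Cons lists_length_Suc_eq
      by (subst sum.reindex) (auto simp: inj_on_def case_prod_beta' o_def)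
    also have "\<dots> = (\<Sum>p\<in>?J \<times> {..<n}. c (fst p) * (d (snd p) * iter_partial (snd p # fst p) f (\<lambda>i. z (X i))))"
      by (intro sum.cong refl)
         (simp add: c_def d_def prod.lessThan_Suc_shift cov_commute[of "binc e"] mult_ac del: prod.lessThan_Suc)
    also have "\<dots> = (\<Sum>js\<in>?J. \<Sum>k<n. c js * (d k * iter_partial (k # js) f (\<lambda>i. z (X i))))"
      by (simp add: sum.cartesian_product case_prod_beta')
    finally show ?thesis by (simp add: sum_distrib_left)
  qed
  have line: "((\<lambda>s. iter_partial js f (\<lambda>i. z (X i) + s * d i)) has_real_derivative
      (\<Sum>k<n. d k * iter_partial (k # js) f (\<lambda>i. z (X i) + s * d i))) (at s)" if js: "js \<in> ?J" for js z s
  proof -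
    have sj: "set js \<subseteq> {..<n}" using js by auto
    have dep: "iter_partial ks f (\<lambda>i. if i < n then z (X i) + s * d i else 0) = iter_partial ks f (\<lambda>i. z (X i) + s * d i)"
      if "set ks \<subseteq> {..<n}" for s ks
      by (rule smooth_poly_growth_depends[OF f that]) simp
    have "((\<lambda>s. iter_partial js f (\<lambda>i. if i < n then z (X i) + s * d i else 0)) has_real_derivative
      (\<Sum>k<n. d k * partial_deriv k (iter_partial js f) (\<lambda>i. if i < n then z (X i) + s * d i else 0))) (at s)"
    proof (rule line_derivative)
      show "(\<lambda>z. iter_partial js f (x(i := z))) field_differentiable at (x i)" if "i < n" for i x
        using smooth_poly_growthD(2)[OF f sj that] .
      show "continuous_on UNIV (partial_deriv i (iter_partial js f))" if "i < n" for i
        using smooth_poly_growthD(1)[OF f, of "i # js"] sj that by (simp add: iter_partial_Cons)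
    qed
    moreover have "(\<Sum>k<n. d k * partial_deriv k (iter_partial js f) (\<lambda>i. if i < n then z (X i) + s * d i else 0)) =
        (\<Sum>k<n. d k * iter_partial (k # js) f (\<lambda>i. z (X i) + s * d i))"
      using sj by (intro sum.cong refl arg_cong2[where f="(*)"]) (simp add: iter_partial_Cons[symmetric] dep)
    ultimately show ?thesis using dep[OF sj] by simp
  qed
  show ?thesis
  proof (rule cyldI[OF cyl_cder[OF f X] cyl_cder[OF f X]])
    fix z s
    show "((\<lambda>s. cder n f X es (shift (binc e) s z)) has_real_derivative cder n f X (e # es) (shift (binc e) s z)) (at s)"
      unfolding Cons unfolding cder_def shift_def c_def[symmetric] d_def[symmetric]
      by (intro DERIV_sum DERIV_cmult line) auto
  next
    fix z
    have "continuous_on UNIV (\<lambda>s. iter_partial (k # js) f (\<lambda>i. z (X i) + s * d i))" if "js \<in> ?J" "k < n" for k js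
      by (rule continuous_on_compose2[OF smooth_poly_growthD(1)[OF f]])
         (use that in \<open>auto intro!: continuous_intros\<close>)
    then show "continuous_on UNIV (\<lambda>s. cder n f X (e # es) (shift (binc e) s z))"
      unfolding Cons shift_def d_def[symmetric]
      by (intro continuous_on_sum continuous_on_mult continuous_on_const) auto
  qed
qed

end

section \<open>Approximation, integration by parts and uniqueness for Malliavin derivatives\<close>

context fbm
begin

abbreviation "vdirs es \<equiv> (\<forall>e\<in>set es. vdir e)"

text \<open>\<open>has_malliavin_derivs\<close> says nothing about \<open>G 0\<close>, hence the
  separate value at the empty list.\<close>

definition VG :: "('w \<Rightarrow> real) \<Rightarrow> (nat \<Rightarrow> 'w \<Rightarrow> (nat \<Rightarrow> real \<times> 'd) \<Rightarrow> real) \<Rightarrow> ('d \<times> real \<times> real) list \<Rightarrow> 'w \<Rightarrow> real" where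
  "VG F G es \<omega> = (if es = [] then F \<omega> else rinc es (G (length es) \<omega>))"

text \<open>Integrability of the difference is part of the notion, since \<open>nrm\<close> would be
  0 on a non-integrable one.\<close>

definition near :: "nat \<Rightarrow> ('w \<Rightarrow> real) \<Rightarrow> ((('w \<Rightarrow> real) \<Rightarrow> real) \<Rightarrow> real) \<Rightarrow> real \<Rightarrow> bool" where
  "near q \<Phi> h \<epsilon> \<longleftrightarrow> \<Phi> \<in> borel_measurable M \<and> integrable M (\<lambda>\<omega>. \<bar>\<Phi> \<omega> - h (ev \<omega>)\<bar> ^ q) \<and>
     nrm q (\<lambda>\<omega>. \<Phi> \<omega> - h (ev \<omega>)) < \<epsilon>"

lemma cder_all_moments:
  assumes "smooth_poly_growth n f" "\<And>i. i < n \<Longrightarrow> X i \<in> \<C>"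
  shows "(\<lambda>\<omega>. cder n f X es (ev \<omega>)) \<in> all_moments"
  by (rule cyl_all_moments[OF cyl_cder[OF assms]])

text \<open>A rectangular increment has \<open>2 ^ length es\<close> corners, and each corner value
  is at most the norm in the tensor space. This is the factor compensated by \<open>2 ^ k\<close> in
  the hypothesis.\<close>

lemma malliavin_approx_deriv:
  assumes G: "has_malliavin_derivs M B k (real q) F G" and q: "0 < q"
    and es: "vdirs es" "es \<noteq> []" "length es \<le> k"
    and f: "smooth_poly_growth n f" "\<And>i. i < n \<Longrightarrow> X i \<in> \<C>"
    and le: "Lp_norm M q (\<lambda>\<omega>. cm_norm M B (length es)
      (\<lambda>x. G (length es) \<omega> x - cylinder_deriv M B (length es) n f X \<omega> x)) < ennreal (\<epsilon> / 2 ^ k)"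
  shows "near q (VG F G es) (cder n f X es) \<epsilon>"
proof -
  let ?r = "length es"
  have r: "?r \<in> {1..k}" using es by (cases es) auto
  have Gs: "\<And>\<omega>. \<omega> \<in> space M \<Longrightarrow> G ?r \<omega> \<in> cm_tensor_space M B ?r" "\<And>x. (\<lambda>\<omega>. G ?r \<omega> x) \<in> borel_measurable M"
    using G r unfolding has_malliavin_derivs_def cm_sym_space_def by blast+
  have Vm: "VG F G es \<in> borel_measurable M"
    unfolding VG_def[abs_def] rinc_def using es Gs(2) by simp
  have cm: "(\<lambda>\<omega>. cder n f X es (ev \<omega>)) \<in> all_moments" by (rule cder_all_moments[OF f])
  define u where "u \<omega> = (VG F G es \<omega> - cder n f X es (ev \<omega>)) / 2 ^ ?r" for \<omega>
  have um: "u \<in> borel_measurable M" unfolding u_def using Vm all_momentsD(1)[OF cm] by measurable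
  have ule: "\<bar>u \<omega>\<bar> \<le> cm_norm M B ?r (\<lambda>x. G ?r \<omega> x - cylinder_deriv M B ?r n f X \<omega> x)" if \<omega>: "\<omega> \<in> space M" for \<omega>
  proof -
    let ?g = "\<lambda>x. G ?r \<omega> x - cylinder_deriv M B ?r n f X \<omega> x"
    have g: "?g \<in> cm_tensor_space M B ?r"
      by (rule cm_tensor_space_diff[OF Gs(1)[OF \<omega>] cylinder_deriv_space[OF f(2)]])
    have "VG F G es \<omega> - cder n f X es (ev \<omega>) = rinc es ?g"
      using es f(2) rinc_cylinder[where n=n and f=f and X=X and es=es and \<omega>=\<omega>] by (simp add: VG_def rinc_diff)
    moreover have "\<bar>rinc es ?g\<bar> \<le> 2 ^ ?r * cm_norm M B ?r ?g"
      using es(1) cm_eval_le_norm[OF g] by (intro rinc_bound) auto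
    ultimately show ?thesis by (simp add: u_def divide_le_eq mult.commute)
  qed
  note u = Lp_norm_dominated[OF q um ule le]
  have uV: "VG F G es \<omega> - cder n f X es (ev \<omega>) = 2 ^ ?r * u \<omega>" for \<omega> by (simp add: u_def)
  have i: "integrable M (\<lambda>\<omega>. \<bar>VG F G es \<omega> - cder n f X es (ev \<omega>)\<bar> ^ q)"
    unfolding uV abs_mult power_mult_distrib using u(1) by simp
  have "nrm q (\<lambda>\<omega>. VG F G es \<omega> - cder n f X es (ev \<omega>)) = 2 ^ ?r * nrm q u"
    unfolding uV using nrm_cmult[OF q, of "2 ^ ?r" u] by simp
  also have "\<dots> \<le> 2 ^ k * nrm q u" using es(3) by (intro mult_right_mono power_increasing) auto
  also have "\<dots> < 2 ^ k * (\<epsilon> / 2 ^ k)" using u(2) by (intro mult_strict_left_mono) (auto simp: nrm_def)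
  also have "\<dots> = \<epsilon>" by simp
  finally show ?thesis using Vm i by (simp add: near_def)
qed

lemma malliavin_approx_zero:
  assumes F: "F \<in> borel_measurable M" and q: "0 < q"
    and f: "smooth_poly_growth n f" "\<And>i. i < n \<Longrightarrow> X i \<in> \<C>"
    and le: "Lp_norm M q (\<lambda>\<omega>. F \<omega> - f (\<lambda>i. X i \<omega>)) < ennreal \<epsilon>"
  shows "near q (VG F G []) (cder n f X []) \<epsilon>"
proof -
  have cm: "(\<lambda>\<omega>. cder n f X [] (ev \<omega>)) \<in> borel_measurable M" by (rule all_momentsD(1)[OF cder_all_moments[OF f]])
  have e: "cder n f X [] (ev \<omega>) = f (\<lambda>i. X i \<omega>)" for \<omega> by (simp add: cder_Nil ev_def)
  have um: "(\<lambda>\<omega>. F \<omega> - f (\<lambda>i. X i \<omega>)) \<in> borel_measurable M" using F cm unfolding e by measurable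
  have Fin: "Lp_norm M (real q) (\<lambda>\<omega>. F \<omega> - f (\<lambda>i. X i \<omega>)) < \<top>" using le by (rule less_trans) simp
  have i: "integrable M (\<lambda>\<omega>. \<bar>F \<omega> - f (\<lambda>i. X i \<omega>)\<bar> ^ q)"
    using Lp_norm_nat(1)[OF q um] Fin by simp
  have "ennreal (nrm q (\<lambda>\<omega>. F \<omega> - f (\<lambda>i. X i \<omega>))) < ennreal \<epsilon>"
    using Lp_norm_nat(2)[OF q um i] le by (simp add: nrm_def)
  then have "nrm q (\<lambda>\<omega>. F \<omega> - f (\<lambda>i. X i \<omega>)) < \<epsilon>" by (simp add: ennreal_less_iff)
  then show ?thesis using i F by (simp add: near_def VG_def[abs_def] e)
qed

text \<open>The defining convergences of orders 0 to k hold along one sequence, so a single cylinder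
  functional serves all orders and all directions simultaneously. The later derivative relation
  between consecutive orders rests on this.\<close>

lemma malliavin_approx:
  assumes G: "has_malliavin_derivs M B k (real q) F G" and q: "0 < q" and \<epsilon>: "0 < \<epsilon>"
  obtains n f X where "smooth_poly_growth n f" "\<And>i. i < n \<Longrightarrow> X i \<in> \<C>"
    "\<And>es. vdirs es \<Longrightarrow> length es \<le> k \<Longrightarrow> near q (VG F G es) (cder n f X es) \<epsilon>"
proof -
  from G obtain n f X where
    s: "\<And>l. smooth_poly_growth (n l) (f l)" "\<And>l i. i < n l \<Longrightarrow> X l i \<in> \<C>"
    and l0: "(\<lambda>l::nat. Lp_norm M q (\<lambda>\<omega>. F \<omega> - f l (\<lambda>i. X l i \<omega>))) \<longlonglongrightarrow> 0"
    and lj: "\<And>j. j \<in> {1..k} \<Longrightarrow> (\<lambda>l. Lp_norm M q (\<lambda>\<omega>. cm_norm M B j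
                  (\<lambda>x. G j \<omega> x - cylinder_deriv M B j (n l) (f l) (X l) \<omega> x))) \<longlonglongrightarrow> 0"
    unfolding has_malliavin_derivs_def by blast
  have F: "F \<in> borel_measurable M" using G by (simp add: has_malliavin_derivs_def)
  have "\<forall>\<^sub>F l in sequentially. Lp_norm M q (\<lambda>\<omega>. F \<omega> - f l (\<lambda>i. X l i \<omega>)) < ennreal \<epsilon>"
    using order_tendstoD(2)[OF l0, of "ennreal \<epsilon>"] \<epsilon> by simp
  moreover have "\<forall>\<^sub>F l in sequentially. \<forall>j\<in>{1..k}. Lp_norm M q (\<lambda>\<omega>. cm_norm M B j
                  (\<lambda>x. G j \<omega> x - cylinder_deriv M B j (n l) (f l) (X l) \<omega> x)) < ennreal (\<epsilon> / 2 ^ k)"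
    using order_tendstoD(2)[OF lj, of _ "ennreal (\<epsilon> / 2 ^ k)"] \<epsilon>
    by (intro eventually_ball_finite) auto
  ultimately have "\<forall>\<^sub>F l in sequentially. Lp_norm M q (\<lambda>\<omega>. F \<omega> - f l (\<lambda>i. X l i \<omega>)) < ennreal \<epsilon> \<and>
      (\<forall>j\<in>{1..k}. Lp_norm M q (\<lambda>\<omega>. cm_norm M B j
                  (\<lambda>x. G j \<omega> x - cylinder_deriv M B j (n l) (f l) (X l) \<omega> x)) < ennreal (\<epsilon> / 2 ^ k))"
    by (rule eventually_conj)
  from eventually_happens'[OF sequentially_bot this]
  obtain l where l: "Lp_norm M q (\<lambda>\<omega>. F \<omega> - f l (\<lambda>i. X l i \<omega>)) < ennreal \<epsilon>"
      "\<And>j. j \<in> {1..k} \<Longrightarrow> Lp_norm M q (\<lambda>\<omega>. cm_norm M B j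
                  (\<lambda>x. G j \<omega> x - cylinder_deriv M B j (n l) (f l) (X l) \<omega> x)) < ennreal (\<epsilon> / 2 ^ k)"
    by blast
  show ?thesis
  proof (rule that[of "n l" "f l" "X l"])
    fix es :: "('d \<times> real \<times> real) list" assume es: "vdirs es" "length es \<le> k"
    show "near q (VG F G es) (cder (n l) (f l) (X l) es) \<epsilon>"
    proof (cases "es = []")
      case True
      then show ?thesis using malliavin_approx_zero[OF F q s(1) s(2) l(1)] by simp
    next
      case False
      then have "length es \<in> {1..k}" using es by (cases es) auto
      then show ?thesis using malliavin_approx_deriv[OF G q es(1) False es(2) s(1) s(2) l(2)] by simp
    qed
  qed (use s in auto)
qed

lemma all_moments_L2: "f \<in> all_moments \<Longrightarrow> f \<in> L2 M"
  using all_momentsD(1)[of f] all_momentsD(2)[of f 2] by (simp add: L2_def)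

lemma near_L2:
  assumes "near q \<Phi> h (\<epsilon> / 2)" "2 \<le> q" "0 < \<epsilon>" "(\<lambda>\<omega>. h (ev \<omega>)) \<in> all_moments"
  shows "\<Phi> \<in> L2 M" "n2 M (\<lambda>\<omega>. \<Phi> \<omega> - h (ev \<omega>)) < \<epsilon>"
proof -
  have m: "(\<lambda>\<omega>. \<Phi> \<omega> - h (ev \<omega>)) \<in> borel_measurable M"
  proof -
    have [measurable]: "\<Phi> \<in> borel_measurable M" using assms(1) by (simp add: near_def)
    note [measurable] = all_momentsD(1)[OF assms(4)]
    show ?thesis by measurable
  qed
  have n: "integrable M (\<lambda>\<omega>. \<bar>\<Phi> \<omega> - h (ev \<omega>)\<bar> ^ q)" "nrm q (\<lambda>\<omega>. \<Phi> \<omega> - h (ev \<omega>)) < \<epsilon> / 2"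
    using assms(1) by (auto simp: near_def)
  note D = L2_of_Lq[OF assms(2,3) m n]
  show "n2 M (\<lambda>\<omega>. \<Phi> \<omega> - h (ev \<omega>)) < \<epsilon>" by (rule D(2))
  show "\<Phi> \<in> L2 M" using L2_lin[OF D(1) all_moments_L2[OF assms(4)], of 1 1] by simp
qed

lemma VG_L2:
  assumes G: "has_malliavin_derivs M B k (real q) F G" and q: "2 \<le> q" and es: "vdirs es" "length es \<le> k"
  shows "VG F G es \<in> L2 M"
proof -
  have q0: "0 < q" using q by simp
  obtain n f X where f: "smooth_poly_growth n f" "\<And>i. i < n \<Longrightarrow> X i \<in> \<C>"
    "\<And>es. vdirs es \<Longrightarrow> length es \<le> k \<Longrightarrow> near q (VG F G es) (cder n f X es) (1 / 2)"
    using malliavin_approx[OF G q0, of "1 / 2"] by (metis half_gt_zero zero_less_one)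
  show ?thesis by (rule near_L2(1)[OF f(3)[OF es] q _ cder_all_moments[OF f(1,2)]]) simp
qed

text \<open>The adjoint of differentiation along \<open>binc e\<close>, applied to P, is
  \<open>binc e\<close> times P minus P'. The right side involves only the derivative of lower
  order, which makes the identity usable in an induction on the order.\<close>

lemma malliavin_test_ibp:
  assumes G: "has_malliavin_derivs M B k (real q) F G" and q: "2 \<le> q"
    and es: "vdirs (e # es)" "length es < k" and P: "cyld (binc e) P P'"
  shows "(\<integral>\<omega>. VG F G (e # es) \<omega> * P (ev \<omega>) \<partial>M) =
    (\<integral>\<omega>. VG F G es \<omega> * (binc e \<omega> * P (ev \<omega>) - P' (ev \<omega>)) \<partial>M)"
proof -
  have q0: "0 < q" using q by simp
  have be: "binc e \<in> \<C>" using es by (intro binc_chaos) auto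
  obtain V where V: "cyl V P" "cyl V P'" using cyld_cyl[OF P] by blast
  note mP = cyl_all_moments[OF V(1)] cyl_all_moments[OF V(2)]
  define Q where "Q \<omega> = binc e \<omega> * P (ev \<omega>) - P' (ev \<omega>)" for \<omega>
  have mQ: "Q \<in> all_moments" unfolding Q_def[abs_def]
    by (rule all_moments_diff[OF all_moments_mult[OF G_moments(1)[OF be] mP(1)] mP(2)])
  have VL: "VG F G (e # es) \<in> L2 M" "VG F G es \<in> L2 M" using es by (auto intro!: VG_L2[OF G q])
  have PL: "(\<lambda>\<omega>. P (ev \<omega>)) \<in> L2 M" "Q \<in> L2 M" using mP mQ by (auto intro: all_moments_L2)
  have "\<bar>(\<integral>\<omega>. VG F G (e # es) \<omega> * P (ev \<omega>) \<partial>M) - (\<integral>\<omega>. VG F G es \<omega> * Q \<omega> \<partial>M)\<bar> \<le> \<epsilon>" if \<epsilon>: "0 < \<epsilon>" for \<epsilon>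
  proof -
    define A where "A = n2 M (\<lambda>\<omega>. P (ev \<omega>)) + n2 M Q + 1"
    have A: "0 < A" unfolding A_def by (intro add_nonneg_pos add_nonneg_nonneg) auto
    define \<delta> where "\<delta> = \<epsilon> / A"
    have \<delta>: "0 < \<delta>" "\<delta> * A = \<epsilon>" using \<epsilon> A by (auto simp: \<delta>_def)
    have d2: "0 < \<delta> / 2" using \<delta> by simp
    obtain n f X where f: "smooth_poly_growth n f" "\<And>i. i < n \<Longrightarrow> X i \<in> \<C>"
      and nr: "\<And>es. vdirs es \<Longrightarrow> length es \<le> k \<Longrightarrow> near q (VG F G es) (cder n f X es) (\<delta> / 2)"
      by (rule malliavin_approx[OF G q0 d2]) blast
    let ?c1 = "cder n f X (e # es)" and ?c0 = "cder n f X es"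
    have c: "cyld (binc e) ?c0 ?c1" by (rule cder_cyld[OF f])
    note m = cder_all_moments[OF f]
    have d1: "n2 M (\<lambda>\<omega>. VG F G (e # es) \<omega> - ?c1 (ev \<omega>)) < \<delta>"
      by (rule near_L2(2)[OF nr q \<delta>(1) m]) (use es in auto)
    have d0: "n2 M (\<lambda>\<omega>. VG F G es \<omega> - ?c0 (ev \<omega>)) < \<delta>"
      by (rule near_L2(2)[OF nr q \<delta>(1) m]) (use es in auto)
    note cL = all_moments_L2[OF m]
    have ibp: "(\<integral>\<omega>. ?c1 (ev \<omega>) * P (ev \<omega>) \<partial>M) = (\<integral>\<omega>. ?c0 (ev \<omega>) * Q \<omega> \<partial>M)"
    proof -
      have "(\<integral>\<omega>. binc e \<omega> * (?c0 (ev \<omega>) * P (ev \<omega>)) \<partial>M) = (\<integral>\<omega>. ?c1 (ev \<omega>) * P (ev \<omega>) + P' (ev \<omega>) * ?c0 (ev \<omega>) \<partial>M)"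
        by (rule cyld_ibp[OF be cyld_mult[OF c P]])
      also have "\<dots> = (\<integral>\<omega>. ?c1 (ev \<omega>) * P (ev \<omega>) \<partial>M) + (\<integral>\<omega>. P' (ev \<omega>) * ?c0 (ev \<omega>) \<partial>M)"
        by (intro Bochner_Integration.integral_add all_moments_integrable all_moments_mult mP m)
      finally have "(\<integral>\<omega>. ?c1 (ev \<omega>) * P (ev \<omega>) \<partial>M) = (\<integral>\<omega>. binc e \<omega> * (?c0 (ev \<omega>) * P (ev \<omega>)) \<partial>M) - (\<integral>\<omega>. P' (ev \<omega>) * ?c0 (ev \<omega>) \<partial>M)"
        by simp
      also have "\<dots> = (\<integral>\<omega>. binc e \<omega> * (?c0 (ev \<omega>) * P (ev \<omega>)) - P' (ev \<omega>) * ?c0 (ev \<omega>) \<partial>M)"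
        by (intro Bochner_Integration.integral_diff[symmetric] all_moments_integrable all_moments_mult mP m G_moments(1)[OF be])
      also have "\<dots> = (\<integral>\<omega>. ?c0 (ev \<omega>) * Q \<omega> \<partial>M)"
        by (intro Bochner_Integration.integral_cong refl) (simp add: Q_def algebra_simps)
      finally show ?thesis .
    qed
    have e1: "\<bar>(\<integral>\<omega>. VG F G (e # es) \<omega> * P (ev \<omega>) \<partial>M) - (\<integral>\<omega>. ?c1 (ev \<omega>) * P (ev \<omega>) \<partial>M)\<bar> \<le> \<delta> * n2 M (\<lambda>\<omega>. P (ev \<omega>))"
    proof -
      have eq: "(\<integral>\<omega>. VG F G (e # es) \<omega> * P (ev \<omega>) \<partial>M) - (\<integral>\<omega>. ?c1 (ev \<omega>) * P (ev \<omega>) \<partial>M) =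
        (\<integral>\<omega>. (VG F G (e # es) \<omega> - ?c1 (ev \<omega>)) * P (ev \<omega>) \<partial>M)"
        using L2_prod_integrable[OF VL(1) PL(1)] L2_prod_integrable[OF cL PL(1)] by (simp add: left_diff_distrib)
      have "\<bar>\<integral>\<omega>. (VG F G (e # es) \<omega> - ?c1 (ev \<omega>)) * P (ev \<omega>) \<partial>M\<bar> \<le> n2 M (\<lambda>\<omega>. VG F G (e # es) \<omega> - ?c1 (ev \<omega>)) * n2 M (\<lambda>\<omega>. P (ev \<omega>))"
        by (rule L2_Cauchy_Schwarz[OF L2_diff[OF VL(1) cL] PL(1)])
      also have "\<dots> \<le> \<delta> * n2 M (\<lambda>\<omega>. P (ev \<omega>))" using d1 by (intro mult_right_mono) auto
      finally show ?thesis unfolding eq .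
    qed
    have e0: "\<bar>(\<integral>\<omega>. VG F G es \<omega> * Q \<omega> \<partial>M) - (\<integral>\<omega>. ?c0 (ev \<omega>) * Q \<omega> \<partial>M)\<bar> \<le> \<delta> * n2 M Q"
    proof -
      have eq: "(\<integral>\<omega>. VG F G es \<omega> * Q \<omega> \<partial>M) - (\<integral>\<omega>. ?c0 (ev \<omega>) * Q \<omega> \<partial>M) =
        (\<integral>\<omega>. (VG F G es \<omega> - ?c0 (ev \<omega>)) * Q \<omega> \<partial>M)"
        using L2_prod_integrable[OF VL(2) PL(2)] L2_prod_integrable[OF cL PL(2)] by (simp add: left_diff_distrib)
      have "\<bar>\<integral>\<omega>. (VG F G es \<omega> - ?c0 (ev \<omega>)) * Q \<omega> \<partial>M\<bar> \<le> n2 M (\<lambda>\<omega>. VG F G es \<omega> - ?c0 (ev \<omega>)) * n2 M Q"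
        by (rule L2_Cauchy_Schwarz[OF L2_diff[OF VL(2) cL] PL(2)])
      also have "\<dots> \<le> \<delta> * n2 M Q" using d0 by (intro mult_right_mono) auto
      finally show ?thesis unfolding eq .
    qed
    have "\<delta> * n2 M (\<lambda>\<omega>. P (ev \<omega>)) + \<delta> * n2 M Q \<le> \<epsilon>"
      using \<delta> by (simp add: A_def algebra_simps)
    then show ?thesis using e1 e0 ibp by linarith
  qed
  then have "\<bar>(\<integral>\<omega>. VG F G (e # es) \<omega> * P (ev \<omega>) \<partial>M) - (\<integral>\<omega>. VG F G es \<omega> * Q \<omega> \<partial>M)\<bar> \<le> 0"
    by (rule field_le_epsilon) simp
  then show ?thesis by (simp add: Q_def)
qed

lemma arctan_lipschitz: "\<bar>arctan a - arctan b\<bar> \<le> \<bar>a - b\<bar>" for a b :: real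
proof -
  have *: "arctan y - arctan x \<le> y - x" if xy: "x < y" for x y :: real
  proof -
    obtain z where "arctan y - arctan x = (y - x) * inverse (1 + z\<^sup>2)"
      using MVT2[OF xy, of arctan "\<lambda>x. inverse (1 + x\<^sup>2)"] DERIV_arctan by blast
    moreover have "inverse (1 + z\<^sup>2) \<le> 1" by (intro inverse_le_1_iff[THEN iffD2]) simp
    ultimately show ?thesis using xy mult_left_mono[of "inverse (1 + z\<^sup>2)" 1 "y - x"] by simp
  qed
  consider "a < b" | "b < a" | "a = b" by linarith
  then show ?thesis
    using *[of a b] *[of b a] arctan_monotone[of a b] arctan_monotone[of b a] by cases auto
qed

text \<open>Closability: a difference of two derivatives is orthogonal to the arctangents of its own
  cylindrical approximations, hence it vanishes.\<close>

lemma malliavin_unique: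
  assumes G1: "has_malliavin_derivs M B k1 (real q1) F G1" and q1: "2 \<le> q1"
    and G2: "has_malliavin_derivs M B k2 (real q2) F G2" and q2: "2 \<le> q2"
    and es: "vdirs es" "length es \<le> k1" "length es \<le> k2"
  shows "AE \<omega> in M. VG F G1 es \<omega> = VG F G2 es \<omega>"
  using es
proof (induction es)
  case Nil
  then show ?case by (simp add: VG_def)
next
  case (Cons e es)
  have IH: "AE \<omega> in M. VG F G1 es \<omega> = VG F G2 es \<omega>" using Cons by auto
  have L1: "VG F G1 (e # es) \<in> L2 M" "VG F G1 es \<in> L2 M" using Cons.prems by (auto intro!: VG_L2[OF G1 q1])
  have L2': "VG F G2 (e # es) \<in> L2 M" "VG F G2 es \<in> L2 M" using Cons.prems by (auto intro!: VG_L2[OF G2 q2])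
  define \<Delta> where "\<Delta> \<omega> = VG F G1 (e # es) \<omega> - VG F G2 (e # es) \<omega>" for \<omega>
  have \<Delta>L: "\<Delta> \<in> L2 M" unfolding \<Delta>_def[abs_def] by (rule L2_diff[OF L1(1) L2'(1)])
  note [measurable] = L2D(1)[OF \<Delta>L] L2D(1)[OF L1(2)] L2D(1)[OF L2'(2)]
  have be: "binc e \<in> \<C>" using Cons.prems by (intro binc_chaos) auto
  \<comment> \<open>By \<open>malliavin_test_ibp\<close> the pairing with P depends only on the
    derivative along \<open>es\<close>, where the two candidates agree by induction.\<close>
  have test: "(\<integral>\<omega>. \<Delta> \<omega> * P (ev \<omega>) \<partial>M) = 0" if P: "cyld (binc e) P P'" for P P'
  proof -
    obtain V where V: "cyl V P" "cyl V P'" using cyld_cyl[OF P] by blast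
    note mP = cyl_all_moments[OF V(1)] cyl_all_moments[OF V(2)]
    note [measurable] = all_momentsD(1)[OF mP(1)] all_momentsD(1)[OF mP(2)] G_measurable[OF be]
    have "(\<integral>\<omega>. \<Delta> \<omega> * P (ev \<omega>) \<partial>M) = (\<integral>\<omega>. VG F G1 (e # es) \<omega> * P (ev \<omega>) \<partial>M) - (\<integral>\<omega>. VG F G2 (e # es) \<omega> * P (ev \<omega>) \<partial>M)"
      using L2_prod_integrable[OF L1(1) all_moments_L2[OF mP(1)]] L2_prod_integrable[OF L2'(1) all_moments_L2[OF mP(1)]]
      by (simp add: \<Delta>_def left_diff_distrib)
    also have "(\<integral>\<omega>. VG F G1 (e # es) \<omega> * P (ev \<omega>) \<partial>M) = (\<integral>\<omega>. VG F G1 es \<omega> * (binc e \<omega> * P (ev \<omega>) - P' (ev \<omega>)) \<partial>M)"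
      using Cons.prems by (intro malliavin_test_ibp[OF G1 q1 _ _ P]) auto
    also have "\<dots> = (\<integral>\<omega>. VG F G2 es \<omega> * (binc e \<omega> * P (ev \<omega>) - P' (ev \<omega>)) \<partial>M)"
      using IH by (intro integral_cong_AE) auto
    also have "\<dots> = (\<integral>\<omega>. VG F G2 (e # es) \<omega> * P (ev \<omega>) \<partial>M)"
      using Cons.prems by (intro malliavin_test_ibp[OF G2 q2 _ _ P, symmetric]) auto
    finally show ?thesis by simp
  qed
  have atL: "(\<lambda>\<omega>. arctan (u \<omega>)) \<in> L2 M" if [measurable]: "u \<in> borel_measurable M" for u
  proof -
    have "\<bar>arctan x\<bar> \<le> 2" for x using arctan_bounded[of x] pi_less_4 by (simp add: abs_le_iff)
    then have "(arctan x)\<^sup>2 \<le> 2\<^sup>2" for x by (metis abs_le_square_iff abs_numeral)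
    then have "integrable M (\<lambda>\<omega>. (arctan (u \<omega>))\<^sup>2)" by (intro integrable_const_bound[of _ "2\<^sup>2"]) auto
    then show ?thesis by (simp add: L2_def)
  qed
  have "\<bar>\<integral>\<omega>. \<Delta> \<omega> * arctan (\<Delta> \<omega>) \<partial>M\<bar> \<le> \<epsilon>" if \<epsilon>: "0 < \<epsilon>" for \<epsilon>
  proof -
    have A: "0 < n2 M \<Delta> + 1" using n2_nonneg[of M \<Delta>] by linarith
    define K where "K = n2 M \<Delta> + 1"
    define \<delta> where "\<delta> = \<epsilon> / (2 * K)"
    have \<delta>: "0 < \<delta>" "2 * \<delta> * K = \<epsilon>" using \<epsilon> A by (auto simp: \<delta>_def K_def[symmetric])
    have d2: "0 < \<delta> / 2" using \<delta> by simp
    have q10: "0 < q1" and q20: "0 < q2" using q1 q2 by auto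
    obtain n1 f1 X1 where f1: "smooth_poly_growth n1 f1" "\<And>i. i < n1 \<Longrightarrow> X1 i \<in> \<C>"
      and n1: "\<And>es. vdirs es \<Longrightarrow> length es \<le> k1 \<Longrightarrow> near q1 (VG F G1 es) (cder n1 f1 X1 es) (\<delta> / 2)"
      by (rule malliavin_approx[OF G1 q10 d2]) blast
    obtain nn2 f2 X2 where f2: "smooth_poly_growth nn2 f2" "\<And>i. i < nn2 \<Longrightarrow> X2 i \<in> \<C>"
      and near2: "\<And>es. vdirs es \<Longrightarrow> length es \<le> k2 \<Longrightarrow> near q2 (VG F G2 es) (cder nn2 f2 X2 es) (\<delta> / 2)"
      by (rule malliavin_approx[OF G2 q20 d2]) blast
    note m1 = cder_all_moments[OF f1, where es="e # es"] and m2 = cder_all_moments[OF f2, where es="e # es"]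
    \<comment> \<open>An approximation of \<Delta> which is itself differentiable along
      \<open>binc e\<close>, so its arctangent is admissible in \<open>test\<close>; the Lipschitz
      property then compares it with the arctangent of \<Delta>.\<close>
    define C where "C z = cder n1 f1 X1 (e # es) z + (-1) * cder nn2 f2 X2 (e # es) z" for z
    define C' where "C' z = cder n1 f1 X1 (e # e # es) z + (0 * cder nn2 f2 X2 (e # es) z + cder nn2 f2 X2 (e # e # es) z * (-1))" for z
    have C: "cyld (binc e) C C'" unfolding C_def[abs_def] C'_def[abs_def]
      by (intro cyld_add cyld_mult cyld_const cder_cyld f1 f2)
    have C0: "(\<integral>\<omega>. \<Delta> \<omega> * arctan (C (ev \<omega>)) \<partial>M) = 0" by (rule test[OF cyld_arctan[OF C]])
    obtain V where "cyl V C" using cyld_cyl[OF C] by blast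
    then have Cm: "(\<lambda>\<omega>. C (ev \<omega>)) \<in> all_moments" by (rule cyl_all_moments)
    note [measurable] = all_momentsD(1)[OF Cm]
    have D1: "n2 M (\<lambda>\<omega>. VG F G1 (e # es) \<omega> - cder n1 f1 X1 (e # es) (ev \<omega>)) < \<delta>"
      by (rule near_L2(2)[OF n1 q1 \<delta>(1) m1]) (use Cons.prems in auto)
    have D2: "n2 M (\<lambda>\<omega>. VG F G2 (e # es) \<omega> - cder nn2 f2 X2 (e # es) (ev \<omega>)) < \<delta>"
      by (rule near_L2(2)[OF near2 q2 \<delta>(1) m2]) (use Cons.prems in auto)
    note LA = L2_diff[OF L1(1) all_moments_L2[OF m1]] and LB = L2_diff[OF L2'(1) all_moments_L2[OF m2]]
    have CL: "(\<lambda>\<omega>. \<Delta> \<omega> - C (ev \<omega>)) \<in> L2 M" by (rule L2_diff[OF \<Delta>L all_moments_L2[OF Cm]])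
    have "n2 M (\<lambda>\<omega>. \<Delta> \<omega> - C (ev \<omega>)) = n2 M (\<lambda>\<omega>. (VG F G1 (e # es) \<omega> - cder n1 f1 X1 (e # es) (ev \<omega>)) + (-1) * (VG F G2 (e # es) \<omega> - cder nn2 f2 X2 (e # es) (ev \<omega>)))"
      by (intro arg_cong[where f="n2 M"] ext) (simp add: \<Delta>_def C_def)
    also have "\<dots> \<le> n2 M (\<lambda>\<omega>. VG F G1 (e # es) \<omega> - cder n1 f1 X1 (e # es) (ev \<omega>)) + n2 M (\<lambda>\<omega>. (-1) * (VG F G2 (e # es) \<omega> - cder nn2 f2 X2 (e # es) (ev \<omega>)))"
      using n2_add[OF LA L2_lin[OF LB LB, where a="-1" and b=0]] by simp
    also have "\<dots> \<le> 2 * \<delta>" unfolding n2_cmult using D1 D2 by simp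
    finally have nC: "n2 M (\<lambda>\<omega>. \<Delta> \<omega> - C (ev \<omega>)) \<le> 2 * \<delta>" .
    have dL: "(\<lambda>\<omega>. arctan (\<Delta> \<omega>) - arctan (C (ev \<omega>))) \<in> L2 M" by (intro L2_diff atL) measurable
    have "n2 M (\<lambda>\<omega>. arctan (\<Delta> \<omega>) - arctan (C (ev \<omega>))) \<le> n2 M (\<lambda>\<omega>. \<Delta> \<omega> - C (ev \<omega>))"
      unfolding n2_def
      by (intro real_sqrt_le_mono integral_mono L2D(2)[OF dL] L2D(2)[OF CL] iffD1[OF abs_le_square_iff] arctan_lipschitz)
    then have nd: "n2 M (\<lambda>\<omega>. arctan (\<Delta> \<omega>) - arctan (C (ev \<omega>))) \<le> 2 * \<delta>" using nC by linarith
    have eq: "(\<integral>\<omega>. \<Delta> \<omega> * arctan (\<Delta> \<omega>) \<partial>M) = (\<integral>\<omega>. \<Delta> \<omega> * (arctan (\<Delta> \<omega>) - arctan (C (ev \<omega>))) \<partial>M)"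
      using C0 L2_prod_integrable[OF \<Delta>L atL] by (simp add: right_diff_distrib)
    have "\<bar>\<integral>\<omega>. \<Delta> \<omega> * (arctan (\<Delta> \<omega>) - arctan (C (ev \<omega>))) \<partial>M\<bar> \<le> n2 M \<Delta> * n2 M (\<lambda>\<omega>. arctan (\<Delta> \<omega>) - arctan (C (ev \<omega>)))"
      by (rule L2_Cauchy_Schwarz[OF \<Delta>L dL])
    also have "\<dots> \<le> n2 M \<Delta> * (2 * \<delta>)" using nd by (intro mult_left_mono) auto
    also have "\<dots> \<le> \<epsilon>" using \<delta> by (simp add: K_def algebra_simps)
    finally show ?thesis unfolding eq .
  qed
  then have "\<bar>\<integral>\<omega>. \<Delta> \<omega> * arctan (\<Delta> \<omega>) \<partial>M\<bar> \<le> 0" by (rule field_le_epsilon) simp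
  then have E0: "(\<integral>\<omega>. \<Delta> \<omega> * arctan (\<Delta> \<omega>) \<partial>M) = 0" by (simp only: abs_le_zero_iff)
  \<comment> \<open>x and arctan x have the same sign, so the vanishing integral forces the
    integrand, and with it \<Delta>, to be 0 almost surely.\<close>
  have nn: "0 \<le> x * arctan x" for x :: real
    using arctan_le_zero_iff[of x] zero_le_arctan_iff[of x] by (cases "0 \<le> x") (auto intro: mult_nonneg_nonneg mult_nonpos_nonpos)
  have int: "integrable M (\<lambda>\<omega>. \<Delta> \<omega> * arctan (\<Delta> \<omega>))" by (intro L2_prod_integrable \<Delta>L atL) measurable
  have "AE \<omega> in M. \<Delta> \<omega> * arctan (\<Delta> \<omega>) = 0"
    using integral_nonneg_eq_0_iff_AE[OF int] nn E0 by simp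
  then show ?case by eventually_elim (auto simp: \<Delta>_def)
qed

end

section \<open>The chosen versions of the derivatives and their bounds\<close>

context fbm
begin

text \<open>Each order uses its own \<open>SOME\<close>-chosen family, taken with exponent 2.
  Relations between orders, and other exponents, have to come through the almost sure identity
  \<open>W_AE\<close>.\<close>

definition W :: "('w \<Rightarrow> real) \<Rightarrow> ('d \<times> real \<times> real) list \<Rightarrow> 'w \<Rightarrow> real" where
  "W F es = VG F (\<lambda>r. malliavin_D M B r F) es"

lemma malliavin_smoothE:
  assumes "F \<in> malliavin_smooth M B" "1 \<le> k" "1 \<le> q"
  obtains G where "has_malliavin_derivs M B k (real q) F G"
proof -
  have "F \<in> malliavin_space M B k (real q)"
    using assms unfolding malliavin_smooth_def by auto
  then show ?thesis using that by (auto simp: malliavin_space_def)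
qed

lemma W_witness:
  assumes "F \<in> malliavin_smooth M B" "es \<noteq> []"
  obtains G where "has_malliavin_derivs M B (length es) (real 2) F G" "W F es = VG F G es"
    "malliavin_D M B (length es) F = G (length es)"
proof -
  define G where "G = (SOME G. has_malliavin_derivs M B (length es) 2 F G)"
  have "1 \<le> length es" using assms(2) by (cases es) auto
  then obtain G' where "has_malliavin_derivs M B (length es) (real 2) F G'"
    by (rule malliavin_smoothE[OF assms(1), of _ 2]) auto
  then have "has_malliavin_derivs M B (length es) 2 F G"
    unfolding G_def by (intro someI[of "has_malliavin_derivs M B (length es) 2 F" G']) simp
  moreover have D: "malliavin_D M B (length es) F = G (length es)" by (simp add: malliavin_D_def G_def)
  moreover have "W F es = VG F G es"
    by (rule ext) (simp add: W_def VG_def D)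
  ultimately show ?thesis using that by simp
qed

lemma W_AE:
  assumes F: "F \<in> malliavin_smooth M B" and es: "vdirs es" "length es \<le> k"
    and G: "has_malliavin_derivs M B k (real q) F G" "2 \<le> q"
  shows "AE \<omega> in M. W F es \<omega> = VG F G es \<omega>"
proof (cases "es = []")
  case True
  then show ?thesis by (simp add: W_def VG_def)
next
  case False
  obtain G0 where G0: "has_malliavin_derivs M B (length es) (real 2) F G0" "W F es = VG F G0 es"
    by (rule W_witness[OF F False])
  show ?thesis unfolding G0(2) by (rule malliavin_unique[OF G0(1) _ G es(1) _ es(2)]) auto
qed

lemma W_measurable:
  assumes F: "F \<in> malliavin_smooth M B" and es: "vdirs es"
  shows "W F es \<in> borel_measurable M"
proof (cases "es = []")
  case True
  obtain G where "has_malliavin_derivs M B 1 (real 2) F G" by (rule malliavin_smoothE[OF F, of 1 2]) auto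
  then show ?thesis using True by (simp add: W_def VG_def[abs_def] has_malliavin_derivs_def)
next
  case False
  obtain G0 where G0: "has_malliavin_derivs M B (length es) (real 2) F G0" "W F es = VG F G0 es"
    by (rule W_witness[OF F False])
  show ?thesis unfolding G0(2) by (rule L2D(1)[OF VG_L2[OF G0(1) _ es]]) auto
qed

text \<open>A witness for order \<open>Suc (length es)\<close> and exponent q provides a common
  approximant for both lists; it is transferred to the chosen versions along the almost sure
  equalities.\<close>

lemma W_approx:
  assumes F: "F \<in> malliavin_smooth M B" and e: "vdirs (e # es)" and q: "2 \<le> q" and \<epsilon>: "0 < \<epsilon>"
  obtains n f X where "smooth_poly_growth n f" "\<And>i. i < n \<Longrightarrow> X i \<in> \<C>"
    "near q (W F es) (cder n f X es) \<epsilon>" "near q (W F (e # es)) (cder n f X (e # es)) \<epsilon>"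
proof -
  obtain G where G: "has_malliavin_derivs M B (Suc (length es)) (real q) F G"
    by (rule malliavin_smoothE[OF F, of "Suc (length es)" q]) (use q in auto)
  have q0: "0 < q" using q by simp
  obtain n f X where f: "smooth_poly_growth n f" "\<And>i. i < n \<Longrightarrow> X i \<in> \<C>"
    and nr: "\<And>ds. vdirs ds \<Longrightarrow> length ds \<le> Suc (length es) \<Longrightarrow> near q (VG F G ds) (cder n f X ds) \<epsilon>"
    by (rule malliavin_approx[OF G q0 \<epsilon>]) blast
  have "near q (W F ds) (cder n f X ds) \<epsilon>" if ds: "vdirs ds" "length ds \<le> Suc (length es)" for ds
  proof -
    have m: "W F ds \<in> borel_measurable M" by (rule W_measurable[OF F ds(1)])
    have ae: "AE \<omega> in M. W F ds \<omega> = VG F G ds \<omega>" by (rule W_AE[OF F ds G q])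
    have n: "near q (VG F G ds) (cder n f X ds) \<epsilon>" by (rule nr[OF ds])
    have Vm: "VG F G ds \<in> borel_measurable M" using n by (simp add: near_def)
    have c: "(\<lambda>\<omega>. cder n f X ds (ev \<omega>)) \<in> borel_measurable M"
      by (rule all_momentsD(1)[OF cder_all_moments[OF f]])
    have i: "integrable M (\<lambda>\<omega>. \<bar>W F ds \<omega> - cder n f X ds (ev \<omega>)\<bar> ^ q)"
    proof (rule integrable_cong_AE_imp)
      show "integrable M (\<lambda>\<omega>. \<bar>VG F G ds \<omega> - cder n f X ds (ev \<omega>)\<bar> ^ q)" using n by (simp add: near_def)
      show "(\<lambda>\<omega>. \<bar>W F ds \<omega> - cder n f X ds (ev \<omega>)\<bar> ^ q) \<in> borel_measurable M" using m c by measurable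
      show "AE \<omega> in M. \<bar>VG F G ds \<omega> - cder n f X ds (ev \<omega>)\<bar> ^ q = \<bar>W F ds \<omega> - cder n f X ds (ev \<omega>)\<bar> ^ q"
        using ae by eventually_elim simp
    qed
    have "nrm q (\<lambda>\<omega>. W F ds \<omega> - cder n f X ds (ev \<omega>)) = nrm q (\<lambda>\<omega>. VG F G ds \<omega> - cder n f X ds (ev \<omega>))"
    proof (rule nrm_cong_AE)
      show "AE \<omega> in M. W F ds \<omega> - cder n f X ds (ev \<omega>) = VG F G ds \<omega> - cder n f X ds (ev \<omega>)"
        using ae by eventually_elim simp
    qed (use m c Vm in measurable)
    then show ?thesis using n m i by (simp add: near_def)
  qed
  then show ?thesis using that[OF f] e by simp
qed

lemma W_all_moments:
  assumes F: "F \<in> malliavin_smooth M B" and es: "vdirs es"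
  shows "W F es \<in> all_moments"
  unfolding all_moments_def
proof safe
  show m: "W F es \<in> borel_measurable M" by (rule W_measurable[OF F es])
  fix q :: nat
  define p where "p = max q 2"
  \<comment> \<open>\<open>W_approx\<close> speaks about a list with a head. A direction of length 0
    fills that place, and only the statement about the tail is used.\<close>
  have e: "vdirs ((undefined, 0, 0) # es)" using es by (simp add: vdir_def)
  have p2: "2 \<le> p" by (simp add: p_def)
  obtain n f X where f: "smooth_poly_growth n f" "\<And>i. i < n \<Longrightarrow> X i \<in> \<C>"
    and nr: "near p (W F es) (cder n f X es) 1"
    by (rule W_approx[OF F e p2 zero_less_one]) blast
  let ?c = "\<lambda>\<omega>. cder n f X es (ev \<omega>)"
  have c: "?c \<in> all_moments" by (rule cder_all_moments[OF f])
  have i: "integrable M (\<lambda>\<omega>. 2 ^ q * ((1 + \<bar>W F es \<omega> - ?c \<omega>\<bar> ^ p) + \<bar>?c \<omega>\<bar> ^ q))"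
    using nr all_momentsD(2)[OF c, of q] by (simp add: near_def)
  show "integrable M (\<lambda>\<omega>. \<bar>W F es \<omega>\<bar> ^ q)"
  proof (rule Bochner_Integration.integrable_bound[OF i])
    show "(\<lambda>\<omega>. \<bar>W F es \<omega>\<bar> ^ q) \<in> borel_measurable M" using m by measurable
    show "AE \<omega> in M. norm (\<bar>W F es \<omega>\<bar> ^ q) \<le> norm (2 ^ q * ((1 + \<bar>W F es \<omega> - ?c \<omega>\<bar> ^ p) + \<bar>?c \<omega>\<bar> ^ q))"
    proof (rule AE_I2)
      fix \<omega>
      have "\<bar>W F es \<omega>\<bar> ^ q \<le> (\<bar>W F es \<omega> - ?c \<omega>\<bar> + \<bar>?c \<omega>\<bar>) ^ q" by (rule power_mono) auto
      also have "\<dots> \<le> 2 ^ q * (\<bar>W F es \<omega> - ?c \<omega>\<bar> ^ q + \<bar>?c \<omega>\<bar> ^ q)" by (rule power_add_le) auto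
      also have "\<bar>W F es \<omega> - ?c \<omega>\<bar> ^ q \<le> 1 + \<bar>W F es \<omega> - ?c \<omega>\<bar> ^ p"
      proof (cases "\<bar>W F es \<omega> - ?c \<omega>\<bar> \<le> 1")
        case True
        then have "\<bar>W F es \<omega> - ?c \<omega>\<bar> ^ q \<le> 1" by (intro power_le_one) auto
        moreover have "0 \<le> \<bar>W F es \<omega> - ?c \<omega>\<bar> ^ p" by simp
        ultimately show ?thesis by linarith
      next
        case False
        then have "\<bar>W F es \<omega> - ?c \<omega>\<bar> ^ q \<le> \<bar>W F es \<omega> - ?c \<omega>\<bar> ^ p" by (intro power_increasing) (auto simp: p_def)
        then show ?thesis by simp
      qed
      finally have "\<bar>W F es \<omega>\<bar> ^ q \<le> 2 ^ q * ((1 + \<bar>W F es \<omega> - ?c \<omega>\<bar> ^ p) + \<bar>?c \<omega>\<bar> ^ q)"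
        by simp
      then show "norm (\<bar>W F es \<omega>\<bar> ^ q) \<le> norm (2 ^ q * ((1 + \<bar>W F es \<omega> - ?c \<omega>\<bar> ^ p) + \<bar>?c \<omega>\<bar> ^ q))"
        by (simp add: abs_mult)
    qed
  qed
qed

text \<open>The approximants of \<open>W F es\<close> and of \<open>W F (e # es)\<close> come from
  the same cylinder functional, and these are related by \<open>cder_cyld\<close>. From here on,
  Malliavin derivatives obey the product rule and integration by parts of
  \<open>mder\<close>.\<close>

lemma mder_W:
  assumes F: "F \<in> malliavin_smooth M B" and e: "vdirs (e # es)"
  shows "mder (binc e) (W F es) (W F (e # es))"
  unfolding mder_def
proof (intro conjI allI impI)
  have es: "vdirs es" using e by simp
  show A: "W F es \<in> all_moments" "W F (e # es) \<in> all_moments"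
    using W_all_moments[OF F es] W_all_moments[OF F e] by auto
  fix q :: nat and \<epsilon> :: real assume q: "0 < q" and \<epsilon>: "0 < \<epsilon>"
  have p2: "2 \<le> max q 2" by simp
  obtain n f X where f: "smooth_poly_growth n f" "\<And>i. i < n \<Longrightarrow> X i \<in> \<C>"
    and nr: "near (max q 2) (W F es) (cder n f X es) \<epsilon>" "near (max q 2) (W F (e # es)) (cder n f X (e # es)) \<epsilon>"
    by (rule W_approx[OF F e p2 \<epsilon>]) blast
  note m = all_moments_diff[OF A(1) cder_all_moments[where es=es and X=X, OF f]]
    all_moments_diff[OF A(2) cder_all_moments[where es="e # es" and X=X, OF f]]
  have "nrm q (\<lambda>\<omega>. W F es \<omega> - cder n f X es (ev \<omega>)) < \<epsilon>"
    using nrm_mono_exponent[OF q _ m(1), of "max q 2"] nr(1) by (simp add: near_def)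
  moreover have "nrm q (\<lambda>\<omega>. W F (e # es) \<omega> - cder n f X (e # es) (ev \<omega>)) < \<epsilon>"
    using nrm_mono_exponent[OF q _ m(2), of "max q 2"] nr(2) by (simp add: near_def)
  ultimately show "\<exists>f f'. cyld (binc e) f f' \<and> nrm q (\<lambda>\<omega>. W F es \<omega> - f (ev \<omega>)) < \<epsilon> \<and>
        nrm q (\<lambda>\<omega>. W F (e # es) \<omega> - f' (ev \<omega>)) < \<epsilon>"
    using cder_cyld[where X=X and e=e and es=es, OF f] by blast
qed

abbreviation "len e \<equiv> (snd (snd e) - fst (snd e)) powr (2 * H)"

text \<open>By the reproducing property each corner value of \<phi> is a value of the derivative
  itself. A box has finitely many corners, so the exceptional null sets can be combined.\<close>

lemma W_rect_incr:
  assumes F: "F \<in> malliavin_smooth M B" and es: "vdirs es" "length es = r" "1 \<le> r"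
    and \<alpha>: "\<And>i. i < r \<Longrightarrow> fst (es ! i) = \<alpha> i"
    and \<phi>: "\<And>u. u \<in> {..<r} \<rightarrow>\<^sub>E {0..1} \<Longrightarrow> AE \<omega> in M. \<phi> u \<omega> =
              cm_inner M B r (malliavin_D M B r F \<omega>) (cm_sym_tensor r (\<lambda>i. cm_psi H (u i) (\<alpha> i)))"
  shows "AE \<omega> in M. W F es \<omega> = rect_incr r (\<lambda>u. \<phi> u \<omega>) (\<lambda>i\<in>{..<r}. fst (snd (es ! i))) (\<lambda>i\<in>{..<r}. snd (snd (es ! i)))"
proof -
  define u where "u A = (\<lambda>i. if i \<in> A then (\<lambda>i\<in>{..<r}. snd (snd (es ! i))) i else (\<lambda>i\<in>{..<r}. fst (snd (es ! i))) i)" for A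
  have u: "u A \<in> {..<r} \<rightarrow>\<^sub>E {0..1}" if "A \<in> Pow {..<r}" for A
    using that es by (auto simp: u_def vdir_def PiE_iff extensional_def)
  have ne: "es \<noteq> []" using es by auto
  obtain G where G: "has_malliavin_derivs M B r (real 2) F G" "malliavin_D M B r F = G r"
    using W_witness[OF F ne] es(2) by metis
  have sym: "malliavin_D M B r F \<omega> \<in> cm_sym_space M B r" if "\<omega> \<in> space M" for \<omega>
    using G es(3) that unfolding has_malliavin_derivs_def by auto
  have "AE \<omega> in M. \<forall>A\<in>Pow {..<r}. \<phi> (u A) \<omega> =
      cm_inner M B r (malliavin_D M B r F \<omega>) (cm_sym_tensor r (\<lambda>i. cm_psi H (u A i) (\<alpha> i)))"
    using \<phi>[OF u] by (intro AE_finite_allI) auto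
  then show ?thesis
  proof (rule AE_mp, intro AE_I2 impI)
    fix \<omega> assume \<omega>: "\<omega> \<in> space M" and eq: "\<forall>A\<in>Pow {..<r}. \<phi> (u A) \<omega> =
      cm_inner M B r (malliavin_D M B r F \<omega>) (cm_sym_tensor r (\<lambda>i. cm_psi H (u A i) (\<alpha> i)))"
    have "\<phi> (u A) \<omega> = malliavin_D M B r F \<omega> (pt es A)" if A: "A \<in> Pow {..<r}" for A
    proof -
      have "\<phi> (u A) \<omega> = malliavin_D M B r F \<omega> (\<lambda>i\<in>{..<r}. (u A i, \<alpha> i))"
        using eq A cm_inner_psi[OF sym[OF \<omega>] u[OF A]] by simp
      also have "(\<lambda>i\<in>{..<r}. (u A i, \<alpha> i)) = pt es A"
        unfolding pt_def es(2) using \<alpha> by (intro restrict_ext) (auto simp: u_def)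
      finally show ?thesis .
    qed
    then show "W F es \<omega> = rect_incr r (\<lambda>u. \<phi> u \<omega>) (\<lambda>i\<in>{..<r}. fst (snd (es ! i))) (\<lambda>i\<in>{..<r}. snd (snd (es ! i)))"
      using ne unfolding W_def VG_def rinc_def rect_incr_def es(2)
      by (auto simp: u_def[symmetric] intro!: sum.cong)
  qed
qed

text \<open>Order 0 is the bound on \<open>F\<close> itself. For r >= 1 the bounding variable of the
  class depends on the tuple of coordinates; there are finitely many tuples, and the sum of absolute
  values bounds them all.\<close>

lemma class_J_bound:
  assumes F: "F \<in> class_J M H B"
  shows "\<exists>C\<in>all_moments. \<forall>t\<in>{0..1}. \<forall>es. length es = r \<longrightarrow> vdirs es \<longrightarrow> (\<forall>e\<in>set es. fst (snd e) \<le> snd (snd e)) \<longrightarrow>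
     (AE \<omega> in M. \<bar>W (F t) es \<omega>\<bar> \<le> C \<omega> * (\<Prod>i<r. len (es ! i)))"
proof (cases "r = 0")
  case True
  obtain C where "C \<in> L_infty_minus M" "\<And>t. t \<in> {0..1} \<Longrightarrow> AE \<omega> in M. \<bar>F t \<omega>\<bar> \<le> C \<omega>"
    using F unfolding class_J_def by blast
  then show ?thesis using True by (auto simp: L_infty_minus_eq W_def VG_def intro!: bexI[of _ C])
next
  case False
  then have r: "1 \<le> r" by simp
  \<comment> \<open>Only the first r coordinates matter; extensional functions make the set of
    tuples finite.\<close>
  define I where "I = {..<r} \<rightarrow>\<^sub>E (UNIV :: 'd set)"
  have fI: "finite I" unfolding I_def by (intro finite_PiE) auto
  define Q where "Q \<alpha> C' t \<longleftrightarrow> (\<exists>\<phi>.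
        (\<forall>u\<in>{..<r} \<rightarrow>\<^sub>E {0..1}. \<phi> u \<in> borel_measurable M \<and>
           (AE \<omega> in M. \<phi> u \<omega> =
              cm_inner M B r (malliavin_D M B r (F t) \<omega>) (cm_sym_tensor r (\<lambda>i. cm_psi H (u i) (\<alpha> i))))) \<and>
        (AE \<omega> in M. continuous_on ({..<r} \<rightarrow>\<^sub>E {0..1}) (\<lambda>u. \<phi> u \<omega>) \<and>
           (\<forall>a\<in>{..<r} \<rightarrow>\<^sub>E {0..1}. \<forall>b\<in>{..<r} \<rightarrow>\<^sub>E {0..1}. (\<forall>i<r. a i \<le> b i) \<longrightarrow>
              \<bar>rect_incr r (\<lambda>u. \<phi> u \<omega>) a b\<bar> \<le> C' \<omega> * (\<Prod>i<r. (b i - a i) powr (2 * H)))))" for \<alpha> C' t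
  have "\<forall>\<alpha>. \<exists>C'. C' \<in> L_infty_minus M \<and> (\<forall>t\<in>{0..1}. Q \<alpha> C' t)"
    using F r unfolding class_J_def Q_def Bex_def[symmetric] by blast
  then have "\<exists>C'. \<forall>\<alpha>. C' \<alpha> \<in> L_infty_minus M \<and> (\<forall>t\<in>{0..1}. Q \<alpha> (C' \<alpha>) t)" by (rule choice)
  then obtain C' where C': "\<And>\<alpha>. C' \<alpha> \<in> L_infty_minus M" and ex: "\<And>\<alpha> t. t \<in> {0..1} \<Longrightarrow> Q \<alpha> (C' \<alpha>) t"
    by blast
  define C where "C \<omega> = (\<Sum>\<alpha>\<in>I. \<bar>C' \<alpha> \<omega>\<bar>)" for \<omega>
  have C: "C \<in> all_moments" unfolding C_def[abs_def]
    using C' by (intro all_moments_sum all_moments_abs) (auto simp: L_infty_minus_eq)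
  have "AE \<omega> in M. \<bar>W (F t) es \<omega>\<bar> \<le> C \<omega> * (\<Prod>i<r. len (es ! i))"
    if t: "t \<in> {0..1}" and es: "length es = r" "vdirs es" "\<forall>e\<in>set es. fst (snd e) \<le> snd (snd e)" for t es
  proof -
    define \<alpha> where "\<alpha> = (\<lambda>i\<in>{..<r}. fst (es ! i))"
    have \<alpha>I: "\<alpha> \<in> I" unfolding \<alpha>_def I_def by (simp add: restrict_PiE_iff)
    define a b where "a = (\<lambda>i\<in>{..<r}. fst (snd (es ! i)))" and "b = (\<lambda>i\<in>{..<r}. snd (snd (es ! i)))"
    have ab: "a \<in> {..<r} \<rightarrow>\<^sub>E {0..1}" "b \<in> {..<r} \<rightarrow>\<^sub>E {0..1}" "\<forall>i<r. a i \<le> b i"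
      using es unfolding a_def b_def by (simp_all add: restrict_PiE_iff vdir_def)
    obtain \<phi> where \<phi>: "\<And>u. u \<in> {..<r} \<rightarrow>\<^sub>E {0..1} \<Longrightarrow> AE \<omega> in M. \<phi> u \<omega> =
              cm_inner M B r (malliavin_D M B r (F t) \<omega>) (cm_sym_tensor r (\<lambda>i. cm_psi H (u i) (\<alpha> i)))"
      and bd: "AE \<omega> in M. continuous_on ({..<r} \<rightarrow>\<^sub>E {0..1}) (\<lambda>u. \<phi> u \<omega>) \<and>
           (\<forall>a\<in>{..<r} \<rightarrow>\<^sub>E {0..1}. \<forall>b\<in>{..<r} \<rightarrow>\<^sub>E {0..1}. (\<forall>i<r. a i \<le> b i) \<longrightarrow>
              \<bar>rect_incr r (\<lambda>u. \<phi> u \<omega>) a b\<bar> \<le> C' \<alpha> \<omega> * (\<Prod>i<r. (b i - a i) powr (2 * H)))"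
      using ex[OF t, of \<alpha>] unfolding Q_def by blast
    have Ft: "F t \<in> malliavin_smooth M B" using F t by (auto simp: class_J_def)
    have eq: "AE \<omega> in M. W (F t) es \<omega> = rect_incr r (\<lambda>u. \<phi> u \<omega>) a b"
      unfolding a_def b_def
      by (rule W_rect_incr[OF Ft es(2,1) r, where \<alpha>=\<alpha>]) (use \<phi> in \<open>auto simp: \<alpha>_def\<close>)
    show ?thesis using eq bd
    proof eventually_elim
      case (elim \<omega>)
      have "\<bar>W (F t) es \<omega>\<bar> \<le> C' \<alpha> \<omega> * (\<Prod>i<r. (b i - a i) powr (2 * H))"
        using elim ab by simp
      also have "\<dots> \<le> C \<omega> * (\<Prod>i<r. (b i - a i) powr (2 * H))"
      proof (rule mult_right_mono)
        have "C' \<alpha> \<omega> \<le> \<bar>C' \<alpha> \<omega>\<bar>" by simp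
        also have "\<dots> \<le> C \<omega>" unfolding C_def using \<alpha>I fI by (intro member_le_sum) auto
        finally show "C' \<alpha> \<omega> \<le> C \<omega>" .
      qed (auto intro!: prod_nonneg)
      also have "(\<Prod>i<r. (b i - a i) powr (2 * H)) = (\<Prod>i<r. len (es ! i))"
        by (intro prod.cong refl) (auto simp: a_def b_def)
      finally show ?case .
    qed
  qed
  then show ?thesis using C by blast
qed

lemma class_J_nrm_bound:
  assumes F: "F \<in> class_J M H B" and q: "0 < q"
  shows "\<exists>K\<ge>0. \<forall>t\<in>{0..1}. \<forall>es. length es = r \<longrightarrow> vdirs es \<longrightarrow> (\<forall>e\<in>set es. fst (snd e) \<le> snd (snd e)) \<longrightarrow>
     nrm q (W (F t) es) \<le> K * (\<Prod>i<r. len (es ! i))"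
proof -
  obtain C where C: "C \<in> all_moments" and bd: "\<And>t es. t \<in> {0..1} \<Longrightarrow> length es = r \<Longrightarrow> vdirs es \<Longrightarrow>
      (\<forall>e\<in>set es. fst (snd e) \<le> snd (snd e)) \<Longrightarrow> AE \<omega> in M. \<bar>W (F t) es \<omega>\<bar> \<le> C \<omega> * (\<Prod>i<r. len (es ! i))"
    using class_J_bound[OF F, of r] by blast
  show ?thesis
  proof (intro exI[of _ "nrm q C"] conjI nrm_nonneg ballI allI impI)
    fix t es assume t: "t \<in> {0..1::real}" and es: "length es = r" "vdirs es" "\<forall>e\<in>set es. fst (snd e) \<le> snd (snd e)"
    define L where "L = (\<Prod>i<r. len (es ! i))"
    have L: "0 \<le> L" by (auto simp: L_def intro!: prod_nonneg)
    have Ft: "F t \<in> malliavin_smooth M B" using F t by (auto simp: class_J_def)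
    have "nrm q (W (F t) es) \<le> nrm q (\<lambda>\<omega>. L * C \<omega>)"
    proof (rule nrm_mono_AE[OF q W_measurable[OF Ft es(2)] all_moments_cmult[OF C]])
      show "AE \<omega> in M. \<bar>W (F t) es \<omega>\<bar> \<le> \<bar>L * C \<omega>\<bar>"
        using bd[OF t es] by eventually_elim (simp add: L_def mult.commute order_trans[OF _ abs_ge_self])
    qed
    also have "\<dots> = nrm q C * L" using nrm_cmult[OF q] L by simp
    finally show "nrm q (W (F t) es) \<le> nrm q C * (\<Prod>i<r. len (es ! i))" by (simp add: L_def)
  qed
qed

end

section \<open>Covariances of dyadic increments\<close>

lemma powr_le_tangent:
  fixes y a :: real
  assumes "0 \<le> y" "0 < a" "a \<le> 1"
  shows "y powr a \<le> 1 + a * (y - 1)"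
proof (cases "y = 0")
  case False
  then show ?thesis using Youngs_inequality_0[of a "1 - a" y 1] assms by (simp add: algebra_simps)
qed (use assms in auto)

text \<open>The negative second difference of x^a at k. For a = 2H, its half with a minus sign is
  the correlation of two equally long increments of the motion at distance k.\<close>

definition sdiff :: "real \<Rightarrow> nat \<Rightarrow> real" where
  "sdiff a k = 2 * real k powr a - real (k + 1) powr a - real (k - 1) powr a"

text \<open>Concavity of x^a for a <= 1: the tangent at 1, evaluated at (k + 1) / k and (k - 1) / k,
  has opposite slope terms which cancel. This is where H <= 1/2 enters.\<close>

lemma sdiff_nonneg:
  assumes "0 < a" "a \<le> 1" "1 \<le> k"
  shows "0 \<le> sdiff a k"
proof -
  have k: "0 < real k" using assms by simp
  have "(real (k + 1) / k) powr a \<le> 1 + a * (real (k + 1) / k - 1)" by (rule powr_le_tangent) (use assms in auto)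
  moreover have "(real (k - 1) / k) powr a \<le> 1 + a * (real (k - 1) / k - 1)" by (rule powr_le_tangent) (use assms in auto)
  moreover have "a * (real (k + 1) / k - 1) + a * (real (k - 1) / k - 1) = 0"
    using assms k by (simp add: field_simps of_nat_diff)
  ultimately have "(real (k + 1) / k) powr a + (real (k - 1) / k) powr a \<le> 2" by linarith
  then have "((real (k + 1) / k) powr a + (real (k - 1) / k) powr a) * real k powr a \<le> 2 * real k powr a"
    by (rule mult_right_mono) simp
  moreover have "(x / real k) powr a * real k powr a = x powr a" if "0 \<le> x" for x
    using k that by (simp add: powr_mult[symmetric])
  ultimately show ?thesis by (simp add: sdiff_def distrib_right)
qed

text \<open>The sum telescopes to 1 minus the last first difference of x^a, which is nonnegative by
  monotonicity. The bound is independent of the number of terms.\<close>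

lemma sdiff_sum:
  assumes "0 < a" "a \<le> 1"
  shows "(\<Sum>k\<in>{1..m}. sdiff a k) \<le> 1"
proof -
  have "(\<Sum>k\<in>{1..m}. sdiff a k) = 1 - (real (m + 1) powr a - real m powr a)"
  proof (induction m)
    case (Suc m)
    have "(\<Sum>k\<in>{1..Suc m}. sdiff a k) = (\<Sum>k\<in>{1..m}. sdiff a k) + sdiff a (Suc m)" by simp
    also have "\<dots> = 1 - (real (Suc m + 1) powr a - real (Suc m) powr a)"
      unfolding Suc.IH by (simp add: sdiff_def)
    finally show ?case .
  qed (use assms in auto)
  moreover have "real m powr a \<le> real (m + 1) powr a" using assms by (intro powr_mono2) auto
  ultimately show ?thesis by linarith
qed

context fbm
begin

definition cell :: "'d \<Rightarrow> nat \<Rightarrow> nat \<Rightarrow> 'd \<times> real \<times> real" where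
  "cell \<alpha> n k = (\<alpha>, dyadic n k, dyadic n (Suc k))"

text \<open>The variance of an increment over a dyadic interval of level n, and also the price in
  the class of one derivative along such an increment.\<close>

definition sig :: "nat \<Rightarrow> real" where "sig n = (1 / 2 ^ n) powr (2 * H)"

lemma sig_pos: "0 < sig n" by (simp add: sig_def)

lemma sig_le_1: "sig n \<le> 1"
  unfolding sig_def using H_pos by (intro powr_le1) (auto simp: divide_le_eq)

lemma vdir_cell: "k < 2 ^ n \<Longrightarrow> vdir (cell \<alpha> n k)"
proof -
  assume k: "k < 2 ^ n"
  then have "real (Suc k) \<le> 2 ^ n" by (metis Suc_leI of_nat_le_iff of_nat_numeral of_nat_power)
  with k show ?thesis by (simp add: vdir_def cell_def dyadic_def)
qed

lemma len_cell: "len (cell \<alpha> n k) = sig n"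
  by (simp add: cell_def dyadic_def sig_def diff_divide_distrib[symmetric])

lemma cov_cell:
  assumes "i < 2 ^ n" "j < 2 ^ n"
  shows "\<alpha> \<noteq> \<beta> \<Longrightarrow> cov (binc (cell \<alpha> n i)) (binc (cell \<beta> n j)) = 0"
    "cov (binc (cell \<alpha> n i)) (binc (cell \<alpha> n j)) = sig n * ((if i = j then 1 else - sdiff (2 * H) (if i < j then j - i else i - j) / 2))"
proof -
  note v = vdir_cell[OF assms(1)] vdir_cell[OF assms(2)]
  have I: "dyadic n i \<in> {0..1}" "dyadic n (Suc i) \<in> {0..1}" "dyadic n j \<in> {0..1}" "dyadic n (Suc j) \<in> {0..1}"
    using v[of \<alpha>] by (auto simp: vdir_def cell_def)
  have c: "cov (binc (cell \<alpha> n i)) (binc (cell \<beta> n j)) =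
    cov (B \<beta> (dyadic n (Suc j))) (B \<alpha> (dyadic n (Suc i))) - cov (B \<beta> (dyadic n (Suc j))) (B \<alpha> (dyadic n i))
    - (cov (B \<beta> (dyadic n j)) (B \<alpha> (dyadic n (Suc i))) - cov (B \<beta> (dyadic n j)) (B \<alpha> (dyadic n i)))" for \<beta>
  proof -
    have "cov (binc (cell \<alpha> n i)) (binc (cell \<beta> n j)) =
      cov (binc (cell \<alpha> n i)) (B \<beta> (dyadic n (Suc j))) - cov (binc (cell \<alpha> n i)) (B \<beta> (dyadic n j))"
      using cov_binc[OF binc_chaos[OF v(1)] v(2), of \<alpha> \<beta>] by (simp add: cell_def)
    also have "cov (binc (cell \<alpha> n i)) (B \<beta> u) = cov (B \<beta> u) (B \<alpha> (dyadic n (Suc i))) - cov (B \<beta> u) (B \<alpha> (dyadic n i))"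
      if "u \<in> {0..1}" for u
      using cov_binc[OF B_chaos[OF that] v(1), of \<beta> \<alpha>] by (simp add: cell_def cov_commute[of _ "B \<beta> u"])
    ultimately show ?thesis using I by simp
  qed
  show "cov (binc (cell \<alpha> n i)) (binc (cell \<beta> n j)) = 0" if "\<alpha> \<noteq> \<beta>"
    unfolding c using that I by (simp add: cov_B)
  have d: "\<bar>dyadic n k - dyadic n l\<bar> powr (2 * H) = sig n * \<bar>real k - real l\<bar> powr (2 * H)" for k l
  proof -
    have "\<bar>dyadic n k - dyadic n l\<bar> = (1 / 2 ^ n) * \<bar>real k - real l\<bar>"
      by (simp add: dyadic_def diff_divide_distrib[symmetric] abs_divide)
    then show ?thesis unfolding sig_def by (simp only:) (subst powr_mult, auto)
  qed
  \<comment> \<open>The single-time terms of the four covariances cancel; a second difference of the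
    powers of distances remains.\<close>
  have "cov (binc (cell \<alpha> n i)) (binc (cell \<alpha> n j)) =
    (\<bar>dyadic n i - dyadic n (Suc j)\<bar> powr (2 * H) + \<bar>dyadic n (Suc i) - dyadic n j\<bar> powr (2 * H)
     - \<bar>dyadic n (Suc i) - dyadic n (Suc j)\<bar> powr (2 * H) - \<bar>dyadic n i - dyadic n j\<bar> powr (2 * H)) / 2"
    unfolding c using I by (simp add: cov_B fbm_cov_def field_simps)
  also have "\<dots> = sig n * ((\<bar>real i - real (Suc j)\<bar> powr (2 * H) + \<bar>real (Suc i) - real j\<bar> powr (2 * H)
     - 2 * \<bar>real i - real j\<bar> powr (2 * H)) / 2)"
    unfolding d by (simp add: algebra_simps)
  also have "(\<bar>real i - real (Suc j)\<bar> powr (2 * H) + \<bar>real (Suc i) - real j\<bar> powr (2 * H)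
     - 2 * \<bar>real i - real j\<bar> powr (2 * H)) / 2 = (if i = j then 1 else - sdiff (2 * H) (if i < j then j - i else i - j) / 2)"
  proof -
    consider "i = j" | "i < j" | "j < i" by linarith
    then show ?thesis
    proof cases
      case 2
      then have "\<bar>real i - real (Suc j)\<bar> = real (j - i + 1)" "\<bar>real (Suc i) - real j\<bar> = real (j - i - 1)" "\<bar>real i - real j\<bar> = real (j - i)"
        by (auto simp: of_nat_diff)
      then show ?thesis using 2 by (simp add: sdiff_def field_simps)
    next
      case 3
      then have "\<bar>real i - real (Suc j)\<bar> = real (i - j - 1)" "\<bar>real (Suc i) - real j\<bar> = real (i - j + 1)" "\<bar>real i - real j\<bar> = real (i - j)"
        by (auto simp: of_nat_diff)
      then show ?thesis using 3 by (simp add: sdiff_def field_simps)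
    qed simp
  qed
  finally show "cov (binc (cell \<alpha> n i)) (binc (cell \<alpha> n j)) = sig n * ((if i = j then 1 else - sdiff (2 * H) (if i < j then j - i else i - j) / 2))" .
qed

lemma var_cell: "i < 2 ^ n \<Longrightarrow> (\<integral>\<omega>. (binc (cell \<alpha> n i) \<omega>)\<^sup>2 \<partial>M) = sig n"
  using cov_cell(2)[of i n i \<alpha>] by (simp add: cov_def power2_eq_square)

text \<open>In units of \<open>sig n\<close> the diagonal contributes 1, and the cells to the left
  and to the right at most 1/2 each by \<open>sdiff_sum\<close>. No factor \<open>2 ^ n\<close>
  appears, and this is the source of cancellation in the moment estimate.\<close>

lemma cov_cell_sum:
  assumes "i < 2 ^ n"
  shows "(\<Sum>j<2 ^ n. \<bar>cov (binc (cell \<alpha> n i)) (binc (cell \<alpha> n j))\<bar>) \<le> 2 * sig n"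
proof -
  let ?a = "2 * H" and ?N = "2 ^ n :: nat"
  have a: "0 < ?a" "?a \<le> 1" using H_pos H_half by auto
  have "(\<Sum>j<?N. \<bar>cov (binc (cell \<alpha> n i)) (binc (cell \<alpha> n j))\<bar>) =
    (\<Sum>j<?N. sig n * (if i = j then 1 else sdiff ?a (if i < j then j - i else i - j) / 2))"
  proof (intro sum.cong refl)
    fix j assume j: "j \<in> {..<?N}"
    have "i \<noteq> j \<Longrightarrow> 0 \<le> sdiff ?a (if i < j then j - i else i - j)" by (rule sdiff_nonneg[OF a]) auto
    then show "\<bar>cov (binc (cell \<alpha> n i)) (binc (cell \<alpha> n j))\<bar> = sig n * (if i = j then 1 else sdiff ?a (if i < j then j - i else i - j) / 2)"
      using cov_cell(2)[OF assms, of j \<alpha>] j sig_pos[of n] by (simp add: abs_mult)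
  qed
  also have "\<dots> = sig n * (\<Sum>j<?N. (if i = j then 1 else sdiff ?a (if i < j then j - i else i - j) / 2))"
    by (simp add: sum_distrib_left)
  also have "(\<Sum>j<?N. (if i = j then 1 else sdiff ?a (if i < j then j - i else i - j) / 2)) \<le> 2"
  proof -
    let ?f = "\<lambda>j. (if i = j then 1 else sdiff ?a (if i < j then j - i else i - j) / 2)"
    have split: "{..<?N} = insert i ({..<i} \<union> {Suc i..<?N})" using assms by auto
    have "(\<Sum>j<?N. ?f j) = 1 + ((\<Sum>j<i. ?f j) + (\<Sum>j\<in>{Suc i..<?N}. ?f j))"
    proof -
      have "(\<Sum>j<?N. ?f j) = ?f i + (\<Sum>j\<in>{..<i} \<union> {Suc i..<?N}. ?f j)"
        unfolding split by (subst sum.insert) auto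
      also have "(\<Sum>j\<in>{..<i} \<union> {Suc i..<?N}. ?f j) = (\<Sum>j<i. ?f j) + (\<Sum>j\<in>{Suc i..<?N}. ?f j)"
        by (rule sum.union_disjoint) auto
      finally show ?thesis by simp
    qed
    also have "(\<Sum>j<i. ?f j) = (\<Sum>k\<in>{1..i}. sdiff ?a k / 2)"
      by (rule sum.reindex_bij_witness[of _ "\<lambda>k. i - k" "\<lambda>j. i - j"]) auto
    also have "(\<Sum>j\<in>{Suc i..<?N}. ?f j) = (\<Sum>k\<in>{1..?N - 1 - i}. sdiff ?a k / 2)"
      by (rule sum.reindex_bij_witness[of _ "\<lambda>k. i + k" "\<lambda>j. j - i"]) auto
    finally show ?thesis
      using sdiff_sum[OF a, of i] sdiff_sum[OF a, of "?N - 1 - i"]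
      unfolding sum_divide_distrib[symmetric] by linarith
  qed
  finally show ?thesis using sig_pos[of n] by (simp add: mult_left_mono mult.commute)
qed

end

section \<open>The moment estimate\<close>

text \<open>Every term produced by two integrations by parts consists of m powers of Z and three
  further factors, so m + 3 is the natural exponent.\<close>

lemma (in prob_space) Hoelder_three:
  assumes Z: "Z \<in> all_moments" and "a \<in> all_moments" "b \<in> all_moments" "c \<in> all_moments"
  shows "\<bar>\<integral>\<omega>. a \<omega> * b \<omega> * c \<omega> * Z \<omega> ^ m \<partial>M\<bar> \<le> nrm (m + 3) a * nrm (m + 3) b * nrm (m + 3) c * nrm (m + 3) Z ^ m"
proof -
  define h where "h i = (if i < m then Z else if i = m then a else if i = m + 1 then b else c)" for i
  have *: "(\<Prod>i<m + 3. G (h i)) = G a * G b * G c * G Z ^ m" for G :: "('a \<Rightarrow> real) \<Rightarrow> real"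
  proof -
    have "(\<Prod>i<m + 3. G (h i)) = (\<Prod>i<m. G (h i)) * G (h m) * G (h (m + 1)) * G (h (m + 2))"
      by (simp add: numeral_3_eq_3 numeral_2_eq_2)
    also have "(\<Prod>i<m. G (h i)) = (\<Prod>i<m. G Z)" by (intro prod.cong) (auto simp: h_def)
    finally show ?thesis by (simp add: h_def mult_ac)
  qed
  have "\<bar>\<integral>\<omega>. a \<omega> * b \<omega> * c \<omega> * Z \<omega> ^ m \<partial>M\<bar> \<le> (\<integral>\<omega>. \<bar>a \<omega> * b \<omega> * c \<omega> * Z \<omega> ^ m\<bar> \<partial>M)"
    by (rule integral_abs_bound)
  also have "\<dots> = (\<integral>\<omega>. \<bar>\<Prod>i<m + 3. h i \<omega>\<bar> \<partial>M)"
    by (intro Bochner_Integration.integral_cong refl) (simp only: *[of "\<lambda>f. f _"])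
  also have "\<dots> \<le> (\<Prod>i<m + 3. nrm (m + 3) (h i))"
    using assms by (intro Hoelder_prod) (auto simp: h_def)
  finally show ?thesis by (simp only: *)
qed

text \<open>In terms of z = v / L the hypothesis reads z^(m+3) <= C (z^(m+2) + z^(m+1) + z^m).
  Either z <= 1, or the three powers on the right are at most z^(m+2) and z <= 3C.\<close>

lemma absorb_powers:
  fixes v L C :: real
  assumes "0 \<le> v" "0 < L" "0 \<le> C"
    and "v ^ (m + 3) \<le> C * (v ^ (m + 2) * L + v ^ (m + 1) * L ^ 2 + v ^ m * L ^ 3)"
  shows "v \<le> (3 * C + 1) * L"
proof -
  define z where "z = v / L"
  have v: "v = z * L" and z0: "0 \<le> z" using assms by (auto simp: z_def)
  have Lp: "0 < L ^ (m + 3)" using assms by simp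
  have "z ^ (m + 3) * L ^ (m + 3) \<le> (C * (z ^ (m + 2) + z ^ (m + 1) + z ^ m)) * L ^ (m + 3)"
    using assms(4) unfolding v power_mult_distrib
    by (simp add: power_add power2_eq_square power3_eq_cube algebra_simps)
  then have le: "z ^ (m + 3) \<le> C * (z ^ (m + 2) + z ^ (m + 1) + z ^ m)"
    using Lp by (simp only: mult_le_cancel_right_pos)
  have "z \<le> 3 * C + 1"
  proof (cases "z \<le> 1")
    case True
    then show ?thesis using assms(3) by linarith
  next
    case False
    then have "z ^ (m + 1) \<le> z ^ (m + 2)" "z ^ m \<le> z ^ (m + 2)"
      using power_increasing[of "m + 1" "m + 2" z] power_increasing[of m "m + 2" z] by linarith+
    then have "C * (z ^ (m + 2) + z ^ (m + 1) + z ^ m) \<le> C * (3 * z ^ (m + 2))"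
      using assms(3) by (intro mult_left_mono) auto
    with le have "z * z ^ (m + 2) \<le> (3 * C) * z ^ (m + 2)" by (simp add: numeral_3_eq_3 numeral_2_eq_2)
    moreover have "0 < z ^ (m + 2)" using False by simp
    ultimately have "z \<le> 3 * C" by (simp only: mult_le_cancel_right_pos)
    then show ?thesis by simp
  qed
  then show ?thesis unfolding v using assms(2) by (simp add: mult_right_mono)
qed

context fbm
begin

text \<open>The index maps are separate because in the refinement of Riemann sums the
  \<alpha>-increment, the \<beta>-increment and the time of the weight belong to three different
  dyadic positions.\<close>

definition area :: "(real \<Rightarrow> 'w \<Rightarrow> real) \<Rightarrow> 'd \<Rightarrow> 'd \<Rightarrow> nat \<Rightarrow> nat set \<Rightarrow> (nat \<Rightarrow> nat) \<Rightarrow> (nat \<Rightarrow> nat) \<Rightarrow> (nat \<Rightarrow> real) \<Rightarrow>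
    ('d \<times> real \<times> real) list \<Rightarrow> 'w \<Rightarrow> real" where
  "area F \<alpha> \<beta> n S x y t es \<omega> = (\<Sum>i\<in>S. W (F (t i)) es \<omega> * (binc (cell \<alpha> n (x i)) \<omega> * binc (cell \<beta> n (y i)) \<omega>))"

text \<open>Directions are restricted to cells of the level n of the sum, so that each derivative
  costs exactly one factor \<open>sig n\<close>.\<close>

definition cdirs :: "nat \<Rightarrow> ('d \<times> real \<times> real) list \<Rightarrow> bool" where
  "cdirs n es \<longleftrightarrow> (\<forall>e\<in>set es. \<exists>\<gamma> k. k < 2 ^ n \<and> e = cell \<gamma> n k)"

lemma cdirs_Nil [simp]: "cdirs n []"
  by (simp add: cdirs_def)

lemma cdirs_Cons: "k < 2 ^ n \<Longrightarrow> cdirs n (cell \<gamma> n k # es) \<longleftrightarrow> cdirs n es"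
  by (auto simp: cdirs_def)

lemma cdirs_vdirs: "cdirs n es \<Longrightarrow> vdirs es"
  by (auto simp: cdirs_def vdir_cell)

text \<open>One constant for all orders up to r, obtained by summing the constants of the single
  orders. The added 1 gives K >= 1, which later estimates use to absorb constants.\<close>

lemma cdirs_W_bound:
  assumes F: "F \<in> class_J M H B" and q: "0 < q"
  shows "\<exists>K\<ge>1. \<forall>n t es. t \<in> {0..1} \<longrightarrow> cdirs n es \<longrightarrow> length es \<le> r \<longrightarrow> nrm q (W (F t) es) \<le> K * sig n ^ length es"
proof -
  have "\<forall>l. \<exists>K. K\<ge>0 \<and> (\<forall>t\<in>{0..1}. \<forall>es. length es = l \<longrightarrow> vdirs es \<longrightarrow> (\<forall>e\<in>set es. fst (snd e) \<le> snd (snd e)) \<longrightarrow>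
     nrm q (W (F t) es) \<le> K * (\<Prod>i<l. len (es ! i)))"
    using class_J_nrm_bound[OF F q] by blast
  from choice[OF this] obtain K where Kb: "\<forall>l. K l\<ge>0 \<and> (\<forall>t\<in>{0..1}. \<forall>es. length es = l \<longrightarrow> vdirs es \<longrightarrow> (\<forall>e\<in>set es. fst (snd e) \<le> snd (snd e)) \<longrightarrow>
     nrm q (W (F t) es) \<le> K l * (\<Prod>i<l. len (es ! i)))" ..
  have K: "K l \<ge> 0" for l using Kb[rule_format, of l] by (rule conjunct1)
  have bd: "nrm q (W (F t) es) \<le> K l * (\<Prod>i<l. len (es ! i))"
    if "t \<in> {0..1}" "length es = l" "vdirs es" "\<forall>e\<in>set es. fst (snd e) \<le> snd (snd e)" for l t es
    by (rule Kb[rule_format, of l, THEN conjunct2, rule_format]) (use that in auto)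
  have "nrm q (W (F t) es) \<le> ((\<Sum>l\<le>r. K l) + 1) * sig n ^ length es"
    if t: "t \<in> {0..1}" and es: "cdirs n es" "length es \<le> r" for n t es
  proof -
    have o: "\<forall>e\<in>set es. fst (snd e) \<le> snd (snd e)"
      using es(1) by (auto simp: cdirs_def cell_def dyadic_def divide_right_mono)
    have "nrm q (W (F t) es) \<le> K (length es) * (\<Prod>i<length es. len (es ! i))"
      by (rule bd[OF t refl cdirs_vdirs[OF es(1)] o])
    also have "(\<Prod>i<length es. len (es ! i)) = (\<Prod>i<length es. sig n)"
    proof (intro prod.cong refl)
      fix i assume "i \<in> {..<length es}"
      then have "es ! i \<in> set es" by simp
      then obtain \<gamma> k where "es ! i = cell \<gamma> n k" using es(1) unfolding cdirs_def by blast
      then show "len (es ! i) = sig n" by (simp only: len_cell)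
    qed
    also have "K (length es) * (\<Prod>i<length es. sig n) \<le> ((\<Sum>l\<le>r. K l) + 1) * sig n ^ length es"
    proof -
      have "K (length es) \<le> (\<Sum>l\<le>r. K l)" using es(2) K by (intro member_le_sum) auto
      then have "K (length es) * sig n ^ length es \<le> ((\<Sum>l\<le>r. K l) + 1) * sig n ^ length es"
        using sig_pos[of n] by (intro mult_right_mono zero_le_power) linarith+
      then show ?thesis by (simp only: prod_constant card_lessThan)
    qed
    finally show ?thesis .
  qed
  moreover have "1 \<le> (\<Sum>l\<le>r. K l) + 1" using K by (simp add: sum_nonneg)
  ultimately show ?thesis by blast
qed

end

text \<open>Injectivity of x and y bounds the row sums of covariances over S by those over all
  cells, and bounds the size of S by \<open>2 ^ n\<close>. Distinct coordinates make every
  \<alpha>-increment uncorrelated with every \<beta>-increment.\<close>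

locale weighted_area = fbm M H B for M :: "'w measure" and H and B :: "'d::finite \<Rightarrow> real \<Rightarrow> 'w \<Rightarrow> real" +
  fixes F :: "real \<Rightarrow> 'w \<Rightarrow> real" and \<alpha> \<beta> :: 'd and n :: nat and S :: "nat set" and x y :: "nat \<Rightarrow> nat" and t :: "nat \<Rightarrow> real"
  assumes FJ: "F \<in> class_J M H B" and ab: "\<alpha> \<noteq> \<beta>" and S: "finite S" "S \<noteq> {}"
    and x: "inj_on x S" "\<And>i. i \<in> S \<Longrightarrow> x i < 2 ^ n"
    and y: "inj_on y S" "\<And>i. i \<in> S \<Longrightarrow> y i < 2 ^ n"
    and t: "\<And>i. i \<in> S \<Longrightarrow> t i \<in> {0..1}"
begin

abbreviation "ex i \<equiv> cell \<alpha> n (x i)"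
abbreviation "ey i \<equiv> cell \<beta> n (y i)"
abbreviation "w es i \<equiv> W (F (t i)) es"
abbreviation "Xv i \<equiv> binc (ex i)"
abbreviation "Yv i \<equiv> binc (ey i)"
abbreviation "Z es \<equiv> area F \<alpha> \<beta> n S x y t es"
abbreviation "\<sigma> \<equiv> sig n"

definition "a i j = cov (Xv i) (Xv j)"
definition "b i j = cov (Yv i) (Yv j)"
text \<open>\<open>P\<close> and \<open>Q\<close> collect what remains when differentiation along
  the i-th \<alpha>- or \<beta>-increment removes the corresponding increment from each summand; in
  \<open>R\<close> both have been removed.\<close>

definition P where "P es i \<omega> = (\<Sum>j\<in>S. w es j \<omega> * (a i j * Yv j \<omega>))"
definition Q where "Q es i \<omega> = (\<Sum>j\<in>S. w es j \<omega> * (b i j * Xv j \<omega>))"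
definition R where "R es i \<omega> = (\<Sum>j\<in>S. w es j \<omega> * (a i j * b i j))"

lemma F_smooth: "i \<in> S \<Longrightarrow> F (t i) \<in> malliavin_smooth M B"
  using FJ t by (auto simp: class_J_def)

lemma XY_chaos: "i \<in> S \<Longrightarrow> Xv i \<in> \<C>" "i \<in> S \<Longrightarrow> Yv i \<in> \<C>"
  using x y by (auto intro: binc_chaos vdir_cell)

lemma XY_mom: "i \<in> S \<Longrightarrow> Xv i \<in> all_moments" "i \<in> S \<Longrightarrow> Yv i \<in> all_moments"
  using XY_chaos G_moments(1) by auto

lemma w_mom: "i \<in> S \<Longrightarrow> cdirs n es \<Longrightarrow> w es i \<in> all_moments"
  by (rule W_all_moments[OF F_smooth cdirs_vdirs])

lemma mder_w:
  assumes "i \<in> S" "cdirs n (e # es)" shows "mder (binc e) (w es i) (w (e # es) i)"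
  by (rule mder_W[OF F_smooth[OF assms(1)] cdirs_vdirs[OF assms(2)]])

lemma cdirs_ex: "i \<in> S \<Longrightarrow> cdirs n (ex i # es) \<longleftrightarrow> cdirs n es" "i \<in> S \<Longrightarrow> cdirs n (ey i # es) \<longleftrightarrow> cdirs n es"
  using x y by (auto simp: cdirs_Cons)

lemma mder_XY:
  assumes "i \<in> S" "j \<in> S"
  shows "mder (Xv i) (Xv j) (\<lambda>_. a i j)" "mder (Xv i) (Yv j) (\<lambda>_. 0)" "mder (Yv i) (Xv j) (\<lambda>_. 0)" "mder (Yv i) (Yv j) (\<lambda>_. b i j)"
proof -
  have c0: "cov (Xv i) (Yv j) = 0" "cov (Yv i) (Xv j) = 0"
    using cov_cell(1) x(2) y(2) assms ab by auto
  show "mder (Xv i) (Xv j) (\<lambda>_. a i j)" unfolding a_def by (rule mder_coord[OF XY_chaos(1)[OF assms(2)]])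
  show "mder (Yv i) (Yv j) (\<lambda>_. b i j)" unfolding b_def by (rule mder_coord[OF XY_chaos(2)[OF assms(2)]])
  show "mder (Xv i) (Yv j) (\<lambda>_. 0)" using mder_coord[OF XY_chaos(2)[OF assms(2)], of "Xv i"] c0 by simp
  show "mder (Yv i) (Xv j) (\<lambda>_. 0)" using mder_coord[OF XY_chaos(1)[OF assms(2)], of "Yv i"] c0 by simp
qed

lemma mder_eq: "mder X \<Phi> \<Phi>' \<Longrightarrow> (\<And>\<omega>. \<Phi> \<omega> = \<Psi> \<omega>) \<Longrightarrow> (\<And>\<omega>. \<Phi>' \<omega> = \<Psi>' \<omega>) \<Longrightarrow> mder X \<Psi> \<Psi>'"
proof -
  assume "mder X \<Phi> \<Phi>'" "\<And>\<omega>. \<Phi> \<omega> = \<Psi> \<omega>" "\<And>\<omega>. \<Phi>' \<omega> = \<Psi>' \<omega>"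
  moreover from this(2,3) have "\<Phi> = \<Psi>" "\<Phi>' = \<Psi>'" by auto
  ultimately show ?thesis by simp
qed

text \<open>The derivative falls either on the weight, which raises the order by one, or on the
  \<alpha>-increment, which leaves a covariance. The \<beta>-increment contributes nothing.\<close>

lemma mder_Z_X:
  assumes i: "i \<in> S" and es: "cdirs n es"
  shows "mder (Xv i) (Z es) (\<lambda>\<omega>. Z (ex i # es) \<omega> + P es i \<omega>)"
proof -
  have "mder (Xv i) (\<lambda>\<omega>. \<Sum>j\<in>S. w es j \<omega> * (Xv j \<omega> * Yv j \<omega>))
     (\<lambda>\<omega>. \<Sum>j\<in>S. w (ex i # es) j \<omega> * (Xv j \<omega> * Yv j \<omega>) + (a i j * Yv j \<omega> + 0 * Xv j \<omega>) * w es j \<omega>)"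
    using i es by (intro mder_sum mder_mult mder_w mder_XY) (simp_all add: cdirs_ex)
  then show ?thesis
    by (rule mder_eq) (simp_all add: area_def P_def sum.distrib mult_ac)
qed

lemma mder_Z_Y:
  assumes i: "i \<in> S" and es: "cdirs n es"
  shows "mder (Yv i) (Z es) (\<lambda>\<omega>. Z (ey i # es) \<omega> + Q es i \<omega>)"
proof -
  have "mder (Yv i) (\<lambda>\<omega>. \<Sum>j\<in>S. w es j \<omega> * (Xv j \<omega> * Yv j \<omega>))
     (\<lambda>\<omega>. \<Sum>j\<in>S. w (ey i # es) j \<omega> * (Xv j \<omega> * Yv j \<omega>) + (0 * Yv j \<omega> + b i j * Xv j \<omega>) * w es j \<omega>)"
    using i es by (intro mder_sum mder_mult mder_w mder_XY) (simp_all add: cdirs_ex)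
  then show ?thesis
    by (rule mder_eq) (simp_all add: area_def Q_def sum.distrib mult_ac)
qed

lemma mder_P_Y:
  assumes i: "i \<in> S" and es: "cdirs n es"
  shows "mder (Yv i) (P es i) (\<lambda>\<omega>. P (ey i # es) i \<omega> + R es i \<omega>)"
proof -
  have "mder (Yv i) (\<lambda>\<omega>. \<Sum>j\<in>S. w es j \<omega> * (a i j * Yv j \<omega>))
     (\<lambda>\<omega>. \<Sum>j\<in>S. w (ey i # es) j \<omega> * (a i j * Yv j \<omega>) + (a i j * b i j) * w es j \<omega>)"
    using i es by (intro mder_sum mder_mult mder_cmult mder_w mder_XY) (simp_all add: cdirs_ex)
  then show ?thesis
    by (rule mder_eq) (simp_all add: P_def R_def sum.distrib mult_ac)
qed

definition DX where "DX es i \<omega> = Z (ex i # es) \<omega> + P es i \<omega>"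
definition DY where "DY es i \<omega> = Z (ey i # es) \<omega> + Q es i \<omega>"
text \<open>The derivative of \<open>DX\<close> along the \<beta>-increment: the first bracket comes
  from the term of higher order, the second from \<open>P\<close>.\<close>

definition DD where "DD es i \<omega> = (Z (ey i # ex i # es) \<omega> + Q (ex i # es) i \<omega>) + (P (ey i # es) i \<omega> + R es i \<omega>)"

lemma mder_DX:
  assumes i: "i \<in> S" and es: "cdirs n es"
  shows "mder (Yv i) (DX es i) (DD es i)"
  unfolding DX_def[abs_def] DD_def[abs_def] using i es
  by (intro mder_add mder_Z_Y mder_P_Y) (simp_all add: cdirs_ex)

lemma moms:
  assumes i: "i \<in> S" and es: "cdirs n es"
  shows "Z es \<in> all_moments" "DX es i \<in> all_moments" "DY es i \<in> all_moments" "DD es i \<in> all_moments"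
    "P es i \<in> all_moments" "Q es i \<in> all_moments" "R es i \<in> all_moments"
proof -
  show "Z es \<in> all_moments" by (rule mderD(1)[OF mder_Z_X[OF i es]])
  show "DX es i \<in> all_moments" "DD es i \<in> all_moments" using mderD[OF mder_DX[OF i es]] by auto
  show "DY es i \<in> all_moments" using mderD(2)[OF mder_Z_Y[OF i es]] unfolding DY_def[abs_def] .
  show "P es i \<in> all_moments" "Q es i \<in> all_moments" "R es i \<in> all_moments"
    unfolding P_def[abs_def] Q_def[abs_def] R_def[abs_def]
    by (intro all_moments_sum all_moments_mult w_mom es all_moments_const XY_mom; assumption)+
qed

text \<open>Integration by parts in \<open>X\<^sub>i\<close>, then in \<open>Y\<^sub>i\<close>.  The order of the moment of \<open>Z\<close> to be estimated is \<open>m + 3\<close>.\<close>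

lemma double_ibp:
  assumes i: "i \<in> S" and es: "cdirs n es"
  shows "(\<integral>\<omega>. Xv i \<omega> * (w es i \<omega> * Yv i \<omega> * Z es \<omega> ^ (m + 2)) \<partial>M) =
    (\<integral>\<omega>. w (ey i # ex i # es) i \<omega> * Z es \<omega> * Z es \<omega> * Z es \<omega> ^ m \<partial>M)
    + real (m + 2) * ((\<integral>\<omega>. w (ex i # es) i \<omega> * DY es i \<omega> * Z es \<omega> * Z es \<omega> ^ m \<partial>M)
      + (\<integral>\<omega>. w (ey i # es) i \<omega> * DX es i \<omega> * Z es \<omega> * Z es \<omega> ^ m \<partial>M)
      + (\<integral>\<omega>. DD es i \<omega> * w es i \<omega> * Z es \<omega> * Z es \<omega> ^ m \<partial>M)
      + real (m + 1) * (\<integral>\<omega>. w es i \<omega> * DX es i \<omega> * DY es i \<omega> * Z es \<omega> ^ m \<partial>M))"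
proof -
  have ex: "cdirs n (ex i # es)" "cdirs n (ey i # es)" "cdirs n (ey i # ex i # es)" using i es by (simp_all add: cdirs_ex)
  \<comment> \<open>Differentiation along the \<alpha>-increment leaves the factor
    \<open>Yv i\<close> untouched. What stands next to it is \<Psi>, ready for the second
    integration by parts.\<close>
  define \<Psi> where "\<Psi> \<omega> = w (ex i # es) i \<omega> * Z es \<omega> ^ (m + 2) + real (m + 2) * ((w es i \<omega> * DX es i \<omega>) * Z es \<omega> ^ (m + 1))" for \<omega>
  have "mder (Xv i) (\<lambda>\<omega>. (w es i \<omega> * Yv i \<omega>) * Z es \<omega> ^ (m + 2))
    (\<lambda>\<omega>. (w (ex i # es) i \<omega> * Yv i \<omega> + 0 * w es i \<omega>) * Z es \<omega> ^ (m + 2) +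
      (of_nat (m + 2) * Z es \<omega> ^ (m + 2 - 1) * (Z (ex i # es) \<omega> + P es i \<omega>)) * (w es i \<omega> * Yv i \<omega>))"
    by (intro mder_mult mder_power mder_w mder_XY mder_Z_X i es ex)
  then have 1: "mder (Xv i) (\<lambda>\<omega>. w es i \<omega> * Yv i \<omega> * Z es \<omega> ^ (m + 2)) (\<lambda>\<omega>. Yv i \<omega> * \<Psi> \<omega>)"
    by (rule mder_eq) (simp_all add: \<Psi>_def DX_def algebra_simps)
  define \<Psi>' where "\<Psi>' \<omega> = w (ey i # ex i # es) i \<omega> * Z es \<omega> * Z es \<omega> * Z es \<omega> ^ m
    + real (m + 2) * (w (ex i # es) i \<omega> * DY es i \<omega> * Z es \<omega> * Z es \<omega> ^ m
      + w (ey i # es) i \<omega> * DX es i \<omega> * Z es \<omega> * Z es \<omega> ^ m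
      + DD es i \<omega> * w es i \<omega> * Z es \<omega> * Z es \<omega> ^ m
      + real (m + 1) * (w es i \<omega> * DX es i \<omega> * DY es i \<omega> * Z es \<omega> ^ m))" for \<omega>
  have "mder (Yv i) (\<lambda>\<omega>. w (ex i # es) i \<omega> * Z es \<omega> ^ (m + 2) + real (m + 2) * ((w es i \<omega> * DX es i \<omega>) * Z es \<omega> ^ (m + 1)))
    (\<lambda>\<omega>. (w (ey i # ex i # es) i \<omega> * Z es \<omega> ^ (m + 2) +
        (of_nat (m + 2) * Z es \<omega> ^ (m + 2 - 1) * (Z (ey i # es) \<omega> + Q es i \<omega>)) * w (ex i # es) i \<omega>)
      + real (m + 2) * ((w (ey i # es) i \<omega> * DX es i \<omega> + DD es i \<omega> * w es i \<omega>) * Z es \<omega> ^ (m + 1)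
        + (of_nat (m + 1) * Z es \<omega> ^ (m + 1 - 1) * (Z (ey i # es) \<omega> + Q es i \<omega>)) * (w es i \<omega> * DX es i \<omega>)))"
    by (intro mder_add mder_cmult mder_mult mder_power mder_w mder_Z_Y mder_DX i es ex)
  then have 2: "mder (Yv i) \<Psi> \<Psi>'"
    by (rule mder_eq) (simp_all add: \<Psi>_def \<Psi>'_def DY_def algebra_simps)
  have "(\<integral>\<omega>. Xv i \<omega> * (w es i \<omega> * Yv i \<omega> * Z es \<omega> ^ (m + 2)) \<partial>M) = (\<integral>\<omega>. Yv i \<omega> * \<Psi> \<omega> \<partial>M)"
    by (rule mder_ibp[OF XY_chaos(1)[OF i] 1])
  also have "\<dots> = (\<integral>\<omega>. \<Psi>' \<omega> \<partial>M)"
    by (rule mder_ibp[OF XY_chaos(2)[OF i] 2])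
  also have "\<dots> = (\<integral>\<omega>. w (ey i # ex i # es) i \<omega> * Z es \<omega> * Z es \<omega> * Z es \<omega> ^ m \<partial>M)
    + real (m + 2) * ((\<integral>\<omega>. w (ex i # es) i \<omega> * DY es i \<omega> * Z es \<omega> * Z es \<omega> ^ m \<partial>M)
      + (\<integral>\<omega>. w (ey i # es) i \<omega> * DX es i \<omega> * Z es \<omega> * Z es \<omega> ^ m \<partial>M)
      + (\<integral>\<omega>. DD es i \<omega> * w es i \<omega> * Z es \<omega> * Z es \<omega> ^ m \<partial>M)
      + real (m + 1) * (\<integral>\<omega>. w es i \<omega> * DX es i \<omega> * DY es i \<omega> * Z es \<omega> ^ m \<partial>M))"
  proof -
    note mm = moms(1-4)[OF i es] w_mom[OF i es] w_mom[OF i ex(1)] w_mom[OF i ex(2)] w_mom[OF i ex(3)]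
    have I: "integrable M (\<lambda>\<omega>. f \<omega> * g \<omega> * h \<omega> * Z es \<omega> ^ m)"
      if "f \<in> all_moments" "g \<in> all_moments" "h \<in> all_moments" for f g h
      by (intro all_moments_integrable all_moments_mult all_moments_power that mm)
    note J = I[OF mm(8,1,1)] I[OF mm(6,3,1)] I[OF mm(7,2,1)] I[OF mm(4,5,1)] I[OF mm(5,2,3)]
    show ?thesis unfolding \<Psi>'_def using J by simp
  qed
  finally show ?thesis .
qed

lemma cov_row_sum:
  assumes i: "i \<in> S"
  shows "(\<Sum>j\<in>S. \<bar>a i j\<bar>) \<le> 2 * \<sigma>" "(\<Sum>j\<in>S. \<bar>b i j\<bar>) \<le> 2 * \<sigma>"
proof -
  have *: "(\<Sum>j\<in>S. \<bar>cov (binc (cell \<gamma> n (z i))) (binc (cell \<gamma> n (z j)))\<bar>) \<le> 2 * \<sigma>"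
    if "inj_on z S" "\<And>j. j \<in> S \<Longrightarrow> z j < 2 ^ n" for z \<gamma>
  proof -
    have "(\<Sum>j\<in>S. \<bar>cov (binc (cell \<gamma> n (z i))) (binc (cell \<gamma> n (z j)))\<bar>) =
      (\<Sum>k\<in>z ` S. \<bar>cov (binc (cell \<gamma> n (z i))) (binc (cell \<gamma> n k))\<bar>)"
      using that(1) by (simp add: sum.reindex)
    also have "\<dots> \<le> (\<Sum>k<2 ^ n. \<bar>cov (binc (cell \<gamma> n (z i))) (binc (cell \<gamma> n k))\<bar>)"
      using that(2) by (intro sum_mono2) auto
    also have "\<dots> \<le> 2 * \<sigma>" using that(2)[OF i] by (rule cov_cell_sum)
    finally show ?thesis .
  qed
  show "(\<Sum>j\<in>S. \<bar>a i j\<bar>) \<le> 2 * \<sigma>" unfolding a_def by (rule *[OF x])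
  show "(\<Sum>j\<in>S. \<bar>b i j\<bar>) \<le> 2 * \<sigma>" unfolding b_def by (rule *[OF y])
qed

lemma nrm_XY:
  assumes "i \<in> S" "0 < q"
  shows "nrm q (Xv i) = gauss_moment q * sqrt \<sigma>" "nrm q (Yv i) = gauss_moment q * sqrt \<sigma>"
proof -
  show "nrm q (Xv i) = gauss_moment q * sqrt \<sigma>"
    unfolding G_moments(2)[OF XY_chaos(1)[OF assms(1)] assms(2)] var_cell[OF x(2)[OF assms(1)]] ..
  show "nrm q (Yv i) = gauss_moment q * sqrt \<sigma>"
    unfolding G_moments(2)[OF XY_chaos(2)[OF assms(1)] assms(2)] var_cell[OF y(2)[OF assms(1)]] ..
qed

text \<open>The row sums of covariances are at most 2 \<sigma> whatever the size of S. A remaining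
  increment contributes its standard deviation, the square root of \<sigma>; in \<open>R\<close> a
  second covariance takes its place.\<close>

lemma PQR_bound:
  assumes i: "i \<in> S" and es: "cdirs n es" and q: "0 < q" and K: "\<And>j. j \<in> S \<Longrightarrow> nrm (2 * q) (w es j) \<le> K"
  shows "nrm q (P es i) \<le> 2 * K * gauss_moment (2 * q) * \<sigma> * sqrt \<sigma>"
    "nrm q (Q es i) \<le> 2 * K * gauss_moment (2 * q) * \<sigma> * sqrt \<sigma>"
    "nrm q (R es i) \<le> 4 * K * \<sigma>\<^sup>2"
proof -
  let ?\<kappa> = "gauss_moment (2 * q)"
  have K0: "0 \<le> K" using K[OF i] order_trans[OF nrm_nonneg] by blast
  have q2: "0 < 2 * q" using q by simp
  have \<kappa>: "0 \<le> ?\<kappa> * sqrt \<sigma>" using gauss_moment_nonneg sig_pos[of n] by simp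
  have gen: "nrm q (\<lambda>\<omega>. \<Sum>j\<in>S. w es j \<omega> * (c j * V j \<omega>)) \<le> 2 * K * ?\<kappa> * \<sigma> * sqrt \<sigma>"
    if V: "\<And>j. j \<in> S \<Longrightarrow> V j \<in> all_moments" "\<And>j. j \<in> S \<Longrightarrow> nrm (2 * q) (V j) = ?\<kappa> * sqrt \<sigma>"
      and c: "(\<Sum>j\<in>S. \<bar>c j\<bar>) \<le> 2 * \<sigma>" for V c
  proof -
    have "nrm q (\<lambda>\<omega>. \<Sum>j\<in>S. w es j \<omega> * (c j * V j \<omega>)) \<le> (\<Sum>j\<in>S. nrm q (\<lambda>\<omega>. w es j \<omega> * (c j * V j \<omega>)))"
      using w_mom[OF _ es] V by (intro nrm_sum q all_moments_mult all_moments_cmult) auto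
    also have "\<dots> \<le> (\<Sum>j\<in>S. \<bar>c j\<bar> * (K * (?\<kappa> * sqrt \<sigma>)))"
    proof (rule sum_mono)
      fix j assume j: "j \<in> S"
      have "nrm q (\<lambda>\<omega>. w es j \<omega> * (c j * V j \<omega>)) = nrm q (\<lambda>\<omega>. c j * (w es j \<omega> * V j \<omega>))" by (simp add: mult_ac)
      also have "\<dots> = \<bar>c j\<bar> * nrm q (\<lambda>\<omega>. w es j \<omega> * V j \<omega>)" by (rule nrm_cmult[OF q])
      also have "\<dots> \<le> \<bar>c j\<bar> * (nrm (2 * q) (w es j) * nrm (2 * q) (V j))"
        by (intro mult_left_mono nrm_mult q w_mom j es V) auto
      also have "\<dots> \<le> \<bar>c j\<bar> * (K * (?\<kappa> * sqrt \<sigma>))"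
        unfolding V(2)[OF j] using K[OF j] \<kappa> by (intro mult_left_mono mult_right_mono) auto
      finally show "nrm q (\<lambda>\<omega>. w es j \<omega> * (c j * V j \<omega>)) \<le> \<bar>c j\<bar> * (K * (?\<kappa> * sqrt \<sigma>))" .
    qed
    also have "\<dots> = (\<Sum>j\<in>S. \<bar>c j\<bar>) * (K * (?\<kappa> * sqrt \<sigma>))" by (simp add: sum_distrib_right)
    also have "\<dots> \<le> 2 * \<sigma> * (K * (?\<kappa> * sqrt \<sigma>))" using c K0 \<kappa> by (intro mult_right_mono) auto
    finally show ?thesis by (simp add: mult_ac)
  qed
  show "nrm q (P es i) \<le> 2 * K * ?\<kappa> * \<sigma> * sqrt \<sigma>" unfolding P_def[abs_def]
    by (rule gen) (use XY_mom nrm_XY[OF _ q2] cov_row_sum[OF i] in auto)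
  show "nrm q (Q es i) \<le> 2 * K * ?\<kappa> * \<sigma> * sqrt \<sigma>" unfolding Q_def[abs_def]
    by (rule gen) (use XY_mom nrm_XY[OF _ q2] cov_row_sum[OF i] in auto)
  have "nrm q (R es i) \<le> (\<Sum>j\<in>S. nrm q (\<lambda>\<omega>. w es j \<omega> * (a i j * b i j)))" unfolding R_def[abs_def]
    using w_mom[OF _ es] by (intro nrm_sum q all_moments_mult) auto
  also have "\<dots> \<le> (\<Sum>j\<in>S. \<bar>a i j\<bar> * (2 * \<sigma> * K))"
  proof (rule sum_mono)
    fix j assume j: "j \<in> S"
    have bj: "\<bar>b i j\<bar> \<le> 2 * \<sigma>" using member_le_sum[OF j, of "\<lambda>j. \<bar>b i j\<bar>"] S cov_row_sum(2)[OF i] by auto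
    have "nrm q (\<lambda>\<omega>. w es j \<omega> * (a i j * b i j)) = nrm q (\<lambda>\<omega>. (a i j * b i j) * w es j \<omega>)" by (simp add: mult_ac)
    also have "\<dots> = \<bar>a i j\<bar> * (\<bar>b i j\<bar> * nrm q (w es j))" unfolding nrm_cmult[OF q] by (simp add: abs_mult)
    also have "\<dots> \<le> \<bar>a i j\<bar> * (2 * \<sigma> * K)"
    proof (intro mult_left_mono mult_mono bj)
      show "nrm q (w es j) \<le> K" using nrm_mono_exponent[OF q _ w_mom[OF j es], of "2 * q"] K[OF j] by simp
    qed (use sig_pos[of n] in auto)
    finally show "nrm q (\<lambda>\<omega>. w es j \<omega> * (a i j * b i j)) \<le> \<bar>a i j\<bar> * (2 * \<sigma> * K)" .
  qed
  also have "\<dots> = (\<Sum>j\<in>S. \<bar>a i j\<bar>) * (2 * \<sigma> * K)" by (simp add: sum_distrib_right)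
  also have "\<dots> \<le> 2 * \<sigma> * (2 * \<sigma> * K)"
    using cov_row_sum(1)[OF i] K0 sig_pos[of n] by (intro mult_right_mono) auto
  finally show "nrm q (R es i) \<le> 4 * K * \<sigma>\<^sup>2" by (simp add: power2_eq_square mult_ac)
qed

end

section \<open>The inequality that improves its own hypothesis\<close>

context weighted_area
begin

lemma sig_sq_pos: "0 < \<sigma>" "\<sigma> \<le> 1" "(sqrt \<sigma>)\<^sup>2 = \<sigma>" "0 < sqrt \<sigma>" "sqrt \<sigma> \<le> 1"
  using sig_pos[of n] sig_le_1[of n] by auto

text \<open>Everything is measured in units of s = \<sigma>^r and one \<sigma> per derivative. The
  square root of \<sigma> is kept in \<open>DX\<close> and \<open>DY\<close>, where it enters
  squared later; in \<open>DD\<close> it is dropped by \<sigma> <= 1.\<close>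

lemma derivative_bounds:
  assumes i: "i \<in> S" and es: "cdirs n es" and q: "0 < q" and K: "1 \<le> K" and A: "0 \<le> A"
    and wK: "\<And>j ds. j \<in> S \<Longrightarrow> cdirs n ds \<Longrightarrow> length ds \<le> length es + 2 \<Longrightarrow> nrm (2 * q) (w ds j) \<le> K * \<sigma> ^ length ds"
    and ZA: "\<And>ds. cdirs n ds \<Longrightarrow> length es < length ds \<Longrightarrow> length ds \<le> length es + 2 \<Longrightarrow> nrm q (Z ds) \<le> A * \<sigma> ^ length ds"
  defines "c \<equiv> 2 * K * gauss_moment (2 * q)" and "s \<equiv> \<sigma> ^ length es"
  shows "nrm q (DX es i) \<le> s * \<sigma> * (A + c * sqrt \<sigma>)" "nrm q (DY es i) \<le> s * \<sigma> * (A + c * sqrt \<sigma>)"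
    "nrm q (DD es i) \<le> s * \<sigma>\<^sup>2 * (A + 2 * c + 4 * K)"
proof -
  note ex = cdirs_ex[OF i, THEN iffD2, OF es] 
  have exy: "cdirs n (ey i # ex i # es)" using i es by (simp add: cdirs_ex)
  have c: "0 \<le> c" using K gauss_moment_nonneg by (simp add: c_def)
  have s: "0 < s" using sig_sq_pos by (simp add: s_def)
  have w0: "nrm (2 * q) (w es j) \<le> K * s" if "j \<in> S" for j using wK[OF that es] by (simp add: s_def)
  have w1: "nrm (2 * q) (w (ex i # es) j) \<le> K * s * \<sigma>" "nrm (2 * q) (w (ey i # es) j) \<le> K * s * \<sigma>" if "j \<in> S" for j
    using wK[OF that ex(1)] wK[OF that ex(2)] by (auto simp: s_def mult_ac)
  note m = moms[OF i es] moms[OF i ex(1)] moms[OF i ex(2)] moms[OF i exy]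
  have Z1: "nrm q (Z (ex i # es)) \<le> s * \<sigma> * A" "nrm q (Z (ey i # es)) \<le> s * \<sigma> * A"
    using ZA[OF ex(1)] ZA[OF ex(2)] by (auto simp: s_def mult_ac)
  have Z2: "nrm q (Z (ey i # ex i # es)) \<le> s * \<sigma>\<^sup>2 * A"
    using ZA[OF exy] by (auto simp: s_def mult_ac power2_eq_square)
  have pq: "nrm q (P es i) \<le> s * \<sigma> * (c * sqrt \<sigma>)" "nrm q (Q es i) \<le> s * \<sigma> * (c * sqrt \<sigma>)"
    using PQR_bound(1,2)[OF i es q w0] by (auto simp: c_def mult_ac)
  show "nrm q (DX es i) \<le> s * \<sigma> * (A + c * sqrt \<sigma>)"
    using nrm_add[OF q m(8) m(5)] Z1(1) pq(1) unfolding DX_def[abs_def] distrib_left by linarith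
  show "nrm q (DY es i) \<le> s * \<sigma> * (A + c * sqrt \<sigma>)"
    using nrm_add[OF q m(15) m(6)] Z1(2) pq(2) unfolding DY_def[abs_def] distrib_left by linarith
  have pq2: "nrm q (P (ey i # es) i) \<le> s * \<sigma>\<^sup>2 * c" "nrm q (Q (ex i # es) i) \<le> s * \<sigma>\<^sup>2 * c"
  proof -
    have "s * \<sigma>\<^sup>2 * c * sqrt \<sigma> \<le> s * \<sigma>\<^sup>2 * c * 1" using s c sig_sq_pos by (intro mult_left_mono) auto
    then show "nrm q (P (ey i # es) i) \<le> s * \<sigma>\<^sup>2 * c" "nrm q (Q (ex i # es) i) \<le> s * \<sigma>\<^sup>2 * c"
      using PQR_bound(1)[OF i ex(2) q w1(2)] PQR_bound(2)[OF i ex(1) q w1(1)]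
      by (auto simp: c_def mult_ac power2_eq_square)
  qed
  have r2: "nrm q (R es i) \<le> s * \<sigma>\<^sup>2 * (4 * K)"
    using PQR_bound(3)[OF i es q w0] by (simp add: mult_ac)
  have "nrm q (DD es i) \<le> (nrm q (Z (ey i # ex i # es)) + nrm q (Q (ex i # es) i)) + (nrm q (P (ey i # es) i) + nrm q (R es i))"
    unfolding DD_def[abs_def]
    using nrm_add[OF q all_moments_add[OF m(22) m(13)] all_moments_add[OF m(19) m(7)]]
      nrm_add[OF q m(22) m(13)] nrm_add[OF q m(19) m(7)] by linarith
  also have "\<dots> \<le> (s * \<sigma>\<^sup>2 * A + s * \<sigma>\<^sup>2 * c) + (s * \<sigma>\<^sup>2 * c + s * \<sigma>\<^sup>2 * (4 * K))"
    by (intro add_mono Z2 pq2 r2)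
  finally show "nrm q (DD es i) \<le> s * \<sigma>\<^sup>2 * (A + 2 * c + 4 * K)" by (simp add: algebra_simps)
qed

text \<open>In each of the five terms of \<open>double_ibp\<close> the two derivatives together give
  \<sigma>^2 and one weight gives K, so K \<sigma>^2 s^(m+3) factors out. The powers of v count how
  many undifferentiated sums remain.\<close>

lemma summand_bound:
  assumes i: "i \<in> S" and es: "cdirs n es" and K: "1 \<le> K" and A: "0 \<le> A"
    and wK: "\<And>j ds. j \<in> S \<Longrightarrow> cdirs n ds \<Longrightarrow> length ds \<le> length es + 2 \<Longrightarrow> nrm (2 * (m + 3)) (w ds j) \<le> K * \<sigma> ^ length ds"
    and ZA: "\<And>ds. cdirs n ds \<Longrightarrow> length es < length ds \<Longrightarrow> length ds \<le> length es + 2 \<Longrightarrow> nrm (m + 3) (Z ds) \<le> A * \<sigma> ^ length ds"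
    and v: "nrm (m + 3) (Z es) = \<sigma> ^ length es * v"
  defines "c \<equiv> 2 * K * gauss_moment (2 * (m + 3))" and "s \<equiv> \<sigma> ^ length es" and "d \<equiv> real (m + 2)"
  shows "\<bar>\<integral>\<omega>. Xv i \<omega> * (w es i \<omega> * Yv i \<omega> * Z es \<omega> ^ (m + 2)) \<partial>M\<bar> \<le>
    s ^ (m + 3) * (K * \<sigma>\<^sup>2 * (v ^ (m + 2) + 3 * d * (A + 2 * c + 4 * K) * v ^ (m + 1) + d\<^sup>2 * (A + c * sqrt \<sigma>)\<^sup>2 * v ^ m))"
proof -
  let ?q = "m + 3"
  have q: "0 < ?q" by simp
  note ex = cdirs_ex[OF i, THEN iffD2, OF es] 
  have exy: "cdirs n (ey i # ex i # es)" using i es by (simp add: cdirs_ex)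
  have c: "0 \<le> c" using K gauss_moment_nonneg by (simp add: c_def)
  have s: "0 < s" using sig_sq_pos by (simp add: s_def)
  have d: "0 \<le> d" by (simp add: d_def)
  have v0: "0 \<le> v" using v s nrm_nonneg[of ?q "Z es"] by (simp add: s_def zero_le_mult_iff)
  have u: "nrm ?q (Z es) = s * v" using v by (simp add: s_def)
  note D = derivative_bounds[OF i es q K A wK ZA, folded c_def s_def]
  define h where "h = A + c * sqrt \<sigma>"
  have h: "0 \<le> h" using A c sig_sq_pos by (simp add: h_def)
  \<comment> \<open>Allows the two terms containing \<open>DX\<close> or \<open>DY\<close> once to
    be merged with the one containing \<open>DD\<close>; hence the 3 in the statement.\<close>
  have hle: "h \<le> A + 2 * c + 4 * K"
  proof -
    have "c * sqrt \<sigma> \<le> c * 1" using c sig_sq_pos by (intro mult_left_mono) auto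
    then show ?thesis using c K by (simp add: h_def)
  qed
  define g where "g = A + 2 * c + 4 * K"
  have g: "0 \<le> g" using A c K by (simp add: g_def)
  have wq: "nrm ?q (w ds i) \<le> K * \<sigma> ^ length ds" if "cdirs n ds" "length ds \<le> length es + 2" for ds
    using nrm_mono_exponent[OF q _ w_mom[OF i that(1)], of "2 * ?q"] wK[OF i that] by simp
  have W0: "nrm ?q (w es i) \<le> K * s" using wq[OF es] by (simp add: s_def)
  have W1: "nrm ?q (w (ex i # es) i) \<le> K * s * \<sigma>" "nrm ?q (w (ey i # es) i) \<le> K * s * \<sigma>"
    using wq[OF ex(1)] wq[OF ex(2)] by (auto simp: s_def mult_ac)
  have W2: "nrm ?q (w (ey i # ex i # es) i) \<le> K * s * \<sigma>\<^sup>2"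
    using wq[OF exy] by (auto simp: s_def mult_ac power2_eq_square)
  note mm = moms(1-4)[OF i es] w_mom[OF i es] w_mom[OF i ex(1)] w_mom[OF i ex(2)] w_mom[OF i exy]
  have prod3: "\<bar>\<integral>\<omega>. f1 \<omega> * f2 \<omega> * f3 \<omega> * Z es \<omega> ^ m \<partial>M\<bar> \<le> b1 * b2 * b3 * (s * v) ^ m"
    if "f1 \<in> all_moments" "f2 \<in> all_moments" "f3 \<in> all_moments"
      "nrm ?q f1 \<le> b1" "nrm ?q f2 \<le> b2" "nrm ?q f3 \<le> b3" for f1 f2 f3 b1 b2 b3
  proof -
    have b: "0 \<le> b1" "0 \<le> b2" "0 \<le> b3" using that(4-6) order_trans[OF nrm_nonneg] by blast+
    have "\<bar>\<integral>\<omega>. f1 \<omega> * f2 \<omega> * f3 \<omega> * Z es \<omega> ^ m \<partial>M\<bar> \<le> nrm ?q f1 * nrm ?q f2 * nrm ?q f3 * nrm ?q (Z es) ^ m"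
      by (rule Hoelder_three[OF mm(1) that(1-3)])
    also have "\<dots> \<le> b1 * b2 * b3 * (s * v) ^ m" unfolding u
      using that b s v0 by (intro mult_mono) auto
    finally show ?thesis .
  qed
  have sv: "nrm ?q (Z es) \<le> s * v" using u by simp
  note T1 = prod3[OF mm(8,1,1) W2 sv sv] and T2 = prod3[OF mm(6,3,1) W1(1) D(2)[folded h_def] sv]
    and T3 = prod3[OF mm(7,2,1) W1(2) D(1)[folded h_def] sv] and T4 = prod3[OF mm(4,5,1) D(3)[folded g_def] W0 sv]
    and T5 = prod3[OF mm(5,2,3) W0 D(1)[folded h_def] D(2)[folded h_def]]
  let ?I1 = "\<integral>\<omega>. w (ey i # ex i # es) i \<omega> * Z es \<omega> * Z es \<omega> * Z es \<omega> ^ m \<partial>M"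
  let ?I2 = "\<integral>\<omega>. w (ex i # es) i \<omega> * DY es i \<omega> * Z es \<omega> * Z es \<omega> ^ m \<partial>M"
  let ?I3 = "\<integral>\<omega>. w (ey i # es) i \<omega> * DX es i \<omega> * Z es \<omega> * Z es \<omega> ^ m \<partial>M"
  let ?I4 = "\<integral>\<omega>. DD es i \<omega> * w es i \<omega> * Z es \<omega> * Z es \<omega> ^ m \<partial>M"
  let ?I5 = "\<integral>\<omega>. w es i \<omega> * DX es i \<omega> * DY es i \<omega> * Z es \<omega> ^ m \<partial>M"
  define E where "E = K * \<sigma>\<^sup>2 * s ^ (m + 3)"
  have E: "0 \<le> E" using K s by (simp add: E_def)
  have t1: "\<bar>?I1\<bar> \<le> E * v ^ (m + 2)"
    using T1 by (simp add: E_def power_mult_distrib power_add power2_eq_square power3_eq_cube mult_ac)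
  have t2: "\<bar>?I2\<bar> \<le> E * (h * v ^ (m + 1))"
    using T2 by (simp add: E_def power_mult_distrib power_add power2_eq_square power3_eq_cube mult_ac)
  have t3: "\<bar>?I3\<bar> \<le> E * (h * v ^ (m + 1))"
    using T3 by (simp add: E_def power_mult_distrib power_add power2_eq_square power3_eq_cube mult_ac)
  have t4: "\<bar>?I4\<bar> \<le> E * (g * v ^ (m + 1))"
    using T4 by (simp add: E_def power_mult_distrib power_add power2_eq_square power3_eq_cube mult_ac)
  have t5: "\<bar>?I5\<bar> \<le> E * (h\<^sup>2 * v ^ m)"
    using T5 by (simp add: E_def power_mult_distrib power_add power2_eq_square power3_eq_cube mult_ac)
  have hg: "E * (h * v ^ (m + 1)) \<le> E * (g * v ^ (m + 1))"
    using E v0 hle by (intro mult_left_mono mult_right_mono) (auto simp: g_def)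
  have d1: "\<bar>real (m + 1) * ?I5\<bar> \<le> d * (E * (h\<^sup>2 * v ^ m))"
    unfolding abs_mult using t5 by (intro mult_mono) (auto simp: d_def)
  have "\<bar>\<integral>\<omega>. Xv i \<omega> * (w es i \<omega> * Yv i \<omega> * Z es \<omega> ^ (m + 2)) \<partial>M\<bar> = \<bar>?I1 + d * (?I2 + ?I3 + ?I4 + real (m + 1) * ?I5)\<bar>"
    unfolding double_ibp[OF i es] d_def ..
  also have "\<dots> \<le> \<bar>?I1\<bar> + \<bar>d * (?I2 + ?I3 + ?I4 + real (m + 1) * ?I5)\<bar>" by (rule abs_triangle_ineq)
  also have "\<bar>d * (?I2 + ?I3 + ?I4 + real (m + 1) * ?I5)\<bar> = d * \<bar>?I2 + ?I3 + ?I4 + real (m + 1) * ?I5\<bar>"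
    using d by (simp add: abs_mult)
  also have "\<bar>?I2 + ?I3 + ?I4 + real (m + 1) * ?I5\<bar> \<le> 3 * (E * (g * v ^ (m + 1))) + d * (E * (h\<^sup>2 * v ^ m))"
    using t2 t3 t4 d1 hg by linarith
  finally have "\<bar>\<integral>\<omega>. Xv i \<omega> * (w es i \<omega> * Yv i \<omega> * Z es \<omega> ^ (m + 2)) \<partial>M\<bar> \<le>
    E * v ^ (m + 2) + d * (3 * (E * (g * v ^ (m + 1))) + d * (E * (h\<^sup>2 * v ^ m)))"
    using t1 d by (simp add: mult_left_mono add_mono)
  also have "\<dots> = s ^ (m + 3) * (K * \<sigma>\<^sup>2 * (v ^ (m + 2) + 3 * d * g * v ^ (m + 1) + d\<^sup>2 * h\<^sup>2 * v ^ m))"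
    by (simp add: E_def algebra_simps power2_eq_square)
  finally show ?thesis by (simp only: g_def h_def)
qed

text \<open>For an even exponent |Z|^(m+3) is Z times Z^(m+2), and writing out the single Z as a sum
  puts each summand into the form of \<open>double_ibp\<close>. Summation contributes the
  cardinality of S; the powers of s cancel.\<close>

lemma moment_inequality:
  assumes es: "cdirs n es" and K: "1 \<le> K" and A: "0 \<le> A" and ev: "even (m + 3)"
    and wK: "\<And>j ds. j \<in> S \<Longrightarrow> cdirs n ds \<Longrightarrow> length ds \<le> length es + 2 \<Longrightarrow> nrm (2 * (m + 3)) (w ds j) \<le> K * \<sigma> ^ length ds"
    and ZA: "\<And>ds. cdirs n ds \<Longrightarrow> length es < length ds \<Longrightarrow> length ds \<le> length es + 2 \<Longrightarrow> nrm (m + 3) (Z ds) \<le> A * \<sigma> ^ length ds"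
  defines "c \<equiv> 2 * K * gauss_moment (2 * (m + 3))" and "s \<equiv> \<sigma> ^ length es" and "d \<equiv> real (m + 2)"
  defines "v \<equiv> nrm (m + 3) (Z es) / \<sigma> ^ length es"
  shows "v ^ (m + 3) \<le> real (card S) * \<sigma>\<^sup>2 * K * (v ^ (m + 2) + 3 * d * (A + 2 * c + 4 * K) * v ^ (m + 1) + d\<^sup>2 * (A + c * sqrt \<sigma>)\<^sup>2 * v ^ m)"
proof -
  have s: "0 < s" using sig_sq_pos by (simp add: s_def)
  have u: "nrm (m + 3) (Z es) = \<sigma> ^ length es * v" using s by (simp add: v_def s_def[symmetric])
  obtain i0 where i0: "i0 \<in> S" using S(2) by blast
  note Zm = moms(1)[OF i0 es]
  have "(s * v) ^ (m + 3) = (\<integral>\<omega>. \<bar>Z es \<omega>\<bar> ^ (m + 3) \<partial>M)"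
    using nrm_power[of "m + 3" "Z es"] u by (simp add: s_def)
  also have "\<dots> = (\<integral>\<omega>. (\<Sum>i\<in>S. Xv i \<omega> * (w es i \<omega> * Yv i \<omega> * Z es \<omega> ^ (m + 2))) \<partial>M)"
  proof (intro Bochner_Integration.integral_cong refl)
    fix \<omega>
    have "\<bar>Z es \<omega>\<bar> ^ (m + 3) = Z es \<omega> ^ (m + 3)" using ev by (simp only: power_even_abs)
    also have "\<dots> = Z es \<omega> * Z es \<omega> ^ (m + 2)" by (simp add: numeral_3_eq_3 numeral_2_eq_2)
    also have "\<dots> = (\<Sum>i\<in>S. Xv i \<omega> * (w es i \<omega> * Yv i \<omega> * Z es \<omega> ^ (m + 2)))"
      unfolding area_def[of F \<alpha> \<beta> n S x y t es \<omega>] sum_distrib_right by (simp add: mult_ac)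
    finally show "\<bar>Z es \<omega>\<bar> ^ (m + 3) = (\<Sum>i\<in>S. Xv i \<omega> * (w es i \<omega> * Yv i \<omega> * Z es \<omega> ^ (m + 2)))" .
  qed
  also have "\<dots> = (\<Sum>i\<in>S. \<integral>\<omega>. Xv i \<omega> * (w es i \<omega> * Yv i \<omega> * Z es \<omega> ^ (m + 2)) \<partial>M)"
    by (intro Bochner_Integration.integral_sum all_moments_integrable all_moments_mult all_moments_power Zm XY_mom w_mom es)
  also have "\<dots> \<le> (\<Sum>i\<in>S. s ^ (m + 3) * (K * \<sigma>\<^sup>2 * (v ^ (m + 2) + 3 * d * (A + 2 * c + 4 * K) * v ^ (m + 1) + d\<^sup>2 * (A + c * sqrt \<sigma>)\<^sup>2 * v ^ m)))"
  proof (rule sum_mono)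
    fix i assume i: "i \<in> S"
    show "(\<integral>\<omega>. Xv i \<omega> * (w es i \<omega> * Yv i \<omega> * Z es \<omega> ^ (m + 2)) \<partial>M) \<le>
      s ^ (m + 3) * (K * \<sigma>\<^sup>2 * (v ^ (m + 2) + 3 * d * (A + 2 * c + 4 * K) * v ^ (m + 1) + d\<^sup>2 * (A + c * sqrt \<sigma>)\<^sup>2 * v ^ m))"
      unfolding c_def s_def d_def
      by (rule order_trans[OF abs_ge_self summand_bound[OF i es K A wK ZA u]])
  qed
  also have "\<dots> = s ^ (m + 3) * (real (card S) * \<sigma>\<^sup>2 * K * (v ^ (m + 2) + 3 * d * (A + 2 * c + 4 * K) * v ^ (m + 1) + d\<^sup>2 * (A + c * sqrt \<sigma>)\<^sup>2 * v ^ m))"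
    by (simp add: mult_ac)
  finally have "s ^ (m + 3) * v ^ (m + 3) \<le> s ^ (m + 3) * (real (card S) * \<sigma>\<^sup>2 * K * (v ^ (m + 2) + 3 * d * (A + 2 * c + 4 * K) * v ^ (m + 1) + d\<^sup>2 * (A + c * sqrt \<sigma>)\<^sup>2 * v ^ m))"
    by (simp only: power_mult_distrib)
  then show ?thesis using s by (simp only: mult_le_cancel_left_pos zero_less_power)
qed

lemma card_S: "1 \<le> real (card S)" "real (card S) \<le> 2 ^ n"
proof -
  have "0 < card S" using S by (simp add: card_gt_0_iff)
  then show "1 \<le> real (card S)" by simp
  have "card S = card (x ` S)" using x(1) by (simp add: card_image)
  also have "\<dots> \<le> card {..<2 ^ n :: nat}" using x(2) by (intro card_mono) auto
  finally show "real (card S) \<le> 2 ^ n" by (metis card_lessThan of_nat_le_iff of_nat_numeral of_nat_power)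
qed

text \<open>The conditions on L' make the three coefficients of \<open>moment_inequality\<close> at
  most constants times L', L'^2 and L'^3, which is the input of \<open>absorb_powers\<close>. In the
  last one the square root of \<sigma> is essential: it reduces the demand to \<open>e2\<close>
  \<sigma> <= L'^3, whereas \<open>e2\<close> <= L'^3 would exclude L' of order the square root of a
  small \<open>e2\<close>.\<close>

lemma improvement:
  assumes es: "cdirs n es" and K: "1 \<le> K" and KA: "0 \<le> KA" and ev: "even (m + 3)"
    and wK: "\<And>j ds. j \<in> S \<Longrightarrow> cdirs n ds \<Longrightarrow> length ds \<le> length es + 2 \<Longrightarrow> nrm (2 * (m + 3)) (w ds j) \<le> K * \<sigma> ^ length ds"
    and ZA: "\<And>ds. cdirs n ds \<Longrightarrow> length es < length ds \<Longrightarrow> length ds \<le> length es + 2 \<Longrightarrow> nrm (m + 3) (Z ds) \<le> (KA * L) * \<sigma> ^ length ds"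
    and L: "0 < L" "0 < L'"
    and e: "real (card S) * \<sigma>\<^sup>2 \<le> 1" "real (card S) * \<sigma>\<^sup>2 \<le> L'\<^sup>2" "real (card S) * \<sigma>\<^sup>2 * L \<le> L'\<^sup>2"
      "real (card S) * \<sigma>\<^sup>2 * L\<^sup>2 \<le> L' ^ 3"
  defines "c \<equiv> 2 * K * gauss_moment (2 * (m + 3))" and "d \<equiv> real (m + 2)"
  shows "nrm (m + 3) (Z es) \<le> (3 * (K * (1 + 3 * d * (KA + 2 * c + 4 * K) + 2 * d\<^sup>2 * (KA\<^sup>2 + c\<^sup>2))) + 1) * L' * \<sigma> ^ length es"
proof -
  define e2 where "e2 = real (card S) * \<sigma>\<^sup>2"
  define v where "v = nrm (m + 3) (Z es) / \<sigma> ^ length es"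
  define C where "C = K * (1 + 3 * d * (KA + 2 * c + 4 * K) + 2 * d\<^sup>2 * (KA\<^sup>2 + c\<^sup>2))"
  have s: "0 < \<sigma> ^ length es" using sig_sq_pos by simp
  have v0: "0 \<le> v" using s by (simp add: v_def)
  have c: "0 \<le> c" using K gauss_moment_nonneg by (simp add: c_def)
  have d: "0 \<le> d" by (simp add: d_def)
  have e20: "0 \<le> e2" "\<sigma>\<^sup>2 \<le> e2" using card_S(1) mult_right_mono[of 1 "real (card S)" "\<sigma>\<^sup>2"] by (auto simp: e2_def)
  \<comment> \<open>Since \<open>e2\<close> <= 1, its square is at most \<open>e2\<close>, hence at
    most L'^2.\<close>
  have eL: "e2 \<le> L'"
  proof (rule power2_le_imp_le)
    have "e2 \<le> 1" using e(1) by (simp only: e2_def)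
    then have "e2\<^sup>2 \<le> e2 * 1" using e20 unfolding power2_eq_square by (intro mult_left_mono) auto
    then show "e2\<^sup>2 \<le> L'\<^sup>2" using e(2) by (simp add: e2_def)
  qed (use L in simp)
  \<comment> \<open>The set S is nonempty, so \<sigma>^2 <= \<open>e2\<close>, and the square of the
    left side is at most the cube of \<open>e2\<close>.\<close>
  have e\<sigma>: "e2 * \<sigma> \<le> L' ^ 3"
  proof (rule power2_le_imp_le)
    have "(e2 * \<sigma>)\<^sup>2 = e2\<^sup>2 * \<sigma>\<^sup>2" by (simp add: power_mult_distrib)
    also have "\<dots> \<le> e2\<^sup>2 * e2" using e20 by (intro mult_left_mono) auto
    also have "\<dots> = e2 ^ 3" by (simp add: power2_eq_square power3_eq_cube)
    also have "\<dots> \<le> (L'\<^sup>2) ^ 3" using e(2) e20 by (intro power_mono) (auto simp: e2_def)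
    also have "\<dots> = (L' ^ 3)\<^sup>2" by (simp add: power_mult[symmetric])
    finally show "(e2 * \<sigma>)\<^sup>2 \<le> (L' ^ 3)\<^sup>2" .
  qed (use L in simp)
  have KL: "0 \<le> KA * L" using KA L by simp
  have "v ^ (m + 3) \<le> e2 * K * (v ^ (m + 2) + 3 * d * (KA * L + 2 * c + 4 * K) * v ^ (m + 1) + d\<^sup>2 * (KA * L + c * sqrt \<sigma>)\<^sup>2 * v ^ m)"
    unfolding e2_def v_def c_def d_def by (rule moment_inequality[OF es K KL ev wK ZA])
  also have "\<dots> = K * (e2 * v ^ (m + 2) + 3 * d * (e2 * (KA * L + 2 * c + 4 * K)) * v ^ (m + 1) + d\<^sup>2 * (e2 * (KA * L + c * sqrt \<sigma>)\<^sup>2) * v ^ m)"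
    by (simp add: algebra_simps)
  also have "\<dots> \<le> K * (L' * v ^ (m + 2) + 3 * d * ((KA + 2 * c + 4 * K) * L'\<^sup>2) * v ^ (m + 1) + d\<^sup>2 * (2 * (KA\<^sup>2 + c\<^sup>2) * L' ^ 3) * v ^ m)"
  proof -
    have 2: "e2 * (KA * L + 2 * c + 4 * K) \<le> (KA + 2 * c + 4 * K) * L'\<^sup>2"
    proof -
      have "KA * (e2 * L) \<le> KA * L'\<^sup>2" using e(3) KA by (intro mult_left_mono) (auto simp: e2_def)
      moreover have "(2 * c + 4 * K) * e2 \<le> (2 * c + 4 * K) * L'\<^sup>2"
        using e(2) K c by (intro mult_left_mono) (auto simp: e2_def)
      ultimately show ?thesis by (simp add: algebra_simps)
    qed
    have 3: "e2 * (KA * L + c * sqrt \<sigma>)\<^sup>2 \<le> 2 * (KA\<^sup>2 + c\<^sup>2) * L' ^ 3"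
    proof -
      have "(KA * L + c * sqrt \<sigma>)\<^sup>2 \<le> 2 * ((KA * L)\<^sup>2 + (c * sqrt \<sigma>)\<^sup>2)"
        using sum_squares_bound[of "KA * L" "c * sqrt \<sigma>"] by (simp add: power2_sum)
      also have "(c * sqrt \<sigma>)\<^sup>2 = c\<^sup>2 * \<sigma>" unfolding power_mult_distrib sig_sq_pos(3) ..
      also have "(KA * L)\<^sup>2 = KA\<^sup>2 * L\<^sup>2" by (rule power_mult_distrib)
      finally have "e2 * (KA * L + c * sqrt \<sigma>)\<^sup>2 \<le> e2 * (2 * (KA\<^sup>2 * L\<^sup>2 + c\<^sup>2 * \<sigma>))"
        using e20(1) by (rule mult_left_mono)
      also have "\<dots> = 2 * (KA\<^sup>2 * (e2 * L\<^sup>2) + c\<^sup>2 * (e2 * \<sigma>))" by (simp add: algebra_simps)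
      also have "\<dots> \<le> 2 * (KA\<^sup>2 * L' ^ 3 + c\<^sup>2 * L' ^ 3)"
        using e(4) e\<sigma> by (intro mult_left_mono add_mono) (auto simp: e2_def)
      finally show ?thesis by (simp add: algebra_simps)
    qed
    show ?thesis using K d v0 eL 2 3
      by (intro mult_left_mono add_mono mult_right_mono mult_left_mono[of _ _ "3 * d"] mult_left_mono[of _ _ "d\<^sup>2"]) auto
  qed
  also have "\<dots> \<le> C * (v ^ (m + 2) * L' + v ^ (m + 1) * L' ^ 2 + v ^ m * L' ^ 3)"
  proof -
    let ?a = "v ^ (m + 2) * L'" and ?b = "v ^ (m + 1) * L' ^ 2" and ?e = "v ^ m * L' ^ 3"
    let ?G = "3 * d * (KA + 2 * c + 4 * K)" and ?H = "2 * d\<^sup>2 * (KA\<^sup>2 + c\<^sup>2)"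
    have pos: "0 \<le> ?a" "0 \<le> ?b" "0 \<le> ?e" using v0 L by auto
    have gh: "0 \<le> ?G" "0 \<le> ?H" using d KA c K by auto
    have "1 * ?a + ?G * ?b + ?H * ?e \<le> (1 + ?G + ?H) * ?a + (1 + ?G + ?H) * ?b + (1 + ?G + ?H) * ?e"
      using pos gh by (intro add_mono mult_right_mono) auto
    then have "K * (1 * ?a + ?G * ?b + ?H * ?e) \<le> K * ((1 + ?G + ?H) * (?a + ?b + ?e))"
      using K by (intro mult_left_mono) (auto simp: distrib_left)
    moreover have "K * (L' * A + 3 * d * (g * P) * A' + D * (2 * h * Q) * A'') = K * (1 * (A * L') + 3 * d * g * (A' * P) + 2 * D * h * (A'' * Q))"
      for A A' A'' P Q g h D :: real by algebra
    ultimately show ?thesis unfolding C_def by (simp only: mult.assoc)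
  qed
  finally have "v \<le> (3 * C + 1) * L'"
    using K KA c d by (intro absorb_powers[OF v0 L(2)]) (auto simp: C_def)
  then have "v * \<sigma> ^ length es \<le> (3 * C + 1) * L' * \<sigma> ^ length es" using s by (intro mult_right_mono) auto
  then show ?thesis using less_imp_neq[OF sig_sq_pos(1)] by (simp add: v_def C_def)
qed

end

section \<open>Iterating the improvement up to the square root\<close>

context fbm
begin

text \<open>K may depend on the order r but not on the level, the index set or the directions, while
  L does not depend on r. This order of quantifiers lets a step for order r use the old bound at
  orders r + 1 and r + 2.\<close>

definition area_bound :: "(real \<Rightarrow> 'w \<Rightarrow> real) \<Rightarrow> 'd \<Rightarrow> 'd \<Rightarrow> nat \<Rightarrow> (nat \<Rightarrow> real \<Rightarrow> real) \<Rightarrow> bool" where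
  "area_bound F \<alpha> \<beta> m L \<longleftrightarrow> (\<forall>r. \<exists>K\<ge>0. \<forall>n S x y t es. weighted_area M H B F \<alpha> \<beta> n S x y t \<longrightarrow> cdirs n es \<longrightarrow> length es = r \<longrightarrow>
     nrm (m + 3) (area F \<alpha> \<beta> n S x y t es) \<le> K * L n (real (card S)) * sig n ^ r)"

text \<open>The triangle inequality over S: the two increments contribute one \<open>sig n\<close>
  through their standard deviations, and the weight contributes \<open>sig n ^ r\<close>. No
  cancellation is used.\<close>

lemma area_bound_trivial:
  assumes F: "F \<in> class_J M H B"
  shows "area_bound F \<alpha> \<beta> m (\<lambda>n k. k * sig n)"
  unfolding area_bound_def
proof (intro allI)
  fix r
  obtain K where K: "1 \<le> K" and bd: "\<forall>n t es. t \<in> {0..1} \<longrightarrow> cdirs n es \<longrightarrow> length es \<le> r \<longrightarrow> nrm (2 * (m + 3)) (W (F t) es) \<le> K * sig n ^ length es"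
    using cdirs_W_bound[OF F, of "2 * (m + 3)" r] by (auto simp del: mult_Suc_right)
  let ?g = "gauss_moment (2 * (2 * (m + 3)))"
  have "nrm (m + 3) (area F \<alpha> \<beta> n S x y t es) \<le> K * ?g\<^sup>2 * (real (card S) * sig n) * sig n ^ r"
    if wa: "weighted_area M H B F \<alpha> \<beta> n S x y t" and es: "cdirs n es" and r: "length es = r" for n S x y t es
  proof -
    interpret weighted_area M H B F \<alpha> \<beta> n S x y t by (rule wa)
    have "nrm (m + 3) (area F \<alpha> \<beta> n S x y t es) \<le> (\<Sum>i\<in>S. nrm (m + 3) (\<lambda>\<omega>. w es i \<omega> * (Xv i \<omega> * Yv i \<omega>)))"
      unfolding area_def[abs_def] by (intro nrm_sum all_moments_mult w_mom es XY_mom) auto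
    also have "\<dots> \<le> (\<Sum>i\<in>S. K * ?g\<^sup>2 * sig n * sig n ^ r)"
    proof (rule sum_mono)
      fix i assume i: "i \<in> S"
      have "nrm (m + 3) (\<lambda>\<omega>. w es i \<omega> * (Xv i \<omega> * Yv i \<omega>)) \<le> nrm (2 * (m + 3)) (w es i) * nrm (2 * (m + 3)) (\<lambda>\<omega>. Xv i \<omega> * Yv i \<omega>)"
        by (intro nrm_mult all_moments_mult w_mom es XY_mom i) auto
      also have "\<dots> \<le> (K * sig n ^ r) * ((?g * sqrt \<sigma>) * (?g * sqrt \<sigma>))"
      proof (rule mult_mono)
        show "nrm (2 * (m + 3)) (w es i) \<le> K * sig n ^ r"
          using bd[rule_format, OF t[OF i] es] r by simp
        have "nrm (2 * (m + 3)) (\<lambda>\<omega>. Xv i \<omega> * Yv i \<omega>) \<le> nrm (2 * (2 * (m + 3))) (Xv i) * nrm (2 * (2 * (m + 3))) (Yv i)"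
          by (intro nrm_mult XY_mom i) auto
        also have "\<dots> = (?g * sqrt \<sigma>) * (?g * sqrt \<sigma>)" using nrm_XY[OF i, of "2 * (2 * (m + 3))"] by simp
        finally show "nrm (2 * (m + 3)) (\<lambda>\<omega>. Xv i \<omega> * Yv i \<omega>) \<le> (?g * sqrt \<sigma>) * (?g * sqrt \<sigma>)" .
      qed (use K sig_pos[of n] in auto)
      also have "\<dots> = K * ?g\<^sup>2 * (sqrt \<sigma>)\<^sup>2 * sig n ^ r" by (simp only: power2_eq_square mult_ac)
      also have "(sqrt \<sigma>)\<^sup>2 = sig n" using sig_pos[of n] by simp
      finally show "nrm (m + 3) (\<lambda>\<omega>. w es i \<omega> * (Xv i \<omega> * Yv i \<omega>)) \<le> K * ?g\<^sup>2 * sig n * sig n ^ r" .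
    qed
    also have "\<dots> = K * ?g\<^sup>2 * (real (card S) * sig n) * sig n ^ r" by (simp add: mult_ac)
    finally show ?thesis .
  qed
  moreover have "0 \<le> K * ?g\<^sup>2" using K by simp
  ultimately show "\<exists>K\<ge>0. \<forall>n S x y t es. weighted_area M H B F \<alpha> \<beta> n S x y t \<longrightarrow> cdirs n es \<longrightarrow> length es = r \<longrightarrow>
     nrm (m + 3) (area F \<alpha> \<beta> n S x y t es) \<le> K * (real (card S) * sig n) * sig n ^ r" by blast
qed

lemma area_bound_step:
  assumes F: "F \<in> class_J M H B" and ev: "even (m + 3)" and old: "area_bound F \<alpha> \<beta> m L"
    and L: "\<And>n k. 1 \<le> k \<Longrightarrow> k \<le> 2 ^ n \<Longrightarrow> 0 < L n k \<and> 0 < L' n k \<and> k * (sig n)\<^sup>2 \<le> 1 \<and> k * (sig n)\<^sup>2 \<le> (L' n k)\<^sup>2 \<and>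
      k * (sig n)\<^sup>2 * L n k \<le> (L' n k)\<^sup>2 \<and> k * (sig n)\<^sup>2 * (L n k)\<^sup>2 \<le> L' n k ^ 3"
  shows "area_bound F \<alpha> \<beta> m L'"
  unfolding area_bound_def
proof (intro allI)
  fix r
  obtain K where K: "1 \<le> K" and bd: "\<forall>n t es. t \<in> {0..1} \<longrightarrow> cdirs n es \<longrightarrow> length es \<le> r + 2 \<longrightarrow> nrm (2 * (m + 3)) (W (F t) es) \<le> K * sig n ^ length es"
    using cdirs_W_bound[OF F, of "2 * (m + 3)" "r + 2"] by (auto simp del: mult_Suc_right)
  obtain K1 where K1: "0 \<le> K1" and b1: "\<forall>n S x y t es. weighted_area M H B F \<alpha> \<beta> n S x y t \<longrightarrow> cdirs n es \<longrightarrow> length es = r + 1 \<longrightarrow>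
     nrm (m + 3) (area F \<alpha> \<beta> n S x y t es) \<le> K1 * L n (real (card S)) * sig n ^ (r + 1)"
    using old[unfolded area_bound_def, rule_format, of "r + 1"] by blast
  obtain K2 where K2: "0 \<le> K2" and b2: "\<forall>n S x y t es. weighted_area M H B F \<alpha> \<beta> n S x y t \<longrightarrow> cdirs n es \<longrightarrow> length es = r + 2 \<longrightarrow>
     nrm (m + 3) (area F \<alpha> \<beta> n S x y t es) \<le> K2 * L n (real (card S)) * sig n ^ (r + 2)"
    using old[unfolded area_bound_def, rule_format, of "r + 2"] by blast
  define KA where "KA = K1 + K2"
  have KA: "0 \<le> KA" using K1 K2 by (simp add: KA_def)
  define c where "c = 2 * K * gauss_moment (2 * (m + 3))"
  define d where "d = real (m + 2)"
  define C where "C = 3 * (K * (1 + 3 * d * (KA + 2 * c + 4 * K) + 2 * d\<^sup>2 * (KA\<^sup>2 + c\<^sup>2))) + 1"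
  have C: "0 \<le> C" using K KA gauss_moment_nonneg by (simp add: C_def c_def d_def)
  have "nrm (m + 3) (area F \<alpha> \<beta> n S x y t es) \<le> C * L' n (real (card S)) * sig n ^ r"
    if wa: "weighted_area M H B F \<alpha> \<beta> n S x y t" and es: "cdirs n es" and r: "length es = r" for n S x y t es
  proof -
    interpret weighted_area M H B F \<alpha> \<beta> n S x y t by (rule wa)
    note LL = L[OF card_S]
    have wK: "nrm (2 * (m + 3)) (w ds j) \<le> K * \<sigma> ^ length ds" if "j \<in> S" "cdirs n ds" "length ds \<le> length es + 2" for j ds
      using bd[rule_format, OF t[OF that(1)] that(2)] that(3) r by simp
    have ZA: "nrm (m + 3) (Z ds) \<le> (KA * L n (real (card S))) * \<sigma> ^ length ds"
      if ds: "cdirs n ds" "length es < length ds" "length ds \<le> length es + 2" for ds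
    proof -
      consider "length ds = r + 1" | "length ds = r + 2" using ds r by linarith
      then obtain K' where "K' \<le> KA" "nrm (m + 3) (Z ds) \<le> K' * L n (real (card S)) * \<sigma> ^ length ds"
      proof cases
        case 1
        show thesis by (rule that[of K1]) (use b1[rule_format, OF wa ds(1) 1] 1 K2 in \<open>auto simp: KA_def\<close>)
      next
        case 2
        show thesis by (rule that[of K2]) (use b2[rule_format, OF wa ds(1) 2] 2 K1 in \<open>auto simp: KA_def\<close>)
      qed
      moreover from this(1) have "K' * L n (real (card S)) * \<sigma> ^ length ds \<le> KA * L n (real (card S)) * \<sigma> ^ length ds"
        using LL sig_pos[of n] by (intro mult_right_mono) auto
      ultimately show ?thesis by linarith
    qed
    have "nrm (m + 3) (Z es) \<le> C * L' n (real (card S)) * \<sigma> ^ length es"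
      unfolding C_def c_def d_def using LL by (intro improvement[OF es K KA ev wK ZA]) auto
    then show ?thesis by (simp only: r)
  qed
  with C show "\<exists>K\<ge>0. \<forall>n S x y t es. weighted_area M H B F \<alpha> \<beta> n S x y t \<longrightarrow> cdirs n es \<longrightarrow> length es = r \<longrightarrow>
     nrm (m + 3) (area F \<alpha> \<beta> n S x y t es) \<le> K * L' n (real (card S)) * sig n ^ r" by blast
qed

text \<open>The first bound holds at k = \<open>2 ^ n\<close> because 6H >= 2, and smaller k only
  help. The second follows by squaring, as one more factor \<open>sig n\<close> is at most
  1.\<close>

lemma sig_card_bound:
  assumes "1 / 3 < H" "0 \<le> k" "k \<le> 2 ^ n"
  shows "k\<^sup>2 * sig n ^ 3 \<le> 1" "k * (sig n)\<^sup>2 \<le> 1"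
proof -
  have "sig n ^ 3 = (1 / 2 ^ n) powr (6 * H)" unfolding sig_def by (simp add: powr_power)
  also have "\<dots> \<le> (1 / 2 ^ n) powr 2"
    by (rule powr_mono') (use assms in \<open>auto simp: divide_le_eq\<close>)
  also have "\<dots> = (1 / 2 ^ n)\<^sup>2" by simp
  finally have "(2 ^ n)\<^sup>2 * sig n ^ 3 \<le> 1" by (simp add: power_divide field_simps)
  moreover have "k\<^sup>2 * sig n ^ 3 \<le> (2 ^ n)\<^sup>2 * sig n ^ 3" using assms sig_pos[of n] by (intro mult_right_mono power_mono) auto
  ultimately show 1: "k\<^sup>2 * sig n ^ 3 \<le> 1" by linarith
  have "(k * (sig n)\<^sup>2)\<^sup>2 = k\<^sup>2 * sig n ^ 3 * sig n" by (simp add: power_mult_distrib power2_eq_square power3_eq_cube)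
  also have "\<dots> \<le> 1 * 1" using 1 sig_pos[of n] sig_le_1[of n] by (intro mult_mono) auto
  finally have "(k * (sig n)\<^sup>2)\<^sup>2 \<le> 1\<^sup>2" by simp
  then show "k * (sig n)\<^sup>2 \<le> 1" by (rule power2_le_imp_le) simp
qed

text \<open>Each step turns a bound \<open>L\<close> for the weighted areas of all orders into a better one; starting from the
  triangle inequality, \<open>L = |S| \<sigma>\<close>, four steps lead to square root cancellation, \<open>L = |S|\<^sup>1\<^sup>/\<^sup>2 \<sigma>\<close>.
  This is where \<open>H > 1/3\<close> enters: it gives \<open>|S|\<^sup>2 \<sigma>\<^sup>3 \<le> 1\<close>.\<close>

lemma area_bound_sqrt:
  assumes F: "F \<in> class_J M H B" and ev: "even (m + 3)" and H: "1 / 3 < H"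
  shows "area_bound F \<alpha> \<beta> m (\<lambda>n k. 2 * sqrt (k * (sig n)\<^sup>2))"
proof -
  note step = area_bound_step[OF F ev]
  \<comment> \<open>From L = k \<sigma>: k \<sigma>^2 L <= 1 and k \<sigma>^2 L^2 <= k \<sigma> by
    k^2 \<sigma>^3 <= 1, so the cube root is allowed. The summand 1 keeps L' >= 1, which settles the
    lower-order conditions.\<close>
  have "area_bound F \<alpha> \<beta> m (\<lambda>n k. root 3 (1 + k * sig n))"
  proof (rule step[OF area_bound_trivial[OF F]])
    fix n and k :: real assume k: "1 \<le> k" "k \<le> 2 ^ n"
    have s: "0 < sig n" by (rule sig_pos)
    note b = sig_card_bound[OF H _ k(2)]
    let ?L = "root 3 (1 + k * sig n)"
    have T: "0 < k * sig n" using k s by simp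
    have L1: "1 \<le> ?L" using T by simp
    then have L2: "1 \<le> ?L\<^sup>2" by (rule one_le_power)
    have c1: "k * (sig n)\<^sup>2 * (k * sig n) \<le> 1" using b(1) k by (simp add: power2_eq_square power3_eq_cube mult_ac)
    have "k * (sig n)\<^sup>2 * (k * sig n)\<^sup>2 = k * (sig n)\<^sup>2 * (k * sig n) * (k * sig n)" by (simp add: power2_eq_square)
    also have "\<dots> \<le> 1 * (k * sig n)" using c1 T by (intro mult_right_mono) auto
    also have "\<dots> \<le> ?L ^ 3" using T by (simp add: odd_real_root_pow)
    finally show "0 < k * sig n \<and> 0 < ?L \<and> k * (sig n)\<^sup>2 \<le> 1 \<and> k * (sig n)\<^sup>2 \<le> ?L\<^sup>2 \<and>
      k * (sig n)\<^sup>2 * (k * sig n) \<le> ?L\<^sup>2 \<and> k * (sig n)\<^sup>2 * (k * sig n)\<^sup>2 \<le> ?L ^ 3"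
      using T L1 L2 c1 b(2) k by linarith
  qed
  \<comment> \<open>Now L and L^2 are at most L^3 = 1 + k \<sigma>, and k \<sigma>^2 (1 + k
    \<sigma>) <= 2 by the two bounds of \<open>sig_card_bound\<close>; a constant is
    reached.\<close>
  then have "area_bound F \<alpha> \<beta> m (\<lambda>n k. 2)"
  proof (rule step)
    fix n and k :: real assume k: "1 \<le> k" "k \<le> 2 ^ n"
    have s: "0 < sig n" by (rule sig_pos)
    note b = sig_card_bound[OF H _ k(2)]
    let ?L = "root 3 (1 + k * sig n)"
    have T: "0 < k * sig n" using k s by simp
    have L1: "1 \<le> ?L" using T by simp
    have L3: "?L ^ 3 = 1 + k * sig n" by (simp add: odd_real_root_pow)
    have L23: "?L\<^sup>2 \<le> 1 + k * sig n" using power_increasing[of 2 3 ?L] L1 L3 by simp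
    have L12: "?L \<le> 1 + k * sig n" using power_increasing[of 1 3 ?L] L1 L3 by simp
    have c1: "k * (sig n)\<^sup>2 * (1 + k * sig n) \<le> 2"
    proof -
      have "k * (sig n)\<^sup>2 * (1 + k * sig n) = k * (sig n)\<^sup>2 + k\<^sup>2 * sig n ^ 3"
        by (simp add: power2_eq_square power3_eq_cube algebra_simps)
      then show ?thesis using b k by simp
    qed
    have "k * (sig n)\<^sup>2 * ?L \<le> k * (sig n)\<^sup>2 * (1 + k * sig n)" "k * (sig n)\<^sup>2 * ?L\<^sup>2 \<le> k * (sig n)\<^sup>2 * (1 + k * sig n)"
      using L12 L23 k by (auto intro!: mult_left_mono)
    then have "k * (sig n)\<^sup>2 * ?L \<le> 2" "k * (sig n)\<^sup>2 * ?L\<^sup>2 \<le> 2" using c1 by linarith+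
    then show "0 < ?L \<and> 0 < (2::real) \<and> k * (sig n)\<^sup>2 \<le> 1 \<and> k * (sig n)\<^sup>2 \<le> 2\<^sup>2 \<and>
      k * (sig n)\<^sup>2 * ?L \<le> 2\<^sup>2 \<and> k * (sig n)\<^sup>2 * ?L\<^sup>2 \<le> 2 ^ 3"
      using L1 b(2) k by simp
  qed
  \<comment> \<open>With a constant L and e = k \<sigma>^2, the decisive condition is e <= L'^3 up
    to a constant, which gives the cube root of e.\<close>
  then have "area_bound F \<alpha> \<beta> m (\<lambda>n k. 2 * root 3 (k * (sig n)\<^sup>2))"
  proof (rule step)
    fix n and k :: real assume k: "1 \<le> k" "k \<le> 2 ^ n"
    have s: "0 < sig n" by (rule sig_pos)
    define e where "e = k * (sig n)\<^sup>2"
    define l where "l = root 3 e"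
    have e: "0 < e" "e \<le> 1" using sig_card_bound(2)[OF H _ k(2)] k s by (auto simp: e_def)
    have l: "0 < l" "l \<le> 1" "l ^ 3 = e" using e by (auto simp: l_def odd_real_root_pow)
    have "e \<le> l\<^sup>2" using power_decreasing[of 2 3 l] l by simp
    with e l have "0 < (2::real) \<and> 0 < 2 * l \<and> e \<le> 1 \<and> e \<le> (2 * l)\<^sup>2 \<and> e * 2 \<le> (2 * l)\<^sup>2 \<and> e * 2\<^sup>2 \<le> (2 * l) ^ 3"
      by (simp add: power_mult_distrib)
    then show "0 < (2::real) \<and> 0 < 2 * root 3 (k * (sig n)\<^sup>2) \<and> k * (sig n)\<^sup>2 \<le> 1 \<and> k * (sig n)\<^sup>2 \<le> (2 * root 3 (k * (sig n)\<^sup>2))\<^sup>2 \<and>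
      k * (sig n)\<^sup>2 * 2 \<le> (2 * root 3 (k * (sig n)\<^sup>2))\<^sup>2 \<and> k * (sig n)\<^sup>2 * 2\<^sup>2 \<le> (2 * root 3 (k * (sig n)\<^sup>2)) ^ 3"
      unfolding e_def l_def .
  qed
  \<comment> \<open>With L of order e^(1/3), the last condition asks for e^(5/3) <= e^(3/2), true
    for e <= 1. The condition e <= L'^2 admits nothing essentially smaller than the square
    root.\<close>
  then show ?thesis
  proof (rule step)
    fix n and k :: real assume k: "1 \<le> k" "k \<le> 2 ^ n"
    have s: "0 < sig n" by (rule sig_pos)
    define e where "e = k * (sig n)\<^sup>2"
    define l where "l = root 3 e"
    define h where "h = sqrt e"
    have e: "0 < e" "e \<le> 1" using sig_card_bound(2)[OF H _ k(2)] k s by (auto simp: e_def)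
    have l: "0 < l" "l \<le> 1" "l ^ 3 = e" using e by (auto simp: l_def odd_real_root_pow)
    have h: "0 < h" "h\<^sup>2 = e" using e by (auto simp: h_def)
    have "l\<^sup>2 \<le> h"
    proof (rule power2_le_imp_le)
      have "(l\<^sup>2)\<^sup>2 = l ^ 4" by simp
      also have "\<dots> \<le> l ^ 3" by (rule power_decreasing) (use l in auto)
      finally show "(l\<^sup>2)\<^sup>2 \<le> h\<^sup>2" using h l by simp
    qed (use h in simp)
    then have "h\<^sup>2 * l\<^sup>2 \<le> h\<^sup>2 * h" by (intro mult_left_mono) auto
    moreover have "e * l \<le> e * 1" using e l by (intro mult_left_mono) auto
    ultimately have "0 < 2 * l \<and> 0 < 2 * h \<and> e \<le> 1 \<and> e \<le> (2 * h)\<^sup>2 \<and> e * (2 * l) \<le> (2 * h)\<^sup>2 \<and> e * (2 * l)\<^sup>2 \<le> (2 * h) ^ 3"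
      using e l h by (simp add: power_mult_distrib power3_eq_cube power2_eq_square mult_ac)
    then show "0 < 2 * root 3 (k * (sig n)\<^sup>2) \<and> 0 < 2 * sqrt (k * (sig n)\<^sup>2) \<and> k * (sig n)\<^sup>2 \<le> 1 \<and> k * (sig n)\<^sup>2 \<le> (2 * sqrt (k * (sig n)\<^sup>2))\<^sup>2 \<and>
      k * (sig n)\<^sup>2 * (2 * root 3 (k * (sig n)\<^sup>2)) \<le> (2 * sqrt (k * (sig n)\<^sup>2))\<^sup>2 \<and> k * (sig n)\<^sup>2 * (2 * root 3 (k * (sig n)\<^sup>2))\<^sup>2 \<le> (2 * sqrt (k * (sig n)\<^sup>2)) ^ 3"
      unfolding e_def l_def h_def .
  qed
qed

lemma area_Nil: "area F \<alpha> \<beta> n S x y t [] = (\<lambda>\<omega>. \<Sum>i\<in>S. F (t i) \<omega> * (binc (cell \<alpha> n (x i)) \<omega> * binc (cell \<beta> n (y i)) \<omega>))"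
  by (rule ext) (simp add: area_def W_def VG_def)

lemma weighted_area_moment:
  assumes F: "F \<in> class_J M H B" and ev: "even q" "4 \<le> q" and H: "1 / 3 < H" and ab: "\<alpha> \<noteq> \<beta>"
  shows "\<exists>K\<ge>0. \<forall>n S x y t. finite S \<longrightarrow> inj_on x S \<longrightarrow> inj_on y S \<longrightarrow> (\<forall>i\<in>S. x i < 2 ^ n \<and> y i < 2 ^ n \<and> t i \<in> {0..1}) \<longrightarrow>
      area F \<alpha> \<beta> n S x y t [] \<in> all_moments \<and> nrm q (area F \<alpha> \<beta> n S x y t []) \<le> K * (sqrt (card S) * sig n)"
proof -
  obtain m where m: "q = m + 3" using le_Suc_ex[of 3 q] ev by auto
  obtain K where K: "0 \<le> K" and bd: "\<forall>n S x y t es. weighted_area M H B F \<alpha> \<beta> n S x y t \<longrightarrow> cdirs n es \<longrightarrow> length es = 0 \<longrightarrow>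
     nrm (m + 3) (area F \<alpha> \<beta> n S x y t es) \<le> K * (2 * sqrt (real (card S) * (sig n)\<^sup>2)) * sig n ^ 0"
    using area_bound_sqrt[OF F ev(1)[unfolded m] H, unfolded area_bound_def, rule_format, of \<alpha> \<beta> 0] by blast
  have "area F \<alpha> \<beta> n S x y t [] \<in> all_moments \<and> nrm q (area F \<alpha> \<beta> n S x y t []) \<le> 2 * K * (sqrt (card S) * sig n)"
    if S: "finite S" "inj_on x S" "inj_on y S" and xyt: "\<forall>i\<in>S. x i < 2 ^ n \<and> y i < 2 ^ n \<and> t i \<in> {0..1}" for n S x y t
  proof (cases "S = {}")
    case True
    then show ?thesis using all_moments_const[of 0] ev by (simp add: area_Nil)
  next
    case False
    then have wa: "weighted_area M H B F \<alpha> \<beta> n S x y t"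
      using F ab S xyt fbm_axioms by (simp add: weighted_area_def weighted_area_axioms_def)
    then interpret weighted_area M H B F \<alpha> \<beta> n S x y t .
    obtain i where "i \<in> S" using False by blast
    from moms(1)[OF this, of "[]"] have "area F \<alpha> \<beta> n S x y t [] \<in> all_moments" by simp
    moreover have "nrm q (area F \<alpha> \<beta> n S x y t []) \<le> 2 * K * (sqrt (card S) * sig n)"
      using bd[rule_format, OF wa, of "[]"] sig_pos[of n] by (simp add: m real_sqrt_mult mult_ac)
    ultimately show ?thesis ..
  qed
  with K show ?thesis by (intro exI[of _ "2 * K"]) simp
qed

end

text \<open>A subsequence converges almost surely, and Fatou's lemma transfers the bound. The limit
  T is not known to have moments of all orders, so its integrability is part of the
  conclusion.\<close>

lemma (in prob_space) nrm_L1_limit: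
  assumes q: "0 < q" and S: "\<And>l. S l \<in> all_moments" "\<And>l. nrm q (S l) \<le> C" and T: "T \<in> borel_measurable M"
    and i: "\<And>l. integrable M (\<lambda>\<omega>. S l \<omega> - T \<omega>)" and lim: "(\<lambda>l. \<integral>\<omega>. \<bar>S l \<omega> - T \<omega>\<bar> \<partial>M) \<longlonglongrightarrow> 0"
  shows "integrable M (\<lambda>\<omega>. \<bar>T \<omega>\<bar> ^ q)" "(\<integral>\<omega>. \<bar>T \<omega>\<bar> ^ q \<partial>M) \<le> C ^ q"
proof -
  note [measurable] = T all_momentsD(1)[OF S(1)]
  have C: "0 \<le> C" using S(2) order_trans[OF nrm_nonneg] by blast
  obtain \<phi> where "strict_mono \<phi>" and AE: "AE \<omega> in M. (\<lambda>l. S (\<phi> l) \<omega> - T \<omega>) \<longlonglongrightarrow> 0"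
    using tendsto_L1_AE_subseq[OF i, of "\<lambda>l. l"] lim by auto
  have bd: "(\<integral>\<^sup>+\<omega>. ennreal (\<bar>S l \<omega>\<bar> ^ q) \<partial>M) \<le> ennreal (C ^ q)" for l
  proof -
    have "(\<integral>\<^sup>+\<omega>. ennreal (\<bar>S l \<omega>\<bar> ^ q) \<partial>M) = ennreal (\<integral>\<omega>. \<bar>S l \<omega>\<bar> ^ q \<partial>M)"
      by (intro nn_integral_eq_integral all_momentsD(2) S) auto
    also have "(\<integral>\<omega>. \<bar>S l \<omega>\<bar> ^ q \<partial>M) = nrm q (S l) ^ q" using nrm_power[OF q, of "S l"] by simp
    also have "ennreal (nrm q (S l) ^ q) \<le> ennreal (C ^ q)" by (intro ennreal_leI power_mono S nrm_nonneg)
    finally show ?thesis .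
  qed
  have "(\<integral>\<^sup>+\<omega>. ennreal (\<bar>T \<omega>\<bar> ^ q) \<partial>M) = (\<integral>\<^sup>+\<omega>. liminf (\<lambda>l. ennreal (\<bar>S (\<phi> l) \<omega>\<bar> ^ q)) \<partial>M)"
  proof (rule nn_integral_cong_AE)
    show "AE \<omega> in M. ennreal (\<bar>T \<omega>\<bar> ^ q) = liminf (\<lambda>l. ennreal (\<bar>S (\<phi> l) \<omega>\<bar> ^ q))"
      using AE
    proof eventually_elim
      case (elim \<omega>)
      then have "(\<lambda>l. S (\<phi> l) \<omega>) \<longlonglongrightarrow> T \<omega>" by (simp add: LIM_zero_cancel)
      then have "(\<lambda>l. ennreal (\<bar>S (\<phi> l) \<omega>\<bar> ^ q)) \<longlonglongrightarrow> ennreal (\<bar>T \<omega>\<bar> ^ q)"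
        by (intro tendsto_ennrealI tendsto_intros)
      then show ?case by (rule lim_imp_Liminf[OF sequentially_bot, symmetric])
    qed
  qed
  also have "\<dots> \<le> liminf (\<lambda>l. \<integral>\<^sup>+\<omega>. ennreal (\<bar>S (\<phi> l) \<omega>\<bar> ^ q) \<partial>M)" by (rule nn_integral_liminf) measurable
  also have "\<dots> \<le> ennreal (C ^ q)"
    using Liminf_mono[of "\<lambda>l. \<integral>\<^sup>+\<omega>. ennreal (\<bar>S (\<phi> l) \<omega>\<bar> ^ q) \<partial>M" "\<lambda>_. ennreal (C ^ q)" sequentially] bd
    by (simp add: Liminf_const)
  finally have fin: "(\<integral>\<^sup>+\<omega>. ennreal (\<bar>T \<omega>\<bar> ^ q) \<partial>M) \<le> ennreal (C ^ q)" .
  show I: "integrable M (\<lambda>\<omega>. \<bar>T \<omega>\<bar> ^ q)"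
    by (rule integrableI_nonneg) (use le_less_trans[OF fin ennreal_less_top] in auto)
  have "ennreal (\<integral>\<omega>. \<bar>T \<omega>\<bar> ^ q \<partial>M) \<le> ennreal (C ^ q)"
    using fin by (subst nn_integral_eq_integral[OF I, symmetric]) auto
  then show "(\<integral>\<omega>. \<bar>T \<omega>\<bar> ^ q \<partial>M) \<le> C ^ q" using C by (subst (asm) ennreal_le_iff) auto
qed

lemma sum_blocks:
  fixes g :: "nat \<Rightarrow> 'a::comm_monoid_add"
  assumes "a \<le> b"
  shows "(\<Sum>i\<in>{a..<b}. \<Sum>j<N. g (i * N + j)) = (\<Sum>k\<in>{a * N..<b * N}. g k)"
  using assms
proof (induction b rule: dec_induct)
  case (step b)
  have "(\<Sum>j<N. g (b * N + j)) = (\<Sum>k\<in>{b * N..<Suc b * N}. g k)"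
    using sum.shift_bounds_nat_ivl[of g 0 "b * N" N] by (simp add: add.commute atLeast0LessThan)
  moreover have "{a * N..<Suc b * N} = {a * N..<b * N} \<union> {b * N..<Suc b * N}"
    using step by (intro ivl_disj_un_two(3)[symmetric]) auto
  ultimately show ?case using step
    by (simp add: sum.union_disjoint ivl_disj_int_two(3))
qed simp

lemma dyadic_01: "k \<le> 2 ^ n \<Longrightarrow> dyadic n k \<in> {0..1}"
proof -
  assume "k \<le> 2 ^ n"
  then have "real k \<le> real (2 ^ n)" by (rule of_nat_mono)
  then show ?thesis by (simp add: dyadic_def)
qed

lemma dyadic_double: "dyadic (m + Suc l) (2 * k) = dyadic (m + l) k"
  by (simp add: dyadic_def)

lemma dyadic_scale: "dyadic (m + l) (i * 2 ^ l) = dyadic m i"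
  by (simp add: dyadic_def power_add)

section \<open>From discrete areas to iterated integrals\<close>

context fbm
begin

text \<open>The Riemann sum of the iterated integral over the i-th cell of level m, along its
  subdivision into \<open>2 ^ l\<close> equal cells. For l = 0 the \<alpha>-factor is an increment
  of length 0, so the telescoping starts at 0.\<close>

definition riem :: "'d \<Rightarrow> 'd \<Rightarrow> nat \<Rightarrow> nat \<Rightarrow> nat \<Rightarrow> 'w \<Rightarrow> real" where
  "riem \<alpha> \<beta> m l i \<omega> = (\<Sum>j<2 ^ l. (B \<alpha> (dyadic (m + l) (i * 2 ^ l + j)) \<omega> - B \<alpha> (dyadic m i) \<omega>) *
     (B \<beta> (dyadic (m + l) (i * 2 ^ l + Suc j)) \<omega> - B \<beta> (dyadic (m + l) (i * 2 ^ l + j)) \<omega>))"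

lemma riem_0: "riem \<alpha> \<beta> m 0 i \<omega> = 0"
  by (simp add: riem_def)

text \<open>When a cell is halved, the left endpoint used by the \<alpha>-factor changes only on the
  second half, where it moves to the midpoint. The correction is therefore the first-half
  \<alpha>-increment times the second-half \<beta>-increment.\<close>

lemma riem_Suc:
  "riem \<alpha> \<beta> m (Suc l) i \<omega> = riem \<alpha> \<beta> m l i \<omega> +
    (\<Sum>j<2 ^ l. binc (cell \<alpha> (Suc (m + l)) (2 * (i * 2 ^ l + j))) \<omega> * binc (cell \<beta> (Suc (m + l)) (Suc (2 * (i * 2 ^ l + j)))) \<omega>)"
proof -
  let ?f = "\<lambda>j. (B \<alpha> (dyadic (m + Suc l) (i * 2 ^ Suc l + j)) \<omega> - B \<alpha> (dyadic m i) \<omega>) *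
     (B \<beta> (dyadic (m + Suc l) (i * 2 ^ Suc l + Suc j)) \<omega> - B \<beta> (dyadic (m + Suc l) (i * 2 ^ Suc l + j)) \<omega>)"
  have pair: "(\<Sum>j<2 * N. f j) = (\<Sum>j<N. f (2 * j) + f (Suc (2 * j)))" for f :: "nat \<Rightarrow> real" and N
    by (induction N) auto
  have "riem \<alpha> \<beta> m (Suc l) i \<omega> = (\<Sum>j<2 ^ l. ?f (2 * j) + ?f (Suc (2 * j)))"
    unfolding riem_def power_Suc by (rule pair)
  also have "\<dots> = (\<Sum>j<2 ^ l. (B \<alpha> (dyadic (m + l) (i * 2 ^ l + j)) \<omega> - B \<alpha> (dyadic m i) \<omega>) *
     (B \<beta> (dyadic (m + l) (i * 2 ^ l + Suc j)) \<omega> - B \<beta> (dyadic (m + l) (i * 2 ^ l + j)) \<omega>) +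
     binc (cell \<alpha> (Suc (m + l)) (2 * (i * 2 ^ l + j))) \<omega> * binc (cell \<beta> (Suc (m + l)) (Suc (2 * (i * 2 ^ l + j)))) \<omega>)"
  proof (intro sum.cong refl)
    fix j
    define k where "k = i * 2 ^ l + j"
    have e: "i * 2 ^ Suc l + 2 * j = 2 * k" "i * 2 ^ Suc l + Suc (2 * j) = Suc (2 * k)"
      "i * 2 ^ Suc l + Suc (Suc (2 * j)) = 2 * Suc k" "i * 2 ^ l + j = k" "i * 2 ^ l + Suc j = Suc k"
      by (auto simp: k_def)
    have c: "cell \<alpha> (Suc (m + l)) (2 * k) = (\<alpha>, dyadic (m + l) k, dyadic (m + Suc l) (Suc (2 * k)))"
      "cell \<beta> (Suc (m + l)) (Suc (2 * k)) = (\<beta>, dyadic (m + Suc l) (Suc (2 * k)), dyadic (m + l) (Suc k))"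
      using dyadic_double[of m l k] dyadic_double[of m l "Suc k"] by (simp_all add: cell_def)
    show "?f (2 * j) + ?f (Suc (2 * j)) = (B \<alpha> (dyadic (m + l) (i * 2 ^ l + j)) \<omega> - B \<alpha> (dyadic m i) \<omega>) *
     (B \<beta> (dyadic (m + l) (i * 2 ^ l + Suc j)) \<omega> - B \<beta> (dyadic (m + l) (i * 2 ^ l + j)) \<omega>) +
     binc (cell \<alpha> (Suc (m + l)) (2 * (i * 2 ^ l + j))) \<omega> * binc (cell \<beta> (Suc (m + l)) (Suc (2 * (i * 2 ^ l + j)))) \<omega>"
      unfolding e dyadic_double c binc_def fst_conv snd_conv by (simp add: algebra_simps)
  qed
  also have "\<dots> = riem \<alpha> \<beta> m l i \<omega> +
    (\<Sum>j<2 ^ l. binc (cell \<alpha> (Suc (m + l)) (2 * (i * 2 ^ l + j))) \<omega> * binc (cell \<beta> (Suc (m + l)) (Suc (2 * (i * 2 ^ l + j)))) \<omega>)"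
    unfolding riem_def by (rule sum.distrib)
  finally show ?thesis .
qed

lemma riem_all_moments:
  assumes "i < 2 ^ m" shows "riem \<alpha> \<beta> m l i \<in> all_moments"
proof -
  have D: "dyadic (m + l) (i * 2 ^ l + j) \<in> {0..1}" if "j \<le> 2 ^ l" for j
  proof -
    have "i * 2 ^ l + j \<le> Suc i * 2 ^ l" using that by simp
    also have "\<dots> \<le> 2 ^ m * 2 ^ l" using assms by (intro mult_right_mono) auto
    finally show ?thesis by (intro dyadic_01) (simp only: power_add)
  qed
  have s: "dyadic m i \<in> {0..1}" using D[of 0] by (simp add: dyadic_scale)
  have Bm: "B \<gamma> t \<in> all_moments" if "t \<in> {0..1}" for \<gamma> t by (rule G_moments(1)[OF B_chaos[OF that]])
  show ?thesis unfolding riem_def[abs_def]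
    by (intro all_moments_sum all_moments_mult all_moments_diff Bm D s) auto
qed

lemma sig_eq_power: "sig n = sig 1 ^ n"
proof -
  have "(1 / 2 ^ n :: real) = (1 / 2) powr real n" by (simp add: powr_realpow power_one_over)
  then show ?thesis unfolding sig_def by (simp add: powr_power powr_powr)
qed

text \<open>Refinement from l to l + 1 adds a weighted area with (b - a) 2^l terms at level m + l +
  1, so square root cancellation makes the corrections decay like \<rho>^l. Without cancellation the
  ratio would be 2 \<open>sig 1\<close>, which is not below 1 for H <= 1/2.\<close>

lemma weighted_riem_moment:
  assumes F: "F \<in> class_J M H B" and ev: "even q" "4 \<le> q" and H: "1 / 3 < H" and ab: "\<alpha> \<noteq> \<beta>"
  obtains K where "0 \<le> K"
    "\<And>m a b l. a \<le> b \<Longrightarrow> b \<le> 2 ^ m \<Longrightarrow>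
      nrm q (\<lambda>\<omega>. \<Sum>i\<in>{a..<b}. F (dyadic m i) \<omega> * riem \<alpha> \<beta> m l i \<omega>) \<le> K * (sqrt (b - a) * sig m)"
proof -
  obtain K where K: "0 \<le> K" and
    bd0: "\<forall>n S x y t. finite S \<longrightarrow> inj_on x S \<longrightarrow> inj_on y S \<longrightarrow> (\<forall>i\<in>S. x i < 2 ^ n \<and> y i < 2 ^ n \<and> t i \<in> {0..1}) \<longrightarrow>
      area F \<alpha> \<beta> n S x y t [] \<in> all_moments \<and> nrm q (area F \<alpha> \<beta> n S x y t []) \<le> K * (sqrt (card S) * sig n)"
    using weighted_area_moment[OF F ev H ab] by blast
  \<comment> \<open>The ratio of consecutive levels: the number of terms doubles, giving the square
    root of 2, and the variance is multiplied by \<open>sig 1\<close> = 2^(-2H). It is below 1 as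
    soon as H > 1/4.\<close>
  define \<rho> where "\<rho> = sqrt 2 * sig 1"
  have s1: "0 < sig 1" "sig 1 \<le> 1" by (rule sig_pos, rule sig_le_1)
  have \<rho>: "0 \<le> \<rho>" "\<rho> < 1"
  proof -
    show "0 \<le> \<rho>" using s1 by (simp add: \<rho>_def)
    have "sig 1 = (1 / 2) powr (2 * H)" by (simp add: sig_def)
    also have "\<dots> < (1 / 2) powr (1 / 2)" using H by (intro powr_less_mono') auto
    also have "\<dots> = 1 / sqrt 2" by (simp add: powr_half_sqrt real_sqrt_divide)
    finally show "\<rho> < 1" by (simp add: \<rho>_def field_simps)
  qed
  have q: "0 < q" using ev by simp
  have "nrm q (\<lambda>\<omega>. \<Sum>i\<in>{a..<b}. F (dyadic m i) \<omega> * riem \<alpha> \<beta> m l i \<omega>) \<le> K * (sqrt (b - a) * sig m) * (\<Sum>k<l. \<rho> ^ k) \<and>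
    (\<lambda>\<omega>. \<Sum>i\<in>{a..<b}. F (dyadic m i) \<omega> * riem \<alpha> \<beta> m l i \<omega>) \<in> all_moments"
    if abm: "a \<le> b" "b \<le> 2 ^ m" for m a b l
  proof (induction l)
    case 0
    then show ?case using q by (simp add: riem_0)
  next
    case (Suc l)
    let ?S = "\<lambda>l \<omega>. \<Sum>i\<in>{a..<b}. F (dyadic m i) \<omega> * riem \<alpha> \<beta> m l i \<omega>"
    let ?n = "Suc (m + l)"
    \<comment> \<open>The pairs (i, j) are merged into k = i 2^l + j, so the coarse cell carrying
      the weight is recovered by \<open>k div 2 ^ l\<close>. The \<alpha>-increments sit on even and
      the \<beta>-increments on odd cells of the finer level.\<close>
    let ?T = "\<lambda>\<omega>. \<Sum>k\<in>{a * 2 ^ l..<b * 2 ^ l}. F (dyadic m (k div 2 ^ l)) \<omega> * (binc (cell \<alpha> ?n (2 * k)) \<omega> * binc (cell \<beta> ?n (Suc (2 * k))) \<omega>)"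
    have eq: "?S (Suc l) = (\<lambda>\<omega>. ?S l \<omega> + ?T \<omega>)"
    proof
      fix \<omega>
      let ?g = "\<lambda>k. F (dyadic m (k div 2 ^ l)) \<omega> * (binc (cell \<alpha> ?n (2 * k)) \<omega> * binc (cell \<beta> ?n (Suc (2 * k))) \<omega>)"
      have "?S (Suc l) \<omega> = ?S l \<omega> + (\<Sum>i\<in>{a..<b}. \<Sum>j<2 ^ l. F (dyadic m i) \<omega> *
         (binc (cell \<alpha> ?n (2 * (i * 2 ^ l + j))) \<omega> * binc (cell \<beta> ?n (Suc (2 * (i * 2 ^ l + j)))) \<omega>))"
        unfolding riem_Suc distrib_left sum.distrib sum_distrib_left ..
      also have "(\<Sum>i\<in>{a..<b}. \<Sum>j<2 ^ l. F (dyadic m i) \<omega> *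
         (binc (cell \<alpha> ?n (2 * (i * 2 ^ l + j))) \<omega> * binc (cell \<beta> ?n (Suc (2 * (i * 2 ^ l + j)))) \<omega>)) =
         (\<Sum>i\<in>{a..<b}. \<Sum>j<2 ^ l. ?g (i * 2 ^ l + j))"
        by (intro sum.cong refl) simp
      also have "\<dots> = ?T \<omega>" by (rule sum_blocks[OF abm(1)])
      finally show "?S (Suc l) \<omega> = ?S l \<omega> + ?T \<omega>" .
    qed
    have T: "?T \<in> all_moments \<and> nrm q ?T \<le> K * (sqrt (card {a * 2 ^ l..<b * 2 ^ l}) * sig ?n)"
    proof (rule bd0[rule_format, of _ "\<lambda>k. 2 * k" "\<lambda>k. Suc (2 * k)" _ "\<lambda>k. dyadic m (k div 2 ^ l)", unfolded area_Nil])
      fix k assume "k \<in> {a * 2 ^ l..<b * 2 ^ l}"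
      then have "k < b * 2 ^ l" by simp
      also have le: "b * 2 ^ l \<le> 2 ^ m * 2 ^ l" using abm by (intro mult_right_mono) auto
      finally have k: "k < 2 ^ (m + l)" by (simp add: power_add)
      have "k div 2 ^ l \<le> 2 ^ m" using k by (simp add: less_mult_imp_div_less power_add less_imp_le)
      then show "2 * k < 2 ^ ?n \<and> Suc (2 * k) < 2 ^ ?n \<and> dyadic m (k div 2 ^ l) \<in> {0..1}"
        using k dyadic_01 by simp
    qed (auto intro: inj_onI)
    have "sqrt (card {a * 2 ^ l..<b * 2 ^ l}) * sig ?n \<le> sqrt (b - a) * sig m * \<rho> ^ l"
    proof -
      have "real (card {a * 2 ^ l..<b * 2 ^ l}) = real (b - a) * 2 ^ l"
        by (simp add: diff_mult_distrib[symmetric])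
      moreover have "sig ?n = sig m * sig 1 ^ l * sig 1"
        using sig_eq_power[of ?n] sig_eq_power[of m] by (simp add: power_add)
      ultimately have "sqrt (card {a * 2 ^ l..<b * 2 ^ l}) * sig ?n = sqrt (b - a) * sig m * \<rho> ^ l * sig 1"
        using abm by (simp add: real_sqrt_mult real_sqrt_power \<rho>_def power_mult_distrib of_nat_diff)
      also have "\<dots> \<le> sqrt (b - a) * sig m * \<rho> ^ l * 1"
        using s1 \<rho> abm sig_pos[of m] by (intro mult_left_mono) auto
      finally show ?thesis by simp
    qed
    then have "nrm q ?T \<le> K * (sqrt (b - a) * sig m * \<rho> ^ l)"
      using T K by (meson mult_left_mono order_trans)
    moreover have "nrm q (?S (Suc l)) \<le> nrm q (?S l) + nrm q ?T"
      unfolding eq using Suc.IH T by (intro nrm_add q) auto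
    ultimately have "nrm q (?S (Suc l)) \<le> K * (sqrt (b - a) * sig m) * (\<Sum>k<Suc l. \<rho> ^ k)"
      using Suc.IH by (simp add: algebra_simps)
    moreover have "?S (Suc l) \<in> all_moments" unfolding eq using Suc.IH T by (intro all_moments_add) auto
    ultimately show ?case ..
  qed
  note main = this
  have geo: "(\<Sum>k<l. \<rho> ^ k) \<le> 1 / (1 - \<rho>)" for l
    using \<rho> by (simp add: sum_gp_strict divide_right_mono)
  show thesis
  proof (rule that[of "K / (1 - \<rho>)"])
    show "0 \<le> K / (1 - \<rho>)" using K \<rho> by simp
    fix m a b l :: nat assume abm: "a \<le> b" "b \<le> 2 ^ m"
    have "nrm q (\<lambda>\<omega>. \<Sum>i\<in>{a..<b}. F (dyadic m i) \<omega> * riem \<alpha> \<beta> m l i \<omega>) \<le> K * (sqrt (b - a) * sig m) * (\<Sum>k<l. \<rho> ^ k)"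
      using main[OF abm] ..
    also have "\<dots> \<le> K * (sqrt (b - a) * sig m) * (1 / (1 - \<rho>))"
      using K abm sig_pos[of m] by (intro mult_left_mono geo) auto
    finally show "nrm q (\<lambda>\<omega>. \<Sum>i\<in>{a..<b}. F (dyadic m i) \<omega> * riem \<alpha> \<beta> m l i \<omega>) \<le> K / (1 - \<rho>) * (sqrt (b - a) * sig m)"
      by simp
  qed
qed

text \<open>The level l subdivision is an admissible partition of mesh 2^-(m+l), so the defining
  limit of the iterated integral applies along these partitions.\<close>

lemma riem_tendsto:
  assumes A: "is_iterated_integral M B \<alpha> \<beta> (dyadic m i) (dyadic m (Suc i)) A" and i: "i < 2 ^ m"
  shows "(\<lambda>l. n2 M (\<lambda>\<omega>. riem \<alpha> \<beta> m l i \<omega> - A \<omega>)) \<longlonglongrightarrow> 0"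
proof (rule LIMSEQ_I)
  fix \<epsilon> :: real assume \<epsilon>: "0 < \<epsilon>"
  have AL: "A \<in> L2 M" using A by (simp add: is_iterated_integral_def Lp_space_2)
  have "0 < ennreal \<epsilon>" using \<epsilon> by simp
  with A obtain \<delta> where \<delta>: "0 < \<delta>" and close: "\<And>n u. is_partition (dyadic m i) (dyadic m (Suc i)) n u \<Longrightarrow> (\<forall>k\<in>{1..n}. u k - u (k - 1) < \<delta>) \<Longrightarrow>
        Lp_norm M 2 (\<lambda>\<omega>. (\<Sum>k=1..n. incr (B \<alpha>) (dyadic m i) (u (k - 1)) \<omega> * incr (B \<beta>) (u (k - 1)) (u k) \<omega>) - A \<omega>) < ennreal \<epsilon>"
    unfolding is_iterated_integral_def by blast
  obtain l0 where l0: "(1 / 2) ^ l0 < \<delta>" using real_arch_pow_inv[OF \<delta>, of "1 / 2"] by auto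
  have "n2 M (\<lambda>\<omega>. riem \<alpha> \<beta> m l i \<omega> - A \<omega>) < \<epsilon>" if l: "l0 \<le> l" for l
  proof -
    define u where "u k = dyadic (m + l) (i * 2 ^ l + k)" for k
    have step: "u k - u (k - 1) = (1 / 2) ^ (m + l)" if "k \<in> {1..2 ^ l}" for k
      using that by (simp add: u_def dyadic_def diff_divide_distrib[symmetric] power_one_over of_nat_diff)
    have p: "is_partition (dyadic m i) (dyadic m (Suc i)) (2 ^ l) u"
      unfolding is_partition_def
    proof (intro conjI ballI)
      show "u 0 = dyadic m i" by (simp add: u_def dyadic_scale)
      show "u (2 ^ l) = dyadic m (Suc i)" using dyadic_scale[of m l "Suc i"] by (simp add: u_def add.commute)
      fix k assume "k \<in> {1..2 ^ l :: nat}"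
      with step[of k] show "u (k - 1) < u k" by (metis diff_gt_0_iff_gt half_gt_zero_iff zero_less_one zero_less_power)
    qed
    have "(1 / 2 :: real) ^ (m + l) \<le> (1 / 2) ^ l0" using l by (intro power_decreasing) auto
    with l0 have "(1 / 2) ^ (m + l) < \<delta>" by linarith
    then have mesh: "\<forall>k\<in>{1..2 ^ l}. u k - u (k - 1) < \<delta>" by (auto simp only: step)
    have "(\<Sum>k=1..2 ^ l. incr (B \<alpha>) (dyadic m i) (u (k - 1)) \<omega> * incr (B \<beta>) (u (k - 1)) (u k) \<omega>) = riem \<alpha> \<beta> m l i \<omega>" for \<omega>
      unfolding riem_def incr_def u_def
      by (rule sum.reindex_bij_witness[of _ Suc "\<lambda>k. k - 1"]) auto
    with close[OF p mesh] have "Lp_norm M 2 (\<lambda>\<omega>. riem \<alpha> \<beta> m l i \<omega> - A \<omega>) < ennreal \<epsilon>" by simp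
    then show ?thesis
      using Lp_norm_2[OF L2_diff[OF all_moments_L2[OF riem_all_moments[OF i]] AL], of \<alpha> \<beta> l] by (simp add: ennreal_less_iff)
  qed
  then show "\<exists>l0. \<forall>l\<ge>l0. norm (n2 M (\<lambda>\<omega>. riem \<alpha> \<beta> m l i \<omega> - A \<omega>) - 0) < \<epsilon>"
    by (intro exI[of _ l0]) auto
qed

text \<open>Each Riemann sum converges in \<open>L^2\<close> and is multiplied by a weight in
  \<open>L^2\<close>, so the weighted sums converge in \<open>L^1\<close>. The bounds, uniform in l,
  then pass to the limit by \<open>nrm_L1_limit\<close>.\<close>

lemma weighted_integral_moment:
  assumes F: "F \<in> class_J M H B" and ev: "even q" "4 \<le> q" and H: "1 / 3 < H" and ab: "\<alpha> \<noteq> \<beta>"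
    and A: "\<And>s t. 0 \<le> s \<Longrightarrow> s < t \<Longrightarrow> t \<le> 1 \<Longrightarrow> is_iterated_integral M B \<alpha> \<beta> s t (A s t)"
  obtains K where "0 \<le> K"
    "\<And>m a b. a \<le> b \<Longrightarrow> b \<le> 2 ^ m \<Longrightarrow>
      integrable M (\<lambda>\<omega>. \<bar>\<Sum>i\<in>{a..<b}. F (dyadic m i) \<omega> * A (dyadic m i) (dyadic m (Suc i)) \<omega>\<bar> ^ q) \<and>
      (\<integral>\<omega>. \<bar>\<Sum>i\<in>{a..<b}. F (dyadic m i) \<omega> * A (dyadic m i) (dyadic m (Suc i)) \<omega>\<bar> ^ q \<partial>M) \<le> (K * (sqrt (b - a) * sig m)) ^ q"
proof -
  obtain K where K: "0 \<le> K" and bd: "\<And>m a b l. a \<le> b \<Longrightarrow> b \<le> 2 ^ m \<Longrightarrow>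
      nrm q (\<lambda>\<omega>. \<Sum>i\<in>{a..<b}. F (dyadic m i) \<omega> * riem \<alpha> \<beta> m l i \<omega>) \<le> K * (sqrt (b - a) * sig m)"
    by (rule weighted_riem_moment[OF F ev H ab]) (rule that, assumption+)
  have q: "0 < q" using ev by simp
  show thesis
  proof (rule that[of K, OF K])
    fix m a b :: nat assume abm: "a \<le> b" "b \<le> 2 ^ m"
    let ?S = "\<lambda>l \<omega>. \<Sum>i\<in>{a..<b}. F (dyadic m i) \<omega> * riem \<alpha> \<beta> m l i \<omega>"
    let ?T = "\<lambda>\<omega>. \<Sum>i\<in>{a..<b}. F (dyadic m i) \<omega> * A (dyadic m i) (dyadic m (Suc i)) \<omega>"
    let ?A = "\<lambda>i. A (dyadic m i) (dyadic m (Suc i))"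
    have I: "is_iterated_integral M B \<alpha> \<beta> (dyadic m i) (dyadic m (Suc i)) (?A i)" "F (dyadic m i) \<in> all_moments" "i < 2 ^ m"
      if "i \<in> {a..<b}" for i
    proof -
      show i: "i < 2 ^ m" using that abm by auto
      note v = vdir_cell[OF i, of \<alpha>, unfolded vdir_def cell_def fst_conv snd_conv]
      show "is_iterated_integral M B \<alpha> \<beta> (dyadic m i) (dyadic m (Suc i)) (?A i)"
        using v by (intro A) (auto simp: dyadic_def divide_strict_right_mono)
      have "F (dyadic m i) \<in> malliavin_smooth M B" using F v by (auto simp: class_J_def)
      from W_all_moments[OF this, of "[]"] show "F (dyadic m i) \<in> all_moments" by (simp add: W_def VG_def[abs_def])
    qed
    have AL: "?A i \<in> L2 M" if "i \<in> {a..<b}" for i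
      using I(1)[OF that] by (simp add: is_iterated_integral_def Lp_space_2)
    note FL = all_moments_L2[OF I(2)] and RL = all_moments_L2[OF riem_all_moments[OF I(3)]]
    have diff: "?S l \<omega> - ?T \<omega> = (\<Sum>i\<in>{a..<b}. F (dyadic m i) \<omega> * (riem \<alpha> \<beta> m l i \<omega> - ?A i \<omega>))" for l \<omega>
      by (simp add: sum_subtractf[symmetric] right_diff_distrib)
    have Sm: "?S l \<in> all_moments" for l
      by (intro all_moments_sum all_moments_mult I riem_all_moments)
    have Tm: "?T \<in> borel_measurable M"
      by (intro borel_measurable_sum borel_measurable_times L2D(1)[OF FL] L2D(1)[OF AL])
    have int: "integrable M (\<lambda>\<omega>. ?S l \<omega> - ?T \<omega>)" for l
      unfolding diff by (intro Bochner_Integration.integrable_sum L2_prod_integrable FL L2_diff RL AL)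
    have le: "(\<integral>\<omega>. \<bar>?S l \<omega> - ?T \<omega>\<bar> \<partial>M) \<le> (\<Sum>i\<in>{a..<b}. n2 M (F (dyadic m i)) * n2 M (\<lambda>\<omega>. riem \<alpha> \<beta> m l i \<omega> - ?A i \<omega>))" for l
    proof -
      have D: "(\<lambda>\<omega>. riem \<alpha> \<beta> m l i \<omega> - ?A i \<omega>) \<in> L2 M" if "i \<in> {a..<b}" for i
        by (rule L2_diff[OF RL[OF that] AL[OF that]])
      have absL: "(\<lambda>\<omega>. \<bar>f \<omega>\<bar>) \<in> L2 M" if "f \<in> L2 M" for f using that by (auto simp: L2_def)
      have PI: "integrable M (\<lambda>\<omega>. \<bar>F (dyadic m i) \<omega>\<bar> * \<bar>riem \<alpha> \<beta> m l i \<omega> - ?A i \<omega>\<bar>)" if "i \<in> {a..<b}" for i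
        by (rule L2_prod_integrable[OF absL[OF FL[OF that]] absL[OF D[OF that]]])
      have "(\<integral>\<omega>. \<bar>?S l \<omega> - ?T \<omega>\<bar> \<partial>M) \<le> (\<integral>\<omega>. (\<Sum>i\<in>{a..<b}. \<bar>F (dyadic m i) \<omega>\<bar> * \<bar>riem \<alpha> \<beta> m l i \<omega> - ?A i \<omega>\<bar>) \<partial>M)"
      proof (rule integral_mono)
        show "integrable M (\<lambda>\<omega>. \<bar>?S l \<omega> - ?T \<omega>\<bar>)" by (rule integrable_abs[OF int])
        show "integrable M (\<lambda>\<omega>. \<Sum>i\<in>{a..<b}. \<bar>F (dyadic m i) \<omega>\<bar> * \<bar>riem \<alpha> \<beta> m l i \<omega> - ?A i \<omega>\<bar>)"
          by (intro Bochner_Integration.integrable_sum PI)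
        fix \<omega>
        show "\<bar>?S l \<omega> - ?T \<omega>\<bar> \<le> (\<Sum>i\<in>{a..<b}. \<bar>F (dyadic m i) \<omega>\<bar> * \<bar>riem \<alpha> \<beta> m l i \<omega> - ?A i \<omega>\<bar>)"
          unfolding diff abs_mult[symmetric] by (rule sum_abs)
      qed
      also have "\<dots> = (\<Sum>i\<in>{a..<b}. \<integral>\<omega>. \<bar>F (dyadic m i) \<omega>\<bar> * \<bar>riem \<alpha> \<beta> m l i \<omega> - ?A i \<omega>\<bar> \<partial>M)"
        by (intro Bochner_Integration.integral_sum PI)
      also have "\<dots> \<le> (\<Sum>i\<in>{a..<b}. n2 M (F (dyadic m i)) * n2 M (\<lambda>\<omega>. riem \<alpha> \<beta> m l i \<omega> - ?A i \<omega>))"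
      proof (rule sum_mono)
        fix i assume i: "i \<in> {a..<b}"
        show "(\<integral>\<omega>. \<bar>F (dyadic m i) \<omega>\<bar> * \<bar>riem \<alpha> \<beta> m l i \<omega> - ?A i \<omega>\<bar> \<partial>M) \<le> n2 M (F (dyadic m i)) * n2 M (\<lambda>\<omega>. riem \<alpha> \<beta> m l i \<omega> - ?A i \<omega>)"
          using L2_Cauchy_Schwarz[OF absL[OF FL[OF i]] absL[OF D[OF i]]] by (simp add: n2_def)
      qed
      finally show ?thesis .
    qed
    have "(\<lambda>l. \<Sum>i\<in>{a..<b}. n2 M (F (dyadic m i)) * n2 M (\<lambda>\<omega>. riem \<alpha> \<beta> m l i \<omega> - ?A i \<omega>)) \<longlonglongrightarrow> (\<Sum>i\<in>{a..<b}. n2 M (F (dyadic m i)) * 0)"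
      by (intro tendsto_sum tendsto_mult tendsto_const riem_tendsto I)
    then have lim0: "(\<lambda>l. \<Sum>i\<in>{a..<b}. n2 M (F (dyadic m i)) * n2 M (\<lambda>\<omega>. riem \<alpha> \<beta> m l i \<omega> - ?A i \<omega>)) \<longlonglongrightarrow> 0"
      by (simp only: mult_zero_right sum.neutral_const)
    have lim: "(\<lambda>l. \<integral>\<omega>. \<bar>?S l \<omega> - ?T \<omega>\<bar> \<partial>M) \<longlonglongrightarrow> 0"
    proof (rule tendsto_sandwich[OF _ _ tendsto_const lim0])
      show "\<forall>\<^sub>F l in sequentially. 0 \<le> (\<integral>\<omega>. \<bar>?S l \<omega> - ?T \<omega>\<bar> \<partial>M)"
        by (intro always_eventually allI Bochner_Integration.integral_nonneg abs_ge_zero)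
      show "\<forall>\<^sub>F l in sequentially. (\<integral>\<omega>. \<bar>?S l \<omega> - ?T \<omega>\<bar> \<partial>M) \<le>
        (\<Sum>i\<in>{a..<b}. n2 M (F (dyadic m i)) * n2 M (\<lambda>\<omega>. riem \<alpha> \<beta> m l i \<omega> - ?A i \<omega>))"
        by (intro always_eventually allI le)
    qed
    show "integrable M (\<lambda>\<omega>. \<bar>?T \<omega>\<bar> ^ q) \<and> (\<integral>\<omega>. \<bar>?T \<omega>\<bar> ^ q \<partial>M) \<le> (K * (sqrt (b - a) * sig m)) ^ q"
      by (intro conjI nrm_L1_limit[of q ?S "K * (sqrt (b - a) * sig m)" ?T] q Sm bd abm Tm int lim)
  qed
qed

lemma weighted_product_moment:
  assumes F: "F \<in> class_J M H B" and ev: "even q" "4 \<le> q" and H: "1 / 3 < H" and ab: "\<alpha> \<noteq> \<beta>"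
  obtains K where "0 \<le> K"
    "\<And>m a b. a \<le> b \<Longrightarrow> b \<le> 2 ^ m \<Longrightarrow>
      integrable M (\<lambda>\<omega>. \<bar>\<Sum>i\<in>{a..<b}. F (dyadic m i) \<omega> * (binc (cell \<alpha> m i) \<omega> * binc (cell \<beta> m i) \<omega>)\<bar> ^ q) \<and>
      (\<integral>\<omega>. \<bar>\<Sum>i\<in>{a..<b}. F (dyadic m i) \<omega> * (binc (cell \<alpha> m i) \<omega> * binc (cell \<beta> m i) \<omega>)\<bar> ^ q \<partial>M) \<le> (K * (sqrt (b - a) * sig m)) ^ q"
proof -
  obtain K where K: "0 \<le> K" and
    bd0: "\<forall>n S x y t. finite S \<longrightarrow> inj_on x S \<longrightarrow> inj_on y S \<longrightarrow> (\<forall>i\<in>S. x i < 2 ^ n \<and> y i < 2 ^ n \<and> t i \<in> {0..1}) \<longrightarrow>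
      area F \<alpha> \<beta> n S x y t [] \<in> all_moments \<and> nrm q (area F \<alpha> \<beta> n S x y t []) \<le> K * (sqrt (card S) * sig n)"
    using weighted_area_moment[OF F ev H ab] by blast
  have q: "0 < q" using ev by simp
  show thesis
  proof (rule that[of K, OF K])
    fix m a b :: nat assume abm: "a \<le> b" "b \<le> 2 ^ m"
    let ?T = "\<lambda>\<omega>. \<Sum>i\<in>{a..<b}. F (dyadic m i) \<omega> * (binc (cell \<alpha> m i) \<omega> * binc (cell \<beta> m i) \<omega>)"
    have T: "?T \<in> all_moments \<and> nrm q ?T \<le> K * (sqrt (card {a..<b}) * sig m)"
    proof (rule bd0[rule_format, of _ "\<lambda>k. k" "\<lambda>k. k" _ "dyadic m", unfolded area_Nil])
      fix i assume "i \<in> {a..<b}"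
      then have i: "i < 2 ^ m" using abm by auto
      show "i < 2 ^ m \<and> i < 2 ^ m \<and> dyadic m i \<in> {0..1}"
        using i vdir_cell[OF i, of \<alpha>] by (simp add: vdir_def cell_def)
    qed auto
    then have "nrm q ?T ^ q \<le> (K * (sqrt (b - a) * sig m)) ^ q" using abm by (intro power_mono) (auto simp: of_nat_diff)
    then show "integrable M (\<lambda>\<omega>. \<bar>?T \<omega>\<bar> ^ q) \<and> (\<integral>\<omega>. \<bar>?T \<omega>\<bar> ^ q \<partial>M) \<le> (K * (sqrt (b - a) * sig m)) ^ q"
      unfolding nrm_power[OF q] using T all_momentsD(2) by blast
  qed
qed

end

section \<open>Chaining over dyadic points\<close>

text \<open>Both indices are projected down to multiples of \<open>2 ^ r\<close>. Each projection
  costs a geometric series of dyadic increments, and the projected points coincide or are neighbours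
  because k - j <= \<open>2 ^ r\<close>. Two projections and one step account for the 3.\<close>

lemma dyadic_chaining:
  fixes g :: "nat \<Rightarrow> real"
  assumes x: "0 < x" "x < 1" and A: "0 \<le> A"
    and inc: "\<And>r i. r \<le> m \<Longrightarrow> i < 2 ^ (m - r) \<Longrightarrow> \<bar>g (Suc i * 2 ^ r) - g (i * 2 ^ r)\<bar> \<le> A * x ^ (m - r)"
    and jk: "j < k" "k \<le> 2 ^ m" and r: "r \<le> m" "k - j \<le> 2 ^ r"
  shows "\<bar>g k - g j\<bar> \<le> 3 / (1 - x) * A * x ^ (m - r)"
proof -
  have project: "\<bar>g k - g (k div 2 ^ r * 2 ^ r)\<bar> \<le> A * (x ^ (m - r) / (1 - x))" if k: "k \<le> 2 ^ m" and "r \<le> m" for k r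
    using that(2)
  proof (induction r)
    case 0
    then show ?case using A x by simp
  next
    case (Suc r)
    define k' where "k' = k div 2 ^ r"
    define y where "y = x ^ (m - Suc r)"
    have y: "x ^ (m - r) = x * y" using Suc.prems by (simp add: y_def Suc_diff_Suc flip: power_Suc)
    have y0: "0 \<le> y" using x by (simp add: y_def)
    have k'_le: "k' \<le> 2 ^ (m - r)"
    proof -
      have "k' \<le> 2 ^ m div 2 ^ r" unfolding k'_def by (rule div_le_mono[OF k])
      also have "\<dots> = 2 ^ (m - r)" using Suc.prems by (simp add: power_diff)
      finally show ?thesis .
    qed
    have d: "k div 2 ^ Suc r * 2 ^ Suc r = (2 * (k' div 2)) * 2 ^ r"
      by (simp add: k'_def div_mult2_eq[symmetric] mult.commute[of 2])
    \<comment> \<open>Passing to the next coarser multiple changes nothing when the quotient is even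
      and uses exactly one increment of the current level when it is odd.\<close>
    have "\<bar>g (k' * 2 ^ r) - g ((2 * (k' div 2)) * 2 ^ r)\<bar> \<le> A * (x * y)"
    proof (cases "even k'")
      case True
      then show ?thesis using A x y0 by simp
    next
      case False
      then have "k' = Suc (2 * (k' div 2))" by simp
      moreover from this have "2 * (k' div 2) < 2 ^ (m - r)" using k'_le by linarith
      ultimately show ?thesis using inc[of r "2 * (k' div 2)"] Suc.prems y by simp
    qed
    moreover have "\<bar>g k - g (k' * 2 ^ r)\<bar> \<le> A * (x * y / (1 - x))" using Suc y by (simp add: k'_def)
    ultimately have "\<bar>g k - g (k div 2 ^ Suc r * 2 ^ Suc r)\<bar> \<le> A * (x * y / (1 - x)) + A * (x * y)"
      unfolding d by linarith
    \<comment> \<open>Collecting the old bound and the new step over the denominator 1 - x leaves 2x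
      - x^2 = 1 - (1 - x)^2, which is at most 1; so the bound reproduces itself.\<close>
    also have "\<dots> = A * ((2 * x - x\<^sup>2) * y / (1 - x))" using x by (simp add: field_simps power2_eq_square)
    also have "\<dots> \<le> A * (1 * y / (1 - x))"
    proof -
      have "2 * x - x\<^sup>2 = 1 - (1 - x)\<^sup>2" by (simp add: power2_eq_square algebra_simps)
      then show ?thesis using x y0 A by (intro mult_left_mono divide_right_mono mult_right_mono) auto
    qed
    finally show ?case by (simp add: y_def)
  qed
  define j' k' where "j' = j div 2 ^ r" and "k' = k div 2 ^ r"
  let ?y = "x ^ (m - r)"
  have y0: "0 \<le> ?y" using x by simp
  have "\<bar>g (k' * 2 ^ r) - g (j' * 2 ^ r)\<bar> \<le> A * ?y"
  proof -
    have "j' \<le> k'" unfolding j'_def k'_def using jk by (intro div_le_mono) simp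
    have "k \<le> j + 2 ^ r" using jk r by simp
    then have "k' \<le> (j + 2 ^ r) div 2 ^ r" unfolding k'_def by (rule div_le_mono)
    then have "k' \<le> Suc j'" by (simp add: j'_def)
    with \<open>j' \<le> k'\<close> consider "k' = j'" | "k' = Suc j'" by linarith
    then show ?thesis
    proof cases
      case 1
      then show ?thesis using A y0 by simp
    next
      case 2
      have "k' \<le> 2 ^ m div 2 ^ r" unfolding k'_def by (rule div_le_mono[OF jk(2)])
      also have "\<dots> = 2 ^ (m - r)" using r by (simp add: power_diff)
      finally show ?thesis using inc[OF r(1), of j'] 2 by simp
    qed
  qed
  moreover have "A * ?y \<le> A * (?y / (1 - x))" using x A y0 by (intro mult_left_mono) (auto simp: field_simps mult_left_le)
  moreover have "\<bar>g k - g (k' * 2 ^ r)\<bar> \<le> A * (?y / (1 - x))" "\<bar>g j - g (j' * 2 ^ r)\<bar> \<le> A * (?y / (1 - x))"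
    using project[of k r] project[of j r] jk r by (auto simp: j'_def k'_def)
  ultimately have "\<bar>g k - g j\<bar> \<le> 3 * (A * (?y / (1 - x)))" by linarith
  then show ?thesis by (simp add: mult_ac)
qed

lemma half_powr:
  assumes "r \<le> m" shows "(1 / 2 :: real) powr real (m - r) = 2 ^ r / 2 ^ m"
proof -
  have "(1 / 2 :: real) powr real (m - r) = (1 / 2) ^ (m - r)" by (rule powr_realpow) simp
  also have "\<dots> = 2 ^ r / 2 ^ m" using assms by (simp add: power_diff power_one_over)
  finally show ?thesis .
qed

text \<open>Chaining at the scale comparable to the distance of the two points. The 3 of
  \<open>dyadic_chaining\<close> becomes 6 because that scale can exceed the distance by a factor 2,
  and 2^\<theta> <= 2.\<close>

lemma dyadic_Hoelder:
  fixes g :: "nat \<Rightarrow> real"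
  assumes \<theta>: "0 < \<theta>" "\<theta> < 1" and A: "0 \<le> A"
    and inc: "\<And>r i. r \<le> m \<Longrightarrow> i < 2 ^ (m - r) \<Longrightarrow> \<bar>g (Suc i * 2 ^ r) - g (i * 2 ^ r)\<bar> \<le> A * ((1 / 2) powr \<theta>) ^ (m - r)"
    and jk: "j < k" "k \<le> 2 ^ m"
  shows "\<bar>g k - g j\<bar> \<le> 6 / (1 - (1 / 2) powr \<theta>) * A * (dyadic m k - dyadic m j) powr \<theta>"
proof -
  define x where "x = (1 / 2 :: real) powr \<theta>"
  have x: "0 < x" "x < 1" using \<theta> powr_less_mono'[of "1 / 2 :: real" 0 \<theta>] by (auto simp: x_def)
  \<comment> \<open>Minimality gives 2^r <= 2 (k - j), so the scale is also bounded from above by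
    twice the distance; for r = 0 this follows from j < k.\<close>
  define r where "r = (LEAST r. k - j \<le> 2 ^ r)"
  have ex: "k - j \<le> 2 ^ m" using jk by simp
  have r1: "k - j \<le> 2 ^ r" unfolding r_def by (rule LeastI[of "\<lambda>r. k - j \<le> 2 ^ r", OF ex])
  have rm: "r \<le> m" unfolding r_def by (rule Least_le[of "\<lambda>r. k - j \<le> 2 ^ r", OF ex])
  have r2: "2 ^ r \<le> 2 * (k - j)"
  proof (cases r)
    case (Suc s)
    then have "\<not> k - j \<le> 2 ^ s" using not_less_Least[of s "\<lambda>r. k - j \<le> 2 ^ r"] by (simp add: r_def)
    then show ?thesis using Suc by simp
  qed (use jk in simp)
  define u where "u = dyadic m k - dyadic m j"
  have u: "u = real (k - j) / 2 ^ m" using jk by (simp add: u_def dyadic_def diff_divide_distrib)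
  have u0: "0 \<le> u" unfolding u by simp
  have "x ^ (m - r) = (2 ^ r / 2 ^ m) powr \<theta>"
  proof -
    have "x ^ (m - r) = ((1 / 2) powr real (m - r)) powr \<theta>" by (simp add: x_def powr_power powr_powr mult.commute)
    also have "(1 / 2 :: real) powr real (m - r) = 2 ^ r / 2 ^ m" by (rule half_powr[OF rm])
    finally show ?thesis .
  qed
  also have "\<dots> \<le> (2 * u) powr \<theta>"
  proof (rule powr_mono2)
    have "real (2 ^ r) \<le> real (2 * (k - j))" using r2 by (rule of_nat_mono)
    then show "2 ^ r / 2 ^ m \<le> 2 * u" by (simp add: u divide_right_mono)
  qed (use \<theta> in auto)
  also have "\<dots> = 2 powr \<theta> * u powr \<theta>" using u0 by (simp add: powr_mult)
  also have "\<dots> \<le> 2 powr 1 * u powr \<theta>" using \<theta> by (intro mult_right_mono powr_mono) auto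
  finally have "x ^ (m - r) \<le> 2 * u powr \<theta>" by simp
  then have "3 / (1 - x) * A * x ^ (m - r) \<le> 3 / (1 - x) * A * (2 * u powr \<theta>)"
    using x A by (intro mult_left_mono) auto
  moreover have "\<bar>g k - g j\<bar> \<le> 3 / (1 - x) * A * x ^ (m - r)"
    using inc unfolding x_def[symmetric] by (rule dyadic_chaining[OF x A _ jk rm r1])
  ultimately show ?thesis by (simp add: x_def u_def mult_ac)
qed

text \<open>The norm is a supremum in the reals, meaningful only for a nonempty set bounded above.
  The pair formed by the indices 0 and 1 exists at every level, including m = 0, and also shows that
  the supremum is nonnegative.\<close>

lemma holder_norm_le:
  assumes C: "0 \<le> C" and le: "\<And>j k. j < k \<Longrightarrow> k \<le> 2 ^ m \<Longrightarrow> \<bar>f (dyadic m k) - f (dyadic m j)\<bar> \<le> C * (dyadic m k - dyadic m j) powr \<theta>"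
  shows "\<bar>holder_norm m \<theta> f\<bar> \<le> C"
proof -
  let ?X = "{\<bar>f t - f s\<bar> / \<bar>t - s\<bar> powr \<theta> | s t. s \<in> dyadics m \<and> t \<in> dyadics m \<and> s \<noteq> t}"
  have bd: "z \<le> C" if "z \<in> ?X" for z
  proof -
    from that obtain j k where z: "z = \<bar>f (dyadic m k) - f (dyadic m j)\<bar> / \<bar>dyadic m k - dyadic m j\<bar> powr \<theta>"
      and jk: "j \<le> 2 ^ m" "k \<le> 2 ^ m" "dyadic m j \<noteq> dyadic m k" by (auto simp: dyadics_def)
    have "\<bar>f (dyadic m k) - f (dyadic m j)\<bar> \<le> C * \<bar>dyadic m k - dyadic m j\<bar> powr \<theta>"
    proof (cases "j < k")
      case True
      then have "dyadic m j < dyadic m k" by (simp add: dyadic_def divide_strict_right_mono)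
      then show ?thesis using le[OF True jk(2)] by simp
    next
      case False
      then have kj: "k < j" using jk by (metis linorder_neqE_nat)
      then have "dyadic m k < dyadic m j" by (simp add: dyadic_def divide_strict_right_mono)
      then show ?thesis using le[OF kj jk(1)] by (simp add: abs_minus_commute)
    qed
    then show ?thesis using jk by (simp add: z divide_le_eq)
  qed
  have "\<bar>f (dyadic m 1) - f (dyadic m 0)\<bar> / \<bar>dyadic m 1 - dyadic m 0\<bar> powr \<theta> \<in> ?X" (is "?z \<in> _")
  proof -
    have "dyadic m 0 \<in> dyadics m" "dyadic m 1 \<in> dyadics m" "dyadic m 0 \<noteq> dyadic m 1"
      by (auto simp: dyadics_def dyadic_def)
    then show ?thesis by blast
  qed
  moreover have "0 \<le> ?z" by simp
  moreover have "bdd_above ?X" using bd by (rule bdd_aboveI)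
  ultimately have "0 \<le> Sup ?X" by (meson cSup_upper order_trans)
  moreover have "Sup ?X \<le> C" using \<open>?z \<in> ?X\<close> bd by (intro cSup_least) auto
  ultimately show ?thesis by (simp add: holder_norm_def)
qed

text \<open>The p-th power is compared pointwise with an integrable g inside
  \<open>nn_integral\<close>, so a discrete Hoelder norm can be inserted for f directly.\<close>

lemma Lp_norm_le:
  assumes p: "0 < p" and le: "\<And>\<omega>. \<omega> \<in> space M \<Longrightarrow> \<bar>f \<omega>\<bar> ^ p \<le> g \<omega>" and g: "integrable M g" "(\<integral>\<omega>. g \<omega> \<partial>M) \<le> b"
  shows "Lp_norm M (real p) f \<le> ennreal (b powr (1 / real p))"
proof -
  define I where "I = (\<integral>\<^sup>+ \<omega>. ennreal (\<bar>f \<omega>\<bar> powr real p) \<partial>M)"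
  have g0: "AE \<omega> in M. 0 \<le> g \<omega>" using le by (intro AE_I2) (meson order_trans zero_le_power abs_ge_zero)
  have "I \<le> (\<integral>\<^sup>+ \<omega>. ennreal (g \<omega>) \<partial>M)" unfolding I_def
    using p le by (intro nn_integral_mono ennreal_leI) (simp add: powr_realpow')
  also have "\<dots> = ennreal (\<integral>\<omega>. g \<omega> \<partial>M)" by (rule nn_integral_eq_integral[OF g(1) g0])
  finally have I: "I \<le> ennreal (\<integral>\<omega>. g \<omega> \<partial>M)" .
  then have fin: "I \<noteq> \<top>" using ennreal_less_top le_less_trans top.not_eq_extremum by blast
  have "enn2real I \<le> enn2real (ennreal (\<integral>\<omega>. g \<omega> \<partial>M))" using I by (intro enn2real_mono) auto
  also have "\<dots> = (\<integral>\<omega>. g \<omega> \<partial>M)" by (rule enn2real_ennreal[OF integral_nonneg_AE[OF g0]])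
  finally have "enn2real I \<le> b" using g(2) by linarith
  then have "enn2real I powr (1 / real p) \<le> b powr (1 / real p)" by (intro powr_mono2) auto
  then show ?thesis using fin by (simp add: Lp_norm_def Let_def I_def ennreal_leI)
qed

text \<open>Kolmogorov's criterion on a finite grid, uniformly in m. All dyadic increments, divided
  by their target size x^(m-r) and raised to the power q, are summed; the expectation of the sum is
  bounded by a geometric series, and its q-th root is an admissible constant in
  \<open>dyadic_Hoelder\<close>.\<close>

lemma (in prob_space) dyadic_Kolmogorov:
  fixes v :: "nat \<Rightarrow> nat \<Rightarrow> 'a \<Rightarrow> real" and G :: "nat \<Rightarrow> real \<Rightarrow> 'a \<Rightarrow> real"
  assumes \<theta>: "0 < \<theta>" "\<theta> < 1 / 2" and p: "0 < p" "p \<le> q" and q: "1 < real q * (1 / 2 - \<theta>)" and K: "0 \<le> K"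
    and G: "\<And>m k \<omega>. k \<le> 2 ^ m \<Longrightarrow> G m (dyadic m k) \<omega> = (\<Sum>i<k. v m i \<omega>)"
    and v: "\<And>m a b. a \<le> b \<Longrightarrow> b \<le> 2 ^ m \<Longrightarrow> integrable M (\<lambda>\<omega>. \<bar>\<Sum>i\<in>{a..<b}. v m i \<omega>\<bar> ^ q) \<and>
      (\<integral>\<omega>. \<bar>\<Sum>i\<in>{a..<b}. v m i \<omega>\<bar> ^ q \<partial>M) \<le> (K * (real (b - a) / 2 ^ m) powr (1 / 2)) ^ q"
  shows "\<exists>c. \<forall>m. Lp_norm M (real p) (\<lambda>\<omega>. holder_norm m \<theta> (\<lambda>t. G m t \<omega>)) \<le> ennreal c"
proof -
  have q0: "0 < q" using p by simp
  define x where "x = (1 / 2 :: real) powr \<theta>"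
  have x: "0 < x" "x < 1" using \<theta> powr_less_mono'[of "1 / 2 :: real" 0 \<theta>] by (auto simp: x_def)
  define h where "h = (1 / 2 :: real) powr (1 / 2)"
  define C where "C = 6 / (1 - x)"
  have C: "0 \<le> C" using x by (simp add: C_def)
  \<comment> \<open>The ratio of consecutive levels: twice as many increments, each with normalised
    q-th moment smaller by the factor (h / x)^q. The condition on q says precisely that this ratio
    is below 1.\<close>
  define \<eta> where "\<eta> = 2 * (h / x) ^ q"
  have \<eta>: "0 \<le> \<eta>" "\<eta> < 1"
  proof -
    show "0 \<le> \<eta>" using x by (simp add: \<eta>_def h_def)
    have "h / x = (1 / 2) powr (1 / 2 - \<theta>)" by (simp add: h_def x_def powr_diff)
    then have "(h / x) ^ q = (1 / 2) powr (real q * (1 / 2 - \<theta>))" by (simp add: powr_power)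
    also have "\<dots> < (1 / 2) powr 1" using q by (intro powr_less_mono') auto
    finally show "\<eta> < 1" by (simp add: \<eta>_def)
  qed
  define D where "D m r i \<omega> = (\<Sum>l\<in>{i * 2 ^ r..<Suc i * 2 ^ r}. v m l \<omega>)" for m r i \<omega>
  define Y where "Y m \<omega> = (\<Sum>r\<le>m. \<Sum>i<2 ^ (m - r). (\<bar>D m r i \<omega>\<bar> / x ^ (m - r)) ^ q)" for m \<omega>
  have D: "integrable M (\<lambda>\<omega>. \<bar>D m r i \<omega>\<bar> ^ q)" "(\<integral>\<omega>. \<bar>D m r i \<omega>\<bar> ^ q \<partial>M) \<le> (K * h ^ (m - r)) ^ q"
    if r: "r \<le> m" and i: "i < 2 ^ (m - r)" for m r i
  proof -
    have le: "Suc i * 2 ^ r \<le> 2 ^ m"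
    proof -
      have "Suc i * 2 ^ r \<le> 2 ^ (m - r) * 2 ^ r" using i by (intro mult_right_mono) auto
      then show ?thesis using r by (simp add: power_add[symmetric])
    qed
    have "real (Suc i * 2 ^ r - i * 2 ^ r) / 2 ^ m = 2 ^ r / 2 ^ m" by simp
    also have "\<dots> = (1 / 2) powr real (m - r)" by (rule half_powr[OF r, symmetric])
    finally have "(real (Suc i * 2 ^ r - i * 2 ^ r) / 2 ^ m) powr (1 / 2) = h ^ (m - r)"
      by (simp add: h_def powr_powr powr_power)
    then show "integrable M (\<lambda>\<omega>. \<bar>D m r i \<omega>\<bar> ^ q)" "(\<integral>\<omega>. \<bar>D m r i \<omega>\<bar> ^ q \<partial>M) \<le> (K * h ^ (m - r)) ^ q"
      using v[of "i * 2 ^ r" "Suc i * 2 ^ r" m] le unfolding D_def by auto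
  qed
  have DI: "integrable M (\<lambda>\<omega>. (\<bar>D m r i \<omega>\<bar> / x ^ (m - r)) ^ q)" if "r \<le> m" "i < 2 ^ (m - r)" for m r i
    unfolding power_divide using D(1)[OF that] by simp
  have YI: "integrable M (Y m)" for m
    unfolding Y_def[abs_def] by (intro Bochner_Integration.integrable_sum DI) auto
  have Yb: "(\<integral>\<omega>. Y m \<omega> \<partial>M) \<le> K ^ q / (1 - \<eta>)" for m
  proof -
    have "(\<integral>\<omega>. Y m \<omega> \<partial>M) = (\<Sum>r\<le>m. \<integral>\<omega>. (\<Sum>i<2 ^ (m - r). (\<bar>D m r i \<omega>\<bar> / x ^ (m - r)) ^ q) \<partial>M)"
      unfolding Y_def by (intro Bochner_Integration.integral_sum Bochner_Integration.integrable_sum DI) auto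
    also have "\<dots> = (\<Sum>r\<le>m. \<Sum>i<2 ^ (m - r). \<integral>\<omega>. (\<bar>D m r i \<omega>\<bar> / x ^ (m - r)) ^ q \<partial>M)"
      by (intro sum.cong refl Bochner_Integration.integral_sum DI) auto
    also have "\<dots> \<le> (\<Sum>r\<le>m. \<Sum>i<2 ^ (m - r) :: nat. (K * h ^ (m - r)) ^ q / (x ^ (m - r)) ^ q)"
      using D(2) x by (intro sum_mono) (auto simp: power_divide divide_right_mono)
    also have "\<dots> = (\<Sum>r\<le>m. K ^ q * \<eta> ^ (m - r))"
      by (intro sum.cong refl) (simp add: \<eta>_def power_mult_distrib power_divide power_mult[symmetric] mult.commute[of q])
    also have "\<dots> = K ^ q * (\<Sum>r\<le>m. \<eta> ^ (m - r))" by (simp add: sum_distrib_left)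
    also have "(\<Sum>r\<le>m. \<eta> ^ (m - r)) = (\<Sum>r\<le>m. \<eta> ^ r)"
      by (rule sum.reindex_bij_witness[of _ "\<lambda>r. m - r" "\<lambda>r. m - r"]) auto
    also have "\<dots> \<le> 1 / (1 - \<eta>)"
      unfolding lessThan_Suc_atMost[symmetric] sum_gp_strict using \<eta> by (simp add: divide_right_mono del: power_Suc)
    finally show ?thesis using K by (simp add: mult_left_mono)
  qed
  have holder: "\<bar>holder_norm m \<theta> (\<lambda>t. G m t \<omega>)\<bar> ^ q \<le> C ^ q * Y m \<omega>" for m \<omega>
  proof -
    \<comment> \<open>Every single normalised increment has q-th power at most \<open>Y m\<close>,
      so this root bounds all dyadic increments of the path simultaneously.\<close>
    define A where "A = root q (Y m \<omega>)"
    have nn: "0 \<le> (\<bar>D m r i \<omega>\<bar> / x ^ (m - r)) ^ q" for r i using x by (intro zero_le_power divide_nonneg_nonneg) auto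
    have Y0: "0 \<le> Y m \<omega>" unfolding Y_def by (intro sum_nonneg nn)
    have A: "0 \<le> A" "A ^ q = Y m \<omega>" using Y0 q0 by (auto simp: A_def)
    define g where "g k = G m (dyadic m k) \<omega>" for k
    have inc: "\<bar>g (Suc i * 2 ^ r) - g (i * 2 ^ r)\<bar> \<le> A * x ^ (m - r)" if r: "r \<le> m" and i: "i < 2 ^ (m - r)" for r i
    proof -
      have le: "Suc i * 2 ^ r \<le> 2 ^ m"
      proof -
        have "Suc i * 2 ^ r \<le> 2 ^ (m - r) * 2 ^ r" using i by (intro mult_right_mono) auto
        then show ?thesis using r by (simp add: power_add[symmetric])
      qed
      have le2: "i * 2 ^ r \<le> Suc i * 2 ^ r" by simp
      have g: "g (Suc i * 2 ^ r) - g (i * 2 ^ r) = D m r i \<omega>"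
      proof -
        have "g (Suc i * 2 ^ r) = (\<Sum>l<Suc i * 2 ^ r. v m l \<omega>)" unfolding g_def by (rule G[OF le])
        also have "\<dots> = (\<Sum>l<i * 2 ^ r. v m l \<omega>) + D m r i \<omega>"
          unfolding D_def lessThan_atLeast0 using le2 by (intro sum.atLeastLessThan_concat[symmetric]) auto
        also have "(\<Sum>l<i * 2 ^ r. v m l \<omega>) = g (i * 2 ^ r)" unfolding g_def using le le2 by (intro G[symmetric]) linarith
        finally show ?thesis by simp
      qed
      have "(\<bar>D m r i \<omega>\<bar> / x ^ (m - r)) ^ q \<le> (\<Sum>i<2 ^ (m - r). (\<bar>D m r i \<omega>\<bar> / x ^ (m - r)) ^ q)"
        by (rule member_le_sum[where f="\<lambda>i. (\<bar>D m r i \<omega>\<bar> / x ^ (m - r)) ^ q"]) (use i nn in auto)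
      also have "\<dots> \<le> Y m \<omega>" unfolding Y_def
        by (rule member_le_sum[where f="\<lambda>r. \<Sum>i<2 ^ (m - r). (\<bar>D m r i \<omega>\<bar> / x ^ (m - r)) ^ q"])
          (use r in \<open>auto intro!: sum_nonneg nn\<close>)
      finally have "(\<bar>D m r i \<omega>\<bar> / x ^ (m - r)) ^ q \<le> A ^ q" unfolding A .
      then have "\<bar>D m r i \<omega>\<bar> / x ^ (m - r) \<le> A"
        using power_mono_iff[OF _ A(1) q0, of "\<bar>D m r i \<omega>\<bar> / x ^ (m - r)"] x by simp
      then show ?thesis unfolding g by (simp only: pos_divide_le_eq[OF zero_less_power[OF x(1)]])
    qed
    have "\<bar>holder_norm m \<theta> (\<lambda>t. G m t \<omega>)\<bar> \<le> C * A"
    proof (rule holder_norm_le)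
      show "0 \<le> C * A" using A C by simp
      fix j k :: nat assume jk: "j < k" "k \<le> 2 ^ m"
      have "\<theta> < 1" using \<theta> by simp
      then have "\<bar>g k - g j\<bar> \<le> C * A * (dyadic m k - dyadic m j) powr \<theta>"
        unfolding C_def x_def by (rule dyadic_Hoelder[OF \<theta>(1) _ A(1) inc[unfolded x_def] jk])
      then show "\<bar>G m (dyadic m k) \<omega> - G m (dyadic m j) \<omega>\<bar> \<le> C * A * (dyadic m k - dyadic m j) powr \<theta>"
        unfolding g_def .
    qed
    then have "\<bar>holder_norm m \<theta> (\<lambda>t. G m t \<omega>)\<bar> ^ q \<le> (C * A) ^ q" by (intro power_mono) auto
    then show ?thesis by (simp add: power_mult_distrib A)
  qed
  define b where "b = 1 + C ^ q * (K ^ q / (1 - \<eta>))"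
  have "Lp_norm M (real p) (\<lambda>\<omega>. holder_norm m \<theta> (\<lambda>t. G m t \<omega>)) \<le> ennreal (b powr (1 / real p))" for m
  proof (rule Lp_norm_le[OF p(1)])
    show "integrable M (\<lambda>\<omega>. 1 + C ^ q * Y m \<omega>)" using YI by simp
    have "(\<integral>\<omega>. 1 + C ^ q * Y m \<omega> \<partial>M) = 1 + C ^ q * (\<integral>\<omega>. Y m \<omega> \<partial>M)" using YI by (simp add: prob_space)
    also have "\<dots> \<le> b" unfolding b_def using Yb C by (intro add_left_mono mult_left_mono) auto
    finally show "(\<integral>\<omega>. 1 + C ^ q * Y m \<omega> \<partial>M) \<le> b" .
    fix \<omega>
    let ?z = "\<bar>holder_norm m \<theta> (\<lambda>t. G m t \<omega>)\<bar>"
    have "?z ^ p \<le> 1 + ?z ^ q"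
    proof (cases "?z \<le> 1")
      case True
      then have "?z ^ p \<le> 1" by (intro power_le_one) auto
      then show ?thesis by (simp add: add_increasing2)
    next
      case False
      then have "?z ^ p \<le> ?z ^ q" using p by (intro power_increasing) auto
      then show ?thesis by simp
    qed
    then show "?z ^ p \<le> 1 + C ^ q * Y m \<omega>" using holder[of m \<omega>] by linarith
  qed
  then show ?thesis by blast
qed

section \<open>The weighted sums\<close>

text \<open>At grid points the floor is exact, and the index is shifted by one so that cells are
  named by their left endpoints.\<close>

lemma sum_dyadic_floor:
  assumes "k \<le> 2 ^ m"
  shows "(\<Sum>i=1..nat \<lfloor>2 ^ m * dyadic m k\<rfloor>. f (i - 1) i) = (\<Sum>i<k. f i (Suc i))"
proof -
  have "nat \<lfloor>2 ^ m * dyadic m k\<rfloor> = k" by (simp add: dyadic_def)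
  then show ?thesis by (simp only:) (rule sum.reindex_bij_witness[of _ Suc "\<lambda>i. i - 1"], auto)
qed

text \<open>The normalisation turns the moment bound \<open>sqrt d * sig m\<close> into the square
  root of the elapsed time d / 2^m, the form required by \<open>dyadic_Kolmogorov\<close>.\<close>

lemma (in fbm) scaling: "c = (2 ^ m) powr (2 * H - 1 / 2) \<Longrightarrow> 0 \<le> d \<Longrightarrow> c * (K * (sqrt d * sig m)) = K * (d / 2 ^ m) powr (1 / 2)"
proof -
  assume c: "c = (2 ^ m) powr (2 * H - 1 / 2)" and d: "0 \<le> d"
  have "sig m = (2 ^ m) powr (- (2 * H))" unfolding sig_def by (simp add: powr_divide powr_minus_divide)
  then have "c * sig m = (2 ^ m) powr (2 * H - 1 / 2 + - (2 * H))" unfolding c powr_add by simp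
  also have "2 * H - 1 / 2 + - (2 * H) = - (1 / 2)" by simp
  also have "(2 ^ m :: real) powr - (1 / 2) = 1 / sqrt (2 ^ m)" unfolding powr_minus_divide by (subst powr_half_sqrt) auto
  finally have "c * sig m = 1 / sqrt (2 ^ m)" .
  moreover have "(d / 2 ^ m) powr (1 / 2) = sqrt d / sqrt (2 ^ m)"
    using d by (subst powr_half_sqrt) (auto simp: real_sqrt_divide)
  moreover have "c * (K * (sqrt d * sig m)) = K * (sqrt d * (c * sig m))" by (simp only: mult_ac)
  ultimately show ?thesis by (simp only:) simp
qed

theorem corollary2p3:
  fixes M :: "'w measure"
    and B :: "'d::finite \<Rightarrow> real \<Rightarrow> 'w \<Rightarrow> real"
    and B\<alpha>\<beta> :: "real \<Rightarrow> real \<Rightarrow> 'w \<Rightarrow> real"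
    and F :: "real \<Rightarrow> 'w \<Rightarrow> real"
    and H \<theta> :: real and p :: nat and \<alpha> \<beta> :: 'd
  assumes "prob_space M"
    and "1 / 3 < H" and "H \<le> 1 / 2"
    and "is_fbm M H B"
    and "\<alpha> \<noteq> \<beta>"
    and "\<And>s t. 0 \<le> s \<Longrightarrow> s < t \<Longrightarrow> t \<le> 1 \<Longrightarrow> is_iterated_integral M B \<alpha> \<beta> s t (B\<alpha>\<beta> s t)"
    and "F \<in> class_J M H B"
    and "0 < \<theta>" and "\<theta> < 1 / 2"
    and "0 < p"
  shows "(SUP m. Lp_norm M p (\<lambda>\<omega>. holder_norm m \<theta>
                   (\<lambda>t. (2 ^ m) powr (2 * H - 1 / 2) * weighted_area_sum F B\<alpha>\<beta> m t \<omega>))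
               + Lp_norm M p (\<lambda>\<omega>. holder_norm m \<theta>
                   (\<lambda>t. (2 ^ m) powr (2 * H - 1 / 2) * weighted_product_sum B \<alpha> \<beta> F m t \<omega>))) < \<top>"
proof -
  interpret prob_space M by fact
  interpret fbm M H B using assms(2-4) by unfold_locales auto
  obtain q0 :: nat where q0: "1 / (1 / 2 - \<theta>) < real q0" using reals_Archimedean2 by blast
  \<comment> \<open>Even and at least 4 for the moment estimates, at least p for the comparison of
    norms, and larger than 1 / (1/2 - \<theta>) for the chaining series.\<close>
  define q where "q = 2 * (q0 + p + 2)"
  have q: "even q" "4 \<le> q" "p \<le> q" "0 < q" by (auto simp: q_def)
  have "1 / (1 / 2 - \<theta>) < real q" using q0 by (simp add: q_def)
  then have q\<theta>: "1 < real q * (1 / 2 - \<theta>)" using assms(9) by (simp add: divide_less_eq)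
  define c where "c m = (2 ^ m :: real) powr (2 * H - 1 / 2)" for m :: nat
  have c: "0 \<le> c m" for m by (simp add: c_def)
  \<comment> \<open>Stated once for a generic array v, because the iterated integrals and the
    products satisfy the same moment bound.\<close>
  have Kolmogorov: "\<exists>b. \<forall>m. Lp_norm M (real p) (\<lambda>\<omega>. holder_norm m \<theta> (\<lambda>t. c m * G m t \<omega>)) \<le> ennreal b"
    if K: "0 \<le> K" and G: "\<And>m k \<omega>. k \<le> 2 ^ m \<Longrightarrow> G m (dyadic m k) \<omega> = (\<Sum>i<k. v m i \<omega>)"
      and v: "\<And>m a b. a \<le> b \<Longrightarrow> b \<le> 2 ^ m \<Longrightarrow> integrable M (\<lambda>\<omega>. \<bar>\<Sum>i\<in>{a..<b}. v m i \<omega>\<bar> ^ q) \<and>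
        (\<integral>\<omega>. \<bar>\<Sum>i\<in>{a..<b}. v m i \<omega>\<bar> ^ q \<partial>M) \<le> (K * (sqrt (real (b - a)) * sig m)) ^ q"
    for K and G :: "nat \<Rightarrow> real \<Rightarrow> 'w \<Rightarrow> real" and v :: "nat \<Rightarrow> nat \<Rightarrow> 'w \<Rightarrow> real"
  proof (rule dyadic_Kolmogorov[OF assms(8-10) q(3) q\<theta> K, where v="\<lambda>m i \<omega>. c m * v m i \<omega>"])
    show "c m * G m (dyadic m k) \<omega> = (\<Sum>i<k. c m * v m i \<omega>)" if "k \<le> 2 ^ m" for m k \<omega>
      using G[OF that] by (simp add: sum_distrib_left)
    fix m a b :: nat assume ab: "a \<le> b" "b \<le> 2 ^ m"
    note vv = v[OF ab]
    have eq: "\<bar>\<Sum>i\<in>{a..<b}. c m * v m i \<omega>\<bar> ^ q = c m ^ q * \<bar>\<Sum>i\<in>{a..<b}. v m i \<omega>\<bar> ^ q" for \<omega>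
      using c[of m] by (simp add: sum_distrib_left[symmetric] abs_mult power_mult_distrib)
    have "c m ^ q * (\<integral>\<omega>. \<bar>\<Sum>i\<in>{a..<b}. v m i \<omega>\<bar> ^ q \<partial>M) \<le> c m ^ q * (K * (sqrt (real (b - a)) * sig m)) ^ q"
      using vv c by (intro mult_left_mono) auto
    also have "\<dots> = (K * (real (b - a) / 2 ^ m) powr (1 / 2)) ^ q"
      using ab unfolding power_mult_distrib[symmetric] by (subst scaling[OF c_def]) auto
    finally show "integrable M (\<lambda>\<omega>. \<bar>\<Sum>i\<in>{a..<b}. c m * v m i \<omega>\<bar> ^ q) \<and>
        (\<integral>\<omega>. \<bar>\<Sum>i\<in>{a..<b}. c m * v m i \<omega>\<bar> ^ q \<partial>M) \<le> (K * (real (b - a) / 2 ^ m) powr (1 / 2)) ^ q"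
      unfolding eq using vv by simp
  qed
  obtain K1 where K1: "0 \<le> K1" and v1: "\<And>m a b. a \<le> b \<Longrightarrow> b \<le> 2 ^ m \<Longrightarrow>
      integrable M (\<lambda>\<omega>. \<bar>\<Sum>i\<in>{a..<b}. F (dyadic m i) \<omega> * B\<alpha>\<beta> (dyadic m i) (dyadic m (Suc i)) \<omega>\<bar> ^ q) \<and>
      (\<integral>\<omega>. \<bar>\<Sum>i\<in>{a..<b}. F (dyadic m i) \<omega> * B\<alpha>\<beta> (dyadic m i) (dyadic m (Suc i)) \<omega>\<bar> ^ q \<partial>M) \<le> (K1 * (sqrt (real (b - a)) * sig m)) ^ q"
    by (rule weighted_integral_moment[where A=B\<alpha>\<beta>, OF assms(7) q(1,2) assms(2,5)])
      (rule assms(6), assumption+, rule that, assumption+)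
  have "\<exists>b. \<forall>m. Lp_norm M (real p) (\<lambda>\<omega>. holder_norm m \<theta> (\<lambda>t. c m * weighted_area_sum F B\<alpha>\<beta> m t \<omega>)) \<le> ennreal b"
  proof (rule Kolmogorov[of K1 _ "\<lambda>m i \<omega>. F (dyadic m i) \<omega> * B\<alpha>\<beta> (dyadic m i) (dyadic m (Suc i)) \<omega>", OF K1])
    fix m k \<omega> assume k: "k \<le> (2::nat) ^ m"
    show "weighted_area_sum F B\<alpha>\<beta> m (dyadic m k) \<omega> = (\<Sum>i<k. F (dyadic m i) \<omega> * B\<alpha>\<beta> (dyadic m i) (dyadic m (Suc i)) \<omega>)"
      unfolding weighted_area_sum_def
      by (rule sum_dyadic_floor[OF k, where f="\<lambda>i j. F (dyadic m i) \<omega> * B\<alpha>\<beta> (dyadic m i) (dyadic m j) \<omega>"])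
  qed (rule v1)
  then obtain b1 where b1: "\<And>m. Lp_norm M (real p) (\<lambda>\<omega>. holder_norm m \<theta> (\<lambda>t. c m * weighted_area_sum F B\<alpha>\<beta> m t \<omega>)) \<le> ennreal b1" by blast
  obtain K2 where K2: "0 \<le> K2" and v2: "\<And>m a b. a \<le> b \<Longrightarrow> b \<le> 2 ^ m \<Longrightarrow>
      integrable M (\<lambda>\<omega>. \<bar>\<Sum>i\<in>{a..<b}. F (dyadic m i) \<omega> * (binc (cell \<alpha> m i) \<omega> * binc (cell \<beta> m i) \<omega>)\<bar> ^ q) \<and>
      (\<integral>\<omega>. \<bar>\<Sum>i\<in>{a..<b}. F (dyadic m i) \<omega> * (binc (cell \<alpha> m i) \<omega> * binc (cell \<beta> m i) \<omega>)\<bar> ^ q \<partial>M) \<le> (K2 * (sqrt (real (b - a)) * sig m)) ^ q"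
    by (rule weighted_product_moment[OF assms(7) q(1,2) assms(2,5)]) (rule that, assumption+)
  have "\<exists>b. \<forall>m. Lp_norm M (real p) (\<lambda>\<omega>. holder_norm m \<theta> (\<lambda>t. c m * weighted_product_sum B \<alpha> \<beta> F m t \<omega>)) \<le> ennreal b"
  proof (rule Kolmogorov[of K2 _ "\<lambda>m i \<omega>. F (dyadic m i) \<omega> * (binc (cell \<alpha> m i) \<omega> * binc (cell \<beta> m i) \<omega>)", OF K2])
    fix m k \<omega> assume k: "k \<le> (2::nat) ^ m"
    show "weighted_product_sum B \<alpha> \<beta> F m (dyadic m k) \<omega> = (\<Sum>i<k. F (dyadic m i) \<omega> * (binc (cell \<alpha> m i) \<omega> * binc (cell \<beta> m i) \<omega>))"
      using sum_dyadic_floor[OF k, of "\<lambda>i j. F (dyadic m i) \<omega> * incr (B \<alpha>) (dyadic m i) (dyadic m j) \<omega> * incr (B \<beta>) (dyadic m i) (dyadic m j) \<omega>"]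
      by (simp add: weighted_product_sum_def binc_def cell_def incr_def mult.assoc)
  qed (rule v2)
  then obtain b2 where b2: "\<And>m. Lp_norm M (real p) (\<lambda>\<omega>. holder_norm m \<theta> (\<lambda>t. c m * weighted_product_sum B \<alpha> \<beta> F m t \<omega>)) \<le> ennreal b2" by blast
  have "(SUP m. Lp_norm M p (\<lambda>\<omega>. holder_norm m \<theta> (\<lambda>t. (2 ^ m) powr (2 * H - 1 / 2) * weighted_area_sum F B\<alpha>\<beta> m t \<omega>))
      + Lp_norm M p (\<lambda>\<omega>. holder_norm m \<theta> (\<lambda>t. (2 ^ m) powr (2 * H - 1 / 2) * weighted_product_sum B \<alpha> \<beta> F m t \<omega>))) \<le> ennreal b1 + ennreal b2"
    unfolding c_def[symmetric] by (intro SUP_least add_mono b1 b2)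
  also have "\<dots> < \<top>" by simp
  finally show ?thesis .
qed

end
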